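(* Let $\mathbb D=[1/2,1]$ and let $(X_k)_{k\in\mathbb Z}$ be the real-valued linear process $$X_k=\sum_{j=-\infty}^{\infty}\psi_j\varepsilon_{k-j},\qquad 0<\sum_{j=-\infty}^{\infty}|j|^{\alpha}|\psi_j|<\infty\ \text{ for some }\alpha\in(1/2,1],$$ where $(\varepsilon_k)_{k\in\mathbb Z}$ is a Gaussian white noise with unit variance, and let $f$ be its spectral density. Let $w:[-\pi,\pi]\to\mathbb R$ be symmetric (i.e. $w(-\lambda)=w(\lambda)$), H\"older continuous of order $\beta\in(1/2,1]$, and non-zero Lebesgue-almost everywhere. Put $\Phi=\int_{-\pi}^{\pi}w(\lambda)f(\lambda)\,\mathrm d\lambda$, let $\Phi_N(s)$, $s\in\mathbb D$, be the weighted integrated sequential periodogram $$\Phi_N(s)=\frac{4\pi}{N}\sum_{j=1}^{\lfloor N/2\rfloor}w(\lambda_j)I_N^s(\lambda_j),$$ and let $\Phi_N=\Phi_N(1)$. Then, as $N\to\infty$, $$\frac{\Phi_N-\Phi}{\Big(\int_{\mathbb D}\big(\Phi_N(s)-\Phi_N(1)\big)^2\,\mathrm ds\Big)^{1/2}}\ \stackrel{d}{\longrightarrow}\ \frac{\mathbb B(1)}{\Big(\int_{\mathbb D}\frac1{s^2}\big(\mathbb B(s)-s\,\mathbb B(1)\big)^2\,\mathrm ds\Big)^{1/2}},$$ where $\mathbb B=\{\mathbb B(s)\}_{s\in\mathbb D}$ is a (standard) Brownian motion on $\mathbb D$, and the denominator on the right-hand side is almost surely non-zero.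
   Context: The coefficients $\psi_j$ are real. A Gaussian white noise with unit variance is a sequence of i.i.d. $\mathcal N(0,1)$ random variables. The spectral density is $f(\lambda)=\frac1{2\pi}\sum_{k=-\infty}^{\infty}\operatorname{Cov}(X_0,X_k)\mathrm e^{-\mathrm i\lambda k}$, $\lambda\in[-\pi,\pi]$. The Fourier frequencies are $\lambda_j=2\pi j/N$. The sequential periodogram based on observations $X_1,\dots,X_N$ is $$I_N^s(\lambda)=\frac1{2\pi sN}\Big|\sum_{k=1}^{\lfloor sN\rfloor}X_k\mathrm e^{-\mathrm ik\lambda}\Big|^2,\qquad s\in\mathbb D,\ \lambda\in[-\pi,\pi].$$ A Brownian motion on $\mathbb D=[1/2,1]$ means the restriction to $\mathbb D$ of a standard Brownian motion, i.e. a centered Gaussian process with continuous paths and $\operatorname{Cov}(\mathbb B(s),\mathbb B(t))=\min(s,t)$. The symbol $\stackrel{d}{\longrightarrow}$ denotes weak convergence (convergence in distribution). *)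

theory Defs
  imports "HOL-Probability.Probability"
begin

definition gaussian_white_noise :: "'a measure \<Rightarrow> (int \<Rightarrow> 'a \<Rightarrow> real) \<Rightarrow> bool" where
  "gaussian_white_noise M \<epsilon> \<longleftrightarrow>
     prob_space.indep_vars M (\<lambda>_. borel) \<epsilon> UNIV \<and>
     (\<forall>k. distributed M lborel (\<epsilon> k) std_normal_density)"

text \<open>The two-sided series is read pathwise. It is only required to represent \<open>X k\<close> almost surely,
  so that \<open>X\<close> may be any version of the process; \<^const>\<open>infsum\<close> is \<open>0\<close> where the series diverges.\<close>

definition linear_process ::
  "'a measure \<Rightarrow> (int \<Rightarrow> real) \<Rightarrow> (int \<Rightarrow> 'a \<Rightarrow> real) \<Rightarrow> (int \<Rightarrow> 'a \<Rightarrow> real) \<Rightarrow> bool" where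
  "linear_process M \<psi> \<epsilon> X \<longleftrightarrow>
     (\<forall>k. X k \<in> borel_measurable M \<and> (AE \<omega> in M. X k \<omega> = (\<Sum>\<^sub>\<infinity>j. \<psi> j * \<epsilon> (k - j) \<omega>)))"

definition covariance :: "'a measure \<Rightarrow> ('a \<Rightarrow> real) \<Rightarrow> ('a \<Rightarrow> real) \<Rightarrow> real" where
  "covariance M Y Z =
     (LINT \<omega>|M. (Y \<omega> - (LINT \<omega>'|M. Y \<omega>')) * (Z \<omega> - (LINT \<omega>'|M. Z \<omega>')))"

text \<open>For a stationary real-valued process the autocovariances are even in \<open>k\<close>, so the sum is real
  and \<^const>\<open>Re\<close> only adjusts the type.\<close>

definition spectral_density :: "'a measure \<Rightarrow> (int \<Rightarrow> 'a \<Rightarrow> real) \<Rightarrow> real \<Rightarrow> real" where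
  "spectral_density M X l =
     Re (1 / (2 * of_real pi) *
       (\<Sum>\<^sub>\<infinity>k::int. of_real (covariance M (X 0) (X k)) * exp (- (\<i> * of_real l * of_int k))))"

definition fourier_freq :: "nat \<Rightarrow> nat \<Rightarrow> real" where
  "fourier_freq N j = 2 * pi * real j / real N"

text \<open>Here \<open>x\<close> is one sample path \<open>\<lambda>k. X k \<omega>\<close> of the process.\<close>

definition seq_periodogram :: "(int \<Rightarrow> real) \<Rightarrow> nat \<Rightarrow> real \<Rightarrow> real \<Rightarrow> real" where
  "seq_periodogram x N s l =
     1 / (2 * pi * s * real N) *
       (cmod (\<Sum>k = 1..nat \<lfloor>s * real N\<rfloor>.
          of_real (x (int k)) * exp (- (\<i> * of_nat k * of_real l))))\<^sup>2"

definition integrated_periodogram :: "(real \<Rightarrow> real) \<Rightarrow> (int \<Rightarrow> real) \<Rightarrow> nat \<Rightarrow> real \<Rightarrow> real" where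
  "integrated_periodogram w x N s =
     4 * pi / real N *
       (\<Sum>j = 1..N div 2. w (fourier_freq N j) * seq_periodogram x N s (fourier_freq N j))"

definition holder_continuous_on :: "real set \<Rightarrow> real \<Rightarrow> (real \<Rightarrow> real) \<Rightarrow> bool" where
  "holder_continuous_on S \<beta> w \<longleftrightarrow>
     (\<exists>C. \<forall>x\<in>S. \<forall>y\<in>S. \<bar>w x - w y\<bar> \<le> C * \<bar>x - y\<bar> powr \<beta>)"

text \<open>Degenerate (almost surely constant) normal variables are included; they occur as linear
  combinations of jointly Gaussian ones.\<close>

definition gaussian_rv :: "'a measure \<Rightarrow> ('a \<Rightarrow> real) \<Rightarrow> bool" where
  "gaussian_rv M Y \<longleftrightarrow>
     Y \<in> borel_measurable M \<and>
     (\<exists>\<mu>. (AE \<omega> in M. Y \<omega> = \<mu>) \<or>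
          (\<exists>\<sigma>>0. distributed M lborel Y (normal_density \<mu> \<sigma>)))"

definition gaussian_process_on :: "'a measure \<Rightarrow> real set \<Rightarrow> (real \<Rightarrow> 'a \<Rightarrow> real) \<Rightarrow> bool" where
  "gaussian_process_on M T B \<longleftrightarrow>
     (\<forall>F c. finite F \<and> F \<subseteq> T \<longrightarrow> gaussian_rv M (\<lambda>\<omega>. \<Sum>t\<in>F. c t * B t \<omega>))"

definition brownian_motion_on :: "'a measure \<Rightarrow> real set \<Rightarrow> (real \<Rightarrow> 'a \<Rightarrow> real) \<Rightarrow> bool" where
  "brownian_motion_on M T B \<longleftrightarrow>
     gaussian_process_on M T B \<and>
     (\<forall>t\<in>T. (LINT \<omega>|M. B t \<omega>) = 0) \<and>
     (\<forall>s\<in>T. \<forall>t\<in>T. covariance M (B s) (B t) = min s t) \<and>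
     (\<forall>\<omega>\<in>space M. continuous_on T (\<lambda>t. B t \<omega>))"

end

theory Submission
  imports Defs
begin

text \<open>
  The integrated periodogram is a quadratic form in \<open>X\<^sub>1, \<dots>, X\<^sub>m\<close>, \<open>m = \<lfloor>sN\<rfloor>\<close>, whose coefficients are Riemann
  sums over the Fourier frequencies. Hoelder continuity of order above \<open>1/2\<close> allows these sums to be replaced by
  the cosine coefficients of \<open>w\<close>, and the filter \<open>\<psi>\<close> can then be moved from the process to the coefficients. Up
  to an error that is small in \<open>L\<^sup>2\<close>, \<open>\<surd>N (\<Phi>\<^sub>N(s) - \<Phi>)\<close> is therefore \<open>1 / (s \<surd>N)\<close> times the centred Toeplitz form
  \<open>\<Sum> a(k - l) (\<epsilon>\<^sub>k \<epsilon>\<^sub>l - \<delta>\<^sub>k\<^sub>l)\<close>, where \<open>a\<close> are the cosine coefficients of \<open>w\<close> times the squared transfer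
  function. Since \<open>a\<close> is square summable (Bessel and Parseval), discarding all index pairs outside a block
  diagonal with large blocks changes little; the blocks are independent and identically distributed, and the
  central limit theorem for their sums turns the form into \<open>\<sigma> B(s) / s\<close>, with \<open>\<sigma> > 0\<close> because \<open>w\<close> vanishes almost
  nowhere. Centring and \<open>\<sigma>\<close> cancel in the ratio.

  No tightness argument is needed: the ratio depends only on the value at \<open>s = 1\<close> and on an integral over \<open>s\<close>, and
  Lipschitz functions of these two are controlled by second moments at fixed \<open>s\<close>, so that the discretisation
  of \<open>s\<close> is absorbed into the \<open>L\<^sup>2\<close> error.
\<close>

section \<open>Cosine coefficients\<close>

text \<open>Every random error reduces to a square sum: centred noise products are orthogonal up to
  swapping their indices, so the second moment of a form is at most twice the sum of its squared
  coefficients. The obstacle is that the error of \<open>dcos w N h\<close> is only known to be of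
  order \<open>(\<bar>h\<bar> / N) powr \<kappa>\<close>, useless for lags comparable with
  \<open>N\<close>. Instead, the rows of \<open>dcos\<close> obey a discrete Parseval identity, and
  convergence at each lag together with convergence of the norms gives convergence in mean square.
  The exponent 1/2 enters twice, for \<open>\<kappa> = min \<alpha> \<beta>\<close>: the
  deterministic error, of order \<open>N powr (1 - \<kappa>)\<close>, must be o(\<surd>N); and
  displacing the index square by lags \<open>i\<close>, \<open>j\<close> costs \<bar>i\<bar> +
  \<bar>j\<bar>, which the squared weights of \<psi> absorb if 2 \<kappa> \<ge> 1. The blocks are
  grouped along a grid of \<open>s\<close>, so that finitely many independent sums carry the whole
  path. Their joint limit rests on one-dimensional results: Skorohod representation in each
  coordinate for the convergence, tilted measures for the law of the Brownian increments.\<close>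

lemma integral_cos_int:
  "integral {0..pi} (\<lambda>x. cos (real_of_int n * x)) = pi * of_bool (n = 0)"
proof (cases "n = 0")
  case False
  have "((\<lambda>x. cos (real_of_int n * x)) has_integral
      (sin (real_of_int n * pi) / real_of_int n - sin (real_of_int n * 0) / real_of_int n)) {0..pi}"
    using False
    by (intro fundamental_theorem_of_calculus)
       (auto intro!: derivative_eq_intros simp: has_real_derivative_iff_has_vector_derivative [symmetric])
  then show ?thesis
    using False by (simp add: integral_unique sin_int_times_real mult.commute)
qed simp

lemma cos_times_cos_int:
  "cos (real_of_int h * x) * cos (real_of_int k * x) =
    (cos (real_of_int (h - k) * x) + cos (real_of_int (h + k) * x)) / 2"
  by (simp add: cos_times_cos algebra_simps)

lemma integral_cos_cos_int:
  "integral {0..pi} (\<lambda>x. cos (real_of_int h * x) * cos (real_of_int k * x)) =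
    pi / 2 * (of_bool (h = k) + of_bool (h = - k))"
proof -
  have "integral {0..pi} (\<lambda>x. cos (real_of_int h * x) * cos (real_of_int k * x)) =
     integral {0..pi} (\<lambda>x. cos (real_of_int (h - k) * x) / 2 + cos (real_of_int (h + k) * x) / 2)"
    by (simp only: cos_times_cos_int add_divide_distrib)
  also have "\<dots> = integral {0..pi} (\<lambda>x. cos (real_of_int (h - k) * x) / 2)
      + integral {0..pi} (\<lambda>x. cos (real_of_int (h + k) * x) / 2)"
    by (intro integral_add integrable_continuous_interval continuous_intros) auto
  also have "\<dots> = pi / 2 * (of_bool (h = k) + of_bool (h = - k))"
    by (simp only: integral_divide integral_cos_int) (auto simp: algebra_simps)
  finally show ?thesis .
qed

text \<open>Fourier coefficient of the even extension of \<open>u\<close>: the factor 1/pi on the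
  half interval is 1/(2 pi) on the whole one. Indexing by all integers yields a symmetric Toeplitz
  kernel and a Parseval identity without a special case at 0.\<close>

definition fcos :: "(real \<Rightarrow> real) \<Rightarrow> int \<Rightarrow> real" where
  "fcos u h = integral {0..pi} (\<lambda>x. u x * cos (real_of_int h * x)) / pi"

lemma fcos_minus [simp]: "fcos u (- h) = fcos u h"
  by (simp add: fcos_def)

definition msq :: "(real \<Rightarrow> real) \<Rightarrow> real" where
  "msq u = integral {0..pi} (\<lambda>x. (u x)\<^sup>2) / pi"

text \<open>The cosines for \<open>h\<close> and \<open>- h\<close> coincide, so the family is not
  orthogonal over the integers; its Gram matrix has pi/2 on the diagonal and on the antidiagonal,
  and symmetry of \<open>q\<close> merges the two. With \<open>q = fcos u\<close> this gives Bessel,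
  and it shows \<open>fcos u\<close> to be the best symmetric choice, as Parseval requires.\<close>

lemma msq_minus_cos_sum:
  fixes q :: "int \<Rightarrow> real"
  assumes u: "continuous_on {0..pi} u" and q: "\<And>h. q (- h) = q h"
  shows "msq (\<lambda>x. u x - (\<Sum>h = - int d..int d. q h * cos (real_of_int h * x))) =
    msq u - (\<Sum>h = - int d..int d. (fcos u h)\<^sup>2) + (\<Sum>h = - int d..int d. (q h - fcos u h)\<^sup>2)"
proof -
  let ?I = "{- int d..int d}"
  let ?c = "\<lambda>h x. cos (real_of_int h * x)"
  have int_uc: "(\<lambda>x. u x * ?c h x) integrable_on {0..pi}" for h
    by (intro integrable_continuous_interval continuous_intros u)
  have int_cc: "(\<lambda>x. ?c h x * ?c k x) integrable_on {0..pi}" for h k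
    by (intro integrable_continuous_interval continuous_intros)
  have uu: "(\<lambda>x. (u x)\<^sup>2) integrable_on {0..pi}"
    by (intro integrable_continuous_interval continuous_intros u)
  have expand: "(u x - (\<Sum>h\<in>?I. q h * ?c h x))\<^sup>2 =
      (u x)\<^sup>2 - (\<Sum>h\<in>?I. 2 * q h * (u x * ?c h x))
      + (\<Sum>h\<in>?I. \<Sum>k\<in>?I. q h * q k * (?c h x * ?c k x))" for x
    by (simp add: power2_diff power2_eq_square sum_product sum_distrib_left algebra_simps)
  have "integral {0..pi} (\<lambda>x. (u x - (\<Sum>h\<in>?I. q h * ?c h x))\<^sup>2) =
      integral {0..pi} (\<lambda>x. (u x)\<^sup>2) - (\<Sum>h\<in>?I. 2 * q h * integral {0..pi} (\<lambda>x. u x * ?c h x))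
      + (\<Sum>h\<in>?I. \<Sum>k\<in>?I. q h * q k * integral {0..pi} (\<lambda>x. ?c h x * ?c k x))"
    unfolding expand
    by (subst integral_add integral_diff integral_sum;
        (intro integrable_add integrable_diff integrable_sum integrable_on_mult_right
           int_uc int_cc uu finite_atLeastAtMost_int)?; simp?)+
  also have "(\<Sum>h\<in>?I. \<Sum>k\<in>?I. q h * q k * integral {0..pi} (\<lambda>x. ?c h x * ?c k x)) =
      pi * (\<Sum>h\<in>?I. (q h)\<^sup>2)"
  proof -
    have "(\<Sum>k\<in>?I. q h * q k * integral {0..pi} (\<lambda>x. ?c h x * ?c k x)) = pi * (q h)\<^sup>2"
      if h: "h \<in> ?I" for h
    proof -
      \<comment> \<open>For \<open>h = 0\<close> both deltas fall on the same \<open>k\<close> and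
        add up to pi, so 0 needs no separate treatment.\<close>
      have "(\<Sum>k\<in>?I. q h * q k * integral {0..pi} (\<lambda>x. ?c h x * ?c k x)) =
         (\<Sum>k\<in>?I. (if k = h then q h * q k * (pi / 2) else 0)) +
         (\<Sum>k\<in>?I. (if k = - h then q h * q k * (pi / 2) else 0))"
        unfolding integral_cos_cos_int sum.distrib [symmetric]
        by (intro sum.cong) (auto simp: algebra_simps)
      also have "\<dots> = pi * (q h)\<^sup>2"
        using h by (simp add: q power2_eq_square)
      finally show ?thesis .
    qed
    then show ?thesis by (simp add: sum_distrib_left)
  qed
  finally have "integral {0..pi} (\<lambda>x. (u x - (\<Sum>h\<in>?I. q h * ?c h x))\<^sup>2) =
      integral {0..pi} (\<lambda>x. (u x)\<^sup>2) - (\<Sum>h\<in>?I. 2 * q h * integral {0..pi} (\<lambda>x. u x * ?c h x))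
      + pi * (\<Sum>h\<in>?I. (q h)\<^sup>2)" .
  moreover have "integral {0..pi} (\<lambda>x. u x * ?c h x) = pi * fcos u h" for h
    by (simp add: fcos_def)
  ultimately have "integral {0..pi} (\<lambda>x. (u x - (\<Sum>h\<in>?I. q h * ?c h x))\<^sup>2) =
      integral {0..pi} (\<lambda>x. (u x)\<^sup>2) + pi * (\<Sum>h\<in>?I. (q h)\<^sup>2 - 2 * q h * fcos u h)"
    by (simp add: sum_subtractf sum_distrib_left right_diff_distrib mult_ac)
  moreover have "(\<Sum>h\<in>?I. (q h)\<^sup>2 - 2 * q h * fcos u h) =
      (\<Sum>h\<in>?I. (q h - fcos u h)\<^sup>2) - (\<Sum>h\<in>?I. (fcos u h)\<^sup>2)"
    by (simp add: power2_diff sum_subtractf [symmetric])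
  ultimately show ?thesis
    by (simp add: msq_def add_divide_distrib)
qed

lemma sum_int_symmetric:
  "(\<Sum>h = - int d..int d. F h) = F 0 + (\<Sum>k = 1..d. F (int k) + F (- int k))"
  for F :: "int \<Rightarrow> real"
proof (induction d)
  case (Suc d)
  have "{- int (Suc d)..int (Suc d)} =
      insert (int (Suc d)) (insert (- int (Suc d)) {- int d..int d})"
    by auto
  with Suc show ?case by simp
qed simp

section \<open>Uniform approximation by cosine polynomials\<close>

definition cos_span :: "(real \<Rightarrow> real) set" where
  "cos_span = {f. \<exists>d a. f = (\<lambda>x. \<Sum>k\<le>d. a k * cos (real (k::nat) * x))}"

lemma cos_span_cos: "(\<lambda>x. c * cos (real k * x)) \<in> cos_span"
  unfolding cos_span_def
  by (rule CollectI, rule exI [of _ k], rule exI [of _ "\<lambda>j. if j = k then c else 0"])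
     (simp add: if_distrib [of "\<lambda>a. a * _"] cong: if_cong)

lemma cos_span_add:
  assumes "f \<in> cos_span" "g \<in> cos_span"
  shows "(\<lambda>x. f x + g x) \<in> cos_span"
proof -
  obtain d a e b where f: "f = (\<lambda>x. \<Sum>k\<le>d. a k * cos (real (k::nat) * x))"
    and g: "g = (\<lambda>x. \<Sum>k\<le>e. b k * cos (real (k::nat) * x))"
    using assms unfolding cos_span_def by blast
  have pad: "(\<Sum>k\<le>d. a k * cos (real (k::nat) * x)) =
      (\<Sum>k\<le>max d e. (if k \<le> d then a k else 0) * cos (real k * x))" for d e a x
    by (rule sum.mono_neutral_cong_left) auto
  have "(\<lambda>x. f x + g x) = (\<lambda>x. \<Sum>k\<le>max d e.
      ((if k \<le> d then a k else 0) + (if k \<le> e then b k else 0)) * cos (real k * x))"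
    unfolding f g
    by (rule ext, subst pad [where d = d and e = e], subst pad [where d = e and e = d])
       (simp add: sum.distrib distrib_right max.commute)
  then show ?thesis
    unfolding cos_span_def by (intro CollectI exI)
qed

lemma cos_span_sum:
  assumes "finite S" "\<And>i. i \<in> S \<Longrightarrow> f i \<in> cos_span"
  shows "(\<lambda>x. \<Sum>i\<in>S. f i x) \<in> cos_span"
  using assms
proof (induction S)
  case empty
  show ?case using cos_span_cos [of 0 0] by simp
next
  case (insert i S)
  then show ?case using cos_span_add [of "f i" "\<lambda>x. \<Sum>i\<in>S. f i x"] by simp
qed

text \<open>The product formula sends frequency \<open>k\<close> to \<open>k + 1\<close> and
  \<open>k - 1\<close>; for \<open>k = 0\<close> the latter is -1, whose cosine is that of 1. By
  iteration all powers of cos lie in the span.\<close>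

lemma cos_span_mult_cos:
  assumes "f \<in> cos_span"
  shows "(\<lambda>x. c * (f x * cos x)) \<in> cos_span"
proof -
  obtain d a where f: "f = (\<lambda>x. \<Sum>k\<le>d. a k * cos (real (k::nat) * x))"
    using assms unfolding cos_span_def by blast
  have "(\<lambda>x. c * (f x * cos x)) = (\<lambda>x. \<Sum>k\<le>d. c * a k / 2 * cos (real (k + 1) * x)
      + c * a k / 2 * cos (real (if k = 0 then 1 else k - 1) * x))"
  proof
    fix x
    have key: "cos (real k * x) * cos x =
        (cos (real (k + 1) * x) + cos (real (if k = 0 then 1 else k - 1) * x)) / 2" for k
    proof (cases k)
      case (Suc j)
      have "real (Suc j) * x - x = real j * x" by (simp add: algebra_simps)
      then show ?thesis unfolding Suc by (simp add: cos_times_cos algebra_simps)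
    qed simp
    then show "c * (f x * cos x) = (\<Sum>k\<le>d. c * a k / 2 * cos (real (k + 1) * x)
      + c * a k / 2 * cos (real (if k = 0 then 1 else k - 1) * x))"
      unfolding f sum_distrib_left sum_distrib_right
      by (intro sum.cong refl) (simp only: mult.assoc key, simp add: algebra_simps)
  qed
  then show ?thesis
    by (simp only:) (intro cos_span_sum cos_span_add cos_span_cos finite_atMost)
qed

lemma cos_span_power: "(\<lambda>x. c * cos x ^ n) \<in> cos_span"
proof -
  have "(\<lambda>x. cos x ^ n) \<in> cos_span"
  proof (induction n)
    case 0
    show ?case using cos_span_cos [of 1 0] by simp
  next
    case (Suc n)
    show ?case using cos_span_mult_cos [OF Suc, of 1] by (simp add: mult.commute)
  qed
  then obtain d a where "(\<lambda>x. cos x ^ n) = (\<lambda>x. \<Sum>k\<le>d. a k * cos (real (k::nat) * x))"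
    unfolding cos_span_def by blast
  then have "cos x ^ n = (\<Sum>k\<le>d. a k * cos (real (k::nat) * x))" for x by (rule fun_cong)
  then have "(\<lambda>x. c * cos x ^ n) = (\<lambda>x. \<Sum>k\<le>d. c * a k * cos (real (k::nat) * x))"
    by (simp add: sum_distrib_left mult.assoc)
  then show ?thesis unfolding cos_span_def by (intro CollectI exI)
qed

text \<open>The substitution y = cos x maps [0, pi] onto [-1, 1], where Weierstrass applies to u
  \<circ> arccos; a polynomial in cos x lies in \<open>cos_span\<close>. This is the completeness
  behind Parseval.\<close>

lemma cos_approximation:
  fixes u :: "real \<Rightarrow> real"
  assumes u: "continuous_on {0..pi} u" and "0 < e"
  obtains d q where "\<And>h::int. q (- h) = q h"
    and "\<And>x. x \<in> {0..pi} \<Longrightarrow> \<bar>u x - (\<Sum>h = - int d..int d. q h * cos (real_of_int h * x))\<bar> < e"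
proof -
  have "continuous_on {-1..1} (\<lambda>y. u (arccos y))"
    by (rule continuous_on_compose2 [OF u continuous_on_arccos']) (auto simp: arccos_bounded arccos_lbound arccos_ubound)
  then obtain g where g: "real_polynomial_function g" "\<And>y. y \<in> {-1..1} \<Longrightarrow> \<bar>u (arccos y) - g y\<bar> < e"
    using Stone_Weierstrass_real_polynomial_function [of "{-1..1::real}" "\<lambda>y. u (arccos y)" e] \<open>0 < e\<close>
    by auto
  then obtain c n where gc: "g = (\<lambda>y. \<Sum>i\<le>n. c i * y ^ i)"
    by (auto simp: real_polynomial_function_iff_sum)
  have "(\<lambda>x. g (cos x)) \<in> cos_span"
    unfolding gc by (intro cos_span_sum cos_span_power) auto
  then obtain d a where "(\<lambda>x. g (cos x)) = (\<lambda>x. \<Sum>k\<le>d. a k * cos (real (k::nat) * x))"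
    unfolding cos_span_def by blast
  then have da: "g (cos x) = (\<Sum>k\<le>d. a k * cos (real (k::nat) * x))" for x by (rule fun_cong)
  \<comment> \<open>A positive frequency is shared equally by \<open>h\<close> and
    \<open>- h\<close>, whereas frequency 0 occurs only once.\<close>
  define q where "q h = (if h = 0 then a 0 else a (nat \<bar>h\<bar>) / 2)" for h :: int
  have "(\<Sum>h = - int d..int d. q h * cos (real_of_int h * x)) = g (cos x)" for x
  proof -
    have "(\<Sum>h = - int d..int d. q h * cos (real_of_int h * x)) =
        a 0 + (\<Sum>k = 1..d. a k * cos (real k * x))"
      unfolding sum_int_symmetric by (auto simp: q_def intro!: sum.cong)
    also have "\<dots> = g (cos x)"
      unfolding da atMost_atLeast0 by (simp add: sum.atLeast_Suc_atMost)
    finally show ?thesis .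
  qed
  moreover have "\<bar>u x - g (cos x)\<bar> < e" if "x \<in> {0..pi}" for x
    using g(2) [of "cos x"] that by (simp add: arccos_cos)
  ultimately show thesis
    by (intro that [of q d]) (auto simp: q_def)
qed

lemma msq_nonneg: "0 \<le> msq u"
  unfolding msq_def by (cases "(\<lambda>x. (u x)\<^sup>2) integrable_on {0..pi}")
    (auto intro!: divide_nonneg_pos integral_nonneg simp: not_integrable_integral)

lemma fcos_bessel:
  assumes u: "continuous_on {0..pi} u" and "finite F"
  shows "(\<Sum>h\<in>F. (fcos u h)\<^sup>2) \<le> msq u"
proof -
  obtain k where k: "\<forall>h\<in>F. \<bar>h\<bar> \<le> k"
    using \<open>finite F\<close> by (metis Max_ge finite_imageI imageI)
  then have "(\<Sum>h\<in>F. (fcos u h)\<^sup>2) \<le> (\<Sum>h = - int (nat k)..int (nat k). (fcos u h)\<^sup>2)"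
    by (intro sum_mono2) force+
  also have "\<dots> \<le> msq u"
    using msq_minus_cos_sum [OF u, of "fcos u" "nat k"]
      msq_nonneg [of "\<lambda>x. u x - (\<Sum>h = - int (nat k)..int (nat k). fcos u h * cos (real_of_int h * x))"]
    by simp
  finally show ?thesis .
qed

text \<open>Since \<open>fcos u\<close> is the best symmetric choice in mean square, a uniformly
  close cosine polynomial bounds what Bessel leaves over. The windows increase, so one good window
  settles all larger ones.\<close>

lemma fcos_parseval:
  assumes u: "continuous_on {0..pi} u"
  shows "(\<lambda>n. \<Sum>h = - int n..int n. (fcos u h)\<^sup>2) \<longlonglongrightarrow> msq u"
proof (rule LIMSEQ_I)
  fix r :: real assume "0 < r"
  \<comment> \<open>A uniform error below \<open>sqrt (r / 2)\<close> has mean square at most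
    \<open>r / 2\<close>.\<close>
  then obtain d q where q: "\<And>h::int. q (- h) = q h"
    and d: "\<And>x. x \<in> {0..pi} \<Longrightarrow> \<bar>u x - (\<Sum>h = - int d..int d. q h * cos (real_of_int h * x))\<bar> < sqrt (r / 2)"
    using cos_approximation [OF u, of "sqrt (r / 2)"] by (metis half_gt_zero real_sqrt_gt_zero)
  let ?v = "\<lambda>x. u x - (\<Sum>h = - int d..int d. q h * cos (real_of_int h * x))"
  have "integral {0..pi} (\<lambda>x. (?v x)\<^sup>2) \<le> integral {0..pi} (\<lambda>x. r / 2)"
  proof (intro integral_le integrable_continuous_interval continuous_intros u)
    fix x assume "x \<in> {0..pi}"
    from d [OF this] have "\<bar>?v x\<bar>\<^sup>2 \<le> (sqrt (r / 2))\<^sup>2"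
      by (intro power_mono) auto
    then show "(?v x)\<^sup>2 \<le> r / 2" using \<open>0 < r\<close> by simp
  qed
  then have "msq ?v \<le> r / 2"
    by (simp add: msq_def field_simps)
  moreover have "msq u - (\<Sum>h = - int d..int d. (fcos u h)\<^sup>2) \<le> msq ?v"
    using msq_minus_cos_sum [where u = u and q = q and d = d, OF u q] sum_nonneg [of "{- int d..int d}" "\<lambda>h. (q h - fcos u h)\<^sup>2"]
    by simp
  ultimately have *: "msq u - (\<Sum>h = - int d..int d. (fcos u h)\<^sup>2) \<le> r / 2" by simp
  have "norm ((\<Sum>h = - int n..int n. (fcos u h)\<^sup>2) - msq u) < r" if "n \<ge> d" for n
  proof -
    have "(\<Sum>h = - int d..int d. (fcos u h)\<^sup>2) \<le> (\<Sum>h = - int n..int n. (fcos u h)\<^sup>2)"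
      using that by (intro sum_mono2) auto
    moreover have "(\<Sum>h = - int n..int n. (fcos u h)\<^sup>2) \<le> msq u"
      by (rule fcos_bessel [OF u]) auto
    ultimately show ?thesis using * \<open>0 < r\<close> by (simp add: abs_if)
  qed
  then show "\<exists>no. \<forall>n\<ge>no. norm ((\<Sum>h = - int n..int n. (fcos u h)\<^sup>2) - msq u) < r" by blast
qed


text \<open>Enlarging the square from \<open>n\<close> to \<open>n + 1\<close> adds a border on
  which each difference from \<open>- n\<close> to \<open>n\<close> occurs exactly once. A Toeplitz
  sum divided by \<open>n\<close> is thus a Cesaro mean of symmetric partial sums, to which Bessel
  and Parseval apply.\<close>

lemma sum_toeplitz:
  fixes F :: "int \<Rightarrow> real"
  shows "(\<Sum>k = 1..n. \<Sum>l = 1..n. F (int k - int l)) = (\<Sum>r<n. \<Sum>h = - int r..int r. F h)"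
proof (induction n)
  case (Suc n)
  have "(\<Sum>l = 1..Suc n. F (int (Suc n) - int l)) = (\<Sum>j = 0..n. F (int j))"
    by (rule sum.reindex_bij_witness [of _ "\<lambda>j. Suc n - j" "\<lambda>l. Suc n - l"]) auto
  also have "\<dots> = F 0 + (\<Sum>j = 1..n. F (int j))"
    by (simp add: sum.atLeast_Suc_atMost)
  finally have row: "(\<Sum>l = 1..Suc n. F (int (Suc n) - int l)) = F 0 + (\<Sum>j = 1..n. F (int j))" .
  have col: "(\<Sum>k = 1..n. F (int k - int (Suc n))) = (\<Sum>j = 1..n. F (- int j))"
    by (rule sum.reindex_bij_witness [of _ "\<lambda>j. Suc n - j" "\<lambda>l. Suc n - l"]) (auto simp: of_nat_diff)
  have "(\<Sum>k = 1..Suc n. \<Sum>l = 1..Suc n. F (int k - int l)) =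
      (\<Sum>k = 1..n. (\<Sum>l = 1..n. F (int k - int l)) + F (int k - int (Suc n))) +
      (\<Sum>l = 1..Suc n. F (int (Suc n) - int l))"
    by simp
  also have "\<dots> = (\<Sum>r<n. \<Sum>h = - int r..int r. F h) + (\<Sum>h = - int n..int n. F h)"
    unfolding row sum.distrib col Suc.IH sum_int_symmetric by simp
  finally show ?case by simp
qed simp

lemma cesaro:
  fixes A :: "nat \<Rightarrow> real"
  assumes "A \<longlonglongrightarrow> L"
  shows "(\<lambda>n. (\<Sum>r<n. A r) / real n) \<longlonglongrightarrow> L"
proof (rule LIMSEQ_I)
  fix e :: real assume "0 < e"
  then obtain n0 where n0: "\<And>n. n \<ge> n0 \<Longrightarrow> \<bar>A n - L\<bar> < e / 2"
    using LIMSEQ_D [OF assms, of "e / 2"] by auto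
  define C where "C = (\<Sum>r<n0. \<bar>A r - L\<bar>)"
  obtain n1 where n1: "2 * C / e < real n1"
    using reals_Archimedean2 by blast
  have "norm ((\<Sum>r<n. A r) / real n - L) < e" if n: "n \<ge> Suc (n0 + n1)" for n
  proof -
    have "\<bar>(\<Sum>r<n. A r) - real n * L\<bar> = \<bar>\<Sum>r<n. A r - L\<bar>"
      by (simp add: sum_subtractf)
    also have "\<dots> \<le> (\<Sum>r<n. \<bar>A r - L\<bar>)" by (rule sum_abs)
    also have "\<dots> = C + (\<Sum>r=n0..<n. \<bar>A r - L\<bar>)"
      unfolding C_def using n by (simp add: sum.atLeastLessThan_concat atLeast0LessThan [symmetric])
    also have "(\<Sum>r=n0..<n. \<bar>A r - L\<bar>) \<le> (\<Sum>r=n0..<n. e / 2)"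
      by (intro sum_mono) (auto dest: n0 intro: less_imp_le)
    also have "(\<Sum>r=n0..<n. e / 2) \<le> real n * (e / 2)"
      using \<open>0 < e\<close> n by (simp add: of_nat_diff)
    also have "C < real n * (e / 2)"
      using n1 n \<open>0 < e\<close> by (simp add: field_simps) (smt (verit) mult_left_mono of_nat_add of_nat_le_iff of_nat_0_le_iff of_nat_Suc)
    finally have *: "\<bar>(\<Sum>r<n. A r) - real n * L\<bar> < e * real n" by (simp add: mult.commute)
    have "(\<Sum>r<n. A r) / real n - L = ((\<Sum>r<n. A r) - real n * L) / real n"
      using n by (simp add: field_simps)
    then show ?thesis using * n by (simp add: pos_divide_less_eq)
  qed
  then show "\<exists>no. \<forall>n\<ge>no. norm ((\<Sum>r<n. A r) / real n - L) < e" by blast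
qed

text \<open>Orthogonality of the Fourier frequencies over a full period. Multiplication by 2 sin t
  with t = pi d / N makes the sum telescope, and sin t vanishes only if \<open>N\<close> divides
  \<open>d\<close>. The offset \<open>k\<close> is arbitrary because the rows of a Toeplitz matrix
  start at different lags.\<close>

lemma sum_cos_period:
  assumes "0 < N"
  shows "(\<Sum>l = 1..N. cos (2 * pi * of_int ((k - int l) * d) / real N)) = (if int N dvd d then real N else 0)"
proof (cases "int N dvd d")
  case True
  then obtain c where "d = int N * c" by auto
  then have "2 * pi * of_int ((k - int l) * d) / real N = 2 * pi * of_int ((k - int l) * c)" for l
    using assms by (simp add: field_simps)
  then have "cos (2 * pi * of_int ((k - int l) * d) / real N) = 1" for l
    by (metis cos_int_2pin mult.commute)
  then show ?thesis using True by simp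
next
  case False
  define t where "t = pi * of_int d / real N"
  have "sin t \<noteq> 0"
  proof
    assume "sin t = 0"
    then obtain i where "t = of_int i * pi" by (auto simp: sin_zero_iff_int2)
    then have "of_int d = (of_int (i * int N) :: real)"
      using assms by (simp add: t_def field_simps)
    then have "d = i * int N" by (simp only: of_int_eq_iff)
    then show False using False by simp
  qed
  have tel: "(\<Sum>l = 1..n. g l - g (Suc l)) = g 1 - g (Suc n)" for g :: "nat \<Rightarrow> real" and n
    by (induction n) auto
  let ?s = "\<lambda>l. sin (of_int (2 * k - 2 * int l + 1) * t)"
  have arg: "2 * pi * of_int ((k - int l) * d) / real N = of_int (2 * (k - int l)) * t" for l
    by (simp add: t_def)
  have "2 * sin t * cos (of_int (2 * (k - int l)) * t) = ?s l - ?s (Suc l)" for l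
    by (simp add: sin_times_cos algebra_simps)
       (simp add: sin_add sin_diff algebra_simps cos_add cos_diff)
  then have "2 * sin t * (\<Sum>l = 1..N. cos (of_int (2 * (k - int l)) * t)) = (\<Sum>l = 1..N. ?s l - ?s (Suc l))"
    by (simp add: sum_distrib_left)
  also have "\<dots> = ?s 1 - ?s (Suc N)"
    by (rule tel)
  \<comment> \<open>As 2 N t = 2 pi d, moving the index by \<open>N\<close> changes the argument by
    a multiple of the period.\<close>
  also have "?s (Suc N) = sin (of_int (2 * k - 1) * t - of_int d * (2 * pi))"
    using assms by (simp add: t_def field_simps)
  also have "\<dots> = ?s 1"
  proof -
    have *: "real_of_int d * (2 * pi) = 2 * pi * real_of_int d" by simp
    show ?thesis unfolding * sin_diff by simp
  qed
  finally show ?thesis using \<open>sin t \<noteq> 0\<close> False by (simp only: arg) simp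
qed

section \<open>Averages over the Fourier frequencies\<close>

text \<open>Right-endpoint Riemann sum of mesh 2 pi / N for the mean of \<open>F\<close> over
  [0, pi]; the factor is the mesh divided by pi.\<close>

definition freq_mean :: "(real \<Rightarrow> real) \<Rightarrow> nat \<Rightarrow> real" where
  "freq_mean F N = 2 / real N * (\<Sum>j = 1..N div 2. F (fourier_freq N j))"

text \<open>These are the exact coefficients of the periodogram as a quadratic form;
  \<open>fcos\<close> is their limit at each fixed lag.\<close>

definition dcos :: "(real \<Rightarrow> real) \<Rightarrow> nat \<Rightarrow> int \<Rightarrow> real" where
  "dcos u N h = freq_mean (\<lambda>x. u x * cos (real_of_int h * x)) N"

lemma fourier_freq_in:
  assumes "j \<le> N div 2"
  shows "fourier_freq N j \<in> {0..pi}"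
proof -
  have "2 * real j \<le> real N" using assms by linarith
  then have "2 * real j / real N \<le> 1" by (cases "N = 0") (auto simp: divide_le_eq)
  then have "pi * (2 * real j / real N) \<le> pi * 1" by (intro mult_left_mono) auto
  then show ?thesis by (simp add: fourier_freq_def mult_ac)
qed

lemma freq_mean_bound:
  assumes "\<And>x. x \<in> {0..pi} \<Longrightarrow> \<bar>F x\<bar> \<le> K"
  shows "\<bar>freq_mean F N\<bar> \<le> K"
proof (cases "N = 0")
  case True
  then show ?thesis using assms [of 0] by (simp add: freq_mean_def)
next
  case False
  have K: "0 \<le> K" using assms [of 0] by simp
  have "\<bar>\<Sum>j = 1..N div 2. F (fourier_freq N j)\<bar> \<le> (\<Sum>j = 1..N div 2. K)"
    by (intro sum_abs [THEN order_trans] sum_mono assms fourier_freq_in) auto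
  also have "\<dots> = real (N div 2) * K" by simp
  also have "\<dots> \<le> real N / 2 * K" by (intro mult_right_mono K) linarith
  finally show ?thesis using False by (simp add: freq_mean_def abs_mult field_simps)
qed

text \<open>A cell of length \<delta> = 2 pi / N contributes at most
  \<open>\<delta> * (H * \<delta> powr \<kappa>)\<close>, and the cells have total length at most
  pi. For odd \<open>N\<close> the last frequency stops short of pi; that gap is at most \<delta>
  and is charged to \<open>K\<close>. After division by pi the constants are 7 \<ge> 2 pi and
  2.\<close>

lemma freq_mean_integral_rate:
  assumes cont: "continuous_on {0..pi} F"
    and holder: "\<And>x y. x \<in> {0..pi} \<Longrightarrow> y \<in> {0..pi} \<Longrightarrow> \<bar>F x - F y\<bar> \<le> H * \<bar>x - y\<bar> powr \<kappa>"
    and bound: "\<And>x. x \<in> {0..pi} \<Longrightarrow> \<bar>F x\<bar> \<le> K"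
    and H: "0 \<le> H" and \<kappa>: "0 < \<kappa>" "\<kappa> \<le> 1" and N: "0 < N"
  shows "\<bar>freq_mean F N - integral {0..pi} F / pi\<bar> \<le> (7 * H + 2 * K) * real N powr - \<kappa>"
proof -
  let ?f = "fourier_freq N"
  define \<delta> where "\<delta> = 2 * pi / real N"
  have \<delta>: "0 < \<delta>" using N by (simp add: \<delta>_def)
  have f_Suc: "?f (Suc j) = ?f j + \<delta>" for j
    by (simp add: fourier_freq_def \<delta>_def add_divide_distrib distrib_left)
  have part: "\<bar>\<delta> * (\<Sum>j = 1..n. F (?f j)) - integral {0..?f n} F\<bar> \<le> real n * (\<delta> * (H * \<delta> powr \<kappa>))"
    if "n \<le> N div 2" for n
    using that
  proof (induction n)
    case 0
    then show ?case by (simp add: fourier_freq_def)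
  next
    case (Suc n)
    have in1: "?f n \<in> {0..pi}" and in2: "?f (Suc n) \<in> {0..pi}"
      using Suc.prems by (intro fourier_freq_in; simp)+
    have sub: "{0..?f (Suc n)} \<subseteq> {0..pi}" "{?f n..?f (Suc n)} \<subseteq> {0..pi}"
      using in1 in2 by auto
    have split: "integral {0..?f (Suc n)} F = integral {0..?f n} F + integral {?f n..?f (Suc n)} F"
      using in1 in2 \<delta> f_Suc
      by (intro Henstock_Kurzweil_Integration.integral_combine [symmetric]
            integrable_continuous_interval continuous_on_subset [OF cont sub(1)]) auto
    have "integral {?f n..?f (Suc n)} (\<lambda>x. F (?f (Suc n)) - F x) = \<delta> * F (?f (Suc n)) - integral {?f n..?f (Suc n)} F"
      using \<delta> by (subst integral_diff)
        (auto intro!: integrable_continuous_interval continuous_on_subset [OF cont] sub(2)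
           simp: f_Suc simp del: atLeastatMost_subset_iff, use sub(2) f_Suc in auto)
    moreover have "norm (integral {?f n..?f (Suc n)} (\<lambda>x. F (?f (Suc n)) - F x)) \<le>
        H * \<delta> powr \<kappa> * (?f (Suc n) - ?f n)"
    proof (rule integral_bound)
      show "?f n \<le> ?f (Suc n)" using \<delta> by (simp add: f_Suc)
      show "continuous_on {?f n..?f (Suc n)} (\<lambda>x. F (?f (Suc n)) - F x)"
        by (intro continuous_intros continuous_on_subset [OF cont sub(2)])
      fix x assume x: "x \<in> {?f n..?f (Suc n)}"
      then have "\<bar>F (?f (Suc n)) - F x\<bar> \<le> H * \<bar>?f (Suc n) - x\<bar> powr \<kappa>"
        using sub(2) in2 by (intro holder) auto
      also have "\<dots> \<le> H * \<delta> powr \<kappa>"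
        using x \<kappa> H by (intro mult_left_mono powr_mono2) (auto simp: f_Suc)
      finally show "norm (F (?f (Suc n)) - F x) \<le> H * \<delta> powr \<kappa>" by simp
    qed
    ultimately have "\<bar>\<delta> * F (?f (Suc n)) - integral {?f n..?f (Suc n)} F\<bar> \<le> \<delta> * (H * \<delta> powr \<kappa>)"
      by (simp add: f_Suc mult_ac)
    moreover have "\<bar>\<delta> * (\<Sum>j = 1..n. F (?f j)) - integral {0..?f n} F\<bar> \<le> real n * (\<delta> * (H * \<delta> powr \<kappa>))"
      using Suc by simp
    ultimately show ?case
      unfolding split by (simp add: algebra_simps)
  qed
  let ?n = "N div 2"
  have fn: "?f ?n \<in> {0..pi}" by (rule fourier_freq_in) simp
  have near: "pi - ?f ?n \<le> \<delta>"
  proof -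
    have "real N \<le> 2 * real ?n + 2" by linarith
    then have "pi * real N \<le> pi * (2 * real ?n + 2)" by (intro mult_left_mono) auto
    then have "pi * real N / real N \<le> pi * (2 * real ?n + 2) / real N" by (intro divide_right_mono) auto
    then show ?thesis
      using N by (simp add: fourier_freq_def \<delta>_def distrib_left add_divide_distrib mult_ac)
  qed
  have split: "integral {0..pi} F = integral {0..?f ?n} F + integral {?f ?n..pi} F"
    using fn by (intro Henstock_Kurzweil_Integration.integral_combine [symmetric]
          integrable_continuous_interval cont) auto
  have K: "0 \<le> K" using bound [of 0] by simp
  have "norm (integral {?f ?n..pi} F) \<le> K * (pi - ?f ?n)"
    using fn bound by (intro integral_bound continuous_on_subset [OF cont]) auto
  also have "\<dots> \<le> K * \<delta>" using near K by (rule mult_left_mono)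
  finally have tail: "\<bar>integral {?f ?n..pi} F\<bar> \<le> K * \<delta>" by simp
  have "real ?n * \<delta> \<le> pi"
    using fn by (simp add: fourier_freq_def \<delta>_def mult_ac)
  then have "real ?n * \<delta> * (H * \<delta> powr \<kappa>) \<le> pi * (H * \<delta> powr \<kappa>)"
    using H by (intro mult_right_mono) auto
  with part [of ?n] have main: "\<bar>\<delta> * (\<Sum>j = 1..?n. F (?f j)) - integral {0..?f ?n} F\<bar> \<le> pi * (H * \<delta> powr \<kappa>)"
    by (simp add: mult_ac)
  have "\<bar>\<delta> * (\<Sum>j = 1..?n. F (?f j)) - integral {0..pi} F\<bar> \<le> pi * (H * \<delta> powr \<kappa>) + K * \<delta>"
    unfolding split using main tail by linarith
  also have "\<delta> powr \<kappa> \<le> 7 * real N powr - \<kappa>"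
  proof -
    have "\<delta> powr \<kappa> = (2 * pi) powr \<kappa> * real N powr - \<kappa>"
      using N by (simp add: \<delta>_def powr_divide powr_minus_divide)
    moreover have "(2 * pi) powr \<kappa> \<le> (2 * pi) powr 1"
      using \<kappa> pi_ge_two by (intro powr_mono) auto
    moreover have "(2 * pi) powr 1 \<le> 7" using pi_approx by simp
    ultimately show ?thesis by (simp add: mult_right_mono)
  qed
  also have "\<delta> \<le> 2 * pi * real N powr - \<kappa>"
  proof -
    have "real N powr - 1 \<le> real N powr - \<kappa>" using N \<kappa> by (intro powr_mono) auto
    then show ?thesis using N by (simp add: \<delta>_def powr_minus divide_inverse mult_left_mono)
  qed
  finally have "\<bar>\<delta> * (\<Sum>j = 1..?n. F (?f j)) - integral {0..pi} F\<bar>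
      \<le> pi * (H * (7 * real N powr - \<kappa>)) + K * (2 * pi * real N powr - \<kappa>)"
    using H K by (simp add: mult_left_mono)
  then have "\<bar>\<delta> * (\<Sum>j = 1..?n. F (?f j)) - integral {0..pi} F\<bar> / pi \<le> (7 * H + 2 * K) * real N powr - \<kappa>"
    by (simp add: field_simps)
  also have "\<bar>\<delta> * (\<Sum>j = 1..?n. F (?f j)) - integral {0..pi} F\<bar> / pi = \<bar>freq_mean F N - integral {0..pi} F / pi\<bar>"
  proof -
    have "(\<delta> * (\<Sum>j = 1..?n. F (?f j)) - integral {0..pi} F) / pi = freq_mean F N - integral {0..pi} F / pi"
      by (simp add: freq_mean_def \<delta>_def field_simps)
    then show ?thesis by (metis abs_divide abs_of_pos pi_gt_zero)
  qed
  finally show ?thesis .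
qed

text \<open>The Lipschitz bound suffices if \<bar>x - y\<bar> \<le> 1, the trivial bound 2
  otherwise.\<close>

lemma cos_holder:
  fixes x y \<kappa> :: real
  assumes "0 < \<kappa>" "\<kappa> \<le> 1"
  shows "\<bar>cos x - cos y\<bar> \<le> 2 * \<bar>x - y\<bar> powr \<kappa>"
proof (cases "\<bar>x - y\<bar> \<le> 1")
  case True
  have "\<bar>cos x - cos y\<bar> = 2 * (\<bar>sin ((x + y) / 2)\<bar> * \<bar>sin ((y - x) / 2)\<bar>)"
    by (simp add: cos_diff_cos abs_mult)
  also have "\<dots> \<le> 2 * (1 * \<bar>(y - x) / 2\<bar>)"
    by (intro mult_left_mono mult_mono abs_sin_le_one abs_sin_x_le_abs_x) auto
  also have "\<dots> \<le> \<bar>x - y\<bar> powr 1" by simp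
  also have "\<dots> \<le> \<bar>x - y\<bar> powr \<kappa>" using True assms by (intro powr_mono') auto
  finally show ?thesis using powr_ge_zero [of "\<bar>x - y\<bar>" \<kappa>] by linarith
next
  case False
  then have "1 \<le> \<bar>x - y\<bar> powr \<kappa>" using assms by (intro ge_one_powr_ge_zero) auto
  moreover have "\<bar>cos x - cos y\<bar> \<le> 2"
    using abs_cos_le_one [of x] abs_cos_le_one [of y] by linarith
  ultimately show ?thesis by linarith
qed

text \<open>The Hoelder constant of w(x) cos(h x) is at most
  \<open>H + 2 * K * \<bar>h\<bar> powr \<kappa>\<close>, and 16 = 7 * 2 + 2 collects the terms in
  \<open>K\<close>. Because of its growth in \<open>h\<close> the rate serves fixed lags and the
  deterministic error, where \<psi> supplies weights; sums over all lags go through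
  \<open>dcos_fcos_square_mean\<close>.\<close>

lemma dcos_fcos_rate:
  assumes cont: "continuous_on {0..pi} w"
    and holder: "\<And>x y. x \<in> {0..pi} \<Longrightarrow> y \<in> {0..pi} \<Longrightarrow> \<bar>w x - w y\<bar> \<le> H * \<bar>x - y\<bar> powr \<kappa>"
    and bound: "\<And>x. x \<in> {0..pi} \<Longrightarrow> \<bar>w x\<bar> \<le> K"
    and H: "0 \<le> H" and \<kappa>: "0 < \<kappa>" "\<kappa> \<le> 1" and N: "0 < N"
  shows "\<bar>dcos w N h - fcos w h\<bar> \<le> (7 * H + 16 * K) * (1 + \<bar>real_of_int h\<bar>) powr \<kappa> * real N powr - \<kappa>"
proof -
  let ?h = "\<bar>real_of_int h\<bar>"
  have K: "0 \<le> K" using bound [of 0] by simp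
  have "\<bar>dcos w N h - fcos w h\<bar> \<le> (7 * (H + 2 * K * ?h powr \<kappa>) + 2 * K) * real N powr - \<kappa>"
    unfolding dcos_def fcos_def
  proof (rule freq_mean_integral_rate)
    show "continuous_on {0..pi} (\<lambda>x. w x * cos (real_of_int h * x))"
      by (intro continuous_intros cont)
    fix x y assume x: "x \<in> {0..pi}" and y: "y \<in> {0..pi}"
    show "\<bar>w x * cos (real_of_int h * x)\<bar> \<le> K"
      unfolding abs_mult using mult_mono [OF bound [OF x] abs_cos_le_one [of "real_of_int h * x"]] K by simp
    have "w x * cos (real_of_int h * x) - w y * cos (real_of_int h * y) =
        (w x - w y) * cos (real_of_int h * x) + w y * (cos (real_of_int h * x) - cos (real_of_int h * y))"
      by (simp add: algebra_simps)
    also have "\<bar>\<dots>\<bar> \<le> \<bar>w x - w y\<bar> * \<bar>cos (real_of_int h * x)\<bar> + \<bar>w y\<bar> * \<bar>cos (real_of_int h * x) - cos (real_of_int h * y)\<bar>"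
      by (metis abs_mult abs_triangle_ineq)
    also have "\<dots> \<le> H * \<bar>x - y\<bar> powr \<kappa> * 1 + K * (2 * \<bar>real_of_int h * x - real_of_int h * y\<bar> powr \<kappa>)"
      using x y K H \<kappa> by (intro add_mono mult_mono holder bound cos_holder) auto
    also have "\<bar>real_of_int h * x - real_of_int h * y\<bar> powr \<kappa> = ?h powr \<kappa> * \<bar>x - y\<bar> powr \<kappa>"
      by (simp add: right_diff_distrib [symmetric] abs_mult powr_mult)
    finally show "\<bar>w x * cos (real_of_int h * x) - w y * cos (real_of_int h * y)\<bar>
        \<le> (H + 2 * K * ?h powr \<kappa>) * \<bar>x - y\<bar> powr \<kappa>"
      by (simp add: algebra_simps)
  qed (use H K \<kappa> N in auto)
  also have "\<dots> \<le> (7 * H + 16 * K) * (1 + ?h) powr \<kappa> * real N powr - \<kappa>"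
  proof (rule mult_right_mono)
    have 1: "1 \<le> (1 + ?h) powr \<kappa>" using \<kappa> by (intro ge_one_powr_ge_zero) auto
    have 2: "?h powr \<kappa> \<le> (1 + ?h) powr \<kappa>" using \<kappa> by (intro powr_mono2) auto
    have "7 * H * 1 + 14 * K * ?h powr \<kappa> + 2 * K * 1 \<le>
        7 * H * (1 + ?h) powr \<kappa> + 14 * K * (1 + ?h) powr \<kappa> + 2 * K * (1 + ?h) powr \<kappa>"
      using 1 2 H K by (intro add_mono mult_left_mono) auto
    then show "7 * (H + 2 * K * ?h powr \<kappa>) + 2 * K \<le> (7 * H + 16 * K) * (1 + ?h) powr \<kappa>"
      by (simp add: algebra_simps)
  qed simp
  finally show ?thesis .
qed

text \<open>Discrete Parseval: \<open>N\<close> consecutive lags form a full period, over which the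
  cosines of distinct Fourier frequencies are orthogonal. The frequency pi, present only for even
  \<open>N\<close>, counts twice because both cosines of the product formula are constant
  there.\<close>

lemma dcos_row:
  assumes N: "0 < N"
  shows "(\<Sum>l = 1..N. (dcos w N (k - int l))\<^sup>2) =
    2 / real N * (\<Sum>j = 1..N div 2. (w (fourier_freq N j))\<^sup>2 * (1 + of_bool (2 * j = N)))"
proof -
  let ?J = "{1..N div 2}"
  let ?w = "\<lambda>j. w (fourier_freq N j)"
  let ?c = "\<lambda>j l. cos (real_of_int (k - int l) * fourier_freq N j)"
  have inner: "(\<Sum>l = 1..N. ?c i l * ?c j l) = real N / 2 * (of_bool (i = j) + of_bool (i = j \<and> 2 * j = N))"
    if ij: "i \<in> ?J" "j \<in> ?J" for i j
  proof -
    have "?c i l * ?c j l = (cos (2 * pi * of_int ((k - int l) * (int i - int j)) / real N)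
        + cos (2 * pi * of_int ((k - int l) * (int i + int j)) / real N)) / 2" for l
      by (simp add: cos_times_cos fourier_freq_def algebra_simps add_divide_distrib diff_divide_distrib)
    then have "(\<Sum>l = 1..N. ?c i l * ?c j l) =
        ((if int N dvd int i - int j then real N else 0) + (if int N dvd int i + int j then real N else 0)) / 2"
      by (simp only: sum_divide_distrib [symmetric] sum.distrib sum_cos_period [OF N])
    also have "int N dvd int i - int j \<longleftrightarrow> i = j"
    proof
      assume "int N dvd int i - int j"
      moreover have "\<bar>int i - int j\<bar> < int N" using ij by auto
      ultimately show "i = j" using zdvd_imp_le [of "int N" "\<bar>int i - int j\<bar>"] by force
    qed simp
    \<comment> \<open>Both indices are at most \<open>N / 2\<close>, so their sum reaches
      \<open>N\<close> only if both are equal to it.\<close>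
    also have "int N dvd int i + int j \<longleftrightarrow> i = j \<and> 2 * j = N"
    proof
      assume "int N dvd int i + int j"
      then have "int N \<le> int i + int j" using ij by (intro zdvd_imp_le) auto
      moreover have "2 * i \<le> N" "2 * j \<le> N" using ij by auto
      ultimately show "i = j \<and> 2 * j = N" by linarith
    qed auto
    finally show ?thesis by auto
  qed
  have "(\<Sum>l = 1..N. (dcos w N (k - int l))\<^sup>2) =
      (\<Sum>l = 1..N. (2 / real N)\<^sup>2 * (\<Sum>i\<in>?J. \<Sum>j\<in>?J. ?w i * ?w j * (?c i l * ?c j l)))"
    unfolding dcos_def freq_mean_def power_mult_distrib
      power2_eq_square [of "sum f A" for f :: "nat \<Rightarrow> real" and A] sum_product
    by (simp only: mult.assoc mult.left_commute mult.commute)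
  also have "\<dots> = (2 / real N)\<^sup>2 * (\<Sum>i\<in>?J. \<Sum>j\<in>?J. ?w i * ?w j * (\<Sum>l = 1..N. ?c i l * ?c j l))"
  proof -
    have "(\<Sum>l = 1..N. \<Sum>i\<in>?J. \<Sum>j\<in>?J. ?w i * ?w j * (?c i l * ?c j l)) =
        (\<Sum>i\<in>?J. \<Sum>l = 1..N. \<Sum>j\<in>?J. ?w i * ?w j * (?c i l * ?c j l))"
      by (rule sum.swap)
    also have "\<dots> = (\<Sum>i\<in>?J. \<Sum>j\<in>?J. \<Sum>l = 1..N. ?w i * ?w j * (?c i l * ?c j l))"
      by (rule sum.cong [OF refl], rule sum.swap)
    finally show ?thesis unfolding sum_distrib_left [symmetric] by (rule arg_cong)
  qed
  also have "\<dots> = (2 / real N)\<^sup>2 * (\<Sum>i\<in>?J. \<Sum>j\<in>?J. if j = i then ?w j * ?w j * (real N / 2 * (1 + of_bool (2 * j = N))) else 0)"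
    by (intro arg_cong2 [where f = times] refl sum.cong) (simp only: inner, auto)
  also have "\<dots> = 2 / real N * (\<Sum>j\<in>?J. (?w j)\<^sup>2 * (1 + of_bool (2 * j = N)))"
    using N by (simp add: power2_eq_square sum_distrib_left) (simp add: field_simps)
  finally show ?thesis .
qed

lemma dcos_row_le:
  assumes N: "0 < N" and bound: "\<And>x. x \<in> {0..pi} \<Longrightarrow> \<bar>w x\<bar> \<le> K"
  shows "(\<Sum>l = 1..N. (dcos w N (k - int l))\<^sup>2) \<le> freq_mean (\<lambda>x. (w x)\<^sup>2) N + 2 * K\<^sup>2 / real N"
proof -
  let ?w = "\<lambda>j. w (fourier_freq N j)"
  have "(\<Sum>j = 1..N div 2. (?w j)\<^sup>2 * of_bool (2 * j = N)) \<le> (\<Sum>j = 1..N div 2. if j = N div 2 then K\<^sup>2 else 0)"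
  proof (rule sum_mono)
    fix j assume "j \<in> {1..N div 2}"
    then have "\<bar>?w j\<bar>\<^sup>2 \<le> K\<^sup>2" by (intro power_mono bound fourier_freq_in) auto
    then show "(?w j)\<^sup>2 * of_bool (2 * j = N) \<le> (if j = N div 2 then K\<^sup>2 else 0)" by auto
  qed
  also have "\<dots> \<le> K\<^sup>2" by simp
  finally have "2 / real N * (\<Sum>j = 1..N div 2. (?w j)\<^sup>2 * of_bool (2 * j = N)) \<le> 2 / real N * K\<^sup>2"
    by (intro mult_left_mono) auto
  then show ?thesis
    unfolding dcos_row [OF N] by (simp add: freq_mean_def distrib_left sum.distrib)
qed

text \<open>As in the passage from weak to strong convergence by means of norms: for lags
  \<bar>h\<bar> \<le> D the coefficients converge one by one, and beyond them (d - f)^2 \<le> 2 d^2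
  + 2 f^2, whose mass is the full mass minus that of the window. Both full masses are asymptotically
  at most \<open>msq w\<close> per row, so the upper limit is at most four times the Parseval tail
  beyond \<open>D\<close>.\<close>

lemma dcos_fcos_square_mean:
  assumes cont: "continuous_on {0..pi} w"
    and holder: "\<And>x y. x \<in> {0..pi} \<Longrightarrow> y \<in> {0..pi} \<Longrightarrow> \<bar>w x - w y\<bar> \<le> H * \<bar>x - y\<bar> powr \<kappa>"
    and bound: "\<And>x. x \<in> {0..pi} \<Longrightarrow> \<bar>w x\<bar> \<le> K"
    and H: "0 \<le> H" and \<kappa>: "0 < \<kappa>" "\<kappa> \<le> 1"
  shows "(\<lambda>N. (\<Sum>k = 1..N. \<Sum>l = 1..N. (dcos w N (int k - int l) - fcos w (int k - int l))\<^sup>2) / real N)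
    \<longlonglongrightarrow> 0"
proof -
  have K: "0 \<le> K" using bound [of 0] by simp
  have pow0: "(\<lambda>N. real N powr - \<kappa>) \<longlonglongrightarrow> 0"
    using \<kappa> by (intro tendsto_neg_powr filterlim_real_sequentially) auto
  have conv: "(\<lambda>N. dcos w N h) \<longlonglongrightarrow> fcos w h" for h
  proof -
    have "(\<lambda>N. (7 * H + 16 * K) * (1 + \<bar>real_of_int h\<bar>) powr \<kappa> * real N powr - \<kappa>) \<longlonglongrightarrow> 0"
      by (rule tendsto_mult_right_zero [OF pow0])
    then have "(\<lambda>N. dcos w N h - fcos w h) \<longlonglongrightarrow> 0"
      by (rule Lim_null_comparison [rotated])
        (auto simp: eventually_sequentially intro!: exI [of _ 1] dcos_fcos_rate [OF cont holder bound H \<kappa>])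
    then show ?thesis by (rule LIM_zero_cancel)
  qed
  have conv_sq: "(\<lambda>N. freq_mean (\<lambda>x. (w x)\<^sup>2) N) \<longlonglongrightarrow> msq w"
  proof -
    have "(\<lambda>N. (7 * (2 * K * H) + 2 * K\<^sup>2) * real N powr - \<kappa>) \<longlonglongrightarrow> 0"
      by (rule tendsto_mult_right_zero [OF pow0])
    moreover have "\<bar>freq_mean (\<lambda>x. (w x)\<^sup>2) N - integral {0..pi} (\<lambda>x. (w x)\<^sup>2) / pi\<bar> \<le>
        (7 * (2 * K * H) + 2 * K\<^sup>2) * real N powr - \<kappa>" if "0 < N" for N
    proof (rule freq_mean_integral_rate)
      show "continuous_on {0..pi} (\<lambda>x. (w x)\<^sup>2)" by (intro continuous_intros cont)
      fix x y assume x: "x \<in> {0..pi}" and y: "y \<in> {0..pi}"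
      show "\<bar>(w x)\<^sup>2\<bar> \<le> K\<^sup>2" using power_mono [OF bound [OF x], of 2] by simp
      have "(w x)\<^sup>2 - (w y)\<^sup>2 = (w x + w y) * (w x - w y)" by (simp add: power2_eq_square algebra_simps)
      also have "\<bar>\<dots>\<bar> = \<bar>w x + w y\<bar> * \<bar>w x - w y\<bar>" by (rule abs_mult)
      also have "\<dots> \<le> (2 * K) * (H * \<bar>x - y\<bar> powr \<kappa>)"
        using bound [OF x] bound [OF y] K H x y by (intro mult_mono holder) auto
      finally show "\<bar>(w x)\<^sup>2 - (w y)\<^sup>2\<bar> \<le> 2 * K * H * \<bar>x - y\<bar> powr \<kappa>" by (simp add: mult_ac)
    qed (use K H \<kappa> that in auto)
    then have "\<forall>\<^sub>F N in sequentially. norm (freq_mean (\<lambda>x. (w x)\<^sup>2) N - msq w) \<le>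
        (7 * (2 * K * H) + 2 * K\<^sup>2) * real N powr - \<kappa>"
      by (auto simp: msq_def eventually_sequentially intro!: exI [of _ 1])
    ultimately have "(\<lambda>N. freq_mean (\<lambda>x. (w x)\<^sup>2) N - msq w) \<longlonglongrightarrow> 0"
      by (rule Lim_null_comparison [rotated])
    then show ?thesis by (rule LIM_zero_cancel)
  qed
  let ?E = "\<lambda>N. (\<Sum>k = 1..N. \<Sum>l = 1..N. (dcos w N (int k - int l) - fcos w (int k - int l))\<^sup>2) / real N"
  show ?thesis
  proof (rule LIMSEQ_I)
    fix e :: real assume "0 < e"
    \<comment> \<open>The final bound is four times this tail, that is, below
      \<open>e / 2\<close>.\<close>
    obtain D where "norm ((\<Sum>h = - int D..int D. (fcos w h)\<^sup>2) - msq w) < e / 8"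
      using LIMSEQ_D [OF fcos_parseval [OF cont], of "e / 8"] \<open>0 < e\<close> by auto
    then have D: "msq w - (\<Sum>h = - int D..int D. (fcos w h)\<^sup>2) < e / 8" unfolding real_norm_def by linarith
    let ?I = "{- int D..int D}"
    let ?T = "\<lambda>N F. \<Sum>r<N. \<Sum>h = - int r..int r. F (h::int) :: real"
    define R where "R N = (\<Sum>h\<in>?I. (dcos w N h - fcos w h)\<^sup>2)
        - 2 * (1 - real D / real N) * (\<Sum>h\<in>?I. (dcos w N h)\<^sup>2 + (fcos w h)\<^sup>2)
        + 2 * (freq_mean (\<lambda>x. (w x)\<^sup>2) N + 2 * K\<^sup>2 / real N) + 2 * msq w" for N
    have upper: "?T N (\<lambda>h. if h \<in> ?I then F h else 0) \<le> real N * (\<Sum>h\<in>?I. F h)"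
      if "\<And>h. 0 \<le> F h" for N F
    proof -
      have "(\<Sum>h = - int r..int r. if h \<in> ?I then F h else 0) \<le> (\<Sum>h\<in>?I. F h)" for r
        by (subst sum.inter_restrict [symmetric]) (auto intro!: sum_mono2 that)
      then have "?T N (\<lambda>h. if h \<in> ?I then F h else 0) \<le> (\<Sum>r<N. \<Sum>h\<in>?I. F h)"
        by (rule sum_mono)
      then show ?thesis by simp
    qed
    \<comment> \<open>A lag \<bar>h\<bar> \<le> D can be missing only from the windows with
      \<open>r < D\<close>, so at least \<open>N - D\<close> of the \<open>N\<close> windows contain
      it.\<close>
    have lower: "(real N - real D) * (\<Sum>h\<in>?I. F h) \<le> ?T N (\<lambda>h. if h \<in> ?I then F h else 0)"
      if "\<And>h. 0 \<le> F h" "D \<le> N" for N F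
    proof -
      have "(real N - real D) * (\<Sum>h\<in>?I. F h) = (\<Sum>r\<in>{D..<N}. \<Sum>h\<in>?I. F h)"
        using \<open>D \<le> N\<close> by (simp add: of_nat_diff)
      also have "\<dots> = (\<Sum>r\<in>{D..<N}. \<Sum>h = - int r..int r. if h \<in> ?I then F h else 0)"
        by (intro sum.cong refl sum.mono_neutral_cong_left) auto
      also have "\<dots> \<le> ?T N (\<lambda>h. if h \<in> ?I then F h else 0)"
        by (intro sum_mono2) (auto intro!: sum_nonneg that)
      finally show ?thesis .
    qed
    have EN: "?E N \<le> R N" if N: "0 < N" "D \<le> N" for N
    proof -
      let ?d = "dcos w N" let ?f = "fcos w"
      \<comment> \<open>An equality inside the window; outside, (d + f)^2 is dropped. In this global
        form the full sums of squares can be bounded by Parseval and Bessel.\<close>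
      have pt: "(?d h - ?f h)\<^sup>2 \<le> (if h \<in> ?I then (?d h - ?f h)\<^sup>2 else 0)
          - 2 * (if h \<in> ?I then (?d h)\<^sup>2 + (?f h)\<^sup>2 else 0) + 2 * (?d h)\<^sup>2 + 2 * (?f h)\<^sup>2" for h
        using zero_le_power2 [of "?d h + ?f h"] by (simp add: power2_eq_square algebra_simps)
      have "(\<Sum>k = 1..N. \<Sum>l = 1..N. (?d (int k - int l) - ?f (int k - int l))\<^sup>2) = ?T N (\<lambda>h. (?d h - ?f h)\<^sup>2)"
        by (rule sum_toeplitz)
      also have "\<dots> \<le> ?T N (\<lambda>h. (if h \<in> ?I then (?d h - ?f h)\<^sup>2 else 0)
          - 2 * (if h \<in> ?I then (?d h)\<^sup>2 + (?f h)\<^sup>2 else 0) + 2 * (?d h)\<^sup>2 + 2 * (?f h)\<^sup>2)"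
        by (intro sum_mono pt)
      also have "\<dots> = ?T N (\<lambda>h. if h \<in> ?I then (?d h - ?f h)\<^sup>2 else 0)
          - 2 * ?T N (\<lambda>h. if h \<in> ?I then (?d h)\<^sup>2 + (?f h)\<^sup>2 else 0) + 2 * ?T N (\<lambda>h. (?d h)\<^sup>2)
          + 2 * ?T N (\<lambda>h. (?f h)\<^sup>2)"
        unfolding sum.distrib sum_subtractf sum_distrib_left by simp
      finally have le: "(\<Sum>k = 1..N. \<Sum>l = 1..N. (?d (int k - int l) - ?f (int k - int l))\<^sup>2) \<le>
          ?T N (\<lambda>h. if h \<in> ?I then (?d h - ?f h)\<^sup>2 else 0)
          - 2 * ?T N (\<lambda>h. if h \<in> ?I then (?d h)\<^sup>2 + (?f h)\<^sup>2 else 0) + 2 * ?T N (\<lambda>h. (?d h)\<^sup>2)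
          + 2 * ?T N (\<lambda>h. (?f h)\<^sup>2)" .
      have "?T N (\<lambda>h. (?d h)\<^sup>2) = (\<Sum>k = 1..N. \<Sum>l = 1..N. (?d (int k - int l))\<^sup>2)"
        by (rule sum_toeplitz [symmetric])
      also have "\<dots> \<le> (\<Sum>k = 1..N. freq_mean (\<lambda>x. (w x)\<^sup>2) N + 2 * K\<^sup>2 / real N)"
        by (intro sum_mono dcos_row_le N bound)
      finally have 1: "?T N (\<lambda>h. (?d h)\<^sup>2) \<le> real N * (freq_mean (\<lambda>x. (w x)\<^sup>2) N + 2 * K\<^sup>2 / real N)"
        by simp
      have "?T N (\<lambda>h. (?f h)\<^sup>2) \<le> (\<Sum>r<N. msq w)"
        by (intro sum_mono fcos_bessel cont) auto
      then have 2: "?T N (\<lambda>h. (?f h)\<^sup>2) \<le> real N * msq w" by simp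
      have 3: "?T N (\<lambda>h. if h \<in> ?I then (?d h - ?f h)\<^sup>2 else 0) \<le> real N * (\<Sum>h\<in>?I. (?d h - ?f h)\<^sup>2)"
        by (rule upper) auto
      have 4: "(real N - real D) * (\<Sum>h\<in>?I. (?d h)\<^sup>2 + (?f h)\<^sup>2) \<le>
          ?T N (\<lambda>h. if h \<in> ?I then (?d h)\<^sup>2 + (?f h)\<^sup>2 else 0)"
        using N by (intro lower) auto
      have arith: "S / n \<le> a - 2 * (1 - d / n) * b + 2 * c + 2 * m"
        if "S \<le> A - 2 * B + 2 * C + 2 * G" "A \<le> n * a" "(n - d) * b \<le> B" "C \<le> n * c" "G \<le> n * m" "0 < n"
        for S A B C G n a b c d m :: real
      proof -
        have "S \<le> n * (a - 2 * (1 - d / n) * b + 2 * c + 2 * m)"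
          using that by (simp add: algebra_simps)
        then show ?thesis using \<open>0 < n\<close> by (simp add: pos_divide_le_eq mult.commute)
      qed
      show ?thesis
        unfolding R_def by (rule arith [OF le 3 4 1 2]) (use N in simp)
    qed
    have "R \<longlonglongrightarrow> (\<Sum>h\<in>?I. (fcos w h - fcos w h)\<^sup>2) - 2 * (1 - 0) * (\<Sum>h\<in>?I. (fcos w h)\<^sup>2 + (fcos w h)\<^sup>2)
        + 2 * (msq w + 0) + 2 * msq w"
      unfolding R_def by (intro tendsto_intros conv conv_sq lim_const_over_n)
    then have "R \<longlonglongrightarrow> 4 * (msq w - (\<Sum>h\<in>?I. (fcos w h)\<^sup>2))"
      by (simp add: sum_distrib_left [symmetric] right_diff_distrib)
    moreover have "4 * (msq w - (\<Sum>h\<in>?I. (fcos w h)\<^sup>2)) < e" 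
      using mult_strict_left_mono [OF D, of 4] \<open>0 < e\<close> by simp
    ultimately have "\<forall>\<^sub>F N in sequentially. R N < e" by (rule order_tendstoD)
    moreover have "\<forall>\<^sub>F N in sequentially. 0 < N \<and> D \<le> N"
      by (intro eventually_conj eventually_gt_at_top eventually_ge_at_top)
    ultimately have "\<forall>\<^sub>F N in sequentially. norm (?E N - 0) < e"
    proof eventually_elim
      case (elim N)
      have "0 \<le> ?E N" by (intro divide_nonneg_nonneg sum_nonneg) auto
      then show ?case using EN [of N] elim by auto
    qed
    then show "\<exists>no. \<forall>n\<ge>no. norm (?E n - 0) < e" by (simp add: eventually_sequentially)
  qed
qed

section \<open>Quadratic forms in Gaussian white noise\<close>

text \<open>Cauchy-Schwarz with the weight \<open>t\<close> split off. If \<open>t p\<close> is the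
  growth rate of \<open>x p\<close>, both factors stay finite under weighted summability of
  \<open>c\<close>, with no bound on \<open>x\<close> uniform in \<open>p\<close>.\<close>

lemma weighted_sum_square_le:
  fixes c t x :: "'i \<Rightarrow> real"
  assumes "\<And>p. p \<in> A \<Longrightarrow> 0 < t p"
  shows "(\<Sum>p\<in>A. c p * x p)\<^sup>2 \<le> (\<Sum>p\<in>A. \<bar>c p\<bar> * t p) * (\<Sum>p\<in>A. \<bar>c p\<bar> * (x p)\<^sup>2 / t p)"
proof -
  have "(\<Sum>p\<in>A. c p * x p) = (\<Sum>p\<in>A. (sgn (c p) * sqrt (\<bar>c p\<bar> * t p)) * (sqrt (\<bar>c p\<bar> / t p) * x p))"
  proof (rule sum.cong)
    fix p assume "p \<in> A"
    have "sqrt (\<bar>c p\<bar> * t p) * sqrt (\<bar>c p\<bar> / t p) = \<bar>c p\<bar>"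
      using assms [OF \<open>p \<in> A\<close>] by (simp add: real_sqrt_mult [symmetric])
    then show "c p * x p = (sgn (c p) * sqrt (\<bar>c p\<bar> * t p)) * (sqrt (\<bar>c p\<bar> / t p) * x p)"
      by (metis mult.assoc mult_sgn_abs mult.commute)
  qed simp
  also have "\<dots>\<^sup>2 \<le> (\<Sum>p\<in>A. (sgn (c p) * sqrt (\<bar>c p\<bar> * t p))\<^sup>2) * (\<Sum>p\<in>A. (sqrt (\<bar>c p\<bar> / t p) * x p)\<^sup>2)"
    by (rule Cauchy_Schwarz_ineq_sum)
  also have "(\<Sum>p\<in>A. (sgn (c p) * sqrt (\<bar>c p\<bar> * t p))\<^sup>2) = (\<Sum>p\<in>A. \<bar>c p\<bar> * t p)"
    using assms by (intro sum.cong) (auto simp: power_mult_distrib sgn_if less_imp_le)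
  also have "(\<Sum>p\<in>A. (sqrt (\<bar>c p\<bar> / t p) * x p)\<^sup>2) = (\<Sum>p\<in>A. \<bar>c p\<bar> * (x p)\<^sup>2 / t p)"
    using assms by (intro sum.cong) (auto simp: power_mult_distrib less_imp_le)
  finally show ?thesis .
qed

text \<open>A number below \<open>x\<close> and \<open>n\<close> is below their geometric mean with
  exponents \<kappa> and 1 - \<kappa>. This trades boundary losses, linear in the lag, for the
  available weight of exponent \<kappa>.\<close>

lemma min_one_plus_powr_le:
  fixes x n \<kappa> :: real
  assumes "1 \<le> x" "1 \<le> n" "0 < \<kappa>" "\<kappa> \<le> 1" "y \<le> x" "y \<le> n"
  shows "y \<le> x powr \<kappa> * n powr (1 - \<kappa>)"
proof (cases "x \<le> n")
  case True
  have "y \<le> x powr \<kappa> * x powr (1 - \<kappa>)"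
    using assms by (simp add: powr_add [symmetric])
  also have "\<dots> \<le> x powr \<kappa> * n powr (1 - \<kappa>)"
    using assms True by (intro mult_left_mono powr_mono2) auto
  finally show ?thesis .
next
  case False
  have "y \<le> n powr \<kappa> * n powr (1 - \<kappa>)"
    using assms by (simp add: powr_add [symmetric])
  also have "\<dots> \<le> x powr \<kappa> * n powr (1 - \<kappa>)"
    using assms False by (intro mult_right_mono powr_mono2) auto
  finally show ?thesis .
qed

section \<open>Moments of the noise and orthogonality of its centred products\<close>

locale white_noise = prob_space M for M :: "'a measure" +
  fixes \<epsilon> :: "int \<Rightarrow> 'a \<Rightarrow> real"
  assumes white_noise: "gaussian_white_noise M \<epsilon>"
begin

lemma indep_noise: "indep_vars (\<lambda>_. borel) \<epsilon> UNIV"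
  using white_noise by (simp add: gaussian_white_noise_def)

lemma noise_distributed: "distributed M lborel (\<epsilon> k) std_normal_density"
  using white_noise by (simp add: gaussian_white_noise_def)

lemma noise_measurable [measurable]: "\<epsilon> k \<in> borel_measurable M"
  using distributed_measurable [OF noise_distributed, of k] by simp

lemma noise_power_integrable: "integrable M (\<lambda>\<omega>. \<epsilon> k \<omega> ^ n)"
proof -
  have "integrable lborel (\<lambda>x. std_normal_density x * x ^ n)"
    by (rule integrable_std_normal_moment)
  then show ?thesis
    using distributed_integrable [OF noise_distributed, of "\<lambda>x. x ^ n" k] by simp
qed

definition noise_moment :: "nat \<Rightarrow> real" where
  "noise_moment n = integral\<^sup>L lborel (\<lambda>x. std_normal_density x * x ^ n)"

lemma expectation_noise_power: "expectation (\<lambda>\<omega>. \<epsilon> k \<omega> ^ n) = noise_moment n"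
  unfolding noise_moment_def
  using distributed_integral [OF noise_distributed, of "\<lambda>x. x ^ n" k] by simp

lemma noise_moment_simps [simp]:
  "noise_moment 0 = 1" "noise_moment (Suc 0) = 0" "noise_moment 2 = 1"
  "noise_moment 3 = 0" "noise_moment 4 = 3"
  using integral_std_normal_moment_even [of 0] integral_std_normal_moment_even [of 1]
    integral_std_normal_moment_even [of 2] integral_std_normal_moment_odd [of 0]
    integral_std_normal_moment_odd [of 1]
  by (simp_all add: noise_moment_def fact_numeral)

text \<open>Wick's formula for four factors. Factors with equal index are collected into a power, so
  that independence leaves a product of moments; the pattern of equalities among the indices then
  decides, the fourth moment 3 matching the three pairings.\<close>

lemma noise_product4:
  shows noise_product4_integrable: "integrable M (\<lambda>\<omega>. \<epsilon> a \<omega> * \<epsilon> b \<omega> * (\<epsilon> c \<omega> * \<epsilon> d \<omega>))" (is ?int)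
    and expectation_noise_product4: "expectation (\<lambda>\<omega>. \<epsilon> a \<omega> * \<epsilon> b \<omega> * (\<epsilon> c \<omega> * \<epsilon> d \<omega>)) =
      of_bool (a = b \<and> c = d) + of_bool (a = c \<and> b = d) + of_bool (a = d \<and> b = c)" (is ?exp)
proof -
  let ?I = "{a, b, c, d}"
  define n :: "int \<Rightarrow> nat" where
    "n i = of_bool (i = a) + of_bool (i = b) + of_bool (i = c) + of_bool (i = d)" for i
  have delta: "(\<Prod>i\<in>?I. \<epsilon> i \<omega> ^ of_bool (i = x)) = \<epsilon> x \<omega>" if "x \<in> ?I" for x \<omega>
  proof -
    have "(\<Prod>i\<in>?I. \<epsilon> i \<omega> ^ of_bool (i = x)) = (\<Prod>i\<in>?I. if i = x then \<epsilon> i \<omega> else 1)"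
      by (intro prod.cong) auto
    also have "\<dots> = \<epsilon> x \<omega>" using that by (simp add: prod.delta)
    finally show ?thesis .
  qed
  have prod: "\<epsilon> a \<omega> * \<epsilon> b \<omega> * (\<epsilon> c \<omega> * \<epsilon> d \<omega>) = (\<Prod>i\<in>?I. \<epsilon> i \<omega> ^ n i)" for \<omega>
    unfolding n_def power_add prod.distrib using delta [of _ \<omega>] by (simp add: mult.assoc)
  have ind: "indep_vars (\<lambda>_. borel) (\<lambda>i \<omega>. \<epsilon> i \<omega> ^ n i) ?I"
    by (rule indep_vars_compose2 [OF indep_vars_subset [OF indep_noise]]) auto
  \<comment> \<open>The case split produces exponents as iterated \<open>Suc\<close>, so the moments
    are also needed in that form.\<close>
  have "Suc (Suc (Suc (Suc 0))) = 4" by simp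
  then have mom4: "noise_moment (Suc (Suc (Suc (Suc 0)))) = 3" by (simp only: noise_moment_simps)
  note mom = noise_moment_simps noise_moment_simps(3) [unfolded numeral_2_eq_2]
    noise_moment_simps(4) [unfolded numeral_3_eq_3] mom4
  show ?int unfolding prod
    by (rule indep_vars_integrable [OF _ ind]) (auto intro: noise_power_integrable)
  have "expectation (\<lambda>\<omega>. \<epsilon> a \<omega> * \<epsilon> b \<omega> * (\<epsilon> c \<omega> * \<epsilon> d \<omega>)) = (\<Prod>i\<in>?I. noise_moment (n i))"
    unfolding prod
    by (subst indep_vars_lebesgue_integral [OF _ ind])
      (auto intro: noise_power_integrable simp: expectation_noise_power simp del: prod.insert)
  also have "\<dots> = of_bool (a = b \<and> c = d) + of_bool (a = c \<and> b = d) + of_bool (a = d \<and> b = c)"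
    unfolding n_def
    by (cases "a = b"; cases "a = c"; cases "a = d"; cases "b = c"; cases "b = d"; cases "c = d")
      (simp_all add: prod.insert_if mom)
  finally show ?exp .
qed

lemma noise_product2_integrable: "integrable M (\<lambda>\<omega>. \<epsilon> a \<omega> * \<epsilon> b \<omega>)"
proof (rule Bochner_Integration.integrable_bound)
  show "integrable M (\<lambda>\<omega>. \<epsilon> a \<omega> ^ 2 + \<epsilon> b \<omega> ^ 2)"
    by (intro Bochner_Integration.integrable_add noise_power_integrable)
  have "\<bar>x * y\<bar> \<le> x\<^sup>2 + y\<^sup>2" for x y :: real
    using sum_squares_bound [of "\<bar>x\<bar>" "\<bar>y\<bar>"] abs_ge_zero [of "x * y"]
    unfolding abs_mult power2_abs by linarith
  then show "AE \<omega> in M. norm (\<epsilon> a \<omega> * \<epsilon> b \<omega>) \<le> norm (\<epsilon> a \<omega> ^ 2 + \<epsilon> b \<omega> ^ 2)"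
    by (intro AE_I2) (metis abs_ge_self order_trans real_norm_def)
qed measurable

lemma expectation_noise_product2: "expectation (\<lambda>\<omega>. \<epsilon> a \<omega> * \<epsilon> b \<omega>) = of_bool (a = b)"
proof (cases "a = b")
  case True
  then show ?thesis using expectation_noise_power [of b 2] by (simp add: power2_eq_square)
next
  case False
  have ind: "indep_vars (\<lambda>_. borel) \<epsilon> {a, b}"
    by (rule indep_vars_subset [OF indep_noise]) simp
  have "expectation (\<lambda>\<omega>. \<Prod>i\<in>{a, b}. \<epsilon> i \<omega>) = (\<Prod>i\<in>{a, b}. expectation (\<epsilon> i))"
    using noise_power_integrable [of _ 1] by (intro indep_vars_lebesgue_integral ind) auto
  then show ?thesis using False expectation_noise_power [of a 1] by simp
qed

definition \<eta> :: "int \<Rightarrow> int \<Rightarrow> 'a \<Rightarrow> real" where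
  "\<eta> u v \<omega> = \<epsilon> u \<omega> * \<epsilon> v \<omega> - of_bool (u = v)"

lemma eta_measurable [measurable]: "\<eta> u v \<in> borel_measurable M"
  unfolding \<eta>_def by measurable

lemma eta_integrable: "integrable M (\<eta> u v)"
  unfolding \<eta>_def by (intro Bochner_Integration.integrable_diff noise_product2_integrable) simp

lemma expectation_eta: "expectation (\<eta> u v) = 0"
  unfolding \<eta>_def
  by (subst Bochner_Integration.integral_diff)
    (auto simp: noise_product2_integrable expectation_noise_product2 prob_space)

text \<open>Centring removes the pairing inside each factor; the two pairings across the factors
  remain.\<close>

lemma eta_product:
  shows eta_product_integrable: "integrable M (\<lambda>\<omega>. \<eta> u v \<omega> * \<eta> x y \<omega>)" (is ?int)
    and expectation_eta_product: "expectation (\<lambda>\<omega>. \<eta> u v \<omega> * \<eta> x y \<omega>) =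
      of_bool (u = x \<and> v = y) + of_bool (u = y \<and> v = x)" (is ?exp)
proof -
  have eq: "\<eta> u v \<omega> * \<eta> x y \<omega> = \<epsilon> u \<omega> * \<epsilon> v \<omega> * (\<epsilon> x \<omega> * \<epsilon> y \<omega>)
      - of_bool (u = v) * (\<epsilon> x \<omega> * \<epsilon> y \<omega>) - of_bool (x = y) * (\<epsilon> u \<omega> * \<epsilon> v \<omega>)
      + of_bool (u = v) * of_bool (x = y)" for \<omega>
    by (simp add: \<eta>_def algebra_simps)
  note int = noise_product4_integrable noise_product2_integrable
  show ?int unfolding eq
    by (intro Bochner_Integration.integrable_add Bochner_Integration.integrable_diff
        integrable_mult_right int) simp
  show ?exp unfolding eq
    by (simp add: int expectation_noise_product4 expectation_noise_product2 prob_space)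
qed

lemma eta_sum_square:
  assumes "finite K"
  shows eta_sum_square_integrable: "integrable M (\<lambda>\<omega>. (\<Sum>x\<in>K. c x * \<eta> (f x) (g x) \<omega>)\<^sup>2)" (is ?int)
    and expectation_eta_sum_square: "expectation (\<lambda>\<omega>. (\<Sum>x\<in>K. c x * \<eta> (f x) (g x) \<omega>)\<^sup>2) =
      (\<Sum>x\<in>K. \<Sum>y\<in>K. c x * c y * (of_bool (f x = f y \<and> g x = g y) + of_bool (f x = g y \<and> g x = f y)))" (is ?exp)
proof -
  have eq: "(\<Sum>x\<in>K. c x * \<eta> (f x) (g x) \<omega>)\<^sup>2 =
      (\<Sum>x\<in>K. \<Sum>y\<in>K. c x * c y * (\<eta> (f x) (g x) \<omega> * \<eta> (f y) (g y) \<omega>))" for \<omega>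
    by (simp add: power2_eq_square sum_product mult_ac)
  show ?int unfolding eq
    by (intro Bochner_Integration.integrable_sum integrable_mult_right eta_product_integrable)
  show ?exp unfolding eq
    by (simp add: eta_product_integrable expectation_eta_product)
qed

text \<open>Orthogonality leaves the diagonal and the terms with swapped indices. Swapping matches
  each pair with at most one other, so its matrix has row and column sums at most 1, and 2 x y \<le>
  x^2 + y^2 bounds those terms by a second copy of the diagonal.\<close>

lemma expectation_eta_sum_square_le:
  assumes K: "finite K" and inj: "inj_on (\<lambda>x. (f x, g x)) K"
  shows "expectation (\<lambda>\<omega>. (\<Sum>x\<in>K. c x * \<eta> (f x) (g x) \<omega>)\<^sup>2) \<le> 2 * (\<Sum>x\<in>K. (c x)\<^sup>2)"
proof -
  let ?s = "\<lambda>x y. of_bool (f x = g y \<and> g x = f y) :: real"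
  let ?e = "\<lambda>x y. of_bool (f x = f y \<and> g x = g y) :: real"
  have row: "(\<Sum>y\<in>K. ?s x y) \<le> 1" for x
  proof -
    have "card {y\<in>K. f x = g y \<and> g x = f y} \<le> 1"
      unfolding One_nat_def using K inj by (subst card_le_Suc0_iff_eq) (auto simp: inj_on_def)
    moreover have "(\<Sum>y\<in>K. ?s x y) = real (card {y\<in>K. f x = g y \<and> g x = f y})"
      using K by (simp add: of_bool_def sum.If_cases Int_def)
    ultimately show ?thesis by simp
  qed
  have col: "(\<Sum>x\<in>K. ?s x y) \<le> 1" for y
    using row [of y] by (simp add: conj_commute eq_commute)
  have "c x * c y * ?s x y \<le> (c x)\<^sup>2 / 2 * ?s x y + (c y)\<^sup>2 / 2 * ?s x y" for x y
    using sum_squares_bound [of "c x" "c y"] by auto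
  then have "(\<Sum>x\<in>K. \<Sum>y\<in>K. c x * c y * ?s x y) \<le>
      (\<Sum>x\<in>K. \<Sum>y\<in>K. (c x)\<^sup>2 / 2 * ?s x y + (c y)\<^sup>2 / 2 * ?s x y)"
    by (intro sum_mono)
  also have "\<dots> = (\<Sum>x\<in>K. (c x)\<^sup>2 / 2 * (\<Sum>y\<in>K. ?s x y)) + (\<Sum>y\<in>K. (c y)\<^sup>2 / 2 * (\<Sum>x\<in>K. ?s x y))"
    unfolding sum.distrib sum_distrib_left by (intro arg_cong2 [where f = "(+)"] refl sum.swap)
  also have "\<dots> \<le> (\<Sum>x\<in>K. (c x)\<^sup>2 / 2 * 1) + (\<Sum>y\<in>K. (c y)\<^sup>2 / 2 * 1)"
    by (intro add_mono sum_mono mult_left_mono row col) auto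
  also have "\<dots> = (\<Sum>x\<in>K. (c x)\<^sup>2)"
    by (simp add: sum_divide_distrib [symmetric])
  finally have swap: "(\<Sum>x\<in>K. \<Sum>y\<in>K. c x * c y * ?s x y) \<le> (\<Sum>x\<in>K. (c x)\<^sup>2)" .
  have "(\<Sum>y\<in>K. c x * c y * ?e x y) = (c x)\<^sup>2" if "x \<in> K" for x
  proof -
    have "(\<Sum>y\<in>K. c x * c y * ?e x y) = (\<Sum>y\<in>K. if y = x then c x * c y else 0)"
      using inj that by (intro sum.cong) (auto simp: inj_on_def)
    then show ?thesis using that K by (simp add: power2_eq_square)
  qed
  then have "(\<Sum>x\<in>K. \<Sum>y\<in>K. c x * c y * ?e x y) = (\<Sum>x\<in>K. (c x)\<^sup>2)" by simp
  with swap show ?thesis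
    unfolding expectation_eta_sum_square [OF K] distrib_left sum.distrib by simp
qed

end

text \<open>Submultiplicativity of the weight: a weight in the lag \<open>i - j\<close> splits into
  weights in \<open>i\<close> and \<open>j\<close>, to be paired with
  \<open>\<psi> i * \<psi> j\<close>.\<close>

lemma one_plus_abs_diff_powr_le:
  assumes "0 \<le> \<kappa>"
  shows "(1 + \<bar>real_of_int (i - j)\<bar>) powr \<kappa> \<le>
    (1 + \<bar>real_of_int i\<bar>) powr \<kappa> * (1 + \<bar>real_of_int j\<bar>) powr \<kappa>"
proof -
  have "1 + \<bar>real_of_int (i - j)\<bar> \<le> (1 + \<bar>real_of_int i\<bar>) * (1 + \<bar>real_of_int j\<bar>)"
    using abs_triangle_ineq4 [of "real_of_int i" "real_of_int j"]
      mult_nonneg_nonneg [OF abs_ge_zero [of "real_of_int i"] abs_ge_zero [of "real_of_int j"]]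
    by (simp only: of_int_diff distrib_left distrib_right)
  then have "(1 + \<bar>real_of_int (i - j)\<bar>) powr \<kappa> \<le> ((1 + \<bar>real_of_int i\<bar>) * (1 + \<bar>real_of_int j\<bar>)) powr \<kappa>"
    using assms by (intro powr_mono2) auto
  then show ?thesis by (simp add: powr_mult)
qed

lemma sum_diagonal_count:
  "(\<Sum>k = 1..m. \<Sum>l = 1..m. of_bool (int k - int l = d)) = max 0 (real m - \<bar>real_of_int d\<bar>)"
proof -
  have "(\<Sum>h = - int r..int r. of_bool (h = d)) = (of_bool (\<bar>d\<bar> \<le> int r) :: real)" for r
    by (simp add: of_bool_def sum.delta abs_le_iff)
  then have "(\<Sum>k = 1..m. \<Sum>l = 1..m. of_bool (int k - int l = d)) = (\<Sum>r<m. of_bool (\<bar>d\<bar> \<le> int r) :: real)"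
    unfolding sum_toeplitz [where F = "\<lambda>h. of_bool (h = d)"] by (intro sum.cong) auto
  also have "\<dots> = max 0 (real m - \<bar>real_of_int d\<bar>)"
  proof (induction m)
    case (Suc m)
    show ?case
    proof (cases "\<bar>d\<bar> \<le> int m")
      case True
      then have "\<bar>real_of_int d\<bar> \<le> real m" by linarith
      then show ?thesis using Suc True by simp
    next
      case False
      then have "real m + 1 \<le> \<bar>real_of_int d\<bar>" by linarith
      then show ?thesis using Suc False by simp
    qed
  qed simp
  finally show ?thesis .
qed

lemma sum_swap_pairs:
  "(\<Sum>k\<in>A. \<Sum>l\<in>B. \<Sum>i\<in>C. \<Sum>j\<in>D. f k l i j) = (\<Sum>i\<in>C. \<Sum>j\<in>D. \<Sum>k\<in>A. \<Sum>l\<in>B. f k l i j)"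
  by (simp only: sum.swap [of _ C B] sum.swap [of _ C A] sum.swap [of _ D B] sum.swap [of _ D A])

section \<open>Moving averages and displaced Toeplitz forms\<close>

context white_noise
begin

definition moving_average :: "int set \<Rightarrow> (int \<Rightarrow> real) \<Rightarrow> int \<Rightarrow> 'a \<Rightarrow> real" where
  "moving_average F \<psi> k \<omega> = (\<Sum>i\<in>F. \<psi> i * \<epsilon> (k - i) \<omega>)"

definition toeplitz_form :: "(int \<Rightarrow> real) \<Rightarrow> nat \<Rightarrow> 'a \<Rightarrow> real" where
  "toeplitz_form a m \<omega> = (\<Sum>k = 1..m. \<Sum>l = 1..m. a (int k - int l) * \<eta> (int k) (int l) \<omega>)"

text \<open>Coefficients in the noise of a form that has coefficients \<open>b\<close> in the moving
  average, when the displacement of the index range is ignored.\<close>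

definition double_sum :: "int set \<Rightarrow> (int \<Rightarrow> real) \<Rightarrow> (int \<Rightarrow> real) \<Rightarrow> int \<Rightarrow> real" where
  "double_sum F \<psi> b h = (\<Sum>i\<in>F. \<Sum>j\<in>F. \<psi> i * \<psi> j * b (h + i - j))"

text \<open>Only index pairs in the symmetric difference of the square \<open>{1..m} \<times> {1..m}\<close> and its translate by
  \<open>(i, j)\<close> contribute; they fill at most \<open>2 (\<bar>i\<bar> + \<bar>j\<bar>)\<close> rows and columns, each of square sum at most \<open>B\<close>.\<close>

lemma toeplitz_shift_diff:
  assumes bessel: "\<And>F. finite F \<Longrightarrow> (\<Sum>h\<in>F. (b h)\<^sup>2) \<le> B"
  shows "expectation (\<lambda>\<omega>. ((\<Sum>k = 1..m. \<Sum>l = 1..m. b (int k - int l) * \<eta> (int k - i) (int l - j) \<omega>)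
      - (\<Sum>k = 1..m. \<Sum>l = 1..m. b (int k - int l + i - j) * \<eta> (int k) (int l) \<omega>))\<^sup>2)
    \<le> 4 * (\<bar>real_of_int i\<bar> + \<bar>real_of_int j\<bar>) * B" (is "expectation (\<lambda>\<omega>. (?S1 \<omega> - ?S2 \<omega>)\<^sup>2) \<le> _")
proof -
  let ?A = "\<lambda>d. {1 - d..int m - d}"
  define c where "c p = b (fst p - snd p + i - j) *
      (of_bool (p \<in> ?A i \<times> ?A j) - of_bool (p \<in> ?A 0 \<times> ?A 0))" for p
  let ?P = "?A i \<times> ?A j" and ?Q = "?A 0 \<times> ?A 0"
  let ?e = "\<lambda>p. \<eta> (fst p) (snd p)"
  have fin: "finite (?P \<union> ?Q)" by simp
  have S1: "?S1 \<omega> = (\<Sum>p\<in>?P. b (fst p - snd p + i - j) * ?e p \<omega>)" for \<omega>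
    unfolding sum.cartesian_product
    by (rule sum.reindex_bij_witness [of _ "\<lambda>p. (nat (fst p + i), nat (snd p + j))" "\<lambda>p. (int (fst p) - i, int (snd p) - j)"])
      auto
  have S2: "?S2 \<omega> = (\<Sum>p\<in>?Q. b (fst p - snd p + i - j) * ?e p \<omega>)" for \<omega>
    unfolding sum.cartesian_product
    by (rule sum.reindex_bij_witness [of _ "\<lambda>p. (nat (fst p), nat (snd p))" "\<lambda>p. (int (fst p), int (snd p))"])
      auto
  have ext: "(\<Sum>p\<in>R. g p) = (\<Sum>p\<in>?P \<union> ?Q. g p * of_bool (p \<in> R))" if "R \<subseteq> ?P \<union> ?Q" for R and g :: "_ \<Rightarrow> real"
    using that fin by (intro sum.mono_neutral_cong_left) auto
  have eq: "?S1 \<omega> - ?S2 \<omega> = (\<Sum>p\<in>?P \<union> ?Q. c p * ?e p \<omega>)" for \<omega>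
    unfolding S1 S2 by (subst ext, simp, subst (2) ext, simp)
      (simp add: sum_subtractf [symmetric] c_def algebra_simps)
  have "expectation (\<lambda>\<omega>. (?S1 \<omega> - ?S2 \<omega>)\<^sup>2) \<le> 2 * (\<Sum>p\<in>?P \<union> ?Q. (c p)\<^sup>2)"
    unfolding eq by (intro expectation_eta_sum_square_le fin) (auto simp: inj_on_def)
  also have "(\<Sum>p\<in>?P \<union> ?Q. (c p)\<^sup>2) \<le> 2 * (\<bar>real_of_int i\<bar> + \<bar>real_of_int j\<bar>) * B"
  proof -
    let ?g = "\<lambda>p. (b (fst p - snd p + i - j))\<^sup>2"
    have B: "0 \<le> B" using bessel [of "{}"] by simp
    have rows: "(\<Sum>p\<in>X \<times> Y. ?g p) \<le> real (card X) * B" if "finite X" "finite Y" for X Y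
    proof -
      have "(\<Sum>v\<in>Y. (b (u - v + i - j))\<^sup>2) \<le> B" for u
      proof -
        have "(\<Sum>v\<in>Y. (b (u - v + i - j))\<^sup>2) = (\<Sum>h\<in>(\<lambda>v. u - v + i - j) ` Y. (b h)\<^sup>2)"
          by (subst sum.reindex) (auto simp: inj_on_def)
        also have "\<dots> \<le> B" using that by (intro bessel) auto
        finally show ?thesis .
      qed
      then have "(\<Sum>u\<in>X. \<Sum>v\<in>Y. (b (u - v + i - j))\<^sup>2) \<le> (\<Sum>u\<in>X. B)"
        by (intro sum_mono)
      then show ?thesis by (simp add: sum.cartesian_product split_beta)
    qed
    have cols: "(\<Sum>p\<in>X \<times> Y. ?g p) \<le> real (card Y) * B" if "finite X" "finite Y" for X Y
    proof -
      have "(\<Sum>u\<in>X. (b (u - v + i - j))\<^sup>2) \<le> B" for v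
      proof -
        have "(\<Sum>u\<in>X. (b (u - v + i - j))\<^sup>2) = (\<Sum>h\<in>(\<lambda>u. u - v + i - j) ` X. (b h)\<^sup>2)"
          by (subst sum.reindex) (auto simp: inj_on_def)
        also have "\<dots> \<le> B" using that by (intro bessel) auto
        finally show ?thesis .
      qed
      then have "(\<Sum>v\<in>Y. \<Sum>u\<in>X. (b (u - v + i - j))\<^sup>2) \<le> (\<Sum>v\<in>Y. B)"
        by (intro sum_mono)
      then show ?thesis by (subst (asm) sum.swap) (simp add: sum.cartesian_product split_beta)
    qed
    have card_diff: "real (card (?A d - ?A e)) \<le> \<bar>real_of_int (d - e)\<bar>" for d e
    proof -
      have "?A d - ?A e \<subseteq> {1 - d..- e} \<union> {int m - e + 1..int m - d}" by auto
      moreover have "card ({1 - d..- e} \<union> {int m - e + 1..int m - d}) \<le> nat \<bar>d - e\<bar>"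
        by (rule order_trans [OF card_Un_le]) auto
      ultimately have "card (?A d - ?A e) \<le> nat \<bar>d - e\<bar>"
        by (meson card_mono finite_Un finite_atLeastAtMost_int le_trans)
      then show ?thesis by linarith
    qed
    have "(\<Sum>p\<in>?P \<union> ?Q. (c p)\<^sup>2) = (\<Sum>p\<in>(?P - ?Q) \<union> (?Q - ?P). ?g p)"
      using fin by (intro sum.mono_neutral_cong_right) (auto simp: c_def)
    also have "\<dots> \<le> (\<Sum>p\<in>((?A i - ?A 0) \<times> ?A j \<union> ?A i \<times> (?A j - ?A 0))
        \<union> ((?A 0 - ?A i) \<times> ?A 0 \<union> ?A 0 \<times> (?A 0 - ?A j)). ?g p)"
      by (intro sum_mono2) auto
    also have "\<dots> \<le> (\<Sum>p\<in>(?A i - ?A 0) \<times> ?A j. ?g p) + (\<Sum>p\<in>?A i \<times> (?A j - ?A 0). ?g p)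
        + ((\<Sum>p\<in>(?A 0 - ?A i) \<times> ?A 0. ?g p) + (\<Sum>p\<in>?A 0 \<times> (?A 0 - ?A j). ?g p))"
    proof -
      have un: "(\<Sum>p\<in>X \<union> Y. ?g p) \<le> (\<Sum>p\<in>X. ?g p) + (\<Sum>p\<in>Y. ?g p)" if "finite X" "finite Y" for X Y
        using that by (simp add: sum_Un sum_nonneg)
      show ?thesis
        by (rule order_trans [OF un add_mono [OF un un]]) auto
    qed
    also have "\<dots> \<le> real (card (?A i - ?A 0)) * B + real (card (?A j - ?A 0)) * B
        + (real (card (?A 0 - ?A i)) * B + real (card (?A 0 - ?A j)) * B)"
      by (intro add_mono rows cols) auto
    also have "\<dots> \<le> \<bar>real_of_int i\<bar> * B + \<bar>real_of_int j\<bar> * B + (\<bar>real_of_int i\<bar> * B + \<bar>real_of_int j\<bar> * B)"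
      using card_diff [of i 0] card_diff [of j 0] card_diff [of 0 i] card_diff [of 0 j] B
      by (intro add_mono mult_right_mono) auto
    finally show ?thesis by (simp add: algebra_simps)
  qed
  finally show ?thesis by (simp add: algebra_simps)
qed

text \<open>Each noise product is its centred version plus the indicator of equal indices, and the
  indicator selects the diagonal k - l = i - j of the square, counted by
  \<open>sum_diagonal_count\<close>.\<close>

lemma moving_average_form:
  "(\<Sum>k = 1..m. \<Sum>l = 1..m. b (int k - int l) * (moving_average F \<psi> (int k) \<omega> * moving_average F \<psi> (int l) \<omega>)) =
   (\<Sum>i\<in>F. \<Sum>j\<in>F. \<psi> i * \<psi> j * ((\<Sum>k = 1..m. \<Sum>l = 1..m. b (int k - int l) * \<eta> (int k - i) (int l - j) \<omega>)
      + max 0 (real m - \<bar>real_of_int (i - j)\<bar>) * b (i - j)))"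
proof -
  have diag: "(\<Sum>k = 1..m. \<Sum>l = 1..m. b (int k - int l) * of_bool (int k - i = int l - j)) =
      max 0 (real m - \<bar>real_of_int (i - j)\<bar>) * b (i - j)" for i j
  proof -
    have "(\<Sum>k = 1..m. \<Sum>l = 1..m. b (int k - int l) * of_bool (int k - i = int l - j)) =
        (\<Sum>k = 1..m. \<Sum>l = 1..m. of_bool (int k - int l = i - j) * b (i - j))"
    proof (intro sum.cong refl)
      fix k l
      show "b (int k - int l) * of_bool (int k - i = int l - j) = of_bool (int k - int l = i - j) * b (i - j)"
      proof (cases "int k - int l = i - j")
        case True
        then have "int k - i = int l - j" by linarith
        then show ?thesis unfolding True by simp
      next
        case False
        then have "int k - i \<noteq> int l - j" by linarith
        with False show ?thesis by simp
      qed
    qed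
    then show ?thesis unfolding sum_distrib_right [symmetric] sum_diagonal_count .
  qed
  have "(\<Sum>k = 1..m. \<Sum>l = 1..m. b (int k - int l) * (moving_average F \<psi> (int k) \<omega> * moving_average F \<psi> (int l) \<omega>)) =
      (\<Sum>k = 1..m. \<Sum>l = 1..m. \<Sum>i\<in>F. \<Sum>j\<in>F. \<psi> i * \<psi> j *
        (b (int k - int l) * \<eta> (int k - i) (int l - j) \<omega> + b (int k - int l) * of_bool (int k - i = int l - j)))"
  proof (intro sum.cong refl)
    fix k l
    have "moving_average F \<psi> (int k) \<omega> * moving_average F \<psi> (int l) \<omega> =
        (\<Sum>i\<in>F. \<Sum>j\<in>F. \<psi> i * \<psi> j * (\<eta> (int k - i) (int l - j) \<omega> + of_bool (int k - i = int l - j)))"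
      unfolding moving_average_def sum_product by (simp add: \<eta>_def mult_ac)
    then show "b (int k - int l) * (moving_average F \<psi> (int k) \<omega> * moving_average F \<psi> (int l) \<omega>) =
        (\<Sum>i\<in>F. \<Sum>j\<in>F. \<psi> i * \<psi> j *
        (b (int k - int l) * \<eta> (int k - i) (int l - j) \<omega> + b (int k - int l) * of_bool (int k - i = int l - j)))"
      by (simp only: sum_distrib_left distrib_left mult.left_commute)
  qed
  also have "\<dots> = (\<Sum>i\<in>F. \<Sum>j\<in>F. \<Sum>k = 1..m. \<Sum>l = 1..m. \<psi> i * \<psi> j *
        (b (int k - int l) * \<eta> (int k - i) (int l - j) \<omega> + b (int k - int l) * of_bool (int k - i = int l - j)))"
    by (rule sum_swap_pairs)
  also have "\<dots> = (\<Sum>i\<in>F. \<Sum>j\<in>F. \<psi> i * \<psi> j * (\<Sum>k = 1..m. \<Sum>l = 1..m.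
        b (int k - int l) * \<eta> (int k - i) (int l - j) \<omega> + b (int k - int l) * of_bool (int k - i = int l - j)))"
    by (simp only: sum_distrib_left)
  finally show ?thesis by (simp only: sum.distrib diag)
qed

end

section \<open>Reduction of the periodogram to a Toeplitz form\<close>

definition square_integrable :: "'a measure \<Rightarrow> ('a \<Rightarrow> real) \<Rightarrow> bool" where
  "square_integrable M f \<longleftrightarrow> f \<in> borel_measurable M \<and> integrable M (\<lambda>x. (f x)\<^sup>2)"

lemma square_sum_le: "(x + y)\<^sup>2 \<le> 2 * x\<^sup>2 + 2 * y\<^sup>2" for x y :: real
  using zero_le_power2 [of "x - y"] by (simp add: power2_eq_square algebra_simps)

lemma square_integrable_add:
  assumes "square_integrable M f" "square_integrable M g"
  shows "square_integrable M (\<lambda>x. f x + g x)"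
proof -
  have [measurable]: "f \<in> borel_measurable M" "g \<in> borel_measurable M"
    using assms by (auto simp: square_integrable_def)
  have "integrable M (\<lambda>x. 2 * (f x)\<^sup>2 + 2 * (g x)\<^sup>2)"
    using assms by (auto simp: square_integrable_def)
  then have "integrable M (\<lambda>x. (f x + g x)\<^sup>2)"
    by (rule Bochner_Integration.integrable_bound) (auto intro!: AE_I2 order_trans [OF square_sum_le])
  then show ?thesis by (simp add: square_integrable_def)
qed

lemma square_integrable_cmult:
  assumes "square_integrable M f"
  shows "square_integrable M (\<lambda>x. c * f x)"
  using assms by (auto simp: square_integrable_def power_mult_distrib)

lemma square_integrable_diff:
  assumes "square_integrable M f" "square_integrable M g"
  shows "square_integrable M (\<lambda>x. f x - g x)"
  using square_integrable_add [OF assms(1) square_integrable_cmult [OF assms(2), of "-1"]] by simp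

lemma square_integrable_zero: "square_integrable M (\<lambda>x. 0)"
  by (simp add: square_integrable_def)

lemma square_integrable_sum:
  assumes "\<And>i. i \<in> A \<Longrightarrow> square_integrable M (f i)"
  shows "square_integrable M (\<lambda>x. \<Sum>i\<in>A. f i x)"
  using assms
proof (induction A rule: infinite_finite_induct)
  case (insert i A)
  then show ?case using square_integrable_add [of M "f i"] by simp
qed (simp_all add: square_integrable_zero)

lemma (in finite_measure) square_integrable_const: "square_integrable M (\<lambda>x. c)"
  by (simp add: square_integrable_def)

lemma integral_square_add_le:
  assumes "square_integrable M f" "square_integrable M g"
  shows "(\<integral>x. (f x + g x)\<^sup>2 \<partial>M) \<le> 2 * (\<integral>x. (f x)\<^sup>2 \<partial>M) + 2 * (\<integral>x. (g x)\<^sup>2 \<partial>M)"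
proof -
  have "(\<integral>x. (f x + g x)\<^sup>2 \<partial>M) \<le> (\<integral>x. 2 * (f x)\<^sup>2 + 2 * (g x)\<^sup>2 \<partial>M)"
    using assms square_integrable_add [OF assms]
    by (intro integral_mono) (auto simp: square_integrable_def intro: square_sum_le)
  also have "\<dots> = 2 * (\<integral>x. (f x)\<^sup>2 \<partial>M) + 2 * (\<integral>x. (g x)\<^sup>2 \<partial>M)"
    using assms by (simp add: square_integrable_def)
  finally show ?thesis .
qed

text \<open>Fatou's lemma for squares. It carries a bound for finite filters over to the two-sided
  series from almost sure convergence alone, with no estimate of the truncation error.\<close>

lemma square_integrable_fatou:
  assumes f: "\<And>n. square_integrable M (f n)" and le: "\<And>n. (\<integral>x. (f n x)\<^sup>2 \<partial>M) \<le> C"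
    and conv: "AE x in M. (\<lambda>n. f n x) \<longlonglongrightarrow> g x" and g: "g \<in> borel_measurable M"
  shows "square_integrable M g" and "(\<integral>x. (g x)\<^sup>2 \<partial>M) \<le> C"
proof -
  have [measurable]: "f n \<in> borel_measurable M" for n using f by (simp add: square_integrable_def)
  note g [measurable]
  have C: "0 \<le> C" using le [of 0] by (rule order_trans [rotated]) simp
  have "(\<integral>\<^sup>+x. ennreal ((g x)\<^sup>2) \<partial>M) = (\<integral>\<^sup>+x. liminf (\<lambda>n. ennreal ((f n x)\<^sup>2)) \<partial>M)"
  proof (rule nn_integral_cong_AE)
    show "AE x in M. ennreal ((g x)\<^sup>2) = liminf (\<lambda>n. ennreal ((f n x)\<^sup>2))"
      using conv
    proof eventually_elim
      case (elim x)
      then have "(\<lambda>n. ennreal ((f n x)\<^sup>2)) \<longlonglongrightarrow> ennreal ((g x)\<^sup>2)"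
        by (intro tendsto_ennrealI tendsto_power)
      then show ?case by (rule lim_imp_Liminf [OF trivial_limit_sequentially, symmetric])
    qed
  qed
  also have "\<dots> \<le> liminf (\<lambda>n. \<integral>\<^sup>+x. ennreal ((f n x)\<^sup>2) \<partial>M)"
    by (rule nn_integral_liminf) measurable
  also have "\<dots> \<le> ennreal C"
  proof -
    have "(\<integral>\<^sup>+x. ennreal ((f n x)\<^sup>2) \<partial>M) \<le> ennreal C" for n
      using f [of n] le [of n] by (subst nn_integral_eq_integral) (auto simp: square_integrable_def ennreal_leI)
    then have "liminf (\<lambda>n. \<integral>\<^sup>+x. ennreal ((f n x)\<^sup>2) \<partial>M) \<le> liminf (\<lambda>n. ennreal C)"
      by (intro Liminf_mono always_eventually allI)
    then show ?thesis by (simp add: Liminf_const)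
  qed
  finally have *: "(\<integral>\<^sup>+x. ennreal ((g x)\<^sup>2) \<partial>M) \<le> ennreal C" .
  then have "(\<integral>\<^sup>+x. ennreal (norm ((g x)\<^sup>2)) \<partial>M) < \<infinity>"
    by (simp only: real_norm_def abs_power2) (rule le_less_trans, assumption, simp)
  then have int: "integrable M (\<lambda>x. (g x)\<^sup>2)"
    by (intro integrableI_bounded) auto
  then show "square_integrable M g" by (simp add: square_integrable_def)
  have "ennreal (\<integral>x. (g x)\<^sup>2 \<partial>M) \<le> ennreal C"
    using * int by (subst nn_integral_eq_integral [symmetric]) auto
  then show "(\<integral>x. (g x)\<^sup>2 \<partial>M) \<le> C" using C by simp
qed

context white_noise
begin

lemma square_integrable_eta: "square_integrable M (\<eta> u v)"
  using eta_product_integrable [of u v u v] by (simp add: square_integrable_def power2_eq_square)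

lemma square_integrable_toeplitz_form: "square_integrable M (toeplitz_form a m)"
  unfolding toeplitz_form_def
  by (intro square_integrable_sum square_integrable_cmult square_integrable_eta)

lemma toeplitz_form_double_sum:
  "toeplitz_form (double_sum F \<psi> b) m \<omega> =
    (\<Sum>i\<in>F. \<Sum>j\<in>F. \<psi> i * \<psi> j * (\<Sum>k = 1..m. \<Sum>l = 1..m. b (int k - int l + i - j) * \<eta> (int k) (int l) \<omega>))"
proof -
  have "toeplitz_form (double_sum F \<psi> b) m \<omega> =
    (\<Sum>k = 1..m. \<Sum>l = 1..m. \<Sum>i\<in>F. \<Sum>j\<in>F. \<psi> i * \<psi> j * (b (int k - int l + i - j) * \<eta> (int k) (int l) \<omega>))"
    unfolding toeplitz_form_def double_sum_def sum_distrib_right by (simp only: mult.assoc)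
  also have "\<dots> = (\<Sum>i\<in>F. \<Sum>j\<in>F. \<Sum>k = 1..m. \<Sum>l = 1..m. \<psi> i * \<psi> j * (b (int k - int l + i - j) * \<eta> (int k) (int l) \<omega>))"
    by (rule sum_swap_pairs)
  finally show ?thesis by (simp only: sum_distrib_left)
qed

text \<open>The filter enters the bound only through its weighted sum, bounded by \<open>T\<close>,
  which later permits the limit over finite filters. For a pair (i, j) the error consists of
  replacing \<open>dcos\<close> by \<open>fcos\<close> (\<open>G1\<close>), displacing the index
  square (\<open>G2\<close>), and a deterministic part from the diagonal (\<open>e\<close>). The
  second moment of \<open>G1 + G2\<close> is bounded by t^2 and \<bar>e\<bar> by t, up to factors
  free of the pair; weighted Cauchy-Schwarz over the pairs then produces the powers of
  \<open>T\<close>.\<close>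

lemma moving_average_periodogram_approx:
  fixes \<psi> :: "int \<Rightarrow> real"
  assumes cont: "continuous_on {0..pi} w"
    and holder: "\<And>x y. x \<in> {0..pi} \<Longrightarrow> y \<in> {0..pi} \<Longrightarrow> \<bar>w x - w y\<bar> \<le> H * \<bar>x - y\<bar> powr \<kappa>"
    and bound: "\<And>x. x \<in> {0..pi} \<Longrightarrow> \<bar>w x\<bar> \<le> K"
    and H: "0 \<le> H" and \<kappa>: "1 / 2 < \<kappa>" "\<kappa> \<le> 1" and N: "0 < N"
    and s: "s \<in> {0..1}" and F: "finite F"
    and T: "(\<Sum>i\<in>F. \<bar>\<psi> i\<bar> * (1 + \<bar>real_of_int i\<bar>) powr \<kappa>) \<le> T"
  defines "m \<equiv> nat \<lfloor>s * real N\<rfloor>"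
  defines "D \<equiv> (\<lambda>\<omega>. (\<Sum>k = 1..m. \<Sum>l = 1..m. dcos w N (int k - int l) *
        (moving_average F \<psi> (int k) \<omega> * moving_average F \<psi> (int l) \<omega>))
      - s * real N * double_sum F \<psi> (fcos w) 0 - toeplitz_form (double_sum F \<psi> (fcos w)) m \<omega>)"
  shows "square_integrable M D"
    and "expectation (\<lambda>\<omega>. (D \<omega>)\<^sup>2) \<le>
      2 * (T ^ 4 * (4 * (\<Sum>k = 1..N. \<Sum>l = 1..N. (dcos w N (int k - int l) - fcos w (int k - int l))\<^sup>2) + 8 * msq w))
      + 2 * (T\<^sup>2 * ((7 * H + 17 * K) * real N powr (1 - \<kappa>)))\<^sup>2"
proof -
  let ?d = "dcos w N" let ?b = "fcos w"
  let ?E = "\<Sum>k = 1..N. \<Sum>l = 1..N. (?d (int k - int l) - ?b (int k - int l))\<^sup>2"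
  let ?P = "F \<times> F"
  define t where "t p = (1 + \<bar>real_of_int (fst p)\<bar>) powr \<kappa> * (1 + \<bar>real_of_int (snd p)\<bar>) powr \<kappa>" for p
  define c where "c p = \<psi> (fst p) * \<psi> (snd p)" for p
  define G1 where "G1 i j \<omega> = (\<Sum>k = 1..m. \<Sum>l = 1..m. (?d (int k - int l) - ?b (int k - int l)) * \<eta> (int k - i) (int l - j) \<omega>)" for i j \<omega>
  define G2 where "G2 i j \<omega> = (\<Sum>k = 1..m. \<Sum>l = 1..m. ?b (int k - int l) * \<eta> (int k - i) (int l - j) \<omega>)
      - (\<Sum>k = 1..m. \<Sum>l = 1..m. ?b (int k - int l + i - j) * \<eta> (int k) (int l) \<omega>)" for i j \<omega>
  define G where "G p \<omega> = G1 (fst p) (snd p) \<omega> + G2 (fst p) (snd p) \<omega>" for p \<omega>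
  define A1 where "A1 i j \<omega> = (\<Sum>k = 1..m. \<Sum>l = 1..m. ?d (int k - int l) * \<eta> (int k - i) (int l - j) \<omega>)" for i j \<omega>
  define A3 where "A3 i j \<omega> = (\<Sum>k = 1..m. \<Sum>l = 1..m. ?b (int k - int l + i - j) * \<eta> (int k) (int l) \<omega>)" for i j \<omega>
  \<comment> \<open>Between \<open>A1\<close> and \<open>A3\<close> the form with coefficients
    \<open>fcos\<close> but displaced noise is inserted and removed.\<close>
  have G12: "G1 i j \<omega> + G2 i j \<omega> = A1 i j \<omega> - A3 i j \<omega>" for i j \<omega>
    unfolding G1_def G2_def A1_def A3_def left_diff_distrib sum_subtractf by simp
  define e where "e p = max 0 (real m - \<bar>real_of_int (fst p - snd p)\<bar>) * ?d (fst p - snd p)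
      - s * real N * ?b (fst p - snd p)" for p
  have K: "0 \<le> K" using bound [of 0] by simp
  have tpos: "0 < t p" for p unfolding t_def by (intro mult_pos_pos) auto
  have tnn: "0 \<le> t p" for p using tpos [of p] by simp
  have tnz: "t p \<noteq> 0" for p using tpos [of p] by simp
  have T0: "0 \<le> T" by (rule order_trans [OF _ T]) (auto intro!: sum_nonneg)
  have m_le: "m \<le> N"
  proof -
    have "s * real N \<le> 1 * real N" using s by (intro mult_right_mono) auto
    then show ?thesis unfolding m_def by linarith
  qed
  have sq_G1: "square_integrable M (G1 i j)" for i j
    unfolding G1_def by (intro square_integrable_sum square_integrable_cmult square_integrable_eta)
  have sq_G2: "square_integrable M (G2 i j)" for i j
    unfolding G2_def
    by (intro square_integrable_sum square_integrable_diff square_integrable_cmult square_integrable_eta)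
  have sq_G: "square_integrable M (G p)" for p
    unfolding G_def by (intro square_integrable_add sq_G1 sq_G2)
  have D: "D \<omega> = (\<Sum>p\<in>?P. c p * G p \<omega>) + (\<Sum>p\<in>?P. c p * e p)" for \<omega>
  proof -
    have "D \<omega> = (\<Sum>i\<in>F. \<Sum>j\<in>F. \<psi> i * \<psi> j * (A1 i j \<omega> + max 0 (real m - \<bar>real_of_int (i - j)\<bar>) * ?d (i - j)))
        - s * real N * (\<Sum>i\<in>F. \<Sum>j\<in>F. \<psi> i * \<psi> j * ?b (0 + i - j))
        - (\<Sum>i\<in>F. \<Sum>j\<in>F. \<psi> i * \<psi> j * A3 i j \<omega>)"
      unfolding D_def moving_average_form toeplitz_form_double_sum double_sum_def A1_def A3_def ..
    also have "\<dots> = (\<Sum>i\<in>F. \<Sum>j\<in>F. \<psi> i * \<psi> j * (A1 i j \<omega> - A3 i j \<omega>) + \<psi> i * \<psi> j * e (i, j))"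
      unfolding sum_distrib_left sum_subtractf [symmetric] e_def
      by (intro sum.cong refl) (simp add: algebra_simps)
    finally have "D \<omega> = (\<Sum>i\<in>F. \<Sum>j\<in>F. \<psi> i * \<psi> j * (G1 i j \<omega> + G2 i j \<omega>) + \<psi> i * \<psi> j * e (i, j))"
      unfolding G12 .
    then show ?thesis
      by (simp add: sum.cartesian_product split_beta sum.distrib c_def G_def)
  qed
  have sq_sum: "square_integrable M (\<lambda>\<omega>. \<Sum>p\<in>?P. c p * G p \<omega>)"
    by (intro square_integrable_sum square_integrable_cmult sq_G)
  show "square_integrable M D"
    unfolding D by (intro square_integrable_add sq_sum square_integrable_const)
  have ct: "(\<Sum>p\<in>?P. \<bar>c p\<bar> * t p) \<le> T\<^sup>2"
  proof -
    have "(\<Sum>p\<in>?P. \<bar>c p\<bar> * t p) = (\<Sum>i\<in>F. \<bar>\<psi> i\<bar> * (1 + \<bar>real_of_int i\<bar>) powr \<kappa>)\<^sup>2"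
      by (simp add: power2_eq_square sum_product sum.cartesian_product split_beta c_def t_def abs_mult mult_ac)
    also have "\<dots> \<le> T\<^sup>2" by (intro power_mono T sum_nonneg) auto
    finally show ?thesis .
  qed
  have EG: "expectation (\<lambda>\<omega>. (G p \<omega>)\<^sup>2) \<le> (4 * ?E + 8 * msq w) * (t p)\<^sup>2" for p
  proof -
    let ?i = "fst p" let ?j = "snd p"
    have "expectation (\<lambda>\<omega>. (G1 ?i ?j \<omega>)\<^sup>2) \<le>
        2 * (\<Sum>x\<in>{1..m} \<times> {1..m}. (?d (int (fst x) - int (snd x)) - ?b (int (fst x) - int (snd x)))\<^sup>2)"
      unfolding G1_def sum.cartesian_product split_beta
      by (rule expectation_eta_sum_square_le) (auto simp: inj_on_def)
    also have "\<dots> \<le> 2 * (\<Sum>x\<in>{1..N} \<times> {1..N}. (?d (int (fst x) - int (snd x)) - ?b (int (fst x) - int (snd x)))\<^sup>2)"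
      using m_le by (intro mult_left_mono sum_mono2) auto
    also have "\<dots> = 2 * ?E"
      by (simp add: sum.cartesian_product split_beta)
    finally have 1: "expectation (\<lambda>\<omega>. (G1 ?i ?j \<omega>)\<^sup>2) \<le> 2 * ?E" .
    have 2: "expectation (\<lambda>\<omega>. (G2 ?i ?j \<omega>)\<^sup>2) \<le> 4 * (\<bar>real_of_int ?i\<bar> + \<bar>real_of_int ?j\<bar>) * msq w"
      unfolding G2_def by (rule toeplitz_shift_diff) (rule fcos_bessel [OF cont])
    have t2: "(1 + \<bar>real_of_int ?i\<bar>) * (1 + \<bar>real_of_int ?j\<bar>) \<le> (t p)\<^sup>2"
    proof -
      \<comment> \<open>Here 2 \<kappa> \<ge> 1 is used: the displacement costs \<bar>i\<bar> +
        \<bar>j\<bar>, while \<open>t\<close> carries only the exponent \<kappa>.\<close>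
      have pw: "x \<le> (x powr \<kappa>)\<^sup>2" if "1 \<le> x" for x :: real
      proof -
        have "x powr 1 \<le> x powr (\<kappa> + \<kappa>)" using that \<kappa> by (intro powr_mono) auto
        then show ?thesis using that by (simp only: powr_add power2_eq_square) simp
      qed
      show ?thesis unfolding t_def power_mult_distrib by (intro mult_mono pw) auto
    qed
    have prod0: "0 \<le> \<bar>real_of_int ?i\<bar> * \<bar>real_of_int ?j\<bar>" by simp
    have 3: "1 \<le> (t p)\<^sup>2" "\<bar>real_of_int ?i\<bar> + \<bar>real_of_int ?j\<bar> \<le> (t p)\<^sup>2"
      using t2 prod0 unfolding distrib_left distrib_right by linarith+
    have E0: "0 \<le> ?E" by (intro sum_nonneg) auto
    have "expectation (\<lambda>\<omega>. (G p \<omega>)\<^sup>2) \<le> 2 * expectation (\<lambda>\<omega>. (G1 ?i ?j \<omega>)\<^sup>2) + 2 * expectation (\<lambda>\<omega>. (G2 ?i ?j \<omega>)\<^sup>2)"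
      unfolding G_def by (rule integral_square_add_le [OF sq_G1 sq_G2])
    also have "\<dots> \<le> 4 * ?E * 1 + 8 * msq w * (\<bar>real_of_int ?i\<bar> + \<bar>real_of_int ?j\<bar>)"
    proof -
      have "expectation (\<lambda>\<omega>. (G2 ?i ?j \<omega>)\<^sup>2) \<le> 4 * (msq w * (\<bar>real_of_int ?i\<bar> + \<bar>real_of_int ?j\<bar>))"
        using 2 by (simp only: mult_ac)
      with 1 show ?thesis unfolding mult.assoc by linarith
    qed
    also have "\<dots> \<le> 4 * ?E * (t p)\<^sup>2 + 8 * msq w * (t p)\<^sup>2"
      using E0 msq_nonneg [of w] by (intro add_mono mult_left_mono 3) auto
    finally show ?thesis by (simp add: algebra_simps)
  qed
  have EX0: "0 \<le> 4 * ?E + 8 * msq w"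
    using msq_nonneg [of w] by (intro add_nonneg_nonneg mult_nonneg_nonneg sum_nonneg) auto
  have first: "expectation (\<lambda>\<omega>. (\<Sum>p\<in>?P. c p * G p \<omega>)\<^sup>2) \<le> T ^ 4 * (4 * ?E + 8 * msq w)"
  proof -
    define Z where "Z = 4 * ?E + 8 * msq w"
    have Z0: "0 \<le> Z" and EGZ: "expectation (\<lambda>\<omega>. (G p \<omega>)\<^sup>2) \<le> Z * (t p)\<^sup>2" for p
      using EX0 EG [of p] by (simp_all only: Z_def)
    have intG: "integrable M (\<lambda>\<omega>. (G p \<omega>)\<^sup>2)" for p
      using sq_G by (simp add: square_integrable_def)
    have "expectation (\<lambda>\<omega>. (\<Sum>p\<in>?P. c p * G p \<omega>)\<^sup>2) \<le>
        expectation (\<lambda>\<omega>. T\<^sup>2 * (\<Sum>p\<in>?P. \<bar>c p\<bar> / t p * (G p \<omega>)\<^sup>2))"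
    proof (rule integral_mono)
      show "integrable M (\<lambda>\<omega>. (\<Sum>p\<in>?P. c p * G p \<omega>)\<^sup>2)"
        using sq_sum by (simp add: square_integrable_def)
      show "integrable M (\<lambda>\<omega>. T\<^sup>2 * (\<Sum>p\<in>?P. \<bar>c p\<bar> / t p * (G p \<omega>)\<^sup>2))"
        by (intro integrable_mult_right Bochner_Integration.integrable_sum intG)
      fix \<omega>
      have "(\<Sum>p\<in>?P. c p * G p \<omega>)\<^sup>2 \<le> (\<Sum>p\<in>?P. \<bar>c p\<bar> * t p) * (\<Sum>p\<in>?P. \<bar>c p\<bar> * (G p \<omega>)\<^sup>2 / t p)"
        by (rule weighted_sum_square_le) (rule tpos)
      also have "\<dots> \<le> T\<^sup>2 * (\<Sum>p\<in>?P. \<bar>c p\<bar> * (G p \<omega>)\<^sup>2 / t p)"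
        by (intro mult_right_mono ct sum_nonneg divide_nonneg_nonneg mult_nonneg_nonneg tnn) simp_all
      finally show "(\<Sum>p\<in>?P. c p * G p \<omega>)\<^sup>2 \<le> T\<^sup>2 * (\<Sum>p\<in>?P. \<bar>c p\<bar> / t p * (G p \<omega>)\<^sup>2)"
        by simp
    qed
    also have "\<dots> = T\<^sup>2 * (\<Sum>p\<in>?P. \<bar>c p\<bar> / t p * expectation (\<lambda>\<omega>. (G p \<omega>)\<^sup>2))"
      by (simp add: intG)
    also have "\<dots> \<le> T\<^sup>2 * (\<Sum>p\<in>?P. \<bar>c p\<bar> / t p * (Z * (t p)\<^sup>2))"
      by (intro mult_left_mono sum_mono EGZ divide_nonneg_nonneg tnn) simp_all
    also have "\<dots> = T\<^sup>2 * ((\<Sum>p\<in>?P. \<bar>c p\<bar> * t p) * Z)"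
      unfolding sum_distrib_right
      by (intro arg_cong [where f = "times (T\<^sup>2)"] sum.cong refl) (simp add: power2_eq_square tnz)
    also have "\<dots> \<le> T\<^sup>2 * (T\<^sup>2 * Z)"
      by (intro mult_left_mono mult_right_mono ct Z0) auto
    also have "\<dots> = T ^ 4 * Z" by (simp only: mult.assoc [symmetric] power_add [symmetric]) simp
    finally show ?thesis unfolding Z_def .
  qed
  have second: "\<bar>\<Sum>p\<in>?P. c p * e p\<bar> \<le> T\<^sup>2 * ((7 * H + 17 * K) * real N powr (1 - \<kappa>))"
  proof -
    have e: "\<bar>e p\<bar> \<le> t p * ((7 * H + 17 * K) * real N powr (1 - \<kappa>))" for p
    proof -
      define h where "h = fst p - snd p"
      let ?x = "1 + \<bar>real_of_int h\<bar>"
      \<comment> \<open>The floor and the shorter diagonal lose at most 1 + \<bar>h\<bar>, and both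
        numbers lie between 0 and \<open>N\<close>; the geometric mean of these two bounds fits the
        weight.\<close>
      have *: "\<bar>max 0 (real m - \<bar>real_of_int h\<bar>) - s * real N\<bar> \<le> ?x powr \<kappa> * real N powr (1 - \<kappa>)"
      proof (rule min_one_plus_powr_le)
        have "0 \<le> s * real N" "s * real N \<le> 1 * real N" using s mult_right_mono [of s 1 "real N"] by auto
        then have "0 \<le> s * real N" "s * real N \<le> real N" "real m \<le> s * real N" "s * real N < real m + 1"
          unfolding m_def by linarith+
        then show "\<bar>max 0 (real m - \<bar>real_of_int h\<bar>) - s * real N\<bar> \<le> ?x"
          "\<bar>max 0 (real m - \<bar>real_of_int h\<bar>) - s * real N\<bar> \<le> real N"
          by linarith+
      qed (use \<kappa> N in auto)
      have dK: "\<bar>?d h\<bar> \<le> K"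
        unfolding dcos_def
      proof (rule freq_mean_bound)
        fix x assume "x \<in> {0..pi}"
        then show "\<bar>w x * cos (real_of_int h * x)\<bar> \<le> K"
          using mult_mono [OF bound abs_cos_le_one [of "real_of_int h * x"]] K by (simp add: abs_mult)
      qed
      have rate: "\<bar>?d h - ?b h\<bar> \<le> (7 * H + 16 * K) * ?x powr \<kappa> * real N powr - \<kappa>"
        using \<kappa> by (intro dcos_fcos_rate [OF cont holder bound H _ _ N]) auto
      \<comment> \<open>The count error contributes \<open>K\<close> and the coefficient error
        \<open>7 * H + 16 * K\<close>, hence the 17.\<close>
      have "e p = (max 0 (real m - \<bar>real_of_int h\<bar>) - s * real N) * ?d h + s * real N * (?d h - ?b h)"
        unfolding e_def h_def by (simp add: algebra_simps)
      also have "\<bar>\<dots>\<bar> \<le> \<bar>max 0 (real m - \<bar>real_of_int h\<bar>) - s * real N\<bar> * \<bar>?d h\<bar> + s * real N * \<bar>?d h - ?b h\<bar>"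
        using s by (intro order_trans [OF abs_triangle_ineq]) (simp add: abs_mult)
      also have "\<dots> \<le> ?x powr \<kappa> * real N powr (1 - \<kappa>) * K + 1 * real N * ((7 * H + 16 * K) * ?x powr \<kappa> * real N powr - \<kappa>)"
        using s K by (intro add_mono mult_mono * dK rate) auto
      also have "\<dots> = (?x powr \<kappa>) * ((7 * H + 17 * K) * real N powr (1 - \<kappa>))"
        using N by (simp add: powr_diff powr_minus divide_inverse algebra_simps)
      also have "\<dots> \<le> t p * ((7 * H + 17 * K) * real N powr (1 - \<kappa>))"
        unfolding h_def t_def using \<kappa> H K by (intro mult_right_mono one_plus_abs_diff_powr_le) auto
      finally show ?thesis .
    qed
    have "\<bar>\<Sum>p\<in>?P. c p * e p\<bar> \<le> (\<Sum>p\<in>?P. \<bar>c p\<bar> * (t p * ((7 * H + 17 * K) * real N powr (1 - \<kappa>))))"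
      by (intro order_trans [OF sum_abs] sum_mono) (simp only: abs_mult, intro mult_left_mono e abs_ge_zero)
    also have "\<dots> = (\<Sum>p\<in>?P. \<bar>c p\<bar> * t p) * ((7 * H + 17 * K) * real N powr (1 - \<kappa>))"
      by (simp only: sum_distrib_right mult.assoc)
    also have "\<dots> \<le> T\<^sup>2 * ((7 * H + 17 * K) * real N powr (1 - \<kappa>))"
      using H K by (intro mult_right_mono ct) auto
    finally show ?thesis .
  qed
  have "expectation (\<lambda>\<omega>. (D \<omega>)\<^sup>2) \<le> 2 * expectation (\<lambda>\<omega>. (\<Sum>p\<in>?P. c p * G p \<omega>)\<^sup>2) +
      2 * expectation (\<lambda>\<omega>. (\<Sum>p\<in>?P. c p * e p)\<^sup>2)"
    unfolding D by (rule integral_square_add_le [OF sq_sum square_integrable_const])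
  also have "expectation (\<lambda>\<omega>. (\<Sum>p\<in>?P. c p * e p)\<^sup>2) = \<bar>\<Sum>p\<in>?P. c p * e p\<bar>\<^sup>2"
    by (simp add: prob_space)
  also have "\<dots> \<le> (T\<^sup>2 * ((7 * H + 17 * K) * real N powr (1 - \<kappa>)))\<^sup>2"
    by (rule power_mono [OF second]) simp
  finally have "expectation (\<lambda>\<omega>. (D \<omega>)\<^sup>2) \<le> 2 * expectation (\<lambda>\<omega>. (\<Sum>p\<in>?P. c p * G p \<omega>)\<^sup>2)
      + 2 * (T\<^sup>2 * ((7 * H + 17 * K) * real N powr (1 - \<kappa>)))\<^sup>2"
    by (simp only: mult_le_cancel_left_pos zero_less_numeral add_le_cancel_left)
  then show "expectation (\<lambda>\<omega>. (D \<omega>)\<^sup>2) \<le> 2 * (T ^ 4 * (4 * ?E + 8 * msq w))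
      + 2 * (T\<^sup>2 * ((7 * H + 17 * K) * real N powr (1 - \<kappa>)))\<^sup>2"
    by (rule order_trans [OF _ add_right_mono [OF mult_left_mono [OF first]]]) simp
qed

end

section \<open>Transfer functions of summable filters\<close>

lemma filterlim_int_window:
  "filterlim (\<lambda>n. {- int n..int n}) (finite_subsets_at_top UNIV) sequentially"
  unfolding filterlim_finite_subsets_at_top
proof safe
  fix X :: "int set" assume "finite X"
  then obtain k where k: "\<forall>h\<in>X. \<bar>h\<bar> \<le> k"
    by (metis Max_ge finite_imageI imageI)
  have "X \<subseteq> {- int n..int n}" if "nat k \<le> n" for n
    using k that by (force simp: abs_le_iff)
  then show "\<forall>\<^sub>F n in sequentially. finite {- int n..int n} \<and> X \<subseteq> {- int n..int n} \<and> {- int n..int n} \<subseteq> UNIV"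
    by (auto simp: eventually_sequentially)
qed

text \<open>Squared modulus of the series with terms \<psi> j times e^(i j x), in real form; by
  \<open>spectral_density_linear_process\<close> it is 2 pi times the spectral density.\<close>

definition power_transfer :: "(int \<Rightarrow> real) \<Rightarrow> real \<Rightarrow> real" where
  "power_transfer \<psi> x = (\<Sum>\<^sub>\<infinity>j. \<psi> j * cos (real_of_int j * x))\<^sup>2 + (\<Sum>\<^sub>\<infinity>j. \<psi> j * sin (real_of_int j * x))\<^sup>2"

definition finite_transfer :: "int set \<Rightarrow> (int \<Rightarrow> real) \<Rightarrow> real \<Rightarrow> real" where
  "finite_transfer F \<psi> x = (\<Sum>j\<in>F. \<psi> j * cos (real_of_int j * x))\<^sup>2 + (\<Sum>j\<in>F. \<psi> j * sin (real_of_int j * x))\<^sup>2"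

text \<open>Both sides are the real part of e^(i h x) times the squared modulus of the transfer
  function; the mixed sine terms cancel under exchange of \<open>i\<close> and
  \<open>j\<close>.\<close>

lemma finite_transfer_times_cos:
  "(\<Sum>i\<in>F. \<Sum>j\<in>F. \<psi> i * \<psi> j * cos (real_of_int (h + i - j) * x)) = finite_transfer F \<psi> x * cos (real_of_int h * x)"
proof -
  let ?c = "\<lambda>j. cos (real_of_int j * x)" and ?s = "\<lambda>j. sin (real_of_int j * x)"
  have eq: "cos (real_of_int (h + i - j) * x) = ?c h * (?c i * ?c j) + ?c h * (?s i * ?s j)
      - (?s h * (?s i * ?c j) - ?s h * (?c i * ?s j))" for i j
  proof -
    have "real_of_int (h + i - j) * x = real_of_int h * x + (real_of_int i * x - real_of_int j * x)"
      by (simp add: algebra_simps)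
    then show ?thesis by (simp add: cos_add cos_diff sin_add sin_diff algebra_simps)
  qed
  have "(\<Sum>i\<in>F. \<Sum>j\<in>F. \<psi> i * \<psi> j * cos (real_of_int (h + i - j) * x)) =
      (\<Sum>i\<in>F. \<Sum>j\<in>F. ?c h * ((\<psi> i * ?c i) * (\<psi> j * ?c j)) + ?c h * ((\<psi> i * ?s i) * (\<psi> j * ?s j))
        - (?s h * ((\<psi> i * ?s i) * (\<psi> j * ?c j)) - ?s h * ((\<psi> i * ?c i) * (\<psi> j * ?s j))))"
    unfolding eq by (intro sum.cong refl) (simp add: algebra_simps)
  also have "\<dots> = ?c h * ((\<Sum>i\<in>F. \<psi> i * ?c i) * (\<Sum>j\<in>F. \<psi> j * ?c j))
      + ?c h * ((\<Sum>i\<in>F. \<psi> i * ?s i) * (\<Sum>j\<in>F. \<psi> j * ?s j))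
      - (?s h * ((\<Sum>i\<in>F. \<psi> i * ?s i) * (\<Sum>j\<in>F. \<psi> j * ?c j))
         - ?s h * ((\<Sum>i\<in>F. \<psi> i * ?c i) * (\<Sum>j\<in>F. \<psi> j * ?s j)))"
    by (simp only: sum_product) (simp only: sum_distrib_left sum.distrib sum_subtractf)
  also have "\<dots> = finite_transfer F \<psi> x * ?c h"
    by (simp add: finite_transfer_def power2_eq_square algebra_simps)
  finally show ?thesis .
qed

text \<open>Shifting the lag by \<open>i - j\<close> happens under the integral, so moving the
  filter into the coefficients amounts to multiplying the weight \<open>w\<close> by the transfer
  function.\<close>

lemma double_sum_fcos:
  assumes w: "continuous_on {0..pi} w"
  shows "(\<Sum>i\<in>F. \<Sum>j\<in>F. \<psi> i * \<psi> j * fcos w (h + i - j)) = fcos (\<lambda>x. w x * finite_transfer F \<psi> x) h"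
proof (cases "finite F")
  case True
  have int: "(\<lambda>x. w x * cos (real_of_int k * x)) integrable_on {0..pi}" for k
    by (intro integrable_continuous_interval continuous_intros w)
  have "fcos (\<lambda>x. w x * finite_transfer F \<psi> x) h =
      integral {0..pi} (\<lambda>x. \<Sum>i\<in>F. \<Sum>j\<in>F. \<psi> i * \<psi> j * (w x * cos (real_of_int (h + i - j) * x))) / pi"
    unfolding fcos_def mult.assoc finite_transfer_times_cos [symmetric] sum_distrib_left
    by (simp only: mult.left_commute)
  also have "\<dots> = (\<Sum>i\<in>F. \<Sum>j\<in>F. \<psi> i * \<psi> j * integral {0..pi} (\<lambda>x. w x * cos (real_of_int (h + i - j) * x))) / pi"
  proof -
    have "integral {0..pi} (\<lambda>x. \<Sum>i\<in>F. \<Sum>j\<in>F. \<psi> i * \<psi> j * (w x * cos (real_of_int (h + i - j) * x))) =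
        (\<Sum>i\<in>F. integral {0..pi} (\<lambda>x. \<Sum>j\<in>F. \<psi> i * \<psi> j * (w x * cos (real_of_int (h + i - j) * x))))"
      using True by (intro integral_sum integrable_sum integrable_on_mult_right int)
    also have "\<dots> = (\<Sum>i\<in>F. \<Sum>j\<in>F. integral {0..pi} (\<lambda>x. \<psi> i * \<psi> j * (w x * cos (real_of_int (h + i - j) * x))))"
      using True by (intro sum.cong refl integral_sum integrable_on_mult_right int)
    finally show ?thesis by (simp only: integral_mult_right)
  qed
  finally show ?thesis
    by (simp only: fcos_def sum_divide_distrib times_divide_eq_right)
qed (simp add: fcos_def finite_transfer_def)

text \<open>The M-test gives uniform convergence of the cosine and the sine series; squaring
  preserves it because the limits are bounded by the sum of \<bar>\<psi> j\<bar>.\<close>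

lemma finite_transfer_uniform_limit:
  assumes \<psi>: "(\<lambda>j. \<bar>\<psi> j\<bar>) summable_on UNIV"
  shows "uniform_limit A (\<lambda>n. finite_transfer {- int n..int n} \<psi>) (power_transfer \<psi>) sequentially"
proof -
  define L where "L = (\<Sum>\<^sub>\<infinity>j. \<bar>\<psi> j\<bar>)"
  have one: "uniform_limit A (\<lambda>n x. (\<Sum>j = - int n..int n. \<psi> j * f (real_of_int j * x))\<^sup>2)
      (\<lambda>x. (\<Sum>\<^sub>\<infinity>j. \<psi> j * f (real_of_int j * x))\<^sup>2) sequentially"
    if f: "\<And>x. \<bar>f x\<bar> \<le> 1" for f :: "real \<Rightarrow> real"
  proof -
    have le: "norm (\<psi> j * f (real_of_int j * x)) \<le> \<bar>\<psi> j\<bar>" for j x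
      using mult_left_mono [OF f, of "\<bar>\<psi> j\<bar>" "real_of_int j * x"] by (simp add: abs_mult)
    have "uniform_limit A (\<lambda>X x. \<Sum>j\<in>X. \<psi> j * f (real_of_int j * x)) (\<lambda>x. \<Sum>\<^sub>\<infinity>j. \<psi> j * f (real_of_int j * x))
        (finite_subsets_at_top UNIV)"
      by (rule Weierstrass_m_test_general [OF le \<psi>])
    then have lim: "uniform_limit A (\<lambda>n x. \<Sum>j = - int n..int n. \<psi> j * f (real_of_int j * x))
        (\<lambda>x. \<Sum>\<^sub>\<infinity>j. \<psi> j * f (real_of_int j * x)) sequentially"
      using filterlim_int_window by (rule filterlim_compose)
    have "norm (\<Sum>\<^sub>\<infinity>j. \<psi> j * f (real_of_int j * x)) \<le> L" for x
      unfolding L_def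
    proof (rule norm_infsum_le)
      show "((\<lambda>j. \<bar>\<psi> j\<bar>) has_sum (\<Sum>\<^sub>\<infinity>j. \<bar>\<psi> j\<bar>)) UNIV" using \<psi> by simp
      have "(\<lambda>j. norm (\<psi> j * f (real_of_int j * x))) summable_on UNIV"
      proof (rule summable_on_comparison_test [OF \<psi>])
        fix j
        show "norm (\<psi> j * f (real_of_int j * x)) \<le> \<bar>\<psi> j\<bar>" by (rule le)
        show "0 \<le> norm (\<psi> j * f (real_of_int j * x))" by simp
      qed
      then show "((\<lambda>j. \<psi> j * f (real_of_int j * x)) has_sum (\<Sum>\<^sub>\<infinity>j. \<psi> j * f (real_of_int j * x))) UNIV"
        by (rule has_sum_infsum [OF abs_summable_summable])
    qed (rule le)
    then have "bounded ((\<lambda>x. \<Sum>\<^sub>\<infinity>j. \<psi> j * f (real_of_int j * x)) ` A)"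
      by (auto simp: bounded_iff)
    then show ?thesis
      unfolding power2_eq_square by (intro uniform_lim_mult lim)
  qed
  show ?thesis
    unfolding finite_transfer_def power_transfer_def
    by (intro uniform_limit_add one) auto
qed

lemma continuous_finite_transfer: "continuous_on A (finite_transfer F \<psi>)"
  unfolding finite_transfer_def by (intro continuous_intros)

lemma continuous_power_transfer:
  assumes "(\<lambda>j. \<bar>\<psi> j\<bar>) summable_on UNIV"
  shows "continuous_on A (power_transfer \<psi>)"
  by (rule uniform_limit_theorem [OF _ finite_transfer_uniform_limit [OF assms]])
    (auto simp: continuous_finite_transfer)

lemma fcos_transfer_limit:
  assumes w: "continuous_on {0..pi} w" and \<psi>: "(\<lambda>j. \<bar>\<psi> j\<bar>) summable_on UNIV"
  shows "(\<lambda>n. fcos (\<lambda>x. w x * finite_transfer {- int n..int n} \<psi> x) h) \<longlonglongrightarrow> fcos (\<lambda>x. w x * power_transfer \<psi> x) h"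
proof -
  let ?v = "\<lambda>x. w x * cos (real_of_int h * x)"
  have cv: "continuous_on {0..pi} ?v" by (intro continuous_intros w)
  have bv: "bounded (?v ` {0..pi})"
    by (intro compact_imp_bounded compact_continuous_image cv) simp
  have bp: "bounded (power_transfer \<psi> ` {0..pi})"
    by (intro compact_imp_bounded compact_continuous_image continuous_power_transfer \<psi>) simp
  have "uniform_limit {0..pi} (\<lambda>n x. ?v x * finite_transfer {- int n..int n} \<psi> x)
      (\<lambda>x. ?v x * power_transfer \<psi> x) sequentially"
    by (intro uniform_lim_mult uniform_limit_const finite_transfer_uniform_limit \<psi> bv bp)
  then obtain I J where I: "\<And>n. ((\<lambda>x. ?v x * finite_transfer {- int n..int n} \<psi> x) has_integral I n) {0..pi}"
    and J: "((\<lambda>x. ?v x * power_transfer \<psi> x) has_integral J) {0..pi}" and IJ: "I \<longlonglongrightarrow> J"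
    by (rule uniform_limit_integral) (auto intro!: continuous_on_mult cv continuous_finite_transfer)
  have eq: "(\<lambda>x. (w x * g x) * cos (real_of_int h * x)) = (\<lambda>x. ?v x * g x)" for g :: "real \<Rightarrow> real"
    by (simp add: mult_ac)
  show ?thesis
    unfolding fcos_def eq using IJ integral_unique [OF I] integral_unique [OF J]
    by (auto intro!: tendsto_divide)
qed

lemma fcos_one: "fcos (\<lambda>x. 1) h = of_bool (h = 0)"
  by (simp add: fcos_def integral_cos_int)

text \<open>With weight 1, \<open>double_sum_fcos\<close> evaluates the lag-0 coefficient of a
  finite transfer function as a sum of squares of \<psi>, and one fixed square survives the
  limit.\<close>

lemma fcos_power_transfer_pos:
  assumes \<psi>: "(\<lambda>j. \<bar>\<psi> j\<bar>) summable_on UNIV" and j: "\<psi> j \<noteq> 0"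
  shows "0 < fcos (power_transfer \<psi>) 0"
proof -
  have "(\<psi> j)\<^sup>2 \<le> fcos (\<lambda>x. 1 * finite_transfer {- int n..int n} \<psi> x) 0" if "nat \<bar>j\<bar> \<le> n" for n
  proof -
    have "(\<psi> j)\<^sup>2 \<le> (\<Sum>i = - int n..int n. (\<psi> i)\<^sup>2)"
      using that by (intro member_le_sum) (auto simp: abs_le_iff)
    also have "\<dots> = (\<Sum>i = - int n..int n. \<Sum>k = - int n..int n. if k = i then \<psi> i * \<psi> k else 0)"
      by (intro sum.cong refl) (simp add: power2_eq_square)
    also have "\<dots> = (\<Sum>i = - int n..int n. \<Sum>k = - int n..int n. \<psi> i * \<psi> k * fcos (\<lambda>x. 1) (0 + i - k))"
      by (intro sum.cong refl) (auto simp: fcos_one)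
    also have "\<dots> = fcos (\<lambda>x. 1 * finite_transfer {- int n..int n} \<psi> x) 0"
      by (rule double_sum_fcos) simp
    finally show ?thesis .
  qed
  then have "(\<psi> j)\<^sup>2 \<le> fcos (\<lambda>x. 1 * power_transfer \<psi> x) 0"
    by (intro LIMSEQ_le_const [OF fcos_transfer_limit [OF _ \<psi>]]) auto
  with j show ?thesis by (simp add: less_le_trans [OF zero_less_power2 [THEN iffD2]])
qed

text \<open>If the mean square were 0, continuity would make the product vanish on all of [0, pi];
  as \<open>w\<close> is non-zero almost everywhere, the transfer function would have mean 0,
  contrary to \<open>fcos_power_transfer_pos\<close>.\<close>

lemma msq_weighted_transfer_pos:
  assumes w: "continuous_on {0..pi} w" and \<psi>: "(\<lambda>j. \<bar>\<psi> j\<bar>) summable_on UNIV" and j: "\<psi> j \<noteq> 0"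
    and nz: "AE l in lborel. l \<in> {- pi..pi} \<longrightarrow> w l \<noteq> 0"
  shows "0 < msq (\<lambda>x. w x * power_transfer \<psi> x)"
proof -
  let ?g = "power_transfer \<psi>"
  have cg: "continuous_on {0..pi} ?g" by (rule continuous_power_transfer [OF \<psi>])
  have "msq (\<lambda>x. w x * ?g x) \<noteq> 0"
  proof
    assume "msq (\<lambda>x. w x * ?g x) = 0"
    then have "integral {0..pi} (\<lambda>x. (w x * ?g x)\<^sup>2) = 0" by (simp add: msq_def)
    then have zero: "w x * ?g x = 0" if "x \<in> {0..pi}" for x
      using that by (subst (asm) integral_eq_0_iff) (auto intro!: continuous_intros w cg)
    obtain Z where Z: "{l \<in> space lborel. \<not> (l \<in> {- pi..pi} \<longrightarrow> w l \<noteq> 0)} \<subseteq> Z"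
      "emeasure lborel Z = 0" "Z \<in> sets lborel"
      using AE_E [OF nz] by blast
    have "negligible Z"
      using null_setsI [OF Z(2,3)] by (simp add: negligible_iff_null_sets null_sets_completionI)
    then have "integral {0..pi} (\<lambda>x. ?g x * cos (real_of_int 0 * x)) = integral {0..pi} (\<lambda>x. 0)"
    proof (rule integral_spike)
      fix x assume x: "x \<in> {0..pi} - Z"
      then have "- pi \<le> x" using pi_gt_zero by (auto intro: order_trans [of _ 0])
      with x have "x \<in> {l \<in> space lborel. \<not> (l \<in> {- pi..pi} \<longrightarrow> w l \<noteq> 0)}" if "w x = 0"
        using that by simp
      with x Z(1) have "w x \<noteq> 0" by blast
      with zero [of x] x show "0 = power_transfer \<psi> x * cos (real_of_int 0 * x)" by auto
    qed
    then have "fcos ?g 0 = 0" by (simp add: fcos_def)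
    with fcos_power_transfer_pos [OF \<psi> j] show False by simp
  qed
  with msq_nonneg [of "\<lambda>x. w x * ?g x"] show ?thesis by simp
qed

section \<open>From finite filters to the linear process\<close>

context white_noise
begin

lemma expectation_abs_noise_le: "expectation (\<lambda>\<omega>. \<bar>\<epsilon> k \<omega>\<bar>) \<le> 1"
proof -
  have "\<bar>x\<bar> \<le> (1 + x\<^sup>2) / 2" for x :: real
    using zero_le_power2 [of "\<bar>x\<bar> - 1"] by (simp add: power2_eq_square algebra_simps)
  then have "expectation (\<lambda>\<omega>. \<bar>\<epsilon> k \<omega>\<bar>) \<le> expectation (\<lambda>\<omega>. (1 + (\<epsilon> k \<omega>)\<^sup>2) / 2)"
    using noise_power_integrable [of k 1] noise_power_integrable [of k 2] by (intro integral_mono) auto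
  also have "\<dots> = 1"
    using noise_power_integrable [of k 2] expectation_noise_power [of k 2] by (simp add: prob_space)
  finally show ?thesis .
qed

text \<open>By monotone convergence the expected sum of absolute values is at most the sum of
  \<bar>\<psi> j\<bar>, so it is almost surely finite. Absolute convergence then identifies the
  pathwise \<open>infsum\<close> with the limit along symmetric windows.\<close>

lemma AE_noise_series_summable:
  assumes \<psi>: "(\<lambda>j. \<bar>\<psi> j\<bar>) summable_on UNIV"
  shows "AE \<omega> in M. (\<lambda>j. \<bar>\<psi> j * \<epsilon> (k - j) \<omega>\<bar>) summable_on UNIV"
proof -
  define S where "S n \<omega> = (\<Sum>j = - int n..int n. \<bar>\<psi> j\<bar> * \<bar>\<epsilon> (k - j) \<omega>\<bar>)" for n \<omega>
  define L where "L = (\<Sum>\<^sub>\<infinity>j. \<bar>\<psi> j\<bar>)"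
  have [measurable]: "S n \<in> borel_measurable M" for n unfolding S_def by measurable
  have inc: "S n \<omega> \<le> S n' \<omega>" if "n \<le> n'" for n n' \<omega>
    unfolding S_def using that by (intro sum_mono2) auto
  have S0: "0 \<le> S n \<omega>" for n \<omega> unfolding S_def by (intro sum_nonneg) auto
  have "(\<integral>\<^sup>+\<omega>. (SUP n. ennreal (S n \<omega>)) \<partial>M) = (SUP n. \<integral>\<^sup>+\<omega>. ennreal (S n \<omega>) \<partial>M)"
    by (intro nn_integral_monotone_convergence_SUP)
      (auto simp: incseq_def le_fun_def intro!: ennreal_leI inc)
  also have "\<dots> \<le> ennreal L"
  proof (rule SUP_least)
    fix n
    have int: "integrable M (S n)"
      unfolding S_def using noise_power_integrable [of _ 1]
      by (intro Bochner_Integration.integrable_sum integrable_mult_right integrable_abs) simp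
    have "expectation (S n) = (\<Sum>j = - int n..int n. \<bar>\<psi> j\<bar> * expectation (\<lambda>\<omega>. \<bar>\<epsilon> (k - j) \<omega>\<bar>))"
      unfolding S_def using noise_power_integrable [of _ 1]
      by (subst Bochner_Integration.integral_sum) (auto intro!: integrable_mult_right integrable_abs)
    also have "\<dots> \<le> (\<Sum>j = - int n..int n. \<bar>\<psi> j\<bar> * 1)"
      by (intro sum_mono mult_left_mono expectation_abs_noise_le) auto
    also have "\<dots> \<le> L"
      unfolding L_def using finite_sum_le_infsum [OF \<psi>, of "{- int n..int n}"] by simp
    finally show "(\<integral>\<^sup>+\<omega>. ennreal (S n \<omega>) \<partial>M) \<le> ennreal L"
      using int S0 by (subst nn_integral_eq_integral) (auto intro: ennreal_leI)
  qed
  finally have "(\<integral>\<^sup>+\<omega>. (SUP n. ennreal (S n \<omega>)) \<partial>M) \<noteq> \<infinity>"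
    by (auto simp: top_unique)
  then have "AE \<omega> in M. (SUP n. ennreal (S n \<omega>)) \<noteq> \<infinity>"
    by (intro nn_integral_noteq_infinite) measurable
  then show ?thesis
  proof eventually_elim
    case (elim \<omega>)
    then obtain C where C: "0 \<le> C" "(SUP n. ennreal (S n \<omega>)) = ennreal C"
      by (cases "(SUP n. ennreal (S n \<omega>))") auto
    have SC: "S n \<omega> \<le> C" for n
    proof -
      have "ennreal (S n \<omega>) \<le> ennreal C" unfolding C(2) [symmetric] by (rule SUP_upper) simp
      then show ?thesis using C(1) by simp
    qed
    show ?case
    proof (rule nonneg_bdd_above_summable_on)
      show "bdd_above (sum (\<lambda>j. \<bar>\<psi> j * \<epsilon> (k - j) \<omega>\<bar>) ` {F. F \<subseteq> UNIV \<and> finite F})"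
      proof (rule bdd_aboveI2)
        fix F :: "int set" assume "F \<in> {F. F \<subseteq> UNIV \<and> finite F}"
        then have "finite F" by simp
        then obtain n where n: "\<forall>h\<in>F. \<bar>h\<bar> \<le> n"
          by (metis Max_ge finite_imageI imageI)
        have "(\<Sum>j\<in>F. \<bar>\<psi> j * \<epsilon> (k - j) \<omega>\<bar>) \<le> S (nat n) \<omega>"
          unfolding S_def abs_mult using n by (intro sum_mono2) force+
        then show "(\<Sum>j\<in>F. \<bar>\<psi> j * \<epsilon> (k - j) \<omega>\<bar>) \<le> C" using SC by (rule order_trans)
      qed
    qed auto
  qed
qed

lemma AE_moving_average_limit:
  assumes \<psi>: "(\<lambda>j. \<bar>\<psi> j\<bar>) summable_on UNIV" and X: "linear_process M \<psi> \<epsilon> X"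
  shows "AE \<omega> in M. (\<lambda>n. moving_average {- int n..int n} \<psi> k \<omega>) \<longlonglongrightarrow> X k \<omega>"
proof -
  have "AE \<omega> in M. X k \<omega> = (\<Sum>\<^sub>\<infinity>j. \<psi> j * \<epsilon> (k - j) \<omega>)"
    using X by (simp add: linear_process_def)
  with AE_noise_series_summable [OF \<psi>, of k] show ?thesis
  proof eventually_elim
    case (elim \<omega>)
    have "(\<lambda>j. \<psi> j * \<epsilon> (k - j) \<omega>) summable_on UNIV"
      by (rule abs_summable_summable) (use elim in simp)
    then have "((\<lambda>j. \<psi> j * \<epsilon> (k - j) \<omega>) has_sum X k \<omega>) UNIV"
      using elim by simp
    then show ?case
      unfolding has_sum_def moving_average_def using filterlim_int_window by (rule filterlim_compose)
  qed
qed

text \<open>The bound for the windows from \<open>- n\<close> to \<open>n\<close> holds with one and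
  the same \<open>T\<close>, and on almost every path the finitely many variables and coefficients
  in the error converge, so Fatou passes to the limit.\<close>

lemma periodogram_form_approx:
  fixes \<psi> :: "int \<Rightarrow> real"
  assumes cont: "continuous_on {0..pi} w"
    and holder: "\<And>x y. x \<in> {0..pi} \<Longrightarrow> y \<in> {0..pi} \<Longrightarrow> \<bar>w x - w y\<bar> \<le> H * \<bar>x - y\<bar> powr \<kappa>"
    and bound: "\<And>x. x \<in> {0..pi} \<Longrightarrow> \<bar>w x\<bar> \<le> K"
    and H: "0 \<le> H" and \<kappa>: "1 / 2 < \<kappa>" "\<kappa> \<le> 1" and N: "0 < N"
    and s: "s \<in> {0..1}" and X: "linear_process M \<psi> \<epsilon> X"
    and \<psi>: "(\<lambda>i. \<bar>\<psi> i\<bar> * (1 + \<bar>real_of_int i\<bar>) powr \<kappa>) summable_on UNIV"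
  defines "T \<equiv> (\<Sum>\<^sub>\<infinity>i. \<bar>\<psi> i\<bar> * (1 + \<bar>real_of_int i\<bar>) powr \<kappa>)"
  defines "m \<equiv> nat \<lfloor>s * real N\<rfloor>"
  defines "a \<equiv> fcos (\<lambda>x. w x * power_transfer \<psi> x)"
  defines "D \<equiv> (\<lambda>\<omega>. (\<Sum>k = 1..m. \<Sum>l = 1..m. dcos w N (int k - int l) * (X (int k) \<omega> * X (int l) \<omega>))
      - s * real N * a 0 - toeplitz_form a m \<omega>)"
  shows "square_integrable M D"
    and "expectation (\<lambda>\<omega>. (D \<omega>)\<^sup>2) \<le>
      2 * (T ^ 4 * (4 * (\<Sum>k = 1..N. \<Sum>l = 1..N. (dcos w N (int k - int l) - fcos w (int k - int l))\<^sup>2) + 8 * msq w))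
      + 2 * (T\<^sup>2 * ((7 * H + 17 * K) * real N powr (1 - \<kappa>)))\<^sup>2"
proof -
  let ?F = "\<lambda>n. {- int n..int n}"
  define Dn where "Dn n \<omega> = (\<Sum>k = 1..m. \<Sum>l = 1..m. dcos w N (int k - int l) *
        (moving_average (?F n) \<psi> (int k) \<omega> * moving_average (?F n) \<psi> (int l) \<omega>))
      - s * real N * double_sum (?F n) \<psi> (fcos w) 0 - toeplitz_form (double_sum (?F n) \<psi> (fcos w)) m \<omega>" for n \<omega>
  have abs_\<psi>: "(\<lambda>j. \<bar>\<psi> j\<bar>) summable_on UNIV"
  proof (rule summable_on_comparison_test [OF \<psi>])
    fix j
    have "1 \<le> (1 + \<bar>real_of_int j\<bar>) powr \<kappa>" using \<kappa> by (intro ge_one_powr_ge_zero) auto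
    from mult_left_mono [OF this, of "\<bar>\<psi> j\<bar>"]
    show "\<bar>\<psi> j\<bar> \<le> \<bar>\<psi> j\<bar> * (1 + \<bar>real_of_int j\<bar>) powr \<kappa>" by simp
  qed auto
  have TF: "(\<Sum>i\<in>?F n. \<bar>\<psi> i\<bar> * (1 + \<bar>real_of_int i\<bar>) powr \<kappa>) \<le> T" for n
    unfolding T_def by (rule finite_sum_le_infsum [OF \<psi>]) auto
  have a_lim: "(\<lambda>n. double_sum (?F n) \<psi> (fcos w) h) \<longlonglongrightarrow> a h" for h
    unfolding double_sum_def double_sum_fcos [OF cont] a_def by (rule fcos_transfer_limit [OF cont abs_\<psi>])
  have [measurable]: "X k \<in> borel_measurable M" for k
    using X by (simp add: linear_process_def)
  have meas: "D \<in> borel_measurable M"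
    unfolding D_def toeplitz_form_def by measurable
  have lim: "AE \<omega> in M. (\<lambda>n. Dn n \<omega>) \<longlonglongrightarrow> D \<omega>"
  proof -
    have "AE \<omega> in M. \<forall>k. (\<lambda>n. moving_average (?F n) \<psi> k \<omega>) \<longlonglongrightarrow> X k \<omega>"
      unfolding AE_all_countable by (intro allI AE_moving_average_limit [OF abs_\<psi> X])
    then show ?thesis
    proof eventually_elim
    case (elim \<omega>)
    then show ?case
      unfolding Dn_def D_def toeplitz_form_def by (intro tendsto_intros a_lim) auto
    qed
  qed
  note approx = moving_average_periodogram_approx [OF cont holder bound H \<kappa> N s finite_atLeastAtMost_int TF,
      folded m_def, folded Dn_def]
  show "square_integrable M D"
    by (rule square_integrable_fatou(1) [OF approx lim meas])
  show "expectation (\<lambda>\<omega>. (D \<omega>)\<^sup>2) \<le>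
      2 * (T ^ 4 * (4 * (\<Sum>k = 1..N. \<Sum>l = 1..N. (dcos w N (int k - int l) - fcos w (int k - int l))\<^sup>2) + 8 * msq w))
      + 2 * (T\<^sup>2 * ((7 * H + 17 * K) * real N powr (1 - \<kappa>)))\<^sup>2"
    by (rule square_integrable_fatou(2) [OF approx lim meas])
qed

end

section \<open>The quadratic form of the periodogram and the spectral density\<close>

definition autocov :: "(int \<Rightarrow> real) \<Rightarrow> int \<Rightarrow> real" where
  "autocov \<psi> k = (\<Sum>\<^sub>\<infinity>j. \<psi> j * \<psi> (j + k))"

text \<open>A finite set of pairs lies in a rectangle, over which the sum factorises.\<close>

lemma abs_summable_pairs:
  fixes \<psi> :: "int \<Rightarrow> real"
  assumes \<psi>: "(\<lambda>j. \<bar>\<psi> j\<bar>) summable_on UNIV"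
  shows "(\<lambda>(i, j). \<bar>\<psi> i * \<psi> j\<bar>) summable_on UNIV"
proof (rule nonneg_bdd_above_summable_on)
  define L where "L = (\<Sum>\<^sub>\<infinity>j. \<bar>\<psi> j\<bar>)"
  have part: "(\<Sum>j\<in>A. \<bar>\<psi> j\<bar>) \<le> L" if "finite A" for A
    unfolding L_def by (rule finite_sum_le_infsum [OF \<psi> that]) auto
  have L: "0 \<le> L" using part [of "{}"] by simp
  show "bdd_above (sum (\<lambda>(i, j). \<bar>\<psi> i * \<psi> j\<bar>) ` {F. F \<subseteq> UNIV \<and> finite F})"
  proof (rule bdd_aboveI2)
    fix F :: "(int \<times> int) set" assume "F \<in> {F. F \<subseteq> UNIV \<and> finite F}"
    then have "finite F" by simp
    then have "(\<Sum>(i, j)\<in>F. \<bar>\<psi> i * \<psi> j\<bar>) \<le> (\<Sum>(i, j)\<in>fst ` F \<times> snd ` F. \<bar>\<psi> i * \<psi> j\<bar>)"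
      by (intro sum_mono2) (auto simp: image_iff, force+)
    also have "\<dots> = (\<Sum>i\<in>fst ` F. \<bar>\<psi> i\<bar>) * (\<Sum>j\<in>snd ` F. \<bar>\<psi> j\<bar>)"
      by (simp add: sum_product sum.cartesian_product abs_mult)
    also have "\<dots> \<le> L * L"
      using \<open>finite F\<close> L by (intro mult_mono part sum_nonneg) auto
    finally show "(\<Sum>(i, j)\<in>F. \<bar>\<psi> i * \<psi> j\<bar>) \<le> L * L" .
  qed
qed auto

lemma trig_summable:
  fixes \<psi> :: "int \<Rightarrow> real"
  assumes \<psi>: "(\<lambda>j. \<bar>\<psi> j\<bar>) summable_on UNIV"
  shows "(\<lambda>j. \<psi> j * cos (real_of_int j * x)) summable_on UNIV"
    and "(\<lambda>j. \<psi> j * sin (real_of_int j * x)) summable_on UNIV"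
proof -
  have "(\<lambda>j. \<psi> j * f j) summable_on UNIV" if f: "\<And>j. \<bar>f j\<bar> \<le> 1" for f :: "int \<Rightarrow> real"
  proof (rule abs_summable_summable, rule summable_on_comparison_test [OF \<psi>])
    show "norm (\<psi> j * f j) \<le> \<bar>\<psi> j\<bar>" for j
      using mult_left_mono [OF f, of "\<bar>\<psi> j\<bar>" j] by (simp add: abs_mult)
  qed simp
  from this [of "\<lambda>j. cos (real_of_int j * x)"] this [of "\<lambda>j. sin (real_of_int j * x)"]
  show "(\<lambda>j. \<psi> j * cos (real_of_int j * x)) summable_on UNIV"
    "(\<lambda>j. \<psi> j * sin (real_of_int j * x)) summable_on UNIV" by simp_all
qed

text \<open>Wiener-Khinchin: grouping the pairs (i, j) by their difference turns the squared cosine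
  and sine series into a series of autocovariances. Absolute summability over pairs justifies the
  reindexing and both orders of summation.\<close>

lemma autocov_cos_series:
  fixes \<psi> :: "int \<Rightarrow> real"
  assumes \<psi>: "(\<lambda>j. \<bar>\<psi> j\<bar>) summable_on UNIV"
  shows "(\<lambda>k. \<bar>autocov \<psi> k\<bar>) summable_on UNIV"
    and "(\<Sum>\<^sub>\<infinity>k. autocov \<psi> k * cos (real_of_int k * x)) = power_transfer \<psi> x"
proof -
  let ?c = "\<lambda>j. cos (real_of_int j * x)" and ?s = "\<lambda>j. sin (real_of_int j * x)"
  have bij: "bij_betw (\<lambda>(k, i). (i, i + k)) UNIV (UNIV :: (int \<times> int) set)"
    by (rule bij_betw_byWitness [where f' = "\<lambda>(i, j). (j - i, i)"]) auto
  have "(\<lambda>p. case (case p of (k, i) \<Rightarrow> (i, i + k)) of (i, j) \<Rightarrow> \<bar>\<psi> i * \<psi> j\<bar>) summable_on UNIV"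
    using abs_summable_pairs [OF \<psi>] by (subst summable_on_reindex_bij_betw [OF bij])
  then have abs_ki: "(\<lambda>(k, i). \<bar>\<psi> i * \<psi> (i + k)\<bar>) summable_on UNIV \<times> UNIV"
    by (simp add: case_prod_unfold)
  have summ: "(\<lambda>(k, i). \<psi> i * \<psi> (i + k) * g k) summable_on UNIV \<times> UNIV"
    if g: "\<And>k. \<bar>g k\<bar> \<le> 1" for g :: "int \<Rightarrow> real"
  proof (rule abs_summable_summable, rule summable_on_comparison_test [OF abs_ki])
    fix p :: "int \<times> int"
    obtain k i where p: "p = (k, i)" by (cases p)
    show "norm (case p of (k, i) \<Rightarrow> \<psi> i * \<psi> (i + k) * g k) \<le> (case p of (k, i) \<Rightarrow> \<bar>\<psi> i * \<psi> (i + k)\<bar>)"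
      using mult_left_mono [OF g [of k], of "\<bar>\<psi> i * \<psi> (i + k)\<bar>"] by (simp add: p abs_mult)
    show "0 \<le> norm (case p of (k, i) \<Rightarrow> \<psi> i * \<psi> (i + k) * g k)" by (rule norm_ge_zero)
  qed
  have row: "(\<lambda>i. \<bar>\<psi> i * \<psi> (i + k)\<bar>) summable_on UNIV" for k
    using summable_on_SigmaD1 [OF abs_ki, of k] by simp
  show "(\<lambda>k. \<bar>autocov \<psi> k\<bar>) summable_on UNIV"
  proof (rule summable_on_comparison_test)
    show "(\<lambda>k. \<Sum>\<^sub>\<infinity>i. \<bar>\<psi> i * \<psi> (i + k)\<bar>) summable_on UNIV"
      using abs_ki by (rule summable_on_Sigma_banach)
    show "\<bar>autocov \<psi> k\<bar> \<le> (\<Sum>\<^sub>\<infinity>i. \<bar>\<psi> i * \<psi> (i + k)\<bar>)" for k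
      using norm_infsum_bound [of "\<lambda>i. \<psi> i * \<psi> (i + k)" UNIV] row [of k]
      by (simp add: autocov_def)
  qed auto
  have "(\<Sum>\<^sub>\<infinity>k. autocov \<psi> k * ?c k) = (\<Sum>\<^sub>\<infinity>k. \<Sum>\<^sub>\<infinity>i. \<psi> i * \<psi> (i + k) * ?c k)"
    by (simp add: autocov_def infsum_cmult_left')
  also have "\<dots> = (\<Sum>\<^sub>\<infinity>(k, i)\<in>UNIV \<times> UNIV. \<psi> i * \<psi> (i + k) * ?c k)"
    by (rule infsum_Sigma'_banach, rule summ) simp
  also have "\<dots> = (\<Sum>\<^sub>\<infinity>p\<in>UNIV. (\<lambda>(i, j). \<psi> i * \<psi> j * ?c (j - i)) (case p of (k, i) \<Rightarrow> (i, i + k)))"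
    unfolding UNIV_Times_UNIV by (intro infsum_cong) (auto split: prod.splits)
  also have "\<dots> = (\<Sum>\<^sub>\<infinity>(i, j)\<in>UNIV \<times> UNIV. \<psi> i * \<psi> j * ?c (j - i))"
    by (subst infsum_reindex_bij_betw [OF bij]) simp
  also have "\<dots> = (\<Sum>\<^sub>\<infinity>i. \<Sum>\<^sub>\<infinity>j. \<psi> i * \<psi> j * ?c (j - i))"
  proof (rule infsum_Sigma'_banach [symmetric])
    have "(\<lambda>(i, j). \<bar>\<psi> i * \<psi> j\<bar>) summable_on UNIV \<times> UNIV" using abs_summable_pairs [OF \<psi>] by simp
    then have "(\<lambda>p. norm (case p of (i, j) \<Rightarrow> \<psi> i * \<psi> j * ?c (j - i))) summable_on UNIV \<times> UNIV"
    proof (rule summable_on_comparison_test)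
      fix p :: "int \<times> int"
      obtain i j where p: "p = (i, j)" by (cases p)
      show "norm (case p of (i, j) \<Rightarrow> \<psi> i * \<psi> j * ?c (j - i)) \<le> (case p of (i, j) \<Rightarrow> \<bar>\<psi> i * \<psi> j\<bar>)"
        using mult_left_mono [OF abs_cos_le_one [of "real_of_int (j - i) * x"], of "\<bar>\<psi> i * \<psi> j\<bar>"]
        by (simp add: p abs_mult)
      show "0 \<le> norm (case p of (i, j) \<Rightarrow> \<psi> i * \<psi> j * ?c (j - i))" by (rule norm_ge_zero)
    qed
    then show "(\<lambda>(i, j). \<psi> i * \<psi> j * ?c (j - i)) summable_on UNIV \<times> UNIV"
      by (rule abs_summable_summable)
  qed
  also have "\<dots> = (\<Sum>\<^sub>\<infinity>i. (\<psi> i * ?c i) * (\<Sum>\<^sub>\<infinity>j. \<psi> j * ?c j) + (\<psi> i * ?s i) * (\<Sum>\<^sub>\<infinity>j. \<psi> j * ?s j))"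
  proof (rule infsum_cong)
    fix i
    have "(\<Sum>\<^sub>\<infinity>j. \<psi> i * \<psi> j * ?c (j - i)) =
        (\<Sum>\<^sub>\<infinity>j. (\<psi> i * ?c i) * (\<psi> j * ?c j) + (\<psi> i * ?s i) * (\<psi> j * ?s j))"
      by (intro infsum_cong) (simp add: left_diff_distrib cos_diff algebra_simps)
    also have "\<dots> = (\<psi> i * ?c i) * (\<Sum>\<^sub>\<infinity>j. \<psi> j * ?c j) + (\<psi> i * ?s i) * (\<Sum>\<^sub>\<infinity>j. \<psi> j * ?s j)"
      using trig_summable [OF \<psi>] by (subst infsum_add) (auto simp: infsum_cmult_right' intro!: summable_on_cmult_right)
    finally show "(\<Sum>\<^sub>\<infinity>j. \<psi> i * \<psi> j * ?c (j - i)) = (\<psi> i * ?c i) * (\<Sum>\<^sub>\<infinity>j. \<psi> j * ?c j) + (\<psi> i * ?s i) * (\<Sum>\<^sub>\<infinity>j. \<psi> j * ?s j)" .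
  qed
  also have "\<dots> = power_transfer \<psi> x"
    using trig_summable [OF \<psi>]
    by (subst infsum_add) (auto simp: power_transfer_def infsum_cmult_left' power2_eq_square intro!: summable_on_cmult_left)
  finally show "(\<Sum>\<^sub>\<infinity>k. autocov \<psi> k * ?c k) = power_transfer \<psi> x" .
qed


section \<open>The periodogram as an exact quadratic form\<close>

lemma seq_periodogram_quadratic:
  "seq_periodogram x N s l = 1 / (2 * pi * s * real N) *
    (\<Sum>k = 1..nat \<lfloor>s * real N\<rfloor>. \<Sum>j = 1..nat \<lfloor>s * real N\<rfloor>.
       x (int k) * x (int j) * cos (real_of_int (int k - int j) * l))"
proof -
  let ?m = "nat \<lfloor>s * real N\<rfloor>"
  let ?z = "\<Sum>k = 1..?m. of_real (x (int k)) * exp (- (\<i> * of_nat k * of_real l)) :: complex"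
  have "exp (- (\<i> * of_nat k * of_real l)) = cis (- (real k * l))" for k
    by (simp add: cis_conv_exp mult.assoc)
  then have "Re ?z = (\<Sum>k = 1..?m. x (int k) * cos (real k * l))"
    "Im ?z = - (\<Sum>k = 1..?m. x (int k) * sin (real k * l))"
    by (simp_all add: Re_sum Im_sum sum_negf)
  then have "(cmod ?z)\<^sup>2 = (\<Sum>k = 1..?m. x (int k) * cos (real k * l))\<^sup>2 + (\<Sum>k = 1..?m. x (int k) * sin (real k * l))\<^sup>2"
    by (simp add: cmod_power2)
  also have "\<dots> = (\<Sum>k = 1..?m. \<Sum>j = 1..?m. x (int k) * x (int j) * cos (real_of_int (int k - int j) * l))"
    unfolding power2_eq_square sum_product sum.distrib [symmetric]
    by (intro sum.cong refl) (simp add: left_diff_distrib cos_diff algebra_simps)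
  finally show ?thesis by (simp add: seq_periodogram_def)
qed

text \<open>Once the sums are interchanged, the average over frequencies acts on \<open>w\<close>
  and the cosines alone; of the prefactor 4 pi / N times 1 / (2 pi s N), the part 2 / N goes into
  \<open>freq_mean\<close> and 1 / (s N) remains.\<close>

lemma integrated_periodogram_quadratic:
  "integrated_periodogram w x N s = 1 / (s * real N) *
    (\<Sum>k = 1..nat \<lfloor>s * real N\<rfloor>. \<Sum>l = 1..nat \<lfloor>s * real N\<rfloor>. dcos w N (int k - int l) * (x (int k) * x (int l)))"
proof -
  let ?m = "nat \<lfloor>s * real N\<rfloor>"
  have "integrated_periodogram w x N s = 4 * pi / real N * (1 / (2 * pi * s * real N)) *
      (\<Sum>j = 1..N div 2. \<Sum>k = 1..?m. \<Sum>l = 1..?m.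
        w (fourier_freq N j) * (x (int k) * x (int l) * cos (real_of_int (int k - int l) * fourier_freq N j)))"
    unfolding integrated_periodogram_def seq_periodogram_quadratic
    by (simp only: sum_distrib_left) (simp only: mult.assoc mult.left_commute)
  also have "(\<Sum>j = 1..N div 2. \<Sum>k = 1..?m. \<Sum>l = 1..?m.
        w (fourier_freq N j) * (x (int k) * x (int l) * cos (real_of_int (int k - int l) * fourier_freq N j))) =
      (\<Sum>k = 1..?m. \<Sum>l = 1..?m. \<Sum>j = 1..N div 2.
        w (fourier_freq N j) * (x (int k) * x (int l) * cos (real_of_int (int k - int l) * fourier_freq N j)))"
    (is "?A = ?B")
  proof -
    have "?A = (\<Sum>k = 1..?m. \<Sum>j = 1..N div 2. \<Sum>l = 1..?m.
        w (fourier_freq N j) * (x (int k) * x (int l) * cos (real_of_int (int k - int l) * fourier_freq N j)))"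
      by (rule sum.swap)
    also have "\<dots> = ?B" by (rule sum.cong [OF refl], rule sum.swap)
    finally show ?thesis .
  qed
  also have "4 * pi / real N * (1 / (2 * pi * s * real N)) * \<dots> = 1 / (s * real N) * (2 / real N * \<dots>)"
    by simp
  also have "2 / real N * ?B = (\<Sum>k = 1..?m. \<Sum>l = 1..?m. dcos w N (int k - int l) * (x (int k) * x (int l)))"
    unfolding dcos_def freq_mean_def sum_distrib_left sum_distrib_right
    by (intro sum.cong refl) (simp add: mult_ac)
  finally show ?thesis .
qed

text \<open>The constant of the definition may be negative if \<open>S\<close> has at most one
  point, so its absolute value is taken.\<close>

lemma holder_continuous_on_bound:
  assumes w: "holder_continuous_on S \<beta> w"
  obtains C where "0 \<le> C" "\<And>x y. x \<in> S \<Longrightarrow> y \<in> S \<Longrightarrow> \<bar>w x - w y\<bar> \<le> C * \<bar>x - y\<bar> powr \<beta>"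
proof -
  obtain C where C: "\<And>x y. x \<in> S \<Longrightarrow> y \<in> S \<Longrightarrow> \<bar>w x - w y\<bar> \<le> C * \<bar>x - y\<bar> powr \<beta>"
    using w unfolding holder_continuous_on_def by blast
  have "\<bar>w x - w y\<bar> \<le> \<bar>C\<bar> * \<bar>x - y\<bar> powr \<beta>" if "x \<in> S" "y \<in> S" for x y
    by (rule order_trans [OF C [OF that]]) (intro mult_right_mono; simp)
  then show thesis by (rule that [of "\<bar>C\<bar>", rotated]) auto
qed

lemma holder_imp_continuous_on:
  assumes w: "holder_continuous_on S \<beta> w" and \<beta>: "0 < \<beta>"
  shows "continuous_on S w"
proof -
  obtain C where C: "\<And>x y. x \<in> S \<Longrightarrow> y \<in> S \<Longrightarrow> \<bar>w x - w y\<bar> \<le> C * \<bar>x - y\<bar> powr \<beta>"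
    using holder_continuous_on_bound [OF w] by blast
  show ?thesis
    unfolding continuous_on_def
  proof
    fix x assume x: "x \<in> S"
    have "((\<lambda>y. \<bar>y - x\<bar> powr \<beta>) \<longlongrightarrow> 0) (at x within S)"
      using \<beta> by (intro tendsto_zero_powrI [of _ _ _ \<beta>] tendsto_const) (auto intro!: tendsto_eq_intros)
    then have "((\<lambda>y. C * \<bar>y - x\<bar> powr \<beta>) \<longlongrightarrow> 0) (at x within S)"
      by (rule tendsto_mult_right_zero)
    moreover have "\<forall>\<^sub>F y in at x within S. norm (w y - w x) \<le> C * \<bar>y - x\<bar> powr \<beta>"
      using x C by (auto simp: eventually_at_filter)
    ultimately have "((\<lambda>y. w y - w x) \<longlongrightarrow> 0) (at x within S)"
      by (rule Lim_null_comparison [rotated])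
    then show "(w \<longlongrightarrow> w x) (at x within S)" by (rule LIM_zero_cancel)
  qed
qed

lemma integral_even:
  fixes f :: "real \<Rightarrow> real"
  assumes cont: "continuous_on {- a..a} f" and even: "\<And>x. x \<in> {- a..a} \<Longrightarrow> f (- x) = f x" and a: "0 \<le> a"
  shows "integral {- a..a} f = 2 * integral {0..a} f"
proof -
  have sub: "{- a..0} \<subseteq> {- a..a}" "{0..a} \<subseteq> {- a..a}" using a by auto
  have "integral {- a..a} f = integral {- a..0} f + integral {0..a} f"
    using a by (intro Henstock_Kurzweil_Integration.integral_combine [symmetric]
        integrable_continuous_interval cont) auto
  also have "integral {- a..0} f = integral {- a..0} (\<lambda>x. f (- x))"
    using even a by (intro integral_cong) auto
  also have "\<dots> = integral {- a..- 0} (\<lambda>x. f (- x))" by simp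
  also have "\<dots> = integral {0..a} f"
    by (rule Henstock_Kurzweil_Integration.integral_reflect_real)
  finally show ?thesis by simp
qed

section \<open>Moments and spectral density of the linear process\<close>

context white_noise
begin

lemma moving_average_measurable [measurable]: "moving_average F \<psi> k \<in> borel_measurable M"
  unfolding moving_average_def by measurable

text \<open>The truncated series are dominated by \<open>Y k\<close>, the limit of the sums of
  \<bar>\<psi> j\<bar> times the absolute noise. Weighted Cauchy-Schwarz bounds the second moments
  of those sums by L^2 and Fatou makes \<open>Y k\<close> square integrable, so that dominated
  convergence applies to the variables and to their products.\<close>

lemma
  fixes \<psi> :: "int \<Rightarrow> real"
  assumes \<psi>: "(\<lambda>j. \<bar>\<psi> j\<bar>) summable_on UNIV" and X: "linear_process M \<psi> \<epsilon> X"
  shows expectation_linear_process: "expectation (X k) = 0"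
    and expectation_linear_process_product: "expectation (\<lambda>\<omega>. X 0 \<omega> * X k \<omega>) = autocov \<psi> k"
proof -
  let ?F = "\<lambda>n. {- int n..int n}"
  let ?X = "\<lambda>n k. moving_average (?F n) \<psi> k"
  have [measurable]: "X k \<in> borel_measurable M" for k using X by (simp add: linear_process_def)
  define L where "L = (\<Sum>\<^sub>\<infinity>j. \<bar>\<psi> j\<bar>)"
  define S where "S n k \<omega> = (\<Sum>j\<in>?F n. \<bar>\<psi> j\<bar> * \<bar>\<epsilon> (k - j) \<omega>\<bar>)" for n k \<omega>
  \<comment> \<open>Taken as the limit of a sequence, \<open>Y k\<close> is measurable; almost
    everywhere it is the sum of the series.\<close>
  define Y where "Y k \<omega> = lim (\<lambda>n. S n k \<omega>)" for k \<omega>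
  have part: "(\<Sum>j\<in>?F n. \<bar>\<psi> j\<bar>) \<le> L" for n
    unfolding L_def by (rule finite_sum_le_infsum [OF \<psi>]) auto
  have L: "0 \<le> L" by (rule order_trans [OF _ part [of 0]]) simp
  have sq_noise: "square_integrable M (\<lambda>\<omega>. \<bar>\<epsilon> j \<omega>\<bar>)" for j
    using noise_power_integrable [of j 2] by (simp add: square_integrable_def)
  have sq_S: "square_integrable M (S n k)" for n k
    unfolding S_def by (intro square_integrable_sum square_integrable_cmult sq_noise)
  have [measurable]: "S n k \<in> borel_measurable M" for n k using sq_S by (simp add: square_integrable_def)
  have [measurable]: "Y k \<in> borel_measurable M" for k
    unfolding Y_def by (rule borel_measurable_lim_metric) measurable
  have ES: "expectation (\<lambda>\<omega>. (S n k \<omega>)\<^sup>2) \<le> L\<^sup>2" for n k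
  proof -
    have int2: "integrable M (\<lambda>\<omega>. (\<epsilon> j \<omega>)\<^sup>2)" for j by (rule noise_power_integrable)
    have "expectation (\<lambda>\<omega>. (S n k \<omega>)\<^sup>2) \<le> expectation (\<lambda>\<omega>. L * (\<Sum>j\<in>?F n. \<bar>\<psi> j\<bar> * (\<epsilon> (k - j) \<omega>)\<^sup>2))"
    proof (rule integral_mono)
      show "integrable M (\<lambda>\<omega>. (S n k \<omega>)\<^sup>2)" using sq_S by (simp add: square_integrable_def)
      show "integrable M (\<lambda>\<omega>. L * (\<Sum>j\<in>?F n. \<bar>\<psi> j\<bar> * (\<epsilon> (k - j) \<omega>)\<^sup>2))"
        by (intro integrable_mult_right Bochner_Integration.integrable_sum int2)
      fix \<omega>
      have "(S n k \<omega>)\<^sup>2 \<le> (\<Sum>j\<in>?F n. \<bar>\<bar>\<psi> j\<bar>\<bar> * 1) * (\<Sum>j\<in>?F n. \<bar>\<bar>\<psi> j\<bar>\<bar> * \<bar>\<epsilon> (k - j) \<omega>\<bar>\<^sup>2 / 1)"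
        unfolding S_def by (rule weighted_sum_square_le) simp
      also have "\<dots> \<le> L * (\<Sum>j\<in>?F n. \<bar>\<psi> j\<bar> * (\<epsilon> (k - j) \<omega>)\<^sup>2)"
        using part [of n] by (simp add: mult_right_mono sum_nonneg)
      finally show "(S n k \<omega>)\<^sup>2 \<le> L * (\<Sum>j\<in>?F n. \<bar>\<psi> j\<bar> * (\<epsilon> (k - j) \<omega>)\<^sup>2)" .
    qed
    also have "\<dots> = L * (\<Sum>j\<in>?F n. \<bar>\<psi> j\<bar>)"
      using int2 expectation_noise_power [of _ 2] by simp
    also have "\<dots> \<le> L * L" by (intro mult_left_mono part L)
    finally show ?thesis by (simp add: power2_eq_square)
  qed
  have SY: "AE \<omega> in M. (\<lambda>n. S n k \<omega>) \<longlonglongrightarrow> Y k \<omega> \<and> (\<forall>n. S n k \<omega> \<le> Y k \<omega>)" for k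
    using AE_noise_series_summable [OF \<psi>, of k]
  proof eventually_elim
    case (elim \<omega>)
    let ?f = "\<lambda>j. \<bar>\<psi> j\<bar> * \<bar>\<epsilon> (k - j) \<omega>\<bar>"
    have summ: "?f summable_on UNIV" using elim by (simp add: abs_mult)
    have "(\<lambda>n. S n k \<omega>) \<longlonglongrightarrow> infsum ?f UNIV"
      using has_sum_infsum [OF summ] unfolding has_sum_def S_def
      by (rule filterlim_compose) (rule filterlim_int_window)
    moreover from this have "Y k \<omega> = infsum ?f UNIV" unfolding Y_def by (rule limI)
    moreover have "S n k \<omega> \<le> infsum ?f UNIV" for n
      unfolding S_def by (rule finite_sum_le_infsum [OF summ]) auto
    ultimately show ?case by simp
  qed
  have sq_Y: "square_integrable M (Y k)" for k
    by (rule square_integrable_fatou(1) [of M "\<lambda>n. S n k" "L\<^sup>2"])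
      (use SY [of k] sq_S ES in \<open>auto elim!: eventually_mono\<close>)
  have XY: "AE \<omega> in M. \<forall>n. \<bar>?X n k \<omega>\<bar> \<le> Y k \<omega>" for k
    using SY [of k]
  proof eventually_elim
    case (elim \<omega>)
    have "\<bar>?X n k \<omega>\<bar> \<le> S n k \<omega>" for n
      unfolding moving_average_def S_def abs_mult [symmetric] by (rule sum_abs)
    then show ?case using elim by (blast intro: order_trans)
  qed
  have XL: "AE \<omega> in M. (\<lambda>n. ?X n k \<omega>) \<longlonglongrightarrow> X k \<omega>" for k
    by (rule AE_moving_average_limit [OF \<psi> X])
  have intY: "integrable M (Y k)"
    using sq_Y [of k] 
    by (simp add: square_integrable_def square_integrable_imp_integrable [of "Y k"])
  have XY1: "AE \<omega> in M. norm (?X n k \<omega>) \<le> Y k \<omega>" for n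
    using XY [of k] by (rule eventually_mono) simp
  have "(\<lambda>n. expectation (?X n k)) \<longlonglongrightarrow> expectation (X k)"
    by (rule integral_dominated_convergence [OF _ _ intY XL XY1]) measurable
  moreover have "expectation (?X n k) = 0" for n
    unfolding moving_average_def using noise_power_integrable [of _ 1] expectation_noise_power [of _ 1]
    by (subst Bochner_Integration.integral_sum) auto
  ultimately show "expectation (X k) = 0" by (simp add: LIMSEQ_const_iff)
  have "(\<lambda>n. expectation (\<lambda>\<omega>. ?X n 0 \<omega> * ?X n k \<omega>)) \<longlonglongrightarrow> expectation (\<lambda>\<omega>. X 0 \<omega> * X k \<omega>)"
  proof (rule integral_dominated_convergence)
    show "integrable M (\<lambda>\<omega>. (Y 0 \<omega>)\<^sup>2 + (Y k \<omega>)\<^sup>2)"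
      using sq_Y by (auto simp: square_integrable_def)
    show "AE \<omega> in M. norm (?X n 0 \<omega> * ?X n k \<omega>) \<le> (Y 0 \<omega>)\<^sup>2 + (Y k \<omega>)\<^sup>2" for n
      using XY [of k] XY [of 0]
    proof eventually_elim
      case (elim \<omega>)
      then have "\<bar>?X n 0 \<omega>\<bar> \<le> Y 0 \<omega>" "\<bar>?X n k \<omega>\<bar> \<le> Y k \<omega>" by auto
      then have "\<bar>?X n 0 \<omega>\<bar> * \<bar>?X n k \<omega>\<bar> \<le> Y 0 \<omega> * Y k \<omega>" by (intro mult_mono) auto
      also have "\<dots> \<le> (Y 0 \<omega>)\<^sup>2 + (Y k \<omega>)\<^sup>2"
        using sum_squares_bound [of "Y 0 \<omega>" "Y k \<omega>"] zero_le_power2 [of "Y 0 \<omega>"] zero_le_power2 [of "Y k \<omega>"]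
        by linarith
      finally show ?case by (simp add: abs_mult)
    qed
    show "AE \<omega> in M. (\<lambda>n. ?X n 0 \<omega> * ?X n k \<omega>) \<longlonglongrightarrow> X 0 \<omega> * X k \<omega>"
      using XL [of 0] XL [of k] by eventually_elim (rule tendsto_mult)
  qed measurable
  moreover have "(\<lambda>n. expectation (\<lambda>\<omega>. ?X n 0 \<omega> * ?X n k \<omega>)) \<longlonglongrightarrow> autocov \<psi> k"
  proof -
    \<comment> \<open>Only pairs with j = i + k survive, and both members must lie in the window;
      these smaller windows still exhaust the integers.\<close>
    let ?G = "\<lambda>n. {i \<in> ?F n. i + k \<in> ?F n}"
    have E: "expectation (\<lambda>\<omega>. ?X n 0 \<omega> * ?X n k \<omega>) = (\<Sum>i\<in>?G n. \<psi> i * \<psi> (i + k))" for n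
    proof -
      have "expectation (\<lambda>\<omega>. ?X n 0 \<omega> * ?X n k \<omega>) =
          expectation (\<lambda>\<omega>. \<Sum>i\<in>?F n. \<Sum>j\<in>?F n. \<psi> i * \<psi> j * (\<epsilon> (0 - i) \<omega> * \<epsilon> (k - j) \<omega>))"
        unfolding moving_average_def sum_product by (simp only: mult.assoc mult.left_commute)
      also have "\<dots> = (\<Sum>i\<in>?F n. \<Sum>j\<in>?F n. \<psi> i * \<psi> j * of_bool (0 - i = k - j))"
        by (simp add: noise_product2_integrable expectation_noise_product2)
      also have "\<dots> = (\<Sum>i\<in>?F n. \<Sum>j\<in>?F n. if j = i + k then \<psi> i * \<psi> j else 0)"
        by (intro sum.cong refl) auto
      also have "\<dots> = (\<Sum>i\<in>?F n. if i + k \<in> ?F n then \<psi> i * \<psi> (i + k) else 0)"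
        by (intro sum.cong refl) simp
      also have "\<dots> = (\<Sum>i\<in>?G n. \<psi> i * \<psi> (i + k))"
        by (simp only: sum.inter_filter finite_atLeastAtMost_int)
      finally show ?thesis .
    qed
    have win: "filterlim ?G (finite_subsets_at_top UNIV) sequentially"
      unfolding filterlim_finite_subsets_at_top
    proof safe
      fix A :: "int set" assume "finite A"
      then obtain b where b: "\<forall>h\<in>A. \<bar>h\<bar> \<le> b" by (metis Max_ge finite_imageI imageI)
      have "A \<subseteq> ?G n" if "nat (b + \<bar>k\<bar>) \<le> n" for n
        using b that by (force simp: abs_le_iff)
      moreover have "finite (?G n)" for n by (rule finite_subset [of _ "?F n"]) auto
      ultimately show "\<forall>\<^sub>F n in sequentially. finite (?G n) \<and> A \<subseteq> ?G n \<and> ?G n \<subseteq> UNIV"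
        by (intro eventually_sequentiallyI [of "nat (b + \<bar>k\<bar>)"] conjI subset_UNIV)
    qed
    have "(\<lambda>i. \<psi> i * \<psi> (i + k)) summable_on UNIV"
    proof (rule abs_summable_summable, rule summable_on_comparison_test)
      show "(\<lambda>i. \<bar>\<psi> i\<bar> * L) summable_on UNIV" by (intro summable_on_cmult_left \<psi>)
      have "\<bar>\<psi> i\<bar> \<le> L" for i
        unfolding L_def using finite_sum_le_infsum [OF \<psi>, of "{i}"] by simp
      then show "norm (\<psi> i * \<psi> (i + k)) \<le> \<bar>\<psi> i\<bar> * L" for i by (simp add: abs_mult mult_left_mono)
    qed simp
    from has_sum_infsum [OF this] show ?thesis
      unfolding E autocov_def has_sum_def using win by (rule filterlim_compose)
  qed
  ultimately show "expectation (\<lambda>\<omega>. X 0 \<omega> * X k \<omega>) = autocov \<psi> k" by (rule LIMSEQ_unique)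
qed

lemma spectral_density_linear_process:
  fixes \<psi> :: "int \<Rightarrow> real"
  assumes \<psi>: "(\<lambda>j. \<bar>\<psi> j\<bar>) summable_on UNIV" and X: "linear_process M \<psi> \<epsilon> X"
  shows "spectral_density M X l = power_transfer \<psi> l / (2 * pi)"
proof -
  have cov: "covariance M (X 0) (X k) = autocov \<psi> k" for k
    unfolding covariance_def expectation_linear_process [OF \<psi> X]
    using expectation_linear_process_product [OF \<psi> X] by simp
  let ?f = "\<lambda>k::int. of_real (autocov \<psi> k) * exp (- (\<i> * of_real l * of_int k)) :: complex"
  have exp: "exp (- (\<i> * of_real l * of_int k)) = cis (- (real_of_int k * l))" for k
    by (simp add: cis_conv_exp mult_ac)
  have "?f summable_on UNIV"
    by (rule abs_summable_summable)
      (use autocov_cos_series(1) [OF \<psi>] in \<open>simp add: exp norm_mult\<close>)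
  then have "Re (\<Sum>\<^sub>\<infinity>k. ?f k) = (\<Sum>\<^sub>\<infinity>k. Re (?f k))" by (rule infsum_Re [symmetric])
  also have "\<dots> = (\<Sum>\<^sub>\<infinity>k. autocov \<psi> k * cos (real_of_int k * l))"
    by (simp add: exp)
  also have "\<dots> = power_transfer \<psi> l" by (rule autocov_cos_series(2) [OF \<psi>])
  finally have re: "Re (\<Sum>\<^sub>\<infinity>k. ?f k) = power_transfer \<psi> l" .
  have "Re (1 / (2 * of_real pi) * z) = Re z / (2 * pi)" for z
  proof -
    have "1 / (2 * of_real pi) * z = z / of_real (2 * pi)" by simp
    then show ?thesis by (simp only: Re_divide_of_real)
  qed
  then show ?thesis unfolding spectral_density_def cov by (simp only: re)
qed

text \<open>Folding the even integrand onto [0, pi] gives a factor 2, which cancels against the 2 pi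
  of the spectral density. So \<Phi> is the lag-0 coefficient by which the form is centred.\<close>

lemma spectral_functional:
  fixes \<psi> :: "int \<Rightarrow> real"
  assumes \<psi>: "(\<lambda>j. \<bar>\<psi> j\<bar>) summable_on UNIV" and X: "linear_process M \<psi> \<epsilon> X"
    and w: "continuous_on {- pi..pi} w" and even: "\<And>l. l \<in> {- pi..pi} \<Longrightarrow> w (- l) = w l"
  shows "(LINT l:{- pi..pi}|lborel. w l * spectral_density M X l) = fcos (\<lambda>x. w x * power_transfer \<psi> x) 0"
proof -
  let ?g = "\<lambda>l. w l * power_transfer \<psi> l / (2 * pi)"
  have cont: "continuous_on {- pi..pi} ?g"
    by (intro continuous_intros w continuous_power_transfer \<psi>) auto
  have "(LINT l:{- pi..pi}|lborel. w l * spectral_density M X l) = (LINT l:{- pi..pi}|lborel. ?g l)"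
    by (simp add: spectral_density_linear_process [OF \<psi> X])
  also have "\<dots> = integral {- pi..pi} ?g"
    by (intro set_borel_integral_eq_integral borel_integrable_atLeastAtMost' cont)
  also have "\<dots> = 2 * integral {0..pi} ?g"
  proof (rule integral_even [OF cont])
    fix x assume "x \<in> {- pi..pi}"
    moreover have "power_transfer \<psi> (- x) = power_transfer \<psi> x"
      by (simp add: power_transfer_def infsum_uminus)
    ultimately show "?g (- x) = ?g x" by (simp add: even)
  qed simp
  finally show ?thesis by (simp add: fcos_def)
qed

end

section \<open>Weak convergence of ratios\<close>

text \<open>Young's inequality for the mixed term 2 \<bar>y - z\<bar> \<bar>z\<bar>. With
  \<open>e\<close> the distance of \<open>y\<close> and \<open>z\<close> in mean square, both terms
  are of order \<open>e\<close>.\<close>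

lemma real_abs_sq_diff_le:
  fixes y z e :: real
  assumes "0 < e"
  shows "\<bar>y\<^sup>2 - z\<^sup>2\<bar> \<le> (1 + 1 / e) * (y - z)\<^sup>2 + e * z\<^sup>2"
proof -
  have "2 * (\<bar>y - z\<bar> * \<bar>z\<bar>) \<le> (y - z)\<^sup>2 / e + e * z\<^sup>2"
  proof -
    have "0 \<le> (\<bar>y - z\<bar> / sqrt e - sqrt e * \<bar>z\<bar>)\<^sup>2" by simp
    then show ?thesis using assms by (simp add: power2_diff power_divide power_mult_distrib)
  qed
  moreover have "\<bar>y\<^sup>2 - z\<^sup>2\<bar> \<le> (y - z)\<^sup>2 + 2 * (\<bar>y - z\<bar> * \<bar>z\<bar>)"
  proof -
    have "y\<^sup>2 - z\<^sup>2 = (y - z)\<^sup>2 + 2 * ((y - z) * z)" by (simp add: power2_eq_square algebra_simps)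
    also have "\<bar>\<dots>\<bar> \<le> \<bar>(y - z)\<^sup>2\<bar> + \<bar>2 * ((y - z) * z)\<bar>" by (rule abs_triangle_ineq)
    finally show ?thesis by (simp add: abs_mult)
  qed
  ultimately show ?thesis by (simp add: algebra_simps)
qed

lemma real_abs_le_sq:
  fixes z e :: real
  assumes "0 < e"
  shows "\<bar>z\<bar> \<le> z\<^sup>2 / (2 * e) + e / 2"
proof -
  have "0 \<le> (\<bar>z\<bar> - e)\<^sup>2" by simp
  then have "2 * (\<bar>z\<bar> * e) \<le> z\<^sup>2 + e\<^sup>2" by (simp add: power2_diff)
  then have "2 * (\<bar>z\<bar> * e) / (2 * e) \<le> (z\<^sup>2 + e\<^sup>2) / (2 * e)"
    using assms by (intro divide_right_mono) auto
  then show ?thesis using assms by (simp add: add_divide_distrib power2_eq_square)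
qed

definition sq_deviation :: "(real \<Rightarrow> 'a \<Rightarrow> real) \<Rightarrow> 'a \<Rightarrow> real" where
  "sq_deviation x \<omega> = (LINT s:{1/2..1}|lborel. (x s \<omega> - x 1 \<omega>)\<^sup>2)"

text \<open>Joint measurability is asked only over [1/2, 1], hence the indicator: Brownian motion is
  unspecified outside.\<close>

definition measurable_process :: "'a measure \<Rightarrow> (real \<Rightarrow> 'a \<Rightarrow> real) \<Rightarrow> bool" where
  "measurable_process M x \<longleftrightarrow> x 1 \<in> borel_measurable M \<and>
     (\<lambda>(s, \<omega>). indicator {1/2..1} s * x s \<omega>) \<in> borel_measurable (lborel \<Otimes>\<^sub>M M)"

lemma measurable_sq_deviation_integrand:
  assumes "measurable_process M x"
  shows "(\<lambda>(s, \<omega>). indicator {1/2..1} s * (x s \<omega> - x 1 \<omega>)\<^sup>2) \<in> borel_measurable (lborel \<Otimes>\<^sub>M M)"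
proof -
  have [measurable]: "x 1 \<in> borel_measurable M"
    and x: "(\<lambda>(s, \<omega>). indicator {1/2..1} s * x s \<omega>) \<in> borel_measurable (lborel \<Otimes>\<^sub>M M)"
    using assms by (auto simp: measurable_process_def)
  have "(\<lambda>p. ((case p of (s, \<omega>) \<Rightarrow> indicator {1/2..1} s * x s \<omega>) - indicator {1/2..1} (fst p) * x 1 (snd p))\<^sup>2)
      \<in> borel_measurable (lborel \<Otimes>\<^sub>M M)"
    by (intro borel_measurable_power borel_measurable_diff x) measurable
  also have "(\<lambda>p. ((case p of (s, \<omega>) \<Rightarrow> indicator {1/2..1} s * x s \<omega>) - indicator {1/2..1} (fst p) * x 1 (snd p))\<^sup>2)
      = (\<lambda>(s, \<omega>). indicator {1/2..1} s * (x s \<omega> - x 1 \<omega>)\<^sup>2)"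
    by (auto simp: fun_eq_iff indicator_def)
  finally show ?thesis .
qed

lemma measurable_sq_deviation:
  assumes "measurable_process M x"
  shows "sq_deviation x \<in> borel_measurable M"
proof -
  have "(\<lambda>(\<omega>, s). indicator {1/2..1} s * (x s \<omega> - x 1 \<omega>)\<^sup>2) \<in> borel_measurable (M \<Otimes>\<^sub>M lborel)"
    using measurable_compose [OF measurable_pair_swap' measurable_sq_deviation_integrand [OF assms]]
    by (simp add: split_beta comp_def)
  then have "(\<lambda>\<omega>. LINT s|lborel. indicator {1/2..1} s * (x s \<omega> - x 1 \<omega>)\<^sup>2) \<in> borel_measurable M"
    by (rule lborel.borel_measurable_lebesgue_integral)
  then show ?thesis
    by (simp add: sq_deviation_def [abs_def] set_lebesgue_integral_def)
qed

text \<open>Fubini replaces path regularity: the two deviations differ by at most the integral over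
  \<open>s\<close> of pointwise differences, whose expectations are bounded for each
  \<open>s\<close> separately. The value at 1 contributes \<open>e\<close>; the deviation
  contributes half, the length of the interval, of 4 e^2 + 4 e + 4 K e.\<close>

lemma process_compare:
  fixes x z :: "real \<Rightarrow> 'a \<Rightarrow> real" and g :: "real \<Rightarrow> real \<Rightarrow> real"
  assumes "prob_space M" and x: "measurable_process M x" and z: "measurable_process M z"
    and sqd: "\<And>s. s \<in> {1/2..1} \<Longrightarrow> square_integrable M (\<lambda>\<omega>. x s \<omega> - z s \<omega>)"
    and diff: "\<And>s. s \<in> {1/2..1} \<Longrightarrow> (\<integral>\<omega>. (x s \<omega> - z s \<omega>)\<^sup>2 \<partial>M) \<le> e\<^sup>2"
    and sqz: "\<And>s. s \<in> {1/2..1} \<Longrightarrow> square_integrable M (z s)"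
    and zK: "\<And>s. s \<in> {1/2..1} \<Longrightarrow> (\<integral>\<omega>. (z s \<omega>)\<^sup>2 \<partial>M) \<le> K"
    and e: "0 < e" and L: "0 \<le> L"
    and lip: "\<And>a b c d. \<bar>g a c - g b d\<bar> \<le> L * (\<bar>a - b\<bar> + \<bar>c - d\<bar>)"
    and bnd: "\<And>a c. \<bar>g a c\<bar> \<le> 1" and meas: "case_prod g \<in> borel_measurable borel"
  shows "\<bar>(\<integral>\<omega>. g (x 1 \<omega>) (sq_deviation x \<omega>) \<partial>M) - (\<integral>\<omega>. g (z 1 \<omega>) (sq_deviation z \<omega>) \<partial>M)\<bar>
    \<le> L * (3 * e + 2 * e\<^sup>2 + 2 * K * e)"
proof -
  interpret prob_space M by fact
  interpret pair_sigma_finite lborel M by unfold_locales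
  let ?I = "indicator {1/2..1} :: real \<Rightarrow> real"
  define y where "y s \<omega> = x s \<omega> - x 1 \<omega>" for s \<omega>
  define v where "v s \<omega> = z s \<omega> - z 1 \<omega>" for s \<omega>
  have my: "(\<lambda>(s, \<omega>). ?I s * (y s \<omega>)\<^sup>2) \<in> borel_measurable (lborel \<Otimes>\<^sub>M M)"
    unfolding y_def by (rule measurable_sq_deviation_integrand [OF x])
  have mv: "(\<lambda>(s, \<omega>). ?I s * (v s \<omega>)\<^sup>2) \<in> borel_measurable (lborel \<Otimes>\<^sub>M M)"
    unfolding v_def by (rule measurable_sq_deviation_integrand [OF z])
  have one: "(1::real) \<in> {1/2..1}" by simp
  have sq_v: "square_integrable M (v s)" and Ev: "expectation (\<lambda>\<omega>. (v s \<omega>)\<^sup>2) \<le> 4 * K" if s: "s \<in> {1/2..1}" for s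
  proof -
    show "square_integrable M (v s)"
      unfolding v_def by (intro square_integrable_diff sqz s one)
    have "expectation (\<lambda>\<omega>. (z s \<omega> + (-1) * z 1 \<omega>)\<^sup>2) \<le>
        2 * expectation (\<lambda>\<omega>. (z s \<omega>)\<^sup>2) + 2 * expectation (\<lambda>\<omega>. ((-1) * z 1 \<omega>)\<^sup>2)"
      by (rule integral_square_add_le [OF sqz [OF s] square_integrable_cmult [OF sqz [OF one]]])
    then show "expectation (\<lambda>\<omega>. (v s \<omega>)\<^sup>2) \<le> 4 * K"
      using zK [OF s] zK [OF one] by (simp add: v_def)
  qed
  have sq_yv: "square_integrable M (\<lambda>\<omega>. y s \<omega> - v s \<omega>)"
    and Eyv: "expectation (\<lambda>\<omega>. (y s \<omega> - v s \<omega>)\<^sup>2) \<le> 4 * e\<^sup>2" if s: "s \<in> {1/2..1}" for s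
  proof -
    have eq: "y s \<omega> - v s \<omega> = (x s \<omega> - z s \<omega>) + (-1) * (x 1 \<omega> - z 1 \<omega>)" for \<omega>
      by (simp add: y_def v_def)
    show "square_integrable M (\<lambda>\<omega>. y s \<omega> - v s \<omega>)"
      unfolding eq by (rule square_integrable_add [OF sqd [OF s] square_integrable_cmult [OF sqd [OF one]]])
    have "expectation (\<lambda>\<omega>. (y s \<omega> - v s \<omega>)\<^sup>2) \<le>
        2 * expectation (\<lambda>\<omega>. (x s \<omega> - z s \<omega>)\<^sup>2) + 2 * expectation (\<lambda>\<omega>. ((-1) * (x 1 \<omega> - z 1 \<omega>))\<^sup>2)"
      unfolding eq by (rule integral_square_add_le [OF sqd [OF s] square_integrable_cmult [OF sqd [OF one]]])
    also have "\<dots> \<le> 2 * e\<^sup>2 + 2 * e\<^sup>2"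
      unfolding power_mult_distrib using diff [OF s] diff [OF one] by simp
    finally show "expectation (\<lambda>\<omega>. (y s \<omega> - v s \<omega>)\<^sup>2) \<le> 4 * e\<^sup>2" by simp
  qed
  have sq_y: "square_integrable M (y s)" if s: "s \<in> {1/2..1}" for s
    using square_integrable_add [OF sq_yv [OF s] sq_v [OF s]] by simp
  \<comment> \<open>Increments relative to time 1 carry two errors of mean square at most e^2 and
    two values of mean square at most \<open>K\<close>; squaring a sum doubles, hence both factors
    4.\<close>
  define G where "G s = (1 + 1 / e) * (4 * e\<^sup>2) + e * (4 * K)" for s :: real
  have Ediff: "expectation (\<lambda>\<omega>. \<bar>(y s \<omega>)\<^sup>2 - (v s \<omega>)\<^sup>2\<bar>) \<le> G s"
    and intdiff: "integrable M (\<lambda>\<omega>. (y s \<omega>)\<^sup>2 - (v s \<omega>)\<^sup>2)" if s: "s \<in> {1/2..1}" for s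
  proof -
    show int: "integrable M (\<lambda>\<omega>. (y s \<omega>)\<^sup>2 - (v s \<omega>)\<^sup>2)"
      using sq_y [OF s] sq_v [OF s] by (auto simp: square_integrable_def)
    have "expectation (\<lambda>\<omega>. \<bar>(y s \<omega>)\<^sup>2 - (v s \<omega>)\<^sup>2\<bar>) \<le>
        expectation (\<lambda>\<omega>. (1 + 1 / e) * (y s \<omega> - v s \<omega>)\<^sup>2 + e * (v s \<omega>)\<^sup>2)"
      using int sq_yv [OF s] sq_v [OF s] e
      by (intro integral_mono real_abs_sq_diff_le) (auto simp: square_integrable_def)
    also have "\<dots> = (1 + 1 / e) * expectation (\<lambda>\<omega>. (y s \<omega> - v s \<omega>)\<^sup>2) + e * expectation (\<lambda>\<omega>. (v s \<omega>)\<^sup>2)"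
      using sq_yv [OF s] sq_v [OF s] by (simp add: square_integrable_def)
    also have "\<dots> \<le> G s"
      unfolding G_def using e by (intro add_mono mult_left_mono Eyv Ev s) auto
    finally show "expectation (\<lambda>\<omega>. \<bar>(y s \<omega>)\<^sup>2 - (v s \<omega>)\<^sup>2\<bar>) \<le> G s" .
  qed
  have G0: "0 \<le> G s" for s
    using Ediff [OF one] unfolding G_def by (rule order_trans [rotated]) simp
  have IG: "integrable lborel (\<lambda>s. ?I s * G s)"
    unfolding G_def by (intro integrable_mult_left integrable_real_indicator emeasure_bounded_finite) auto
  \<comment> \<open>Integrability on the product space ensures that the two inner integrals may be
    subtracted for almost every \<omega>.\<close>
  have int_prod: "integrable (lborel \<Otimes>\<^sub>M M) (\<lambda>(s, \<omega>). ?I s * f s \<omega>)"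
    if f: "(\<lambda>(s, \<omega>). ?I s * f s \<omega>) \<in> borel_measurable (lborel \<Otimes>\<^sub>M M)"
      and fi: "\<And>s. s \<in> {1/2..1} \<Longrightarrow> integrable M (f s)"
      and fC: "\<And>s. s \<in> {1/2..1} \<Longrightarrow> expectation (\<lambda>\<omega>. \<bar>f s \<omega>\<bar>) \<le> C" for f :: "real \<Rightarrow> 'a \<Rightarrow> real" and C
  proof (rule integrableI_bounded [OF f])
    have "(\<integral>\<^sup>+p. ennreal (norm (case p of (s, \<omega>) \<Rightarrow> ?I s * f s \<omega>)) \<partial>(lborel \<Otimes>\<^sub>M M)) =
        (\<integral>\<^sup>+s. (\<integral>\<^sup>+\<omega>. ennreal (norm (?I s * f s \<omega>)) \<partial>M) \<partial>lborel)"
      using f by (subst sigma_finite_measure.nn_integral_fst [OF prob_space_imp_sigma_finite [OF \<open>prob_space M\<close>], symmetric]) auto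
    also have "\<dots> \<le> (\<integral>\<^sup>+s. ennreal C * indicator {1/2..1::real} s \<partial>lborel)"
    proof (rule nn_integral_mono)
      fix s :: real
      show "(\<integral>\<^sup>+\<omega>. ennreal (norm (?I s * f s \<omega>)) \<partial>M) \<le> ennreal C * indicator {1/2..1} s"
      proof (cases "s \<in> {1/2..1}")
        case True
        then have "(\<integral>\<^sup>+\<omega>. ennreal (norm (?I s * f s \<omega>)) \<partial>M) = ennreal (expectation (\<lambda>\<omega>. \<bar>f s \<omega>\<bar>))"
          using fi [OF True] by (simp add: nn_integral_eq_integral)
        then show ?thesis using fC [OF True] True by (simp add: ennreal_leI)
      next
        case False
        then have "?I s = 0" by (rule indicator_simps(2))
        then show ?thesis by simp
      qed
    qed
    also have "\<dots> = ennreal C * ennreal (1 - 1 / 2)"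
      by (subst nn_integral_cmult_indicator) (simp_all only: emeasure_lborel_Icc, auto)
    also have "\<dots> < \<infinity>"
      unfolding infinity_ennreal_def ennreal_mult_less_top by (intro disjI2 conjI ennreal_less_top)
    finally show "(\<integral>\<^sup>+p. ennreal (norm (case p of (s, \<omega>) \<Rightarrow> ?I s * f s \<omega>)) \<partial>(lborel \<Otimes>\<^sub>M M)) < \<infinity>" .
  qed
  have intv: "integrable (lborel \<Otimes>\<^sub>M M) (\<lambda>(s, \<omega>). ?I s * (v s \<omega>)\<^sup>2)"
    using sq_v Ev by (intro int_prod [OF mv, of "4 * K"]) (auto simp: square_integrable_def)
  have md: "(\<lambda>(s, \<omega>). ?I s * ((y s \<omega>)\<^sup>2 - (v s \<omega>)\<^sup>2)) \<in> borel_measurable (lborel \<Otimes>\<^sub>M M)"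
    using borel_measurable_diff [OF my mv] by (simp add: case_prod_unfold right_diff_distrib)
  have intd: "integrable (lborel \<Otimes>\<^sub>M M) (\<lambda>(s, \<omega>). ?I s * ((y s \<omega>)\<^sup>2 - (v s \<omega>)\<^sup>2))"
    by (rule int_prod [OF md intdiff]) (use Ediff in \<open>auto simp: G_def\<close>)
  have inty: "integrable (lborel \<Otimes>\<^sub>M M) (\<lambda>(s, \<omega>). ?I s * (y s \<omega>)\<^sup>2)"
    using Bochner_Integration.integrable_add [OF intd intv] by (simp add: case_prod_unfold right_diff_distrib)
  have intabs: "integrable (lborel \<Otimes>\<^sub>M M) (\<lambda>(s, \<omega>). ?I s * \<bar>(y s \<omega>)\<^sup>2 - (v s \<omega>)\<^sup>2\<bar>)"
    using integrable_abs [OF intd] by (simp add: case_prod_unfold abs_mult)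
  define h where "h \<omega> = (LINT s|lborel. ?I s * \<bar>(y s \<omega>)\<^sup>2 - (v s \<omega>)\<^sup>2\<bar>)" for \<omega>
  have int_h: "integrable M h"
    unfolding h_def using integrable_snd [OF intabs] .
  have Dx: "sq_deviation x \<omega> = (LINT s|lborel. ?I s * (y s \<omega>)\<^sup>2)"
    and Dz: "sq_deviation z \<omega> = (LINT s|lborel. ?I s * (v s \<omega>)\<^sup>2)" for \<omega>
    by (simp_all add: sq_deviation_def set_lebesgue_integral_def y_def v_def)
  have AE_h: "AE \<omega> in M. \<bar>sq_deviation x \<omega> - sq_deviation z \<omega>\<bar> \<le> h \<omega>"
    using AE_integrable_snd [OF inty] AE_integrable_snd [OF intv]
  proof eventually_elim
    case (elim \<omega>)
    have "sq_deviation x \<omega> - sq_deviation z \<omega> = (LINT s|lborel. ?I s * (y s \<omega>)\<^sup>2 - ?I s * (v s \<omega>)\<^sup>2)"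
      unfolding Dx Dz by (rule Bochner_Integration.integral_diff [symmetric]) (use elim in \<open>simp_all only: prod.case\<close>)
    then have "\<bar>sq_deviation x \<omega> - sq_deviation z \<omega>\<bar> = \<bar>LINT s|lborel. ?I s * (y s \<omega>)\<^sup>2 - ?I s * (v s \<omega>)\<^sup>2\<bar>"
      by (rule arg_cong)
    also have "\<dots> \<le> (LINT s|lborel. \<bar>?I s * (y s \<omega>)\<^sup>2 - ?I s * (v s \<omega>)\<^sup>2\<bar>)"
      by (rule integral_abs_bound)
    also have "\<dots> = h \<omega>"
      unfolding h_def
    proof (intro Bochner_Integration.integral_cong refl)
      fix s :: real
      show "\<bar>?I s * (y s \<omega>)\<^sup>2 - ?I s * (v s \<omega>)\<^sup>2\<bar> = ?I s * \<bar>(y s \<omega>)\<^sup>2 - (v s \<omega>)\<^sup>2\<bar>"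
        by (cases "s \<in> {1/2..1}") (simp_all only: indicator_simps mult_1 mult_zero_left diff_self abs_zero not_False_eq_True)
    qed
    finally show ?case .
  qed
  have Eh: "expectation h \<le> 2 * e\<^sup>2 + 2 * e + 2 * K * e"
  proof -
    have "expectation h = (LINT s|lborel. expectation (\<lambda>\<omega>. ?I s * \<bar>(y s \<omega>)\<^sup>2 - (v s \<omega>)\<^sup>2\<bar>))"
      unfolding h_def using integral_snd [OF intabs] integral_fst [OF intabs] by simp
    also have "\<dots> \<le> (LINT s|lborel. ?I s * G s)"
    proof (rule integral_mono)
      show "integrable lborel (\<lambda>s. expectation (\<lambda>\<omega>. ?I s * \<bar>(y s \<omega>)\<^sup>2 - (v s \<omega>)\<^sup>2\<bar>))"
        using integrable_fst [OF intabs] .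
      show "expectation (\<lambda>\<omega>. ?I s * \<bar>(y s \<omega>)\<^sup>2 - (v s \<omega>)\<^sup>2\<bar>) \<le> ?I s * G s" for s
        using Ediff [of s] by (cases "s \<in> {1/2..1}") (simp_all add: indicator_simps)
    qed (rule IG)
    also have "\<dots> = G 0 / 2"
      unfolding G_def by simp
    also have "\<dots> = 2 * e\<^sup>2 + 2 * e + 2 * K * e"
      unfolding G_def using e by (simp add: field_simps power2_eq_square)
    finally show ?thesis .
  qed
  have mg: "(\<lambda>\<omega>. g (f \<omega>) (f' \<omega>)) \<in> borel_measurable M"
    if "f \<in> borel_measurable M" "f' \<in> borel_measurable M" for f f'
    using measurable_compose [OF borel_measurable_Pair [OF that] meas] by simp
  have gi: "integrable M (\<lambda>\<omega>. g (f \<omega>) (f' \<omega>))"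
    if "f \<in> borel_measurable M" "f' \<in> borel_measurable M" for f f'
    by (rule integrable_const_bound [of _ 1]) (use bnd mg [OF that] in auto)
  have m1: "x 1 \<in> borel_measurable M" "z 1 \<in> borel_measurable M"
    using x z by (auto simp: measurable_process_def)
  note mD = measurable_sq_deviation [OF x] measurable_sq_deviation [OF z]
  have int1: "integrable M (\<lambda>\<omega>. (x 1 \<omega> - z 1 \<omega>)\<^sup>2)"
    using sqd [OF one] by (simp add: square_integrable_def)
  have "\<bar>(\<integral>\<omega>. g (x 1 \<omega>) (sq_deviation x \<omega>) \<partial>M) - (\<integral>\<omega>. g (z 1 \<omega>) (sq_deviation z \<omega>) \<partial>M)\<bar> =
      \<bar>\<integral>\<omega>. g (x 1 \<omega>) (sq_deviation x \<omega>) - g (z 1 \<omega>) (sq_deviation z \<omega>) \<partial>M\<bar>"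
    by (subst Bochner_Integration.integral_diff) (auto intro!: gi m1 mD)
  also have "\<dots> \<le> (\<integral>\<omega>. \<bar>g (x 1 \<omega>) (sq_deviation x \<omega>) - g (z 1 \<omega>) (sq_deviation z \<omega>)\<bar> \<partial>M)"
    by (rule integral_abs_bound)
  also have "\<dots> \<le> (\<integral>\<omega>. L * (((x 1 \<omega> - z 1 \<omega>)\<^sup>2 / (2 * e) + e / 2) + h \<omega>) \<partial>M)"
  proof (rule integral_mono_AE)
    show "integrable M (\<lambda>\<omega>. \<bar>g (x 1 \<omega>) (sq_deviation x \<omega>) - g (z 1 \<omega>) (sq_deviation z \<omega>)\<bar>)"
      by (intro integrable_abs Bochner_Integration.integrable_diff gi m1 mD)
    show "integrable M (\<lambda>\<omega>. L * (((x 1 \<omega> - z 1 \<omega>)\<^sup>2 / (2 * e) + e / 2) + h \<omega>))"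
      by (intro integrable_mult_right Bochner_Integration.integrable_add integrable_divide int1 int_h) simp
    show "AE \<omega> in M. \<bar>g (x 1 \<omega>) (sq_deviation x \<omega>) - g (z 1 \<omega>) (sq_deviation z \<omega>)\<bar> \<le>
        L * (((x 1 \<omega> - z 1 \<omega>)\<^sup>2 / (2 * e) + e / 2) + h \<omega>)"
      using AE_h
    proof eventually_elim
      case (elim \<omega>)
      show ?case
        by (rule order_trans [OF lip]) (intro mult_left_mono add_mono real_abs_le_sq e elim L)
    qed
  qed
  also have "\<dots> = L * ((expectation (\<lambda>\<omega>. (x 1 \<omega> - z 1 \<omega>)\<^sup>2) / (2 * e) + e / 2) + expectation h)"
    using int1 int_h by (simp add: prob_space)
  also have "\<dots> \<le> L * ((e\<^sup>2 / (2 * e) + e / 2) + (2 * e\<^sup>2 + 2 * e + 2 * K * e))"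
    using e by (intro mult_left_mono add_mono divide_right_mono diff one Eh L) auto
  also have "\<dots> = L * (3 * e + 2 * e\<^sup>2 + 2 * K * e)"
    using e by (simp add: power2_eq_square)
  finally show ?thesis .
qed

section \<open>Lipschitz truncation of the ratio\<close>

lemma cts_step_bounds: "x < y \<Longrightarrow> 0 \<le> cts_step x y r" "x < y \<Longrightarrow> cts_step x y r \<le> 1"
  by (auto simp: cts_step_def divide_simps)

lemma cts_step_lipschitz:
  assumes "x < y"
  shows "\<bar>cts_step x y r - cts_step x y r'\<bar> \<le> \<bar>r - r'\<bar> / (y - x)"
proof -
  have "\<bar>(y - x) * cts_step x y r - (y - x) * cts_step x y r'\<bar> \<le> \<bar>r - r'\<bar>"
    using assms by (auto simp: cts_step_def)
  then have "(y - x) * \<bar>cts_step x y r - cts_step x y r'\<bar> \<le> \<bar>r - r'\<bar>"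
    using assms by (simp add: right_diff_distrib [symmetric] abs_mult)
  then show ?thesis using assms by (simp add: pos_le_divide_eq mult.commute)
qed

text \<open>The difference of the reciprocals times
  \<open>sqrt c * sqrt d * (sqrt c + sqrt d)\<close> is \<bar>c - d\<bar> in absolute value, so a
  lower bound 1 / u^2 for that product suffices.\<close>

lemma inverse_sqrt_lipschitz:
  fixes c d u :: real
  assumes u: "1 \<le> u" and c: "1 / u \<le> c" and d: "1 / u \<le> d"
  shows "\<bar>1 / sqrt c - 1 / sqrt d\<bar> \<le> u\<^sup>2 * \<bar>c - d\<bar>"
proof -
  have pos: "0 < c" "0 < d" using u c d by (auto intro: less_le_trans [of 0 "1 / u"])
  have uc: "1 \<le> u * c" "1 \<le> u * d" using u c d by (auto simp: field_simps)
  have *: "1 \<le> u * sqrt v" if "1 \<le> u * v" "0 < v" for v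
  proof -
    have "1 \<le> sqrt (u * v)" using that by simp
    also have "\<dots> \<le> sqrt (u * (u * v))"
      using u that by (intro real_sqrt_le_mono) (simp add: mult_left_mono [of 1 u "u * v", simplified])
    also have "\<dots> = u * sqrt v" using u by (simp add: real_sqrt_mult)
    finally show ?thesis .
  qed
  have eq: "\<bar>1 / sqrt c - 1 / sqrt d\<bar> * (sqrt c * sqrt d * (sqrt c + sqrt d)) = \<bar>c - d\<bar>"
  proof -
    have "(1 / sqrt c - 1 / sqrt d) * (sqrt c * sqrt d * (sqrt c + sqrt d)) = d - c"
      using pos by (simp add: field_simps)
    moreover have "0 \<le> sqrt c * sqrt d * (sqrt c + sqrt d)" using pos by simp
    ultimately show ?thesis by (metis abs_minus_commute abs_mult abs_of_nonneg)
  qed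
  have "1 \<le> u\<^sup>2 * (sqrt c * sqrt d * (sqrt c + sqrt d))"
  proof -
    have "1 * 1 \<le> (u * c) * (u * sqrt d)"
      using * [OF uc(2) pos(2)] uc by (intro mult_mono) auto
    also have "\<dots> = u\<^sup>2 * (sqrt c * sqrt d * sqrt c)"
      using pos by (simp add: power2_eq_square)
    also have "\<dots> \<le> u\<^sup>2 * (sqrt c * sqrt d * (sqrt c + sqrt d))"
      using pos by (intro mult_left_mono) auto
    finally show ?thesis by simp
  qed
  from mult_left_mono [OF this, of "\<bar>1 / sqrt c - 1 / sqrt d\<bar>"]
  have "\<bar>1 / sqrt c - 1 / sqrt d\<bar> \<le> u\<^sup>2 * (\<bar>1 / sqrt c - 1 / sqrt d\<bar> * (sqrt c * sqrt d * (sqrt c + sqrt d)))"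
    by (simp add: mult_ac)
  then show ?thesis unfolding eq .
qed

text \<open>Lipschitz substitute for \<open>a / sqrt d\<close>, equal to it wherever \<open>trunc_defect u a d < 1\<close>.\<close>

definition trunc_ratio :: "real \<Rightarrow> real \<Rightarrow> real \<Rightarrow> real" where
  "trunc_ratio u a d = max (- u) (min u a) / sqrt (max d (1 / u))"

text \<open>A Lipschitz majorant of the indicator of \<bar>a\<bar> > u or u d < 1, where truncation
  acts; it vanishes for \<bar>a\<bar> \<le> u - 1 and u d \<ge> 2. Being Lipschitz, it is itself a
  test function whose expectation converges.\<close>

definition trunc_defect :: "real \<Rightarrow> real \<Rightarrow> real \<Rightarrow> real" where
  "trunc_defect u a d = max (max 0 (min 1 (\<bar>a\<bar> - u + 1))) (max 0 (min 1 (2 - u * d)))"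

lemma trunc_defect_bounds: "0 \<le> trunc_defect u a d" "trunc_defect u a d \<le> 1"
  by (auto simp: trunc_defect_def)

lemma trunc_defect_lipschitz:
  assumes "1 \<le> u"
  shows "\<bar>trunc_defect u a c - trunc_defect u b d\<bar> \<le> u * (\<bar>a - b\<bar> + \<bar>c - d\<bar>)"
proof -
  have clamp: "\<bar>max 0 (min 1 s) - max 0 (min 1 t)\<bar> \<le> \<bar>s - t\<bar>" for s t :: real
    by (simp add: max_def min_def abs_if)
  have max2: "\<bar>max p q - max p' q'\<bar> \<le> \<bar>p - p'\<bar> + \<bar>q - q'\<bar>" for p q p' q' :: real
    by (simp add: max_def abs_if)
  have "\<bar>trunc_defect u a c - trunc_defect u b d\<bar> \<le>
      \<bar>(\<bar>a\<bar> - u + 1) - (\<bar>b\<bar> - u + 1)\<bar> + \<bar>(2 - u * c) - (2 - u * d)\<bar>"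
    unfolding trunc_defect_def by (rule order_trans [OF max2 add_mono [OF clamp clamp]])
  also have "\<dots> \<le> \<bar>a - b\<bar> + \<bar>u * c - u * d\<bar>" by linarith
  also have "\<dots> \<le> u * \<bar>a - b\<bar> + u * \<bar>c - d\<bar>"
    using assms mult_right_mono [of 1 u "\<bar>a - b\<bar>"] by (simp add: right_diff_distrib [symmetric] abs_mult)
  finally show ?thesis by (simp add: distrib_left)
qed

text \<open>The clamped numerator is bounded by \<open>u\<close> and 1-Lipschitz, the reciprocal
  root is bounded by \<open>u\<close> with constant u^2; the product rule gives at most u^3.\<close>

lemma trunc_ratio_lipschitz:
  assumes u: "1 \<le> u"
  shows "\<bar>trunc_ratio u a c - trunc_ratio u b d\<bar> \<le> u ^ 3 * (\<bar>a - b\<bar> + \<bar>c - d\<bar>)"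
proof -
  define a' where "a' = max (- u) (min u a)"
  define b' where "b' = max (- u) (min u b)"
  define p where "p = 1 / sqrt (max c (1 / u))"
  define q where "q = 1 / sqrt (max d (1 / u))"
  have ab: "\<bar>a' - b'\<bar> \<le> \<bar>a - b\<bar>" "\<bar>b'\<bar> \<le> u" using u by (auto simp: a'_def b'_def max_def min_def)
  have "1 / u \<le> max c (1 / u)" by simp
  then have "sqrt (1 / u) \<le> sqrt (max c (1 / u))" by (rule real_sqrt_le_mono)
  moreover have "0 < sqrt (1 / u)" using u by simp
  ultimately have "p \<le> 1 / sqrt (1 / u)"
    unfolding p_def by (intro divide_left_mono mult_pos_pos) (auto simp: less_max_iff_disj)
  also have "\<dots> = sqrt u" by (simp add: real_sqrt_divide)
  also have "\<dots> \<le> u"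
    using u by (intro real_le_lsqrt) (auto simp: power2_eq_square)
  finally have p: "p \<le> u" .
  have p0: "0 \<le> p" unfolding p_def using u by (simp add: le_max_iff_disj)
  have "\<bar>p - q\<bar> \<le> u\<^sup>2 * \<bar>max c (1 / u) - max d (1 / u)\<bar>"
    unfolding p_def q_def using u by (intro inverse_sqrt_lipschitz) auto
  also have "\<dots> \<le> u\<^sup>2 * \<bar>c - d\<bar>" by (intro mult_left_mono) auto
  finally have pq: "\<bar>p - q\<bar> \<le> u\<^sup>2 * \<bar>c - d\<bar>" .
  have "trunc_ratio u a c - trunc_ratio u b d = (a' - b') * p + b' * (p - q)"
    by (simp add: trunc_ratio_def a'_def b'_def p_def q_def algebra_simps)
  also have "\<bar>\<dots>\<bar> \<le> \<bar>a' - b'\<bar> * p + \<bar>b'\<bar> * \<bar>p - q\<bar>"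
    using p0 by (metis abs_mult abs_of_nonneg abs_triangle_ineq)
  also have "\<dots> \<le> \<bar>a - b\<bar> * u + u * (u\<^sup>2 * \<bar>c - d\<bar>)"
    using ab p p0 pq u by (intro add_mono mult_mono) auto
  also have "\<dots> \<le> \<bar>a - b\<bar> * u ^ 3 + u * (u\<^sup>2 * \<bar>c - d\<bar>)"
    using u self_le_power [OF u, of 3] by (intro add_mono mult_left_mono) auto
  finally show ?thesis by (simp add: power2_eq_square power3_eq_cube algebra_simps)
qed

lemma cts_step_trunc_ratio:
  assumes "x < y"
  shows "\<bar>cts_step x y (a / sqrt d) - cts_step x y (trunc_ratio u a d)\<bar> \<le> trunc_defect u a d"
proof (cases "\<bar>a\<bar> \<le> u \<and> 1 \<le> u * d")
  case True
  show ?thesis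
  proof (cases "0 < u")
    case True
    then have "1 / u \<le> d" using \<open>\<bar>a\<bar> \<le> u \<and> 1 \<le> u * d\<close> by (simp add: field_simps)
    then have "trunc_ratio u a d = a / sqrt d"
      using \<open>\<bar>a\<bar> \<le> u \<and> 1 \<le> u * d\<close> by (auto simp: trunc_ratio_def max_def min_def)
    then show ?thesis by (simp add: trunc_defect_bounds)
  next
    case False
    then have "u = 0" using True by auto
    then show ?thesis using True by simp
  qed
next
  case False
  then have "trunc_defect u a d = 1" by (auto simp: trunc_defect_def)
  moreover have "\<bar>cts_step x y (a / sqrt d) - cts_step x y (trunc_ratio u a d)\<bar> \<le> 1"
    using cts_step_bounds [OF assms, of "a / sqrt d"] cts_step_bounds [OF assms, of "trunc_ratio u a d"]
    by linarith
  ultimately show ?thesis by simp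
qed

lemma trunc_defect_tendsto:
  assumes "0 < d"
  shows "(\<lambda>n. trunc_defect (real (Suc n)) a d) \<longlonglongrightarrow> 0"
proof (rule tendsto_eventually)
  obtain n0 where "\<bar>a\<bar> + 2 / d < real n0" using reals_Archimedean2 by blast
  then have n0: "\<bar>a\<bar> < real n0" "2 / d < real n0" using assms by (auto intro: le_less_trans [rotated])
  have "trunc_defect (real (Suc n)) a d = 0" if "n0 \<le> n" for n
  proof -
    have "2 / d < real (Suc n)" "\<bar>a\<bar> - real (Suc n) + 1 \<le> 0" using n0 that by auto
    then have "2 \<le> real (Suc n) * d" using assms by (simp only: pos_divide_less_eq)
    then show ?thesis using \<open>\<bar>a\<bar> - real (Suc n) + 1 \<le> 0\<close> by (simp add: trunc_defect_def)
  qed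
  then show "\<forall>\<^sub>F n in sequentially. trunc_defect (real (Suc n)) a d = 0"
    by (auto simp: eventually_sequentially)
qed

text \<open>The quotient is discontinuous at d = 0, and the variables \<open>D n\<close> may vanish.
  Replacing it by \<open>trunc_ratio\<close> costs the expectation of \<open>trunc_defect\<close>,
  which is small under the limit law because D' > 0 almost surely, and then small for large
  \<open>n\<close> because \<open>conv\<close> applies to the defect as well. Continuous step
  functions suffice to test weak convergence.\<close>

lemma ratio_weak_conv:
  fixes A D :: "nat \<Rightarrow> 'a \<Rightarrow> real" and A' D' :: "'b \<Rightarrow> real"
  assumes "prob_space M" "prob_space P"
    and [measurable]: "\<And>n. A n \<in> borel_measurable M" "\<And>n. D n \<in> borel_measurable M"
      "A' \<in> borel_measurable P" "D' \<in> borel_measurable P"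
    and pos: "AE \<omega> in P. 0 < D' \<omega>"
    and conv: "\<And>g L. 0 \<le> L \<Longrightarrow> (\<And>a b c d. \<bar>g a c - g b d\<bar> \<le> L * (\<bar>a - b\<bar> + \<bar>c - d\<bar>)) \<Longrightarrow>
      (\<And>a c. \<bar>g a c\<bar> \<le> 1) \<Longrightarrow> case_prod g \<in> borel_measurable borel \<Longrightarrow>
      (\<lambda>n. \<integral>\<omega>. g (A n \<omega>) (D n \<omega>) \<partial>M) \<longlonglongrightarrow> (\<integral>\<omega>. g (A' \<omega>) (D' \<omega>) \<partial>P)"
  shows "weak_conv_m (\<lambda>n. distr M borel (\<lambda>\<omega>. A n \<omega> / sqrt (D n \<omega>))) (distr P borel (\<lambda>\<omega>. A' \<omega> / sqrt (D' \<omega>)))"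
proof -
  interpret M: prob_space M by fact
  interpret P: prob_space P by fact
  have RM: "real_distribution (distr M borel (\<lambda>\<omega>. A n \<omega> / sqrt (D n \<omega>)))" for n
    by (rule M.real_distribution_distr) measurable
  have RP: "real_distribution (distr P borel (\<lambda>\<omega>. A' \<omega> / sqrt (D' \<omega>)))"
    by (rule P.real_distribution_distr) measurable
  show ?thesis
  proof (rule integral_cts_step_conv_imp_weak_conv [OF RM RP])
    fix x y :: real assume xy: "x < y"
    let ?f = "cts_step x y"
    have mf [measurable]: "?f \<in> borel_measurable borel"
      using xy by (intro borel_measurable_continuous_onI uniformly_continuous_imp_continuous
          cts_step_uniformly_continuous)
    have mt [measurable]: "case_prod (trunc_ratio u) \<in> borel_measurable borel"
      "case_prod (trunc_defect u) \<in> borel_measurable borel" for u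
      unfolding trunc_ratio_def [abs_def] trunc_defect_def [abs_def] borel_prod [symmetric] by measurable
    have mg: "case_prod (\<lambda>a d. ?f (trunc_ratio u a d)) \<in> borel_measurable borel" for u
      using measurable_compose [OF mt(1) mf] by (simp add: split_beta)
    have convf: "(\<lambda>n. \<integral>\<omega>. ?f (trunc_ratio u (A n \<omega>) (D n \<omega>)) \<partial>M) \<longlonglongrightarrow> (\<integral>\<omega>. ?f (trunc_ratio u (A' \<omega>) (D' \<omega>)) \<partial>P)"
      if u: "1 \<le> u" for u
    proof (rule conv [OF _ _ _ mg])
      show "0 \<le> u ^ 3 / (y - x)" using u xy by simp
      fix a b c d :: real
      show "\<bar>?f (trunc_ratio u a c)\<bar> \<le> 1"
        using cts_step_bounds [OF xy, of "trunc_ratio u a c"] by simp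
      have "\<bar>?f (trunc_ratio u a c) - ?f (trunc_ratio u b d)\<bar> \<le> \<bar>trunc_ratio u a c - trunc_ratio u b d\<bar> / (y - x)"
        by (rule cts_step_lipschitz [OF xy])
      also have "\<dots> \<le> u ^ 3 * (\<bar>a - b\<bar> + \<bar>c - d\<bar>) / (y - x)"
        using xy by (intro divide_right_mono trunc_ratio_lipschitz u) auto
      finally show "\<bar>?f (trunc_ratio u a c) - ?f (trunc_ratio u b d)\<bar> \<le> u ^ 3 / (y - x) * (\<bar>a - b\<bar> + \<bar>c - d\<bar>)"
        by simp
    qed
    have convh: "(\<lambda>n. \<integral>\<omega>. trunc_defect u (A n \<omega>) (D n \<omega>) \<partial>M) \<longlonglongrightarrow> (\<integral>\<omega>. trunc_defect u (A' \<omega>) (D' \<omega>) \<partial>P)"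
      if u: "1 \<le> u" for u
    proof (rule conv [OF _ trunc_defect_lipschitz [OF u] _ mt(2)])
      show "0 \<le> u" using u by simp
      show "\<bar>trunc_defect u a c\<bar> \<le> 1" for a c
        using trunc_defect_bounds [of u a c] by simp
    qed
    have small: "(\<lambda>n. \<integral>\<omega>. trunc_defect (real (Suc n)) (A' \<omega>) (D' \<omega>) \<partial>P) \<longlonglongrightarrow> (\<integral>\<omega>. 0 \<partial>P)"
    proof (rule integral_dominated_convergence [where w = "\<lambda>_. 1"])
      show "AE \<omega> in P. (\<lambda>n. trunc_defect (real (Suc n)) (A' \<omega>) (D' \<omega>)) \<longlonglongrightarrow> 0"
        using pos by eventually_elim (rule trunc_defect_tendsto)
      show "AE \<omega> in P. norm (trunc_defect (real (Suc n)) (A' \<omega>) (D' \<omega>)) \<le> 1" for n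
        using trunc_defect_bounds by (intro AE_I2) simp
      show "(\<lambda>\<omega>. trunc_defect (real (Suc n)) (A' \<omega>) (D' \<omega>)) \<in> borel_measurable P" for n
        unfolding trunc_defect_def by measurable
    qed simp_all
    have bound: "\<bar>(\<integral>\<omega>. ?f (a \<omega> / sqrt (d \<omega>)) \<partial>Q) - (\<integral>\<omega>. ?f (trunc_ratio u (a \<omega>) (d \<omega>)) \<partial>Q)\<bar> \<le> (\<integral>\<omega>. trunc_defect u (a \<omega>) (d \<omega>) \<partial>Q)"
      if "prob_space Q" and [measurable]: "a \<in> borel_measurable Q" "d \<in> borel_measurable Q"
      for Q :: "'c measure" and a d :: "'c \<Rightarrow> real" and u
    proof -
      interpret Q: prob_space Q by fact
      have [measurable]: "(\<lambda>\<omega>. ?f (trunc_ratio u (a \<omega>) (d \<omega>))) \<in> borel_measurable Q"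
        "(\<lambda>\<omega>. trunc_defect u (a \<omega>) (d \<omega>)) \<in> borel_measurable Q"
        unfolding trunc_ratio_def trunc_defect_def by measurable
      have fb: "norm (?f r) \<le> 1" and tb: "norm (trunc_defect u p q) \<le> 1" for r p q
        using cts_step_bounds [OF xy, of r] trunc_defect_bounds [of u p q] by simp_all
      have i: "integrable Q (\<lambda>\<omega>. ?f (a \<omega> / sqrt (d \<omega>)))" "integrable Q (\<lambda>\<omega>. ?f (trunc_ratio u (a \<omega>) (d \<omega>)))"
        "integrable Q (\<lambda>\<omega>. trunc_defect u (a \<omega>) (d \<omega>))"
        by (intro Q.integrable_const_bound [of _ 1] AE_I2 fb tb; measurable)+
      have "(\<integral>\<omega>. ?f (a \<omega> / sqrt (d \<omega>)) \<partial>Q) - (\<integral>\<omega>. ?f (trunc_ratio u (a \<omega>) (d \<omega>)) \<partial>Q) =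
          (\<integral>\<omega>. ?f (a \<omega> / sqrt (d \<omega>)) - ?f (trunc_ratio u (a \<omega>) (d \<omega>)) \<partial>Q)"
        using i by simp
      also have "\<bar>\<dots>\<bar> \<le> (\<integral>\<omega>. \<bar>?f (a \<omega> / sqrt (d \<omega>)) - ?f (trunc_ratio u (a \<omega>) (d \<omega>))\<bar> \<partial>Q)"
        by (rule integral_abs_bound)
      also have "\<dots> \<le> (\<integral>\<omega>. trunc_defect u (a \<omega>) (d \<omega>) \<partial>Q)"
        using i by (intro integral_mono cts_step_trunc_ratio xy) auto
      finally show ?thesis .
    qed
    have "(\<lambda>n. \<integral>\<omega>. ?f (A n \<omega> / sqrt (D n \<omega>)) \<partial>M) \<longlonglongrightarrow> (\<integral>\<omega>. ?f (A' \<omega> / sqrt (D' \<omega>)) \<partial>P)"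
    proof (rule LIMSEQ_I)
      fix r :: real assume r: "0 < r"
      \<comment> \<open>The truncation level is chosen under the limit law only;
        \<open>convh\<close> then carries the bound to large \<open>n\<close>.\<close>
      obtain k where k: "(\<integral>\<omega>. trunc_defect (real (Suc k)) (A' \<omega>) (D' \<omega>) \<partial>P) < r / 4"
        using order_tendstoD(2) [OF small, of "r / 4"] r by (auto simp: eventually_sequentially)
      define u where "u = real (Suc k)"
      have u: "1 \<le> u" by (simp add: u_def)
      have "\<forall>\<^sub>F n in sequentially. (\<integral>\<omega>. trunc_defect u (A n \<omega>) (D n \<omega>) \<partial>M) < r / 4"
        using k by (intro order_tendstoD(2) [OF convh [OF u]]) (simp add: u_def)
      moreover have "\<forall>\<^sub>F n in sequentially. dist (\<integral>\<omega>. ?f (trunc_ratio u (A n \<omega>) (D n \<omega>)) \<partial>M)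
          (\<integral>\<omega>. ?f (trunc_ratio u (A' \<omega>) (D' \<omega>)) \<partial>P) < r / 4"
        using r by (intro tendstoD [OF convf [OF u]]) simp
      ultimately have "\<forall>\<^sub>F n in sequentially. norm ((\<integral>\<omega>. ?f (A n \<omega> / sqrt (D n \<omega>)) \<partial>M) - (\<integral>\<omega>. ?f (A' \<omega> / sqrt (D' \<omega>)) \<partial>P)) < r"
      proof eventually_elim
        case (elim n)
        have "\<bar>(\<integral>\<omega>. ?f (A n \<omega> / sqrt (D n \<omega>)) \<partial>M) - (\<integral>\<omega>. ?f (trunc_ratio u (A n \<omega>) (D n \<omega>)) \<partial>M)\<bar> \<le>
            (\<integral>\<omega>. trunc_defect u (A n \<omega>) (D n \<omega>) \<partial>M)"
          by (rule bound [OF \<open>prob_space M\<close>]) measurable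
        moreover have "\<bar>(\<integral>\<omega>. ?f (A' \<omega> / sqrt (D' \<omega>)) \<partial>P) - (\<integral>\<omega>. ?f (trunc_ratio u (A' \<omega>) (D' \<omega>)) \<partial>P)\<bar> \<le>
            (\<integral>\<omega>. trunc_defect u (A' \<omega>) (D' \<omega>) \<partial>P)"
          by (rule bound [OF \<open>prob_space P\<close>]) measurable
        ultimately show ?case using elim k unfolding u_def [symmetric] dist_real_def real_norm_def by linarith
      qed
      then show "\<exists>no. \<forall>n\<ge>no. norm ((\<integral>\<omega>. ?f (A n \<omega> / sqrt (D n \<omega>)) \<partial>M) - (\<integral>\<omega>. ?f (A' \<omega> / sqrt (D' \<omega>)) \<partial>P)) < r"
        by (simp add: eventually_sequentially)
    qed
    then show "(\<lambda>n. integral\<^sup>L (distr M borel (\<lambda>\<omega>. A n \<omega> / sqrt (D n \<omega>))) ?f) \<longlonglongrightarrow>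
        integral\<^sup>L (distr P borel (\<lambda>\<omega>. A' \<omega> / sqrt (D' \<omega>))) ?f"
      by (simp add: integral_distr)
  qed
qed

section \<open>Joint laws\<close>

lemma distr_PiM_maps:
  fixes \<Omega> :: "'i \<Rightarrow> 'a measure" and N :: "'i \<Rightarrow> 'b measure"
  assumes I: "finite I" and \<Omega>: "\<And>i. prob_space (\<Omega> i)" and f [measurable]: "\<And>i. f i \<in> measurable (\<Omega> i) (N i)"
  shows "distr (PiM I \<Omega>) (PiM I N) (\<lambda>\<omega>. \<lambda>i\<in>I. f i (\<omega> i)) = PiM I (\<lambda>i. distr (\<Omega> i) (N i) (f i))"
proof -
  interpret \<Omega>: product_prob_space \<Omega> by (rule product_prob_spaceI [OF \<Omega>])
  have D: "prob_space (distr (\<Omega> i) (N i) (f i))" for i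
    by (rule prob_space.prob_space_distr [OF \<Omega> f])
  interpret D: product_sigma_finite "\<lambda>i. distr (\<Omega> i) (N i) (f i)"
    by (rule product_sigma_finite.intro) (rule prob_space_imp_sigma_finite [OF D])
  show ?thesis
  proof (rule D.PiM_eqI [OF I])
    show "sets (distr (PiM I \<Omega>) (PiM I N) (\<lambda>\<omega>. \<lambda>i\<in>I. f i (\<omega> i))) = sets (PiM I (\<lambda>i. distr (\<Omega> i) (N i) (f i)))"
      by (simp cong: sets_PiM_cong)
    fix A assume A: "\<And>i. i \<in> I \<Longrightarrow> A i \<in> sets (distr (\<Omega> i) (N i) (f i))"
    then have A': "\<And>i. i \<in> I \<Longrightarrow> A i \<in> sets (N i)" by simp
    have meas: "(\<lambda>\<omega>. \<lambda>i\<in>I. f i (\<omega> i)) \<in> measurable (PiM I \<Omega>) (PiM I N)" by measurable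
    have "emeasure (distr (PiM I \<Omega>) (PiM I N) (\<lambda>\<omega>. \<lambda>i\<in>I. f i (\<omega> i))) (Pi\<^sub>E I A) =
        emeasure (PiM I \<Omega>) ((\<lambda>\<omega>. \<lambda>i\<in>I. f i (\<omega> i)) -` Pi\<^sub>E I A \<inter> space (PiM I \<Omega>))"
      by (rule emeasure_distr [OF meas]) (intro sets_PiM_I_finite I A')
    also have "(\<lambda>\<omega>. \<lambda>i\<in>I. f i (\<omega> i)) -` Pi\<^sub>E I A \<inter> space (PiM I \<Omega>) = Pi\<^sub>E I (\<lambda>i. f i -` A i \<inter> space (\<Omega> i))"
      by (auto simp: space_PiM PiE_iff)
    also have "emeasure (PiM I \<Omega>) \<dots> = (\<Prod>i\<in>I. emeasure (\<Omega> i) (f i -` A i \<inter> space (\<Omega> i)))"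
      using A' by (intro \<Omega>.emeasure_PiM I) auto
    also have "\<dots> = (\<Prod>i\<in>I. emeasure (distr (\<Omega> i) (N i) (f i)) (A i))"
      using A' by (intro prod.cong refl) (simp add: emeasure_distr)
    finally show "emeasure (distr (PiM I \<Omega>) (PiM I N) (\<lambda>\<omega>. \<lambda>i\<in>I. f i (\<omega> i))) (Pi\<^sub>E I A) =
        (\<Prod>i\<in>I. emeasure (distr (\<Omega> i) (N i) (f i)) (A i))" .
  qed
qed

text \<open>Skorohod representations of the coordinates live together on the product of their
  spaces, so weak convergence in each coordinate becomes pointwise convergence of the vector, and
  dominated convergence applies. The functional varies with \<open>N\<close> because the
  coefficients of the step processes do.\<close>

lemma PiM_weak_conv_integral:
  fixes \<mu> :: "nat \<Rightarrow> 'i \<Rightarrow> real measure" and \<nu> :: "'i \<Rightarrow> real measure"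
    and \<phi> :: "nat \<Rightarrow> ('i \<Rightarrow> real) \<Rightarrow> real" and \<phi>' :: "('i \<Rightarrow> real) \<Rightarrow> real"
  assumes I: "finite I" and \<mu>: "\<And>N i. real_distribution (\<mu> N i)" and \<nu>: "\<And>i. real_distribution (\<nu> i)"
    and conv: "\<And>i. weak_conv_m (\<lambda>N. \<mu> N i) (\<nu> i)"
    and meas [measurable]: "\<And>N. \<phi> N \<in> borel_measurable (PiM I (\<lambda>_. borel))" "\<phi>' \<in> borel_measurable (PiM I (\<lambda>_. borel))"
    and bnd: "\<And>N z. \<bar>\<phi> N z\<bar> \<le> 1"
    and cont: "\<And>z z'. (\<And>i. i \<in> I \<Longrightarrow> (\<lambda>N. z N i) \<longlonglongrightarrow> z' i) \<Longrightarrow> (\<lambda>N. \<phi> N (z N)) \<longlonglongrightarrow> \<phi>' z'"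
  shows "(\<lambda>N. \<integral>z. \<phi> N z \<partial>(PiM I (\<mu> N))) \<longlonglongrightarrow> (\<integral>z. \<phi>' z \<partial>(PiM I \<nu>))"
proof -
  have "\<exists>\<Omega> Y Y'. prob_space (\<Omega> :: real measure) \<and> (\<forall>N. (Y N :: real \<Rightarrow> real) \<in> measurable \<Omega> borel) \<and>
      (\<forall>N. distr \<Omega> borel (Y N) = \<mu> N i) \<and> (Y' :: real \<Rightarrow> real) \<in> measurable \<Omega> lborel \<and>
      distr \<Omega> borel Y' = \<nu> i \<and> (\<forall>x\<in>space \<Omega>. (\<lambda>N. Y N x) \<longlonglongrightarrow> Y' x)" for i
    by (rule Skorohod [OF \<mu> \<nu> conv])
  then obtain \<Omega> Y Y' where \<Omega>: "\<And>i. prob_space (\<Omega> i :: real measure)"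
    and Y [measurable]: "\<And>i N. (Y i N :: real \<Rightarrow> real) \<in> measurable (\<Omega> i) borel"
    and dY: "\<And>i N. distr (\<Omega> i) borel (Y i N) = \<mu> N i"
    and Y'l: "\<And>i. (Y' i :: real \<Rightarrow> real) \<in> measurable (\<Omega> i) lborel"
    and dY': "\<And>i. distr (\<Omega> i) borel (Y' i) = \<nu> i"
    and lim: "\<And>i x. x \<in> space (\<Omega> i) \<Longrightarrow> (\<lambda>N. Y i N x) \<longlonglongrightarrow> Y' i x"
    by metis
  have Y' [measurable]: "Y' i \<in> measurable (\<Omega> i) borel" for i using Y'l [of i] by simp
  interpret Q: prob_space "PiM I \<Omega>" by (rule prob_space_PiM [OF \<Omega>])
  have \<mu>_eq: "PiM I (\<mu> N) = distr (PiM I \<Omega>) (PiM I (\<lambda>_. borel)) (\<lambda>\<omega>. \<lambda>i\<in>I. Y i N (\<omega> i))" for N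
    by (subst distr_PiM_maps [OF I \<Omega> Y]) (simp add: dY)
  have \<nu>_eq: "PiM I \<nu> = distr (PiM I \<Omega>) (PiM I (\<lambda>_. borel)) (\<lambda>\<omega>. \<lambda>i\<in>I. Y' i (\<omega> i))"
    by (subst distr_PiM_maps [OF I \<Omega> Y']) (simp add: dY')
  have mY [measurable]: "(\<lambda>\<omega>. \<lambda>i\<in>I. Y i N (\<omega> i)) \<in> measurable (PiM I \<Omega>) (PiM I (\<lambda>_. borel))" for N by measurable
  have mY' [measurable]: "(\<lambda>\<omega>. \<lambda>i\<in>I. Y' i (\<omega> i)) \<in> measurable (PiM I \<Omega>) (PiM I (\<lambda>_. borel))" by measurable
  have "(\<lambda>N. \<integral>\<omega>. \<phi> N (\<lambda>i\<in>I. Y i N (\<omega> i)) \<partial>(PiM I \<Omega>)) \<longlonglongrightarrow> (\<integral>\<omega>. \<phi>' (\<lambda>i\<in>I. Y' i (\<omega> i)) \<partial>(PiM I \<Omega>))"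
  proof (rule integral_dominated_convergence)
    show "integrable (PiM I \<Omega>) (\<lambda>_. 1 :: real)" by simp
    show "AE \<omega> in PiM I \<Omega>. (\<lambda>N. \<phi> N (\<lambda>i\<in>I. Y i N (\<omega> i))) \<longlonglongrightarrow> \<phi>' (\<lambda>i\<in>I. Y' i (\<omega> i))"
      by (intro AE_I2 cont) (auto simp: space_PiM intro!: lim)
    show "AE \<omega> in PiM I \<Omega>. norm (\<phi> N (\<lambda>i\<in>I. Y i N (\<omega> i))) \<le> 1" for N
      using bnd by (intro AE_I2) simp
    show "(\<lambda>\<omega>. \<phi> N (\<lambda>i\<in>I. Y i N (\<omega> i))) \<in> borel_measurable (PiM I \<Omega>)" for N
      by (rule measurable_compose [OF mY meas(1)])
    show "(\<lambda>\<omega>. \<phi>' (\<lambda>i\<in>I. Y' i (\<omega> i))) \<in> borel_measurable (PiM I \<Omega>)"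
      by (rule measurable_compose [OF mY' meas(2)])
  qed
  then show ?thesis
    unfolding \<mu>_eq \<nu>_eq by (simp add: integral_distr)
qed

context prob_space
begin

lemma bounded_complex_integrable:
  assumes "f \<in> borel_measurable M" "\<And>\<omega>. cmod (f \<omega>) \<le> C"
  shows "integrable M f"
  by (rule integrable_const_bound [of _ C]) (use assms in auto)

text \<open>Tilting: under the measure with density W / c, where c is the mean of \<open>W\<close>,
  the variable \<open>V\<close> keeps its characteristic function and hence its law. A statement on
  a joint law is thereby reduced to uniqueness in one dimension.\<close>

lemma weighted_char_imp_indep:
  fixes V W :: "'a \<Rightarrow> real"
  assumes [measurable]: "V \<in> borel_measurable M" "W \<in> borel_measurable M" and A: "A \<in> sets borel"
    and W: "\<And>\<omega>. 0 \<le> W \<omega>" "\<And>\<omega>. W \<omega> \<le> C"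
    and char: "\<And>t. (\<integral>\<omega>. of_real (W \<omega>) * iexp (t * V \<omega>) \<partial>M) = of_real (expectation W) * char (distr M borel V) t"
  shows "expectation (\<lambda>\<omega>. W \<omega> * indicator A (V \<omega>)) = expectation W * prob (V -` A \<inter> space M)"
proof -
  have intW: "integrable M W"
    by (rule integrable_const_bound [of _ C]) (use W in auto)
  define c where "c = expectation W"
  have c0: "0 \<le> c" unfolding c_def using W by simp
  show ?thesis
  \<comment> \<open>With mean 0 there is no tilted measure, but then \<open>W\<close> vanishes
    almost surely.\<close>
  proof (cases "c = 0")
    case True
    then have "AE \<omega> in M. W \<omega> = 0"
      using integral_nonneg_eq_0_iff_AE [OF intW] W by (simp add: c_def)
    then have "expectation (\<lambda>\<omega>. W \<omega> * indicator A (V \<omega>)) = expectation (\<lambda>\<omega>. 0)"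
      using A by (intro integral_cong_AE) auto
    then show ?thesis using True by (simp add: c_def)
  next
    case False
    with c0 have c: "0 < c" by simp
    define Q where "Q = density M (\<lambda>\<omega>. ennreal (W \<omega> / c))"
    have Q: "prob_space Q"
    proof
      have "emeasure Q (space Q) = (\<integral>\<^sup>+\<omega>. ennreal (W \<omega> / c) \<partial>M)"
        unfolding Q_def by (subst emeasure_density) (auto intro!: nn_integral_cong)
      also have "\<dots> = ennreal (\<integral>\<omega>. W \<omega> / c \<partial>M)"
        using W c intW by (intro nn_integral_eq_integral) auto
      also have "(\<integral>\<omega>. W \<omega> / c \<partial>M) = 1" using c by (simp add: c_def)
      finally show "emeasure Q (space Q) = 1" by simp
    qed
    interpret Q: prob_space Q by (rule Q)
    have [measurable]: "V \<in> borel_measurable Q" unfolding Q_def by simp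
    have intQ: "(\<integral>\<omega>. f (V \<omega>) \<partial>Q) = (\<integral>\<omega>. (W \<omega> / c) *\<^sub>R f (V \<omega>) \<partial>M)"
      if [measurable]: "f \<in> borel_measurable borel" for f :: "real \<Rightarrow> 'c::{banach, second_countable_topology}"
      unfolding Q_def using W c by (subst integral_density) auto
    have "distr Q borel V = distr M borel V"
    proof (rule Levy_uniqueness)
      show "real_distribution (distr Q borel V)" by (rule Q.real_distribution_distr) measurable
      show "real_distribution (distr M borel V)" by (rule real_distribution_distr) measurable
      show "char (distr Q borel V) = char (distr M borel V)"
      proof
        fix t
        have "char (distr Q borel V) t = (\<integral>\<omega>. iexp (t * V \<omega>) \<partial>Q)"
          unfolding char_def by (subst integral_distr) auto
        also have "\<dots> = (\<integral>\<omega>. of_real (1 / c) * (of_real (W \<omega>) * iexp (t * V \<omega>)) \<partial>M)"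
          by (subst intQ) (auto simp: scaleR_conv_of_real)
        also have "\<dots> = of_real (1 / c) * (of_real c * char (distr M borel V) t)"
          unfolding integral_mult_right_zero char c_def ..
        finally show "char (distr Q borel V) t = char (distr M borel V) t" using c by simp
      qed
    qed
    then have "measure (distr Q borel V) A = measure (distr M borel V) A" by simp
    then have "measure Q (V -` A \<inter> space M) = prob (V -` A \<inter> space M)"
      using A by (simp add: measure_distr) (simp add: Q_def)
    moreover have "measure Q (V -` A \<inter> space M) = (\<integral>\<omega>. indicator A (V \<omega>) \<partial>Q)"
    proof -
      have "(\<integral>\<omega>. indicator A (V \<omega>) \<partial>Q) = (\<integral>\<omega>. indicator (V -` A \<inter> space M) \<omega> \<partial>Q)"
        by (intro Bochner_Integration.integral_cong) (auto simp: Q_def indicator_def)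
      also have "\<dots> = measure Q (V -` A \<inter> space M)"
        using A by (simp add: Q_def)
      finally show ?thesis by simp
    qed
    moreover have "(\<integral>\<omega>. indicator A (V \<omega>) \<partial>Q) = (\<integral>\<omega>. W \<omega> * indicator A (V \<omega>) \<partial>M) / c"
      using A by (subst intQ) auto
    ultimately show ?thesis using c by (simp add: c_def field_simps)
  qed
qed

end

context prob_space
begin

text \<open>The oscillating factor is no density, but \<open>W\<close>, W (1 + cos \<theta>) and W
  (1 + sin \<theta>) are non-negative, and e^(i \<theta>) is recovered from them by linearity. Their
  characteristic integrals involve the exponents \<sigma> = 0, 1, -1.\<close>

lemma weighted_char_complex:
  fixes V W \<theta> :: "'a \<Rightarrow> real"
  assumes [measurable]: "V \<in> borel_measurable M" "W \<in> borel_measurable M" "\<theta> \<in> borel_measurable M"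
    and A [measurable]: "A \<in> sets borel" and W: "\<And>\<omega>. 0 \<le> W \<omega>" "\<And>\<omega>. W \<omega> \<le> 1"
    and char: "\<And>\<sigma> t. (\<integral>\<omega>. of_real (W \<omega>) * iexp (\<sigma> * \<theta> \<omega> + t * V \<omega>) \<partial>M) = c \<sigma> * char (distr M borel V) t"
  shows "(\<integral>\<omega>. of_real (W \<omega> * indicator A (V \<omega>)) * iexp (\<theta> \<omega>) \<partial>M) = c 1 * of_real (prob (V -` A \<inter> space M))"
proof -
  let ?p = "prob (V -` A \<inter> space M)"
  let ?char = "char (distr M borel V)"
  have bounds: "\<bar>W \<omega> * r\<bar> \<le> 2" if "\<bar>r\<bar> \<le> 2" for \<omega> r
    using mult_mono [of "W \<omega>" 1 "\<bar>r\<bar>" 2] W that by (simp add: abs_mult)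
  have iW: "integrable M (\<lambda>\<omega>. of_real (W \<omega>) * iexp (f \<omega>) :: complex)" if [measurable]: "f \<in> borel_measurable M" for f
    by (rule bounded_complex_integrable [of _ 1]) (use W in \<open>auto simp: norm_mult\<close>)
  have char0: "?char 0 = 1"
    by (rule real_distribution.char_zero [OF real_distribution_distr]) simp
  have gen: "expectation (\<lambda>\<omega>. U \<omega> * indicator A (V \<omega>)) = expectation U * ?p \<and> of_real (expectation U) = K"
    if [measurable]: "U \<in> borel_measurable M" and U: "\<And>\<omega>. 0 \<le> U \<omega>" "\<And>\<omega>. U \<omega> \<le> 2"
      and UK: "\<And>t. (\<integral>\<omega>. of_real (U \<omega>) * iexp (t * V \<omega>) \<partial>M) = K * ?char t" for U and K :: complex
  proof -
    have "(\<integral>\<omega>. of_real (U \<omega>) \<partial>M) = K" using UK [of 0] by (simp add: char0)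
    then have K: "of_real (expectation U) = K" by (simp add: integral_complex_of_real)
    have "expectation (\<lambda>\<omega>. U \<omega> * indicator A (V \<omega>)) = expectation U * ?p"
      by (rule weighted_char_imp_indep [where C = 2]) (use U UK in \<open>auto simp: K\<close>)
    with K show ?thesis by simp
  qed
  have cos_eq: "of_real (cos x) = (iexp x + iexp (- x)) / (2 :: complex)" for x
    by (simp add: cos_of_real [symmetric] cos_exp_eq)
  have sin_eq: "of_real (sin x) = (iexp x - iexp (- x)) / (2 * \<i> :: complex)" for x
    by (simp add: sin_of_real [symmetric] sin_exp_eq)
  have iF: "integrable M (\<lambda>\<omega>. of_real (W \<omega>) * iexp (\<sigma> * \<theta> \<omega> + t * V \<omega>) :: complex)" for \<sigma> t
    by (rule iW) measurable
  have lin_add: "(\<integral>\<omega>. f \<omega> + (g \<omega> + h \<omega>) / d \<partial>M) = (\<integral>\<omega>. f \<omega> \<partial>M) + ((\<integral>\<omega>. g \<omega> \<partial>M) + (\<integral>\<omega>. h \<omega> \<partial>M)) / d"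
    and lin_diff: "(\<integral>\<omega>. f \<omega> + (g \<omega> - h \<omega>) / d \<partial>M) = (\<integral>\<omega>. f \<omega> \<partial>M) + ((\<integral>\<omega>. g \<omega> \<partial>M) - (\<integral>\<omega>. h \<omega> \<partial>M)) / d"
    if "integrable M f" "integrable M g" "integrable M h" for f g h :: "'a \<Rightarrow> complex" and d
    using that by simp_all
  have g0: "expectation (\<lambda>\<omega>. W \<omega> * indicator A (V \<omega>)) = expectation W * ?p \<and> of_real (expectation W) = c 0"
  proof (rule gen)
    show "W \<omega> \<le> 2" for \<omega> using W(2) [of \<omega>] by simp
  qed (use W char [of 0] in auto)
  have gc: "expectation (\<lambda>\<omega>. W \<omega> * (1 + cos (\<theta> \<omega>)) * indicator A (V \<omega>)) = expectation (\<lambda>\<omega>. W \<omega> * (1 + cos (\<theta> \<omega>))) * ?p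
      \<and> of_real (expectation (\<lambda>\<omega>. W \<omega> * (1 + cos (\<theta> \<omega>)))) = c 0 + (c 1 + c (- 1)) / 2"
  proof (rule gen)
    fix t
    have "of_real (W \<omega> * (1 + cos (\<theta> \<omega>))) * iexp (t * V \<omega>) = of_real (W \<omega>) * iexp (0 * \<theta> \<omega> + t * V \<omega>)
        + (of_real (W \<omega>) * iexp (1 * \<theta> \<omega> + t * V \<omega>) + of_real (W \<omega>) * iexp ((- 1) * \<theta> \<omega> + t * V \<omega>)) / 2" for \<omega>
      by (simp add: cos_eq exp_add [symmetric] algebra_simps add_divide_distrib)
    then have "(\<integral>\<omega>. of_real (W \<omega> * (1 + cos (\<theta> \<omega>))) * iexp (t * V \<omega>) \<partial>M) =
        (\<integral>\<omega>. of_real (W \<omega>) * iexp (0 * \<theta> \<omega> + t * V \<omega>) \<partial>M)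
        + ((\<integral>\<omega>. of_real (W \<omega>) * iexp (1 * \<theta> \<omega> + t * V \<omega>) \<partial>M) + (\<integral>\<omega>. of_real (W \<omega>) * iexp ((- 1) * \<theta> \<omega> + t * V \<omega>) \<partial>M)) / 2"
      by (simp only: lin_add [OF iF iF iF])
    then show "(\<integral>\<omega>. of_real (W \<omega> * (1 + cos (\<theta> \<omega>))) * iexp (t * V \<omega>) \<partial>M) = (c 0 + (c 1 + c (- 1)) / 2) * ?char t"
      unfolding char by (simp add: algebra_simps add_divide_distrib)
    fix \<omega>
    have "\<bar>1 + cos (\<theta> \<omega>)\<bar> \<le> 2" "0 \<le> 1 + cos (\<theta> \<omega>)"
      using cos_le_one [of "\<theta> \<omega>"] cos_ge_minus_one [of "\<theta> \<omega>"] by linarith+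
    then show "0 \<le> W \<omega> * (1 + cos (\<theta> \<omega>))" "W \<omega> * (1 + cos (\<theta> \<omega>)) \<le> 2"
      using W bounds [of "1 + cos (\<theta> \<omega>)" \<omega>] by auto
  qed measurable
  have gs: "expectation (\<lambda>\<omega>. W \<omega> * (1 + sin (\<theta> \<omega>)) * indicator A (V \<omega>)) = expectation (\<lambda>\<omega>. W \<omega> * (1 + sin (\<theta> \<omega>))) * ?p
      \<and> of_real (expectation (\<lambda>\<omega>. W \<omega> * (1 + sin (\<theta> \<omega>)))) = c 0 + (c 1 - c (- 1)) / (2 * \<i>)"
  proof (rule gen)
    fix t
    have "of_real (W \<omega> * (1 + sin (\<theta> \<omega>))) * iexp (t * V \<omega>) = of_real (W \<omega>) * iexp (0 * \<theta> \<omega> + t * V \<omega>)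
        + (of_real (W \<omega>) * iexp (1 * \<theta> \<omega> + t * V \<omega>) - of_real (W \<omega>) * iexp ((- 1) * \<theta> \<omega> + t * V \<omega>)) / (2 * \<i>)" for \<omega>
      by (simp add: sin_eq exp_add [symmetric] algebra_simps add_divide_distrib diff_divide_distrib)
    then have "(\<integral>\<omega>. of_real (W \<omega> * (1 + sin (\<theta> \<omega>))) * iexp (t * V \<omega>) \<partial>M) =
        (\<integral>\<omega>. of_real (W \<omega>) * iexp (0 * \<theta> \<omega> + t * V \<omega>) \<partial>M)
        + ((\<integral>\<omega>. of_real (W \<omega>) * iexp (1 * \<theta> \<omega> + t * V \<omega>) \<partial>M) - (\<integral>\<omega>. of_real (W \<omega>) * iexp ((- 1) * \<theta> \<omega> + t * V \<omega>) \<partial>M)) / (2 * \<i>)"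
      by (simp only: lin_diff [OF iF iF iF])
    then show "(\<integral>\<omega>. of_real (W \<omega> * (1 + sin (\<theta> \<omega>))) * iexp (t * V \<omega>) \<partial>M) = (c 0 + (c 1 - c (- 1)) / (2 * \<i>)) * ?char t"
      unfolding char by (simp add: algebra_simps add_divide_distrib diff_divide_distrib)
    fix \<omega>
    have "\<bar>1 + sin (\<theta> \<omega>)\<bar> \<le> 2" "0 \<le> 1 + sin (\<theta> \<omega>)"
      using sin_le_one [of "\<theta> \<omega>"] sin_ge_minus_one [of "\<theta> \<omega>"] by linarith+
    then show "0 \<le> W \<omega> * (1 + sin (\<theta> \<omega>))" "W \<omega> * (1 + sin (\<theta> \<omega>)) \<le> 2"
      using W bounds [of "1 + sin (\<theta> \<omega>)" \<omega>] by auto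
  qed measurable
  let ?a = "\<lambda>\<omega>. indicator A (V \<omega>) :: real"
  have "integrable M (\<lambda>\<omega>. W \<omega> * f \<omega> * ?a \<omega>)" if "f \<in> borel_measurable M" "\<And>\<omega>. \<bar>f \<omega>\<bar> \<le> 2" for f
    by (rule integrable_const_bound [of _ 2])
      (use that bounds in \<open>auto simp: indicator_def\<close>)
  from this [of "\<lambda>\<omega>. 1"] this [of "\<lambda>\<omega>. cos (\<theta> \<omega>)"] this [of "\<lambda>\<omega>. sin (\<theta> \<omega>)"]
  have i0: "integrable M (\<lambda>\<omega>. W \<omega> * ?a \<omega>)" and ic: "integrable M (\<lambda>\<omega>. W \<omega> * cos (\<theta> \<omega>) * ?a \<omega>)"
    and isn: "integrable M (\<lambda>\<omega>. W \<omega> * sin (\<theta> \<omega>) * ?a \<omega>)"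
    using order_trans [OF abs_cos_le_one, of 2] order_trans [OF abs_sin_le_one, of 2] by simp_all
  have ec: "expectation (\<lambda>\<omega>. W \<omega> * cos (\<theta> \<omega>) * ?a \<omega>) =
      (expectation (\<lambda>\<omega>. W \<omega> * (1 + cos (\<theta> \<omega>))) - expectation W) * ?p"
    using gc g0 i0 ic by (simp add: algebra_simps)
  have es: "expectation (\<lambda>\<omega>. W \<omega> * sin (\<theta> \<omega>) * ?a \<omega>) =
      (expectation (\<lambda>\<omega>. W \<omega> * (1 + sin (\<theta> \<omega>))) - expectation W) * ?p"
    using gs g0 i0 isn by (simp add: algebra_simps)
  have lin_i: "(\<integral>\<omega>. complex_of_real (f \<omega>) + \<i> * complex_of_real (g \<omega>) \<partial>M) =
      of_real (expectation f) + \<i> * of_real (expectation g)" if "integrable M f" "integrable M g" for f g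
    using that by (simp add: complex_of_real_integrable_eq integral_complex_of_real)
  have "of_real (W \<omega> * ?a \<omega>) * iexp (\<theta> \<omega>) =
      of_real (W \<omega> * cos (\<theta> \<omega>) * ?a \<omega>) + \<i> * of_real (W \<omega> * sin (\<theta> \<omega>) * ?a \<omega>)" for \<omega>
    by (simp add: exp_Euler cos_of_real sin_of_real algebra_simps)
  then have "(\<integral>\<omega>. of_real (W \<omega> * ?a \<omega>) * iexp (\<theta> \<omega>) \<partial>M) =
      of_real (expectation (\<lambda>\<omega>. W \<omega> * cos (\<theta> \<omega>) * ?a \<omega>)) + \<i> * of_real (expectation (\<lambda>\<omega>. W \<omega> * sin (\<theta> \<omega>) * ?a \<omega>))"
    using lin_i [OF ic isn] by (simp only:)
  also have "\<dots> = ((of_real (expectation (\<lambda>\<omega>. W \<omega> * (1 + cos (\<theta> \<omega>)))) - of_real (expectation W))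
      + \<i> * (of_real (expectation (\<lambda>\<omega>. W \<omega> * (1 + sin (\<theta> \<omega>)))) - of_real (expectation W))) * of_real ?p"
    unfolding ec es by (simp add: algebra_simps)
  also have "\<dots> = c 1 * of_real ?p"
  proof -
    have c: "of_real (expectation (\<lambda>\<omega>. W \<omega> * (1 + cos (\<theta> \<omega>)))) = c 0 + (c 1 + c (- 1)) / 2"
      using gc by (rule conjunct2)
    have s: "of_real (expectation (\<lambda>\<omega>. W \<omega> * (1 + sin (\<theta> \<omega>)))) = c 0 + (c 1 - c (- 1)) / (2 * \<i>)"
      using gs by (rule conjunct2)
    have w: "of_real (expectation W) = c 0" using g0 by (rule conjunct2)
    show ?thesis unfolding c s w by (simp add: field_simps)
  qed
  finally show ?thesis .
qed

text \<open>Coordinates pass one at a time from the exponential to indicators: \<open>J\<close>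
  collects those already turned into events. For the next one, \<open>weighted_char_complex\<close>
  takes the product of the indicators as \<open>W\<close> and the remaining exponent as \<theta>. At
  \<open>J = I\<close> the product formula for boxes is reached.\<close>

lemma joint_char_imp_PiM:
  fixes V :: "'i \<Rightarrow> 'a \<Rightarrow> real"
  assumes I: "finite I" and V [measurable]: "\<And>i. V i \<in> borel_measurable M"
    and char: "\<And>t. (\<integral>\<omega>. iexp (\<Sum>i\<in>I. t i * V i \<omega>) \<partial>M) = (\<Prod>i\<in>I. char (distr M borel (V i)) (t i))"
  shows "distr M (PiM I (\<lambda>_. borel)) (\<lambda>\<omega>. \<lambda>i\<in>I. V i \<omega>) = PiM I (\<lambda>i. distr M borel (V i))"
proof -
  have char0: "char (distr M borel (V i)) 0 = 1" for i
    by (rule real_distribution.char_zero [OF real_distribution_distr]) simp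
  have claim: "(\<integral>\<omega>. of_real (\<Prod>i\<in>J. indicator (A i) (V i \<omega>)) * iexp (\<Sum>i\<in>I - J. t i * V i \<omega>) \<partial>M) =
      of_real (\<Prod>i\<in>J. prob (V i -` A i \<inter> space M)) * (\<Prod>i\<in>I - J. char (distr M borel (V i)) (t i))"
    if "J \<subseteq> I" and A: "\<And>i. i \<in> I \<Longrightarrow> A i \<in> sets borel" for J A t
    using finite_subset [OF \<open>J \<subseteq> I\<close> I] \<open>J \<subseteq> I\<close>
  proof (induction J arbitrary: t)
    case empty
    then show ?case using char [of t] by simp
  next
    case (insert j J)
    let ?R = "I - insert j J"
    let ?W = "\<lambda>\<omega>. \<Prod>i\<in>J. indicator (A i) (V i \<omega>) :: real"
    have split: "I - J = insert j ?R" "j \<notin> ?R" "finite ?R" using insert I by auto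
    have "(\<integral>\<omega>. of_real (?W \<omega> * indicator (A j) (V j \<omega>)) * iexp (\<Sum>i\<in>?R. t i * V i \<omega>) \<partial>M) =
        (of_real (\<Prod>i\<in>J. prob (V i -` A i \<inter> space M)) * (\<Prod>i\<in>?R. char (distr M borel (V i)) (1 * t i)))
          * of_real (prob (V j -` A j \<inter> space M))"
    proof (rule weighted_char_complex [where c = "\<lambda>\<sigma>. of_real (\<Prod>i\<in>J. prob (V i -` A i \<inter> space M)) *
          (\<Prod>i\<in>?R. char (distr M borel (V i)) (\<sigma> * t i))"])
      show "?W \<in> borel_measurable M"
        using A insert.prems by (intro borel_measurable_prod) (auto intro!: borel_measurable_indicator measurable_compose [OF V])
      show "0 \<le> ?W \<omega>" for \<omega> by (intro prod_nonneg) auto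
      show "?W \<omega> \<le> 1" for \<omega> by (intro prod_le_1) (auto simp: indicator_def)
      show "A j \<in> sets borel" using A insert.prems by auto
      fix \<sigma> s
      \<comment> \<open>Scaling the untouched coordinates by \<sigma> supplies the exponents needed
        for the tilts, which is why the induction runs over arbitrary \<open>t\<close>.\<close>
      let ?t = "\<lambda>i. if i = j then s else \<sigma> * t i"
      have "(\<Sum>i\<in>I - J. ?t i * V i \<omega>) = \<sigma> * (\<Sum>i\<in>?R. t i * V i \<omega>) + s * V j \<omega>" for \<omega>
      proof -
        have "(\<Sum>i\<in>I - J. ?t i * V i \<omega>) = s * V j \<omega> + (\<Sum>i\<in>?R. ?t i * V i \<omega>)"
          unfolding split(1) using split(2,3) by simp
        also have "(\<Sum>i\<in>?R. ?t i * V i \<omega>) = (\<Sum>i\<in>?R. \<sigma> * (t i * V i \<omega>))"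
          by (intro sum.cong) auto
        finally show ?thesis by (simp add: sum_distrib_left)
      qed
      moreover have "(\<Prod>i\<in>I - J. char (distr M borel (V i)) (?t i)) =
          (\<Prod>i\<in>?R. char (distr M borel (V i)) (\<sigma> * t i)) * char (distr M borel (V j)) s"
      proof -
        have "(\<Prod>i\<in>I - J. char (distr M borel (V i)) (?t i)) =
            char (distr M borel (V j)) s * (\<Prod>i\<in>?R. char (distr M borel (V i)) (?t i))"
          unfolding split(1) using split(2,3) by simp
        also have "(\<Prod>i\<in>?R. char (distr M borel (V i)) (?t i)) = (\<Prod>i\<in>?R. char (distr M borel (V i)) (\<sigma> * t i))"
          by (intro prod.cong) auto
        finally show ?thesis by (simp add: mult.commute)
      qed
      ultimately show "(\<integral>\<omega>. of_real (?W \<omega>) * iexp (\<sigma> * (\<Sum>i\<in>?R. t i * V i \<omega>) + s * V j \<omega>) \<partial>M) =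
          of_real (\<Prod>i\<in>J. prob (V i -` A i \<inter> space M)) * (\<Prod>i\<in>?R. char (distr M borel (V i)) (\<sigma> * t i)) * char (distr M borel (V j)) s"
        using insert.IH [of ?t] insert.prems by (simp only: mult.assoc) auto
    qed measurable
    then show ?case
      using insert.hyps by (simp add: mult_ac)
  qed
  have D: "prob_space (distr M borel (V i))" for i by (rule prob_space_distr) simp
  interpret D: product_sigma_finite "\<lambda>i. distr M borel (V i)"
    by (rule product_sigma_finite.intro) (rule prob_space_imp_sigma_finite [OF D])
  show ?thesis
  proof (rule D.PiM_eqI [OF I])
    show "sets (distr M (PiM I (\<lambda>_. borel)) (\<lambda>\<omega>. \<lambda>i\<in>I. V i \<omega>)) = sets (PiM I (\<lambda>i. distr M borel (V i)))"
      by (simp cong: sets_PiM_cong)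
    fix A assume A: "\<And>i. i \<in> I \<Longrightarrow> A i \<in> sets (distr M borel (V i))"
    then have A': "\<And>i. i \<in> I \<Longrightarrow> A i \<in> sets borel" by simp
    have meas: "(\<lambda>\<omega>. \<lambda>i\<in>I. V i \<omega>) \<in> measurable M (PiM I (\<lambda>_. borel))" by measurable
    let ?E = "(\<lambda>\<omega>. \<lambda>i\<in>I. V i \<omega>) -` Pi\<^sub>E I A \<inter> space M"
    have E: "?E \<in> sets M" by (rule measurable_sets [OF meas]) (intro sets_PiM_I_finite I A')
    have "complex_of_real (prob ?E) = (\<integral>\<omega>. complex_of_real (indicator ?E \<omega>) \<partial>M)"
      using E unfolding integral_complex_of_real by simp
    also have "\<dots> = (\<integral>\<omega>. of_real (\<Prod>i\<in>I. indicator (A i) (V i \<omega>)) * iexp (\<Sum>i\<in>I - I. 0 * V i \<omega>) \<partial>M)"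
    proof (intro Bochner_Integration.integral_cong refl)
      fix \<omega> assume "\<omega> \<in> space M"
      have "(\<Prod>i\<in>I. indicator (A i) (V i \<omega>) :: real) = (if \<forall>i\<in>I. V i \<omega> \<in> A i then 1 else 0)"
        using I by (auto simp: indicator_def intro!: prod.neutral)
      then show "complex_of_real (indicator ?E \<omega>) = of_real (\<Prod>i\<in>I. indicator (A i) (V i \<omega>)) * iexp (\<Sum>i\<in>I - I. 0 * V i \<omega>)"
        using \<open>\<omega> \<in> space M\<close> by (auto simp: indicator_def PiE_iff)
    qed
    also have "\<dots> = of_real (\<Prod>i\<in>I. prob (V i -` A i \<inter> space M))"
      by (subst claim) (use A' in auto)
    finally have "prob ?E = (\<Prod>i\<in>I. prob (V i -` A i \<inter> space M))"
      by (simp only: of_real_eq_iff)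
    then have "emeasure M ?E = (\<Prod>i\<in>I. emeasure M (V i -` A i \<inter> space M))"
      by (simp add: emeasure_eq_measure prod_ennreal)
    then show "emeasure (distr M (PiM I (\<lambda>_. borel)) (\<lambda>\<omega>. \<lambda>i\<in>I. V i \<omega>)) (Pi\<^sub>E I A) =
        (\<Prod>i\<in>I. emeasure (distr M borel (V i)) (A i))"
      using A' meas by (subst emeasure_distr) (auto simp: emeasure_distr intro!: sets_PiM_I_finite I)
  qed
qed

section \<open>Gaussian variables, degenerate ones included\<close>

lemma gaussian_rv_square_integrable:
  assumes "gaussian_rv M Z"
  shows "square_integrable M Z"
proof -
  have [measurable]: "Z \<in> borel_measurable M" using assms by (simp add: gaussian_rv_def)
  consider \<mu> where "AE \<omega> in M. Z \<omega> = \<mu>" | \<mu> \<sigma> where "0 < \<sigma>" "distributed M lborel Z (normal_density \<mu> \<sigma>)"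
    using assms unfolding gaussian_rv_def by blast
  then show ?thesis
  proof cases
    case 1
    then have "AE \<omega> in M. norm ((Z \<omega>)\<^sup>2) \<le> \<mu>\<^sup>2" by eventually_elim simp
    then have "integrable M (\<lambda>\<omega>. (Z \<omega>)\<^sup>2)" by (rule integrable_const_bound) measurable
    then show ?thesis by (simp add: square_integrable_def)
  next
    case 2
    have "integrable lborel (\<lambda>x. normal_density \<mu> \<sigma> x * (x - \<mu>) ^ 2)"
      using 2 by (intro integrable_normal_moment) auto
    then have "integrable M (\<lambda>\<omega>. (Z \<omega> - \<mu>)\<^sup>2)"
      using 2 by (subst distributed_integrable [OF 2(2), symmetric]) auto
    then have "square_integrable M (\<lambda>\<omega>. Z \<omega> - \<mu>)" by (simp add: square_integrable_def)
    from square_integrable_add [OF this square_integrable_const [of \<mu>]] show ?thesis by simp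
  qed
qed

lemma gaussian_rv_char:
  assumes Z: "gaussian_rv M Z" and mean: "expectation Z = 0"
  shows "(\<integral>\<omega>. iexp (Z \<omega>) \<partial>M) = exp (- of_real (expectation (\<lambda>\<omega>. (Z \<omega>)\<^sup>2)) / 2)"
proof -
  have [measurable]: "Z \<in> borel_measurable M" using Z by (simp add: gaussian_rv_def)
  consider \<mu> where "AE \<omega> in M. Z \<omega> = \<mu>" | \<mu> \<sigma> where "0 < \<sigma>" "distributed M lborel Z (normal_density \<mu> \<sigma>)"
    using Z unfolding gaussian_rv_def by blast
  then show ?thesis
  proof cases
    case 1
    have "expectation Z = expectation (\<lambda>_. \<mu>)" using 1 by (intro integral_cong_AE) auto
    then have "\<mu> = 0" using mean by (simp add: prob_space)
    then have Z0: "AE \<omega> in M. Z \<omega> = 0" using 1 by simp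
    have "(\<integral>\<omega>. iexp (Z \<omega>) \<partial>M) = (\<integral>\<omega>. 1 \<partial>M)"
      using Z0 by (intro integral_cong_AE) auto
    moreover have "expectation (\<lambda>\<omega>. (Z \<omega>)\<^sup>2) = expectation (\<lambda>_. 0)"
      using Z0 by (intro integral_cong_AE) auto
    ultimately show ?thesis by (simp add: prob_space)
  next
    case 2
    have \<mu>: "\<mu> = 0" using normal_distributed_expectation [OF 2(1,2)] mean by simp
    have var: "expectation (\<lambda>\<omega>. (Z \<omega>)\<^sup>2) = \<sigma>\<^sup>2"
      using normal_distributed_variance [OF 2] mean by simp
    have "distributed M lborel (\<lambda>\<omega>. (Z \<omega> - \<mu>) / \<sigma>) std_normal_density"
      using normal_standard_normal_convert [OF 2(1), of Z \<mu>] 2(2) by simp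
    then have d: "distributed M lborel (\<lambda>\<omega>. Z \<omega> / \<sigma>) std_normal_density" by (simp add: \<mu>)
    have "distr M borel (\<lambda>\<omega>. Z \<omega> / \<sigma>) = distr M lborel (\<lambda>\<omega>. Z \<omega> / \<sigma>)"
      by (rule distr_cong) auto
    also have "\<dots> = std_normal_distribution" by (rule distributed_distr_eq_density [OF d])
    finally have dd: "distr M borel (\<lambda>\<omega>. Z \<omega> / \<sigma>) = std_normal_distribution" .
    have "(\<integral>\<omega>. iexp (Z \<omega>) \<partial>M) = (\<integral>\<omega>. iexp (\<sigma> * (Z \<omega> / \<sigma>)) \<partial>M)"
      using 2(1) by simp
    also have "\<dots> = char (distr M borel (\<lambda>\<omega>. Z \<omega> / \<sigma>)) \<sigma>"
      unfolding char_def by (subst integral_distr) auto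
    also have "\<dots> = of_real (exp (- (\<sigma>\<^sup>2) / 2))"
      unfolding dd char_std_normal_distribution ..
    finally show ?thesis unfolding var by (simp add: exp_of_real [symmetric])
  qed
qed

end

section \<open>Brownian motion on a grid\<close>

definition grid_index :: "nat \<Rightarrow> real \<Rightarrow> nat" where
  "grid_index n s = nat \<lfloor>2 * real n * (s - 1 / 2)\<rfloor>"

definition grid_point :: "nat \<Rightarrow> nat \<Rightarrow> real" where
  "grid_point n i = 1 / 2 + real i / (2 * real n)"

text \<open>Index 0 stands for [0, 1/2]: \<open>B (1/2)\<close>, of variance 1/2, plays the part of
  a first increment.\<close>

definition grid_width :: "nat \<Rightarrow> nat \<Rightarrow> real" where
  "grid_width n i = (if i = 0 then 1 / 2 else 1 / (2 * real n))"

text \<open>A discretisation of B(s) / s in which only the numerator is rounded to the grid; keeping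
  1 / s exact makes every comparison one of numerators.\<close>

definition step_process :: "nat \<Rightarrow> (nat \<Rightarrow> real) \<Rightarrow> real \<Rightarrow> (nat \<Rightarrow> real) \<Rightarrow> real" where
  "step_process n c s z = 1 / s * (\<Sum>i\<le>grid_index n s. c i * z i)"

lemma grid_width_pos: "0 < n \<Longrightarrow> 0 < grid_width n i"
  by (simp add: grid_width_def)

lemma grid_point_in: "0 < n \<Longrightarrow> i \<le> n \<Longrightarrow> grid_point n i \<in> {1/2..1}"
  by (simp add: grid_point_def field_simps)

lemma grid_index_le:
  assumes "s \<le> 1"
  shows "grid_index n s \<le> n"
proof -
  have "2 * real n * (s - 1 / 2) \<le> 2 * real n * (1 / 2)"
    using assms by (intro mult_left_mono) auto
  then show ?thesis unfolding grid_index_def by (simp add: nat_le_iff floor_le_iff)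
qed

lemma grid_index_one [simp]: "grid_index n 1 = n"
  by (simp add: grid_index_def)

lemma grid_point_index:
  assumes "0 < n" "s \<in> {1/2..1}"
  shows "grid_point n (grid_index n s) \<le> s" "s < grid_point n (grid_index n s) + 1 / (2 * real n)"
proof -
  have "0 \<le> 2 * real n * (s - 1 / 2)" using assms by auto
  then have "real (grid_index n s) \<le> 2 * real n * (s - 1 / 2)" "2 * real n * (s - 1 / 2) < real (grid_index n s) + 1"
    unfolding grid_index_def by linarith+
  then show "grid_point n (grid_index n s) \<le> s" "s < grid_point n (grid_index n s) + 1 / (2 * real n)"
    using \<open>0 < n\<close> by (simp_all add: grid_point_def field_simps)
qed

text \<open>The Gaussian hypothesis speaks of sums over sets of distinct times; this notion is
  closed under sums of combinations whose times overlap.\<close>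

definition lincomb_of :: "real set \<Rightarrow> (real \<Rightarrow> 'a \<Rightarrow> real) \<Rightarrow> ('a \<Rightarrow> real) \<Rightarrow> bool" where
  "lincomb_of T B Z \<longleftrightarrow> (\<exists>F c. finite F \<and> F \<subseteq> T \<and> Z = (\<lambda>\<omega>. \<Sum>t\<in>F. c t * B t \<omega>))"

lemma lincomb_of_single: "t \<in> T \<Longrightarrow> lincomb_of T B (\<lambda>\<omega>. c * B t \<omega>)"
  unfolding lincomb_of_def by (intro exI [of _ "{t}"] exI [of _ "\<lambda>_. c"]) auto

lemma lincomb_of_add:
  assumes "lincomb_of T B Y" "lincomb_of T B Z"
  shows "lincomb_of T B (\<lambda>\<omega>. Y \<omega> + Z \<omega>)"
proof -
  obtain F c G d where F: "finite F" "F \<subseteq> T" "Y = (\<lambda>\<omega>. \<Sum>t\<in>F. c t * B t \<omega>)"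
    and G: "finite G" "G \<subseteq> T" "Z = (\<lambda>\<omega>. \<Sum>t\<in>G. d t * B t \<omega>)"
    using assms unfolding lincomb_of_def by blast
  have pad: "(\<Sum>t\<in>A. c t * B t \<omega>) = (\<Sum>t\<in>F \<union> G. (if t \<in> A then c t else 0) * B t \<omega>)"
    if "A \<subseteq> F \<union> G" for A c \<omega>
    using that F(1) G(1) by (intro sum.mono_neutral_cong_left) auto
  have "(\<lambda>\<omega>. Y \<omega> + Z \<omega>) = (\<lambda>\<omega>. \<Sum>t\<in>F \<union> G. ((if t \<in> F then c t else 0) + (if t \<in> G then d t else 0)) * B t \<omega>)"
    unfolding F(3) G(3) by (rule ext, subst pad [of F], simp, subst pad [of G], simp)
      (simp add: sum.distrib distrib_right)
  then show ?thesis
    unfolding lincomb_of_def using F(1,2) G(1,2)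
    by (intro exI [of _ "F \<union> G"] exI [of _ "\<lambda>t. (if t \<in> F then c t else 0) + (if t \<in> G then d t else 0)"]) auto
qed

lemma lincomb_of_cmult:
  assumes "lincomb_of T B Z"
  shows "lincomb_of T B (\<lambda>\<omega>. a * Z \<omega>)"
proof -
  obtain F c where F: "finite F" "F \<subseteq> T" "Z = (\<lambda>\<omega>. \<Sum>t\<in>F. c t * B t \<omega>)"
    using assms unfolding lincomb_of_def by blast
  then show ?thesis
    unfolding lincomb_of_def
    by (intro exI [of _ F] exI [of _ "\<lambda>t. a * c t"]) (auto simp: sum_distrib_left mult.assoc)
qed

lemma lincomb_of_sum:
  assumes "finite A" "\<And>i. i \<in> A \<Longrightarrow> lincomb_of T B (f i)"
  shows "lincomb_of T B (\<lambda>\<omega>. \<Sum>i\<in>A. f i \<omega>)"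
  using assms
proof (induction A)
  case empty
  show ?case unfolding lincomb_of_def by (intro exI [of _ "{}"]) auto
next
  case (insert i A)
  then show ?case using lincomb_of_add [of T B "f i" "\<lambda>\<omega>. \<Sum>i\<in>A. f i \<omega>"] by simp
qed

locale brownian = prob_space P for P :: "'b measure" +
  fixes B :: "real \<Rightarrow> 'b \<Rightarrow> real"
  assumes brownian: "brownian_motion_on P {1/2..1} B"
begin

lemma lincomb_gaussian: "lincomb_of {1/2..1} B Z \<Longrightarrow> gaussian_rv P Z"
  using brownian unfolding brownian_motion_on_def gaussian_process_on_def lincomb_of_def by auto

lemma square_integrable_B: "s \<in> {1/2..1} \<Longrightarrow> square_integrable P (B s)"
  using gaussian_rv_square_integrable [OF lincomb_gaussian [OF lincomb_of_single [of s _ B 1]]] by simp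

lemma B_measurable: "s \<in> {1/2..1} \<Longrightarrow> B s \<in> borel_measurable P"
  using square_integrable_B by (simp add: square_integrable_def)

lemma B_integrable: "s \<in> {1/2..1} \<Longrightarrow> integrable P (B s)"
  using square_integrable_B [of s] by (simp add: square_integrable_def square_integrable_imp_integrable [of "B s"])

lemma expectation_B: "s \<in> {1/2..1} \<Longrightarrow> expectation (B s) = 0"
  using brownian by (simp add: brownian_motion_on_def)

lemma B_product_integrable:
  assumes "s \<in> {1/2..1}" "t \<in> {1/2..1}"
  shows "integrable P (\<lambda>\<omega>. B s \<omega> * B t \<omega>)"
proof (rule Bochner_Integration.integrable_bound)
  show "integrable P (\<lambda>\<omega>. (B s \<omega>)\<^sup>2 + (B t \<omega>)\<^sup>2)"
    using square_integrable_B assms by (auto simp: square_integrable_def)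
  show "(\<lambda>\<omega>. B s \<omega> * B t \<omega>) \<in> borel_measurable P"
    using B_measurable assms by (intro borel_measurable_times) auto
  have "\<bar>x * y\<bar> \<le> x\<^sup>2 + y\<^sup>2" for x y :: real
    using sum_squares_bound [of "\<bar>x\<bar>" "\<bar>y\<bar>"] abs_ge_zero [of "x * y"]
    unfolding abs_mult power2_abs by linarith
  then show "AE \<omega> in P. norm (B s \<omega> * B t \<omega>) \<le> norm ((B s \<omega>)\<^sup>2 + (B t \<omega>)\<^sup>2)"
    by (intro AE_I2) (metis abs_ge_self order_trans real_norm_def)
qed

lemma expectation_B_product:
  assumes "s \<in> {1/2..1}" "t \<in> {1/2..1}"
  shows "expectation (\<lambda>\<omega>. B s \<omega> * B t \<omega>) = min s t"
proof -
  have "covariance P (B s) (B t) = min s t"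
    using brownian assms by (simp add: brownian_motion_on_def)
  then show ?thesis using assms by (simp add: covariance_def expectation_B)
qed

lemma expectation_B_diff_square:
  assumes "s \<in> {1/2..1}" "t \<in> {1/2..1}" "s \<le> t"
  shows "expectation (\<lambda>\<omega>. (B t \<omega> - B s \<omega>)\<^sup>2) = t - s"
proof -
  have "expectation (\<lambda>\<omega>. (B t \<omega> - B s \<omega>)\<^sup>2) =
      expectation (\<lambda>\<omega>. B t \<omega> * B t \<omega> - 2 * (B t \<omega> * B s \<omega>) + B s \<omega> * B s \<omega>)"
    by (intro Bochner_Integration.integral_cong) (auto simp: power2_eq_square algebra_simps)
  also have "\<dots> = t - s"
    using assms by (simp add: B_product_integrable expectation_B_product min_def)
  finally show ?thesis .
qed

text \<open>Standardised to variance 1 for indices up to \<open>n\<close>; the value 0 beyond keeps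
  every member of the family measurable.\<close>

definition increment :: "nat \<Rightarrow> nat \<Rightarrow> 'b \<Rightarrow> real" where
  "increment n i \<omega> = (if i = 0 then B (1/2) \<omega> else if i \<le> n then B (grid_point n i) \<omega> - B (grid_point n (i - 1)) \<omega> else 0)
     / sqrt (grid_width n i)"

lemma increment_lincomb:
  assumes "0 < n" "i \<le> n"
  shows "lincomb_of {1/2..1} B (increment n i)"
proof (cases "i = 0")
  case True
  then have "increment n i = (\<lambda>\<omega>. 1 / sqrt (grid_width n i) * B (1/2) \<omega>)"
    by (simp add: increment_def fun_eq_iff)
  moreover have "lincomb_of {1/2..1} B (\<lambda>\<omega>. 1 / sqrt (grid_width n i) * B (1/2) \<omega>)"
    by (rule lincomb_of_single) simp
  ultimately show ?thesis by (simp only:)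
next
  case False
  then have "increment n i = (\<lambda>\<omega>. 1 / sqrt (grid_width n i) * B (grid_point n i) \<omega>
      + (- 1 / sqrt (grid_width n i)) * B (grid_point n (i - 1)) \<omega>)"
    using assms by (simp add: increment_def fun_eq_iff diff_divide_distrib)
  then show ?thesis
    using assms by (simp only:) (intro lincomb_of_add lincomb_of_single grid_point_in; simp)
qed

lemma increment_measurable: "0 < n \<Longrightarrow> increment n i \<in> borel_measurable P"
proof (cases "i \<le> n")
  case True
  assume "0 < n"
  with True show ?thesis using lincomb_gaussian [OF increment_lincomb] by (simp add: gaussian_rv_def)
next
  case False
  then have "increment n i = (\<lambda>\<omega>. 0)" by (auto simp: increment_def fun_eq_iff)
  then show ?thesis by simp
qed

lemma increment_sum:
  assumes "0 < n" "k \<le> n"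
  shows "(\<Sum>i\<le>k. sqrt (grid_width n i) * increment n i \<omega>) = B (grid_point n k) \<omega>"
  using \<open>k \<le> n\<close>
proof (induction k)
  case 0
  then show ?case using grid_width_pos [OF assms(1), of 0] by (simp add: increment_def grid_point_def)
next
  case (Suc k)
  then show ?case using grid_width_pos [OF assms(1), of "Suc k"] by (simp add: increment_def)
qed

lemma expectation_increment:
  assumes n: "0 < n" and i: "i \<le> n"
  shows "expectation (increment n i) = 0"
proof (cases "i = 0")
  case True
  then show ?thesis unfolding increment_def by (simp add: expectation_B)
next
  case False
  have g: "grid_point n i \<in> {1/2..1}" "grid_point n (i - 1) \<in> {1/2..1}"
    using n i by (auto intro!: grid_point_in simp del: atLeastAtMost_iff)
  show ?thesis
    unfolding increment_def using False i B_integrable [OF g(1)] B_integrable [OF g(2)]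
      expectation_B [OF g(1)] expectation_B [OF g(2)] by simp
qed

lemma increment_product_integrable:
  assumes n: "0 < n" and "i \<le> n" "j \<le> n"
  shows "integrable P (\<lambda>\<omega>. increment n i \<omega> * increment n j \<omega>)"
proof (rule Bochner_Integration.integrable_bound)
  have sq: "square_integrable P (increment n i)" if "i \<le> n" for i
    by (rule gaussian_rv_square_integrable [OF lincomb_gaussian [OF increment_lincomb [OF n that]]])
  show "integrable P (\<lambda>\<omega>. (increment n i \<omega>)\<^sup>2 + (increment n j \<omega>)\<^sup>2)"
    using sq assms by (auto simp: square_integrable_def)
  show "(\<lambda>\<omega>. increment n i \<omega> * increment n j \<omega>) \<in> borel_measurable P"
    using increment_measurable [OF n] by (intro borel_measurable_times) auto
  have "\<bar>x * y\<bar> \<le> x\<^sup>2 + y\<^sup>2" for x y :: real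
    using sum_squares_bound [of "\<bar>x\<bar>" "\<bar>y\<bar>"] abs_ge_zero [of "x * y"]
    unfolding abs_mult power2_abs by linarith
  then show "AE \<omega> in P. norm (increment n i \<omega> * increment n j \<omega>) \<le> norm ((increment n i \<omega>)\<^sup>2 + (increment n j \<omega>)\<^sup>2)"
    by (intro AE_I2) (metis abs_ge_self order_trans real_norm_def)
qed

text \<open>The covariances are values of min at grid points: for i < j those of the two ends
  cancel, and for i = j they leave the width of the cell.\<close>

lemma expectation_increment_product:
  assumes n: "0 < n" and ij: "i \<le> j" "j \<le> n"
  shows "expectation (\<lambda>\<omega>. increment n i \<omega> * increment n j \<omega>) = of_bool (i = j)"
proof -
  let ?g = "grid_point n"
  have in_T: "?g k \<in> {1/2..1}" if "k \<le> n" for k using grid_point_in [OF n that] .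
  have half: "?g 0 = 1 / 2" by (simp add: grid_point_def)
  have mono: "?g k \<le> ?g l" if "k \<le> l" for k l
    using that n by (simp add: grid_point_def divide_right_mono)
  have "integrable P (\<lambda>\<omega>. B (?g k) \<omega> * B (?g l) \<omega>)" if "k \<le> n" "l \<le> n" for k l
    by (rule B_product_integrable [OF in_T [OF that(1)] in_T [OF that(2)]])
  note int = this
  have ex: "expectation (\<lambda>\<omega>. B (?g k) \<omega> * B (?g l) \<omega>) = ?g (min k l)" if "k \<le> n" "l \<le> n" for k l
    using expectation_B_product [OF in_T [OF that(1)] in_T [OF that(2)]] mono [of k l] mono [of l k]
    by (auto simp: min_def split: if_splits)
  define d where "d k \<omega> = (if k = 0 then B (?g 0) \<omega> else B (?g k) \<omega> - B (?g (k - 1)) \<omega>)" for k \<omega>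
  have inc: "increment n k \<omega> = d k \<omega> / sqrt (grid_width n k)" if "k \<le> n" for k \<omega>
    unfolding increment_def d_def half using that by auto
  have Ed: "expectation (\<lambda>\<omega>. d i \<omega> * d j \<omega>) = of_bool (i = j) * grid_width n i"
  proof (cases "i = 0")
    case i0: True
    show ?thesis
    proof (cases "j = 0")
      case True
      have "expectation (\<lambda>\<omega>. d 0 \<omega> * d 0 \<omega>) = 1 / 2"
        using ex [of 0 0] by (simp add: d_def half)
      then show ?thesis unfolding i0 True by (simp add: grid_width_def)
    next
      case False
      then have "expectation (\<lambda>\<omega>. d i \<omega> * d j \<omega>) =
          expectation (\<lambda>\<omega>. B (?g 0) \<omega> * B (?g j) \<omega> - B (?g 0) \<omega> * B (?g (j - 1)) \<omega>)"
        using i0 by (intro Bochner_Integration.integral_cong) (auto simp: d_def algebra_simps)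
      also have "\<dots> = 0"
        using ij by (simp add: int ex)
      finally show ?thesis using i0 False by simp
    qed
  next
    case i0: False
    then have "expectation (\<lambda>\<omega>. d i \<omega> * d j \<omega>) =
        expectation (\<lambda>\<omega>. (B (?g i) \<omega> * B (?g j) \<omega> - B (?g i) \<omega> * B (?g (j - 1)) \<omega>)
          - (B (?g (i - 1)) \<omega> * B (?g j) \<omega> - B (?g (i - 1)) \<omega> * B (?g (j - 1)) \<omega>))"
      using ij by (intro Bochner_Integration.integral_cong) (auto simp: d_def algebra_simps)
    also have "\<dots> = (?g i - ?g (min i (j - 1))) - (?g (i - 1) - ?g (i - 1))"
    proof -
      have m: "min i j = i" "min (i - 1) j = i - 1" "min (i - 1) (j - 1) = i - 1" and le: "i \<le> n" "i - 1 \<le> n" "j - 1 \<le> n"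
        using ij by auto
      show ?thesis
        using int [OF le(1) ij(2)] int [OF le(1,3)] int [OF le(2) ij(2)] int [OF le(2,3)]
        by (simp add: ex [OF le(1) ij(2)] ex [OF le(1,3)] ex [OF le(2) ij(2)] ex [OF le(2,3)] m del: One_nat_def)
    qed
    also have "\<dots> = of_bool (i = j) * grid_width n i"
    proof (cases "i = j")
      case True
      have "real i - real (i - 1) = 1" using i0 by (simp add: of_nat_diff)
      then have "?g i - ?g (i - 1) = 1 / (2 * real n)"
        unfolding grid_point_def by (simp add: diff_divide_distrib [symmetric])
      with True i0 show ?thesis by (simp add: grid_width_def min_def)
    next
      case False
      then have "min i (j - 1) = i" using ij by simp
      with False show ?thesis by simp
    qed
    finally show ?thesis .
  qed
  have "expectation (\<lambda>\<omega>. increment n i \<omega> * increment n j \<omega>) =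
      expectation (\<lambda>\<omega>. d i \<omega> * d j \<omega> / (sqrt (grid_width n i) * sqrt (grid_width n j)))"
    using ij by (intro Bochner_Integration.integral_cong) (auto simp: inc)
  also have "\<dots> = of_bool (i = j)"
    using Ed grid_width_pos [OF n, of i] by auto
  finally show ?thesis .
qed

text \<open>A linear combination of the increments is Gaussian, and as they are orthonormal its
  variance is the sum of the squared coefficients. Its characteristic function therefore factorises,
  which is the hypothesis of \<open>joint_char_imp_PiM\<close>.\<close>

lemma increments_law:
  assumes n: "0 < n"
  shows "distr P (PiM {..n} (\<lambda>_. borel)) (\<lambda>\<omega>. \<lambda>i\<in>{..n}. increment n i \<omega>) = PiM {..n} (\<lambda>_. std_normal_distribution)"
proof -
  let ?V = "\<lambda>i \<omega>. if i \<le> n then increment n i \<omega> else 0"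
  have mV: "?V i \<in> borel_measurable P" for i using increment_measurable [OF n, of i] by simp
  have sq: "expectation (\<lambda>\<omega>. (\<Sum>i\<le>n. t i * increment n i \<omega>)\<^sup>2) = (\<Sum>i\<le>n. (t i)\<^sup>2)" for t
  proof -
    have ex: "expectation (\<lambda>\<omega>. increment n i \<omega> * increment n j \<omega>) = of_bool (i = j)" if "i \<le> n" "j \<le> n" for i j
      using expectation_increment_product [OF n, of i j] expectation_increment_product [OF n, of j i] that
      by (cases "i \<le> j") (auto simp: mult.commute)
    have "(\<Sum>i\<le>n. t i * increment n i \<omega>)\<^sup>2 = (\<Sum>i\<le>n. \<Sum>j\<le>n. t i * t j * (increment n i \<omega> * increment n j \<omega>))" for \<omega>
      unfolding power2_eq_square sum_product by (simp only: mult.assoc mult.left_commute)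
    then have "expectation (\<lambda>\<omega>. (\<Sum>i\<le>n. t i * increment n i \<omega>)\<^sup>2) =
        expectation (\<lambda>\<omega>. \<Sum>i\<le>n. \<Sum>j\<le>n. t i * t j * (increment n i \<omega> * increment n j \<omega>))"
      by (simp only:)
    also have "\<dots> = (\<Sum>i\<le>n. \<Sum>j\<le>n. t i * t j * of_bool (i = j))"
    proof -
      have int: "integrable P (\<lambda>\<omega>. t i * t j * (increment n i \<omega> * increment n j \<omega>))" if "i \<in> {..n}" "j \<in> {..n}" for i j
        using that by (intro integrable_mult_right increment_product_integrable n) auto
      have "expectation (\<lambda>\<omega>. \<Sum>i\<le>n. \<Sum>j\<le>n. t i * t j * (increment n i \<omega> * increment n j \<omega>)) =
          (\<Sum>i\<le>n. expectation (\<lambda>\<omega>. \<Sum>j\<le>n. t i * t j * (increment n i \<omega> * increment n j \<omega>)))"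
        by (intro Bochner_Integration.integral_sum Bochner_Integration.integrable_sum int)
      also have "\<dots> = (\<Sum>i\<le>n. \<Sum>j\<le>n. expectation (\<lambda>\<omega>. t i * t j * (increment n i \<omega> * increment n j \<omega>)))"
        by (intro sum.cong refl Bochner_Integration.integral_sum int)
      finally show ?thesis by (simp add: ex)
    qed
    also have "\<dots> = (\<Sum>i\<le>n. \<Sum>j\<le>n. if j = i then (t i)\<^sup>2 else 0)"
      by (intro sum.cong refl) (auto simp: power2_eq_square)
    finally show ?thesis by simp
  qed
  have char: "(\<integral>\<omega>. iexp (\<Sum>i\<le>n. t i * increment n i \<omega>) \<partial>P) = exp (- of_real (\<Sum>i\<le>n. (t i)\<^sup>2) / 2)" for t
  proof -
    have g: "gaussian_rv P (\<lambda>\<omega>. \<Sum>i\<le>n. t i * increment n i \<omega>)"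
      using n by (intro lincomb_gaussian lincomb_of_sum lincomb_of_cmult increment_lincomb) auto
    have "integrable P (increment n i)" if "i \<le> n" for i
      using gaussian_rv_square_integrable [OF lincomb_gaussian [OF increment_lincomb [OF n that]]]
      by (simp add: square_integrable_def square_integrable_imp_integrable [of "increment n i"])
    then have "expectation (\<lambda>\<omega>. \<Sum>i\<le>n. t i * increment n i \<omega>) = 0"
      using n by (simp add: expectation_increment)
    from gaussian_rv_char [OF g this] show ?thesis unfolding sq .
  qed
  have marg: "char (distr P borel (?V i)) u = exp (- of_real (u\<^sup>2) / 2)" if "i \<le> n" for i u
  proof -
    have "char (distr P borel (?V i)) u = (\<integral>\<omega>. iexp (u * increment n i \<omega>) \<partial>P)"
      unfolding char_def using that mV [of i] by (subst integral_distr) auto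
    also have "\<dots> = (\<integral>\<omega>. iexp (\<Sum>j\<le>n. (if j = i then u else 0) * increment n j \<omega>) \<partial>P)"
      using that by (simp add: if_distrib [of "\<lambda>x. x * _"] cong: if_cong)
    also have "\<dots> = exp (- of_real (\<Sum>j\<le>n. (if j = i then u else 0)\<^sup>2) / 2)"
      by (rule char)
    also have "(\<Sum>j\<le>n. (if j = i then u else 0)\<^sup>2) = u\<^sup>2"
      using that by (simp add: if_distrib [of "\<lambda>x. x\<^sup>2"] cong: if_cong)
    finally show ?thesis .
  qed
  have std: "distr P borel (?V i) = std_normal_distribution" if "i \<le> n" for i
  proof (rule Levy_uniqueness)
    show "real_distribution (distr P borel (?V i))" by (rule real_distribution_distr [OF mV])
    show "real_distribution std_normal_distribution" by (rule real_dist_normal_dist)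
    show "char (distr P borel (?V i)) = char std_normal_distribution"
      unfolding char_std_normal_distribution using marg [OF that] by (simp add: fun_eq_iff exp_of_real [symmetric])
  qed
  have "distr P (PiM {..n} (\<lambda>_. borel)) (\<lambda>\<omega>. \<lambda>i\<in>{..n}. ?V i \<omega>) = PiM {..n} (\<lambda>i. distr P borel (?V i))"
  proof (rule joint_char_imp_PiM)
    fix t
    have "(\<integral>\<omega>. iexp (\<Sum>i\<in>{..n}. t i * ?V i \<omega>) \<partial>P) = (\<integral>\<omega>. iexp (\<Sum>i\<le>n. t i * increment n i \<omega>) \<partial>P)"
      by (intro Bochner_Integration.integral_cong refl arg_cong [where f = iexp] sum.cong) auto
    also have "\<dots> = (\<Prod>i\<le>n. exp (- of_real ((t i)\<^sup>2) / 2))"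
      unfolding char by (simp add: exp_sum [symmetric] sum_divide_distrib [symmetric] sum_negf)
    also have "\<dots> = (\<Prod>i\<in>{..n}. char (distr P borel (?V i)) (t i))"
      by (intro prod.cong refl marg [symmetric]) simp
    finally show "(\<integral>\<omega>. iexp (\<Sum>i\<in>{..n}. t i * ?V i \<omega>) \<partial>P) = (\<Prod>i\<in>{..n}. char (distr P borel (?V i)) (t i))" .
  qed (use mV in auto)
  also have "PiM {..n} (\<lambda>i. distr P borel (?V i)) = PiM {..n} (\<lambda>_. std_normal_distribution)"
    by (intro PiM_cong refl std) simp
  also have "(\<lambda>\<omega>. \<lambda>i\<in>{..n}. ?V i \<omega>) = (\<lambda>\<omega>. \<lambda>i\<in>{..n}. increment n i \<omega>)"
    by (intro ext) (auto simp: restrict_def)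
  finally show ?thesis .
qed

end

section \<open>Independent blocks\<close>

context prob_space
begin

text \<open>The characteristic function of the sum depends only on the number of summands. This
  carries the central limit theorem from initial segments to groups of blocks that start
  anywhere.\<close>

lemma iid_sum_distr:
  fixes U :: "nat \<Rightarrow> 'a \<Rightarrow> real"
  assumes ind: "indep_vars (\<lambda>_. borel) U UNIV" and law: "\<And>b. distr M borel (U b) = distr M borel (U 0)"
    and A: "finite A"
  shows "distr M borel (\<lambda>\<omega>. c * (\<Sum>b\<in>A. U b \<omega>)) = distr M borel (\<lambda>\<omega>. c * (\<Sum>b<card A. U b \<omega>))"
proof -
  have [measurable]: "U b \<in> borel_measurable M" for b
    using ind by (simp add: indep_vars_def2)
  have "distr M borel (\<lambda>\<omega>. \<Sum>b\<in>A. U b \<omega>) = distr M borel (\<lambda>\<omega>. \<Sum>b<card A. U b \<omega>)"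
  proof (rule Levy_uniqueness)
    show "real_distribution (distr M borel (\<lambda>\<omega>. \<Sum>b\<in>A. U b \<omega>))"
      by (rule real_distribution_distr) measurable
    show "real_distribution (distr M borel (\<lambda>\<omega>. \<Sum>b<card A. U b \<omega>))"
      by (rule real_distribution_distr) measurable
    show "char (distr M borel (\<lambda>\<omega>. \<Sum>b\<in>A. U b \<omega>)) = char (distr M borel (\<lambda>\<omega>. \<Sum>b<card A. U b \<omega>))"
    proof
      fix t
      have "char (distr M borel (\<lambda>\<omega>. \<Sum>b\<in>B. U b \<omega>)) t = char (distr M borel (U 0)) t ^ card B" if "finite B" for B
      proof -
        have "char (distr M borel (\<lambda>\<omega>. \<Sum>b\<in>B. U b \<omega>)) t = (\<Prod>b\<in>B. char (distr M borel (U b)) t)"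
          by (rule char_distr_sum [OF indep_vars_subset [OF ind subset_UNIV]])
        also have "\<dots> = (\<Prod>b\<in>B. char (distr M borel (U 0)) t)"
          by (rule prod.cong [OF refl]) (rule arg_cong [where f = "\<lambda>\<mu>. char \<mu> t", OF law])
        finally show ?thesis by simp
      qed
      from this [OF A] this [of "{..<card A}"]
      show "char (distr M borel (\<lambda>\<omega>. \<Sum>b\<in>A. U b \<omega>)) t = char (distr M borel (\<lambda>\<omega>. \<Sum>b<card A. U b \<omega>)) t"
        by simp
    qed
  qed
  then have "distr (distr M borel (\<lambda>\<omega>. \<Sum>b\<in>A. U b \<omega>)) borel (\<lambda>x. c * x) =
      distr (distr M borel (\<lambda>\<omega>. \<Sum>b<card A. U b \<omega>)) borel (\<lambda>x. c * x)" by simp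
  then show ?thesis by (simp add: distr_distr comp_def)
qed

end

section \<open>Block forms: independence, common law and second moments\<close>

context white_noise
begin

definition block_form :: "(int \<Rightarrow> real) \<Rightarrow> nat \<Rightarrow> nat \<Rightarrow> 'a \<Rightarrow> real" where
  "block_form a p b \<omega> = (\<Sum>k = 1..p. \<Sum>l = 1..p. a (int k - int l) * \<eta> (int (b * p + k)) (int (b * p + l)) \<omega>)"

lemma block_form_measurable [measurable]: "block_form a p b \<in> borel_measurable M"
  unfolding block_form_def by measurable

lemma square_integrable_block_form: "square_integrable M (block_form a p b)"
  unfolding block_form_def
  by (intro square_integrable_sum square_integrable_cmult square_integrable_eta)

lemma expectation_block_form: "expectation (block_form a p b) = 0"
  unfolding block_form_def
  by (simp add: eta_integrable expectation_eta)

text \<open>Uniqueness of division with remainders 1 to \<open>p\<close> instead of 0 to p - 1, the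
  observations being numbered from 1.\<close>

lemma block_index_inj:
  assumes "b * p + k = b' * p + k'" "k \<in> {1..p}" "k' \<in> {1..p}"
  shows "b = b' \<and> k = (k' :: nat)"
proof -
  have "\<not> b < b'" if "b * p + k = b' * p + k'" "k \<in> {1..p}" "k' \<in> {1..p}" for b b' k k' :: nat
  proof
    assume "b < b'"
    then have "Suc b * p \<le> b' * p" by (intro mult_le_mono1) simp
    then show False using that by auto
  qed
  from this [OF assms] this [OF assms(1) [symmetric] assms(3,2)]
  show ?thesis using assms(1) by (auto simp: linorder_neq_iff)
qed

text \<open>A block is a measurable function of the noise at its own \<open>p\<close> indices, and
  the index sets of different blocks are disjoint.\<close>

lemma indep_block_form: "indep_vars (\<lambda>_. borel) (block_form a p) UNIV"
proof -
  define K where "K b = (\<lambda>k. int (b * p + k)) ` {1..p}" for b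
  define F where "F b x = (\<Sum>k = 1..p. \<Sum>l = 1..p. a (int k - int l) *
      (x (int (b * p + k)) * x (int (b * p + l)) - of_bool (int (b * p + k) = int (b * p + l))))" for b and x :: "int \<Rightarrow> real"
  have disj: "disjoint_family_on K UNIV"
    unfolding disjoint_family_on_def
  proof (intro ballI impI, rule ccontr)
    fix b b' :: nat assume "b \<noteq> b'" "K b \<inter> K b' \<noteq> {}"
    then obtain k k' where "int (b * p + k) = int (b' * p + k')" "k \<in> {1..p}" "k' \<in> {1..p}"
      unfolding K_def by blast
    then show False using block_index_inj [of b p k b' k'] \<open>b \<noteq> b'\<close> by (metis of_nat_eq_iff)
  qed
  have ind: "indep_vars (\<lambda>b. PiM (K b) (\<lambda>_. borel)) (\<lambda>b \<omega>. restrict (\<lambda>i. \<epsilon> i \<omega>) (K b)) UNIV"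
    by (rule indep_vars_restrict [OF indep_noise _ disj]) auto
  have "F b \<in> borel_measurable (PiM (K b) (\<lambda>_. borel))" for b
    unfolding F_def
    by (intro borel_measurable_sum borel_measurable_times borel_measurable_diff borel_measurable_const
        measurable_component_singleton) (auto simp: K_def)
  from indep_vars_compose2 [OF ind this]
  have "indep_vars (\<lambda>_. borel) (\<lambda>b \<omega>. F b (restrict (\<lambda>i. \<epsilon> i \<omega>) (K b))) UNIV" .
  also have "(\<lambda>b \<omega>. F b (restrict (\<lambda>i. \<epsilon> i \<omega>) (K b))) = block_form a p"
    unfolding F_def block_form_def \<eta>_def
    by (intro ext sum.cong refl) (auto simp: K_def)
  finally show ?thesis .
qed

lemma distr_noise: "distr M borel (\<epsilon> k) = std_normal_distribution"
proof -
  have "distr M borel (\<epsilon> k) = distr M lborel (\<epsilon> k)" by (rule distr_cong) auto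
  also have "\<dots> = std_normal_distribution" by (rule distributed_distr_eq_density [OF noise_distributed])
  finally show ?thesis .
qed

text \<open>All blocks are the same function \<open>G\<close> of \<open>p\<close> consecutive noise
  variables, whose joint law is a product of standard normals wherever they start.\<close>

lemma distr_block_form: "distr M borel (block_form a p b) = distr M borel (block_form a p 0)"
proof (cases "p = 0")
  case True
  then show ?thesis by (simp add: block_form_def [abs_def])
next
  case False
  define G where "G x = (\<Sum>k = 1..p. \<Sum>l = 1..p. a (int k - int l) * (x k * x l - of_bool (k = l)))" for x :: "nat \<Rightarrow> real"
  define v where "v b \<omega> = (\<lambda>k\<in>{1..p}. \<epsilon> (int (b * p + k)) \<omega>)" for b \<omega>
  have law: "distr M (PiM {1..p} (\<lambda>_. borel)) (v b) = PiM {1..p} (\<lambda>_. std_normal_distribution)" for b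
  proof -
    have "distr M (PiM {1..p} (\<lambda>_. borel)) (\<lambda>\<omega>. \<lambda>k\<in>{1..p}. \<epsilon> (int (b * p + k)) \<omega>) =
        PiM {1..p} (\<lambda>k. distr M borel (\<epsilon> (int (b * p + k))))"
    proof (rule joint_char_imp_PiM)
      fix t :: "nat \<Rightarrow> real"
      let ?h = "\<lambda>k. int (b * p + k)"
      have inj: "inj_on ?h {1..p}" by (auto simp: inj_on_def)
      define t' where "t' i = t (nat (i - int (b * p)))" for i
      have t': "t' (?h k) = t k" for k by (simp add: t'_def)
      let ?W = "\<lambda>i \<omega>. t' i * \<epsilon> i \<omega>"
      have indW: "indep_vars (\<lambda>_. borel) ?W (?h ` {1..p})"
        by (rule indep_vars_compose2 [OF indep_vars_subset [OF indep_noise subset_UNIV]]) measurable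
      have "(\<integral>\<omega>. iexp (\<Sum>k\<in>{1..p}. t k * \<epsilon> (?h k) \<omega>) \<partial>M) = (\<integral>\<omega>. iexp (1 * (\<Sum>i\<in>?h ` {1..p}. ?W i \<omega>)) \<partial>M)"
        by (subst sum.reindex [OF inj]) (simp only: comp_def t' mult_1)
      also have "\<dots> = char (distr M borel (\<lambda>\<omega>. \<Sum>i\<in>?h ` {1..p}. ?W i \<omega>)) 1"
        unfolding char_def by (subst integral_distr) auto
      also have "\<dots> = (\<Prod>i\<in>?h ` {1..p}. char (distr M borel (?W i)) 1)"
        by (rule char_distr_sum [OF indW])
      also have "\<dots> = (\<Prod>k\<in>{1..p}. char (distr M borel (?W (?h k))) 1)"
        by (subst prod.reindex [OF inj]) (simp only: comp_def)
      also have "\<dots> = (\<Prod>k\<in>{1..p}. char (distr M borel (\<epsilon> (?h k))) (t k))"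
      proof (rule prod.cong [OF refl])
        fix k
        show "char (distr M borel (?W (?h k))) 1 = char (distr M borel (\<epsilon> (?h k))) (t k)"
          unfolding char_def t' by (simp add: integral_distr)
      qed
      finally show "(\<integral>\<omega>. iexp (\<Sum>k\<in>{1..p}. t k * \<epsilon> (?h k) \<omega>) \<partial>M) = (\<Prod>k\<in>{1..p}. char (distr M borel (\<epsilon> (?h k))) (t k))" .
    qed auto
    then show ?thesis by (simp only: v_def [abs_def] distr_noise)
  qed
  have mG: "G \<in> borel_measurable (PiM {1..p} (\<lambda>_. borel))"
    unfolding G_def
    by (intro borel_measurable_sum borel_measurable_times borel_measurable_diff borel_measurable_const
        measurable_component_singleton) auto
  have mv: "v b \<in> measurable M (PiM {1..p} (\<lambda>_. borel))" for b
    unfolding v_def by measurable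
  have "distr M borel (block_form a p b) = distr (distr M (PiM {1..p} (\<lambda>_. borel)) (v b)) borel G" for b
  proof -
    have "block_form a p b = G \<circ> v b"
      unfolding block_form_def \<eta>_def G_def v_def
      by (intro ext) (auto simp: comp_def intro!: sum.cong)
    then show ?thesis by (simp only: distr_distr [OF mG mv])
  qed
  then show ?thesis by (simp only: law)
qed

definition block_mass :: "(int \<Rightarrow> real) \<Rightarrow> nat \<Rightarrow> real" where
  "block_mass a p = (\<Sum>k = 1..p. \<Sum>l = 1..p. (a (int k - int l))\<^sup>2)"

text \<open>For even coefficients (k, l) and (l, k) carry the same coefficient, so the factor 2 of
  \<open>expectation_eta_sum_square_le\<close> is attained. The central limit theorem needs this
  exact variance.\<close>

lemma expectation_block_form_square:
  assumes even: "\<And>h. a (- h) = a h"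
  shows "expectation (\<lambda>\<omega>. (block_form a p b \<omega>)\<^sup>2) = 2 * block_mass a p"
proof -
  let ?K = "{1..p} \<times> {1..p}"
  let ?c = "\<lambda>x :: nat \<times> nat. a (int (fst x) - int (snd x))"
  have bf: "block_form a p b \<omega> = (\<Sum>x\<in>?K. ?c x * \<eta> (int (b * p + fst x)) (int (b * p + snd x)) \<omega>)" for \<omega>
    unfolding block_form_def sum.cartesian_product by (simp add: split_beta)
  have "expectation (\<lambda>\<omega>. (block_form a p b \<omega>)\<^sup>2) =
      (\<Sum>x\<in>?K. \<Sum>y\<in>?K. ?c x * ?c y * (of_bool (int (b * p + fst x) = int (b * p + fst y) \<and> int (b * p + snd x) = int (b * p + snd y))
        + of_bool (int (b * p + fst x) = int (b * p + snd y) \<and> int (b * p + snd x) = int (b * p + fst y))))"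
    unfolding bf by (rule expectation_eta_sum_square) simp
  also have "\<dots> = (\<Sum>x\<in>?K. 2 * (?c x)\<^sup>2)"
  proof (rule sum.cong [OF refl])
    fix x assume x: "x \<in> ?K"
    obtain k l where kl: "x = (k, l)" by (cases x)
    have "(\<Sum>y\<in>?K. ?c x * ?c y * (of_bool (int (b * p + fst x) = int (b * p + fst y) \<and> int (b * p + snd x) = int (b * p + snd y))
        + of_bool (int (b * p + fst x) = int (b * p + snd y) \<and> int (b * p + snd x) = int (b * p + fst y)))) =
        (\<Sum>y\<in>?K. (if y = x then ?c x * ?c y else 0) + (if y = (l, k) then ?c x * ?c y else 0))"
    proof (rule sum.cong [OF refl])
      fix y :: "nat \<times> nat"
      obtain k' l' where y: "y = (k', l')" by (cases y)
      show "?c x * ?c y * (of_bool (int (b * p + fst x) = int (b * p + fst y) \<and> int (b * p + snd x) = int (b * p + snd y))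
        + of_bool (int (b * p + fst x) = int (b * p + snd y) \<and> int (b * p + snd x) = int (b * p + fst y))) =
        (if y = x then ?c x * ?c y else 0) + (if y = (l, k) then ?c x * ?c y else 0)"
        unfolding kl y by (cases "k = k'"; cases "l = l'"; cases "k = l'"; cases "l = k'"; simp)
    qed
    also have "\<dots> = ?c x * ?c x + ?c x * ?c (l, k)"
    proof -
      have "(l, k) \<in> ?K" using x by (simp add: kl)
      then show ?thesis using x by (simp only: sum.distrib sum.delta finite_cartesian_product finite_atLeastAtMost if_True)
    qed
    also have "?c (l, k) = ?c x"
      using even [of "int k - int l"] by (simp add: kl)
    finally show "(\<Sum>y\<in>?K. ?c x * ?c y * (of_bool (int (b * p + fst x) = int (b * p + fst y) \<and> int (b * p + snd x) = int (b * p + snd y))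
        + of_bool (int (b * p + fst x) = int (b * p + snd y) \<and> int (b * p + snd x) = int (b * p + fst y)))) = 2 * (?c x)\<^sup>2"
      by (simp add: power2_eq_square)
  qed
  also have "\<dots> = 2 * block_mass a p"
    unfolding block_mass_def sum.cartesian_product by (simp add: sum_distrib_left split_beta)
  finally show ?thesis .
qed

lemma expectation_block_sum_square_le:
  assumes A: "finite A"
  shows "expectation (\<lambda>\<omega>. (\<Sum>b\<in>A. block_form a p b \<omega>)\<^sup>2) \<le> 2 * (real (card A) * block_mass a p)"
proof -
  let ?K = "A \<times> {1..p} \<times> {1..p}"
  let ?c = "\<lambda>x :: nat \<times> nat \<times> nat. a (int (fst (snd x)) - int (snd (snd x)))"
  have eq: "(\<Sum>b\<in>A. block_form a p b \<omega>) = (\<Sum>x\<in>?K. ?c x * \<eta> (int (fst x * p + fst (snd x))) (int (fst x * p + snd (snd x))) \<omega>)" for \<omega>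
    unfolding block_form_def sum.cartesian_product by (simp add: split_beta)
  have "expectation (\<lambda>\<omega>. (\<Sum>b\<in>A. block_form a p b \<omega>)\<^sup>2) \<le> 2 * (\<Sum>x\<in>?K. (?c x)\<^sup>2)"
    unfolding eq
  proof (rule expectation_eta_sum_square_le)
    show "inj_on (\<lambda>x. (int (fst x * p + fst (snd x)), int (fst x * p + snd (snd x)))) ?K"
    proof (rule inj_onI)
      fix x y assume x: "x \<in> ?K" and y: "y \<in> ?K"
        and "(int (fst x * p + fst (snd x)), int (fst x * p + snd (snd x))) = (int (fst y * p + fst (snd y)), int (fst y * p + snd (snd y)))"
      then have 1: "fst x * p + fst (snd x) = fst y * p + fst (snd y)" and 2: "fst x * p + snd (snd x) = fst y * p + snd (snd y)"
        by (simp_all only: prod.inject of_nat_eq_iff)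
      show "x = y"
        using block_index_inj [OF 1] block_index_inj [OF 2] x y by (auto simp: prod_eq_iff)
    qed
  qed (use A in simp)
  also have "(\<Sum>x\<in>?K. (?c x)\<^sup>2) = (\<Sum>b\<in>A. block_mass a p)"
    unfolding block_mass_def sum.cartesian_product by (simp add: split_beta)
  finally show ?thesis by simp
qed

text \<open>The diagonal blocks fill a subset of the index square, so the difference is a form over
  the complement, whose mass is the difference of the masses. For \<open>a = fcos u\<close> this is
  small per observation once \<open>p\<close> is large, by \<open>block_mass_limit\<close>.\<close>

lemma toeplitz_block_diff:
  assumes p: "0 < p"
  shows "expectation (\<lambda>\<omega>. (toeplitz_form a m \<omega> - (\<Sum>b<m div p. block_form a p b \<omega>))\<^sup>2) \<le>
    2 * (block_mass a m - real (m div p) * block_mass a p)"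
proof -
  let ?q = "m div p"
  let ?h = "\<lambda>x :: nat \<times> nat \<times> nat. (fst x * p + fst (snd x), fst x * p + snd (snd x))"
  let ?K = "{..<?q} \<times> {1..p} \<times> {1..p}"
  let ?S = "?h ` ?K" and ?T = "{1..m} \<times> {1..m}"
  let ?c = "\<lambda>y :: nat \<times> nat. a (int (fst y) - int (snd y))"
  let ?e = "\<lambda>y :: nat \<times> nat. \<eta> (int (fst y)) (int (snd y))"
  have inj: "inj_on ?h ?K"
  proof (rule inj_onI)
    fix x y assume x: "x \<in> ?K" and y: "y \<in> ?K" and "?h x = ?h y"
    then have 1: "fst x * p + fst (snd x) = fst y * p + fst (snd y)" and 2: "fst x * p + snd (snd x) = fst y * p + snd (snd y)"
      by (simp_all only: prod.inject)
    show "x = y"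
      using block_index_inj [OF 1] block_index_inj [OF 2] x y by (auto simp: prod_eq_iff)
  qed
  have sub: "?S \<subseteq> ?T"
  proof -
    have "b * p + k \<in> {1..m}" if "b < ?q" "k \<in> {1..p}" for b k
    proof -
      have "Suc b * p \<le> ?q * p" using that by (intro mult_le_mono1) simp
      also have "\<dots> \<le> m" by simp
      finally show ?thesis using that by auto
    qed
    then show ?thesis by auto
  qed
  have form: "toeplitz_form a m \<omega> = (\<Sum>y\<in>?T. ?c y * ?e y \<omega>)" for \<omega>
    unfolding toeplitz_form_def sum.cartesian_product by (simp add: split_beta)
  have blocks: "(\<Sum>b<?q. block_form a p b \<omega>) = (\<Sum>y\<in>?S. ?c y * ?e y \<omega>)" for \<omega>
    unfolding block_form_def sum.cartesian_product by (subst sum.reindex [OF inj]) (simp add: split_beta comp_def)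
  have "toeplitz_form a m \<omega> - (\<Sum>b<?q. block_form a p b \<omega>) = (\<Sum>y\<in>?T - ?S. ?c y * ?e y \<omega>)" for \<omega>
    unfolding form blocks using sub by (subst sum_diff) auto
  then have "expectation (\<lambda>\<omega>. (toeplitz_form a m \<omega> - (\<Sum>b<?q. block_form a p b \<omega>))\<^sup>2) =
      expectation (\<lambda>\<omega>. (\<Sum>y\<in>?T - ?S. ?c y * ?e y \<omega>)\<^sup>2)" by (simp only:)
  also have "\<dots> \<le> 2 * (\<Sum>y\<in>?T - ?S. (?c y)\<^sup>2)"
    by (rule expectation_eta_sum_square_le) (auto simp: inj_on_def)
  also have "(\<Sum>y\<in>?T - ?S. (?c y)\<^sup>2) = (\<Sum>y\<in>?T. (?c y)\<^sup>2) - (\<Sum>y\<in>?S. (?c y)\<^sup>2)"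
    using sub by (subst sum_diff) auto
  also have "(\<Sum>y\<in>?T. (?c y)\<^sup>2) = block_mass a m"
    unfolding block_mass_def sum.cartesian_product by (simp add: split_beta)
  also have "(\<Sum>y\<in>?S. (?c y)\<^sup>2) = (\<Sum>b<?q. block_mass a p)"
    unfolding block_mass_def sum.cartesian_product by (subst sum.reindex [OF inj]) (simp add: split_beta comp_def)
  finally show ?thesis by simp
qed

end

lemma (in white_noise) block_mass_le:
  assumes u: "continuous_on {0..pi} u"
  shows "block_mass (fcos u) m \<le> real m * msq u"
proof -
  have "block_mass (fcos u) m = (\<Sum>r<m. \<Sum>h = - int r..int r. (fcos u h)\<^sup>2)"
    unfolding block_mass_def by (rule sum_toeplitz)
  also have "\<dots> \<le> (\<Sum>r<m. msq u)"
    by (intro sum_mono fcos_bessel u) simp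
  finally show ?thesis by simp
qed

lemma (in white_noise) block_mass_limit:
  assumes u: "continuous_on {0..pi} u"
  shows "(\<lambda>p. block_mass (fcos u) p / real p) \<longlonglongrightarrow> msq u"
proof -
  have "block_mass (fcos u) m = (\<Sum>r<m. \<Sum>h = - int r..int r. (fcos u h)\<^sup>2)" for m
    unfolding block_mass_def by (rule sum_toeplitz)
  then show ?thesis using cesaro [OF fcos_parseval [OF u]] by simp
qed

section \<open>Convergence of the step processes\<close>

lemma weak_conv_m_compose:
  assumes "weak_conv_m \<mu> \<nu>" and "filterlim f sequentially sequentially"
  shows "weak_conv_m (\<lambda>N. \<mu> (f N)) \<nu>"
  unfolding weak_conv_m_def weak_conv_def
proof (intro allI impI)
  fix x assume "isCont (cdf \<nu>) x"
  then have "(\<lambda>m. cdf (\<mu> m) x) \<longlonglongrightarrow> cdf \<nu> x"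
    using assms(1) by (simp add: weak_conv_m_def weak_conv_def)
  then show "(\<lambda>N. cdf (\<mu> (f N)) x) \<longlonglongrightarrow> cdf \<nu> x"
    using assms(2) by (rule filterlim_compose)
qed

lemma div_limit:
  assumes "0 < k"
  shows "(\<lambda>N. real (N div k) / real N) \<longlonglongrightarrow> 1 / real k"
proof (rule tendsto_sandwich)
  have bounds: "real N / real k - 1 \<le> real (N div k)" "real (N div k) \<le> real N / real k" for N
  proof -
    have "N = k * (N div k) + N mod k" by simp
    then have "real N = real k * real (N div k) + real (N mod k)"
      by (metis of_nat_add of_nat_mult)
    moreover have "real (N mod k) \<le> real k" using assms by (simp add: less_imp_le)
    ultimately show "real N / real k - 1 \<le> real (N div k)" "real (N div k) \<le> real N / real k"
      using assms by (simp_all add: field_simps)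
  qed
  show "\<forall>\<^sub>F N in sequentially. 1 / real k - 1 / real N \<le> real (N div k) / real N"
    using eventually_gt_at_top [of 0]
  proof eventually_elim
    case (elim N)
    have "(real N / real k - 1) / real N \<le> real (N div k) / real N"
      by (rule divide_right_mono [OF bounds(1)]) simp
    then show ?case using elim by (simp add: diff_divide_distrib)
  qed
  show "\<forall>\<^sub>F N in sequentially. real (N div k) / real N \<le> 1 / real k"
    using eventually_gt_at_top [of 0]
  proof eventually_elim
    case (elim N)
    have "real (N div k) / real N \<le> real N / real k / real N"
      by (rule divide_right_mono [OF bounds(2)]) simp
    then show ?case using elim by simp
  qed
  have "(\<lambda>N. 1 / real k - 1 / real N) \<longlonglongrightarrow> 1 / real k - 0"
    by (intro tendsto_diff tendsto_const lim_const_over_n)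
  then show "(\<lambda>N. 1 / real k - 1 / real N) \<longlonglongrightarrow> 1 / real k" by simp
qed simp

lemma filterlim_div_at_top:
  assumes "0 < k"
  shows "filterlim (\<lambda>N. N div k) at_top sequentially"
  unfolding filterlim_at_top
proof
  fix Z
  have "Z \<le> N div k" if "Z * k \<le> N" for N
    using that assms by (simp add: less_eq_div_iff_mult_less_eq)
  then show "\<forall>\<^sub>F N in sequentially. Z \<le> N div k"
    by (auto simp: eventually_sequentially)
qed

text \<open>Block 0 carries the increment over \<open>[0, 1/2]\<close>, the blocks \<open>1, \<dots>, n\<close> those over the cells of \<open>[1/2, 1]\<close>.\<close>

definition grid_block :: "nat \<Rightarrow> nat \<Rightarrow> nat \<Rightarrow> nat set" where
  "grid_block n q i = (if i = 0 then {..<n * q} else {(n + i - 1) * q..<(n + i) * q})"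

lemma finite_grid_block [simp]: "finite (grid_block n q i)"
  by (simp add: grid_block_def)

lemma card_grid_block: "card (grid_block n q i) = (if i = 0 then n * q else q)"
  by (cases i) (simp_all add: grid_block_def algebra_simps)

lemma sum_grid_block:
  "(\<Sum>i\<le>k. \<Sum>b\<in>grid_block n q i. f b) = (\<Sum>b<(n + k) * q. f b)" for f :: "nat \<Rightarrow> real"
proof (induction k)
  case 0
  then show ?case by (simp add: grid_block_def)
next
  case (Suc k)
  have "(\<Sum>b<(n + Suc k) * q. f b) = (\<Sum>b\<in>{0..<(n + k) * q}. f b) + (\<Sum>b\<in>{(n + k) * q..<(n + Suc k) * q}. f b)"
    unfolding lessThan_atLeast0 by (rule sum.atLeastLessThan_concat [symmetric]) auto
  with Suc show ?case by (simp add: grid_block_def lessThan_atLeast0)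
qed

lemma disjoint_grid_block: "disjoint_family (grid_block n q)"
proof -
  have "grid_block n q i \<inter> grid_block n q j = {}" if "i < j" for i j
  proof -
    have "x < (n + i) * q" if "x \<in> grid_block n q i" for x
      using that by (auto simp: grid_block_def split: if_splits)
    moreover have "(n + i) * q \<le> x" if "x \<in> grid_block n q j" for x
    proof -
      have "(n + i) * q \<le> (n + j - 1) * q" using \<open>i < j\<close> by (intro mult_le_mono1) simp
      also have "\<dots> \<le> x" using that \<open>i < j\<close> by (simp add: grid_block_def)
      finally show ?thesis .
    qed
    ultimately show ?thesis by (meson disjoint_iff leD)
  qed
  then show ?thesis
    unfolding disjoint_family_on_def by (metis Int_commute linorder_neqE_nat)
qed

lemma grid_index_measurable [measurable]: "grid_index n \<in> measurable borel (count_space UNIV)"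
  unfolding grid_index_def [abs_def] by measurable

lemma step_process_cong:
  assumes "s \<le> 1" "\<And>i. i \<le> n \<Longrightarrow> z i = z' i"
  shows "step_process n c s z = step_process n c s z'"
  unfolding step_process_def using assms grid_index_le [of s n]
  by (intro arg_cong [where f = "\<lambda>x. 1 / s * x"] sum.cong) auto

text \<open>The number of summands depends on \<open>s\<close>; as a sum over all i \<le> n with
  cut-off coefficients, the process has jointly measurable terms.\<close>

lemma measurable_step_process:
  assumes Y [measurable]: "\<And>i. i \<in> {..n} \<Longrightarrow> Y i \<in> borel_measurable Q"
  shows "measurable_process Q (\<lambda>s \<omega>. step_process n c s (\<lambda>i. Y i \<omega>))"
  unfolding measurable_process_def
proof
  show "(\<lambda>\<omega>. step_process n c 1 (\<lambda>i. Y i \<omega>)) \<in> borel_measurable Q"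
    unfolding step_process_def by (simp add: Y)
  have "(\<lambda>(s, \<omega>). indicator {1/2..1} s * step_process n c s (\<lambda>i. Y i \<omega>)) =
      (\<lambda>p. \<Sum>i\<le>n. indicator {1/2..1} (fst p) * (1 / fst p) * ((if i \<le> grid_index n (fst p) then c i else 0) * Y i (snd p)))"
  proof (rule ext)
    fix p :: "real \<times> 'a"
    show "(case p of (s, \<omega>) \<Rightarrow> indicator {1/2..1} s * step_process n c s (\<lambda>i. Y i \<omega>)) =
      (\<Sum>i\<le>n. indicator {1/2..1} (fst p) * (1 / fst p) * ((if i \<le> grid_index n (fst p) then c i else 0) * Y i (snd p)))"
    proof (cases "fst p \<in> {1/2..1}")
      case True
      then have le: "grid_index n (fst p) \<le> n" by (intro grid_index_le) auto
      have "(\<Sum>i\<le>grid_index n (fst p). c i * Y i (snd p)) =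
          (\<Sum>i\<le>n. (if i \<le> grid_index n (fst p) then c i else 0) * Y i (snd p))"
        using le by (intro sum.mono_neutral_cong_left) auto
      then show ?thesis using True
        by (simp only: step_process_def split_beta indicator_simps sum_distrib_left [symmetric] mult_1 mult.assoc)
    next
      case False
      then have "(indicator {1/2..1} (fst p) :: real) = 0" by (rule indicator_simps)
      then show ?thesis by (simp only: split_beta mult_zero_left sum.neutral_const)
    qed
  qed
  also have "\<dots> \<in> borel_measurable (lborel \<Otimes>\<^sub>M Q)"
  proof (rule borel_measurable_sum)
    fix i assume i: "i \<in> {..n}"
    note [measurable] = Y [OF i]
    show "(\<lambda>p. indicator {1/2..1} (fst p) * (1 / fst p) * ((if i \<le> grid_index n (fst p) then c i else 0) * Y i (snd p)))
        \<in> borel_measurable (lborel \<Otimes>\<^sub>M Q)"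
      by measurable
  qed
  finally show "(\<lambda>(s, \<omega>). indicator {1/2..1} s * step_process n c s (\<lambda>i. Y i \<omega>)) \<in> borel_measurable (lborel \<Otimes>\<^sub>M Q)" .
qed

lemma step_process_tendsto:
  assumes "s \<le> 1" and c: "\<And>i. i \<le> n \<Longrightarrow> (\<lambda>N. c N i) \<longlonglongrightarrow> c' i" and z: "\<And>i. i \<le> n \<Longrightarrow> (\<lambda>N. z N i) \<longlonglongrightarrow> z' i"
  shows "(\<lambda>N. step_process n (c N) s (z N)) \<longlonglongrightarrow> step_process n c' s z'"
  unfolding step_process_def using grid_index_le [OF assms(1), of n]
  by (intro tendsto_intros c z) auto

lemma step_process_bound:
  assumes "s \<in> {1/2..1}"
  shows "\<bar>step_process n c s z\<bar> \<le> 2 * (\<Sum>i\<le>n. \<bar>c i * z i\<bar>)"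
proof -
  have "\<bar>\<Sum>i\<le>grid_index n s. c i * z i\<bar> \<le> (\<Sum>i\<le>grid_index n s. \<bar>c i * z i\<bar>)" by (rule sum_abs)
  also have "\<dots> \<le> (\<Sum>i\<le>n. \<bar>c i * z i\<bar>)"
    using assms grid_index_le [of s n] by (intro sum_mono2) auto
  finally have "\<bar>1 / s\<bar> * \<bar>\<Sum>i\<le>grid_index n s. c i * z i\<bar> \<le> 2 * (\<Sum>i\<le>n. \<bar>c i * z i\<bar>)"
    using assms by (intro mult_mono) (auto simp: field_simps)
  then show ?thesis by (simp only: step_process_def abs_mult)
qed

text \<open>Dominated convergence in \<open>s\<close>: convergent coordinates are bounded uniformly
  in \<open>N\<close>, and 1 / s \<le> 2 on the interval. This is the continuity that
  \<open>PiM_weak_conv_integral\<close> asks for.\<close>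

lemma sq_deviation_step_tendsto:
  assumes c: "\<And>i. i \<le> n \<Longrightarrow> (\<lambda>N. c N i) \<longlonglongrightarrow> c' i" and z: "\<And>i. i \<le> n \<Longrightarrow> (\<lambda>N. z N i) \<longlonglongrightarrow> z' i"
  shows "(\<lambda>N. sq_deviation (step_process n (c N)) (z N)) \<longlonglongrightarrow> sq_deviation (step_process n c') z'"
proof -
  have "(\<lambda>N. \<Sum>i\<le>n. \<bar>c N i * z N i\<bar>) \<longlonglongrightarrow> (\<Sum>i\<le>n. \<bar>c' i * z' i\<bar>)"
    by (intro tendsto_intros c z) auto
  then have "Bseq (\<lambda>N. \<Sum>i\<le>n. \<bar>c N i * z N i\<bar>)" by (intro convergent_imp_Bseq convergentI)
  then obtain C where C: "\<And>N. norm (\<Sum>i\<le>n. \<bar>c N i * z N i\<bar>) \<le> C" by (auto simp: Bseq_def)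
  have meas: "(\<lambda>s. indicator {1/2..1} s * (step_process n d s y - step_process n d 1 y)\<^sup>2) \<in> borel_measurable lborel"
    for d y :: "nat \<Rightarrow> real"
  proof -
    \<comment> \<open>A deterministic path is read as a process over a one-point space, so that the
      result on joint measurability applies.\<close>
    have "(\<lambda>(s, \<omega>). indicator {1/2..1} s * (step_process n d s y - step_process n d 1 y)\<^sup>2)
        \<in> borel_measurable (lborel \<Otimes>\<^sub>M (count_space {()}))"
      by (rule measurable_sq_deviation_integrand [OF measurable_step_process [where Y = "\<lambda>i _. y i"]]) simp
    then have "(\<lambda>s. (\<lambda>(s, \<omega>). indicator {1/2..1} s * (step_process n d s y - step_process n d 1 y)\<^sup>2) (s, ()))
        \<in> borel_measurable lborel"
      by (rule measurable_compose [rotated]) simp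
    then show ?thesis by simp
  qed
  have "(\<lambda>N. LINT s|lborel. indicator {1/2..1} s * (step_process n (c N) s (z N) - step_process n (c N) 1 (z N))\<^sup>2) \<longlonglongrightarrow>
      (LINT s|lborel. indicator {1/2..1} s * (step_process n c' s z' - step_process n c' 1 z')\<^sup>2)"
  proof (rule integral_dominated_convergence)
    show "integrable lborel (\<lambda>s. indicator {1/2..1::real} s * (4 * C)\<^sup>2)"
      by (intro integrable_mult_left integrable_real_indicator emeasure_bounded_finite) auto
    show "AE s in lborel. (\<lambda>N. indicator {1/2..1} s * (step_process n (c N) s (z N) - step_process n (c N) 1 (z N))\<^sup>2) \<longlonglongrightarrow>
        indicator {1/2..1} s * (step_process n c' s z' - step_process n c' 1 z')\<^sup>2"
    proof (rule AE_I2)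
      fix s :: real
      show "(\<lambda>N. indicator {1/2..1} s * (step_process n (c N) s (z N) - step_process n (c N) 1 (z N))\<^sup>2) \<longlonglongrightarrow>
        indicator {1/2..1} s * (step_process n c' s z' - step_process n c' 1 z')\<^sup>2"
      proof (cases "s \<in> {1/2..1}")
        case True
        then have "s \<le> 1" by simp
        then show ?thesis
          by (intro tendsto_intros step_process_tendsto c z) auto
      next
        case False
        then have "(indicator {1/2..1} s :: real) = 0" by (rule indicator_simps)
        then show ?thesis by (simp only: mult_zero_left tendsto_const)
      qed
    qed
    fix N
    show "AE s in lborel. norm (indicator {1/2..1} s * (step_process n (c N) s (z N) - step_process n (c N) 1 (z N))\<^sup>2) \<le>
        indicator {1/2..1} s * (4 * C)\<^sup>2"
    proof (rule AE_I2)
      fix s :: real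
      have b: "\<bar>step_process n (c N) t (z N)\<bar> \<le> 2 * C" if "t \<in> {1/2..1}" for t
        using step_process_bound [OF that, of n "c N" "z N"] C [of N] by simp
      show "norm (indicator {1/2..1} s * (step_process n (c N) s (z N) - step_process n (c N) 1 (z N))\<^sup>2) \<le>
        indicator {1/2..1} s * (4 * C)\<^sup>2"
      proof (cases "s \<in> {1/2..1}")
        case True
        have "\<bar>step_process n (c N) s (z N) - step_process n (c N) 1 (z N)\<bar> \<le> 4 * C"
          using b [OF True] b [of 1] by simp
        then have "\<bar>step_process n (c N) s (z N) - step_process n (c N) 1 (z N)\<bar>\<^sup>2 \<le> (4 * C)\<^sup>2"
          by (intro power_mono) auto
        then show ?thesis using True by simp
      next
        case False
        then have "(indicator {1/2..1} s :: real) = 0" by (rule indicator_simps)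
        then show ?thesis by (simp only: mult_zero_left norm_zero order_refl)
      qed
    qed
  qed (rule meas)+
  then show ?thesis by (simp only: sq_deviation_def set_lebesgue_integral_def real_scaleR_def)
qed

section \<open>Normalised sums over grid groups and their limit\<close>

context white_noise
begin

text \<open>For even \<open>a\<close>, \<open>2 * block_mass a p\<close> is the variance of one
  block, so a non-empty group of non-zero mass has variance 1; an empty group gives 0.\<close>

definition grid_sum :: "(int \<Rightarrow> real) \<Rightarrow> nat \<Rightarrow> nat \<Rightarrow> nat \<Rightarrow> nat \<Rightarrow> 'a \<Rightarrow> real" where
  "grid_sum a p n q i \<omega> = 1 / sqrt (real (card (grid_block n q i)) * (2 * block_mass a p)) * (\<Sum>b\<in>grid_block n q i. block_form a p b \<omega>)"

text \<open>Restores the scale removed in \<open>grid_sum\<close> and divides by \<surd>N. With q =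
  N div (2 p n), a total of 2 n q blocks of length \<open>p\<close> fit into \<open>N\<close>
  observations, half of them before time 1/2.\<close>

definition grid_coeff :: "(int \<Rightarrow> real) \<Rightarrow> nat \<Rightarrow> nat \<Rightarrow> nat \<Rightarrow> nat \<Rightarrow> real" where
  "grid_coeff a p n N i = sqrt (real (card (grid_block n (N div (2 * p * n)) i)) * (2 * block_mass a p) / real N)"

lemma grid_sum_measurable [measurable]: "grid_sum a p n q i \<in> borel_measurable M"
  unfolding grid_sum_def by measurable

lemma step_grid_sum:
  assumes v: "0 < block_mass a p"
  shows "step_process n (grid_coeff a p n N) s (\<lambda>i. grid_sum a p n (N div (2 * p * n)) i \<omega>) =
    1 / (s * sqrt (real N)) * (\<Sum>b<(n + grid_index n s) * (N div (2 * p * n)). block_form a p b \<omega>)"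
proof -
  let ?q = "N div (2 * p * n)"
  have coeff_term: "grid_coeff a p n N i * grid_sum a p n ?q i \<omega> = 1 / sqrt (real N) * (\<Sum>b\<in>grid_block n ?q i. block_form a p b \<omega>)" for i
  proof (cases "card (grid_block n ?q i) = 0")
    case True
    then have "grid_block n ?q i = {}" by simp
    then show ?thesis by (simp add: grid_coeff_def grid_sum_def)
  next
    case False
    define k where "k = card (grid_block n ?q i)"
    have "k \<noteq> 0" using False by (simp add: k_def)
    with v have "real k * (2 * block_mass a p) \<noteq> 0" by simp
    then show ?thesis
      unfolding grid_coeff_def grid_sum_def k_def [symmetric] real_sqrt_divide by (simp del: mult_eq_0_iff)
  qed
  show ?thesis
    unfolding step_process_def coeff_term sum_distrib_left [symmetric] sum_grid_block by simp
qed

text \<open>The number of blocks in group \<open>i\<close>, divided by \<open>N\<close>, tends to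
  the width of the cell over the block length.\<close>

lemma grid_coeff_limit:
  assumes p: "0 < p" and n: "0 < n" 
  shows "(\<lambda>N. grid_coeff a p n N i) \<longlonglongrightarrow> sqrt (2 * block_mass a p / real p) * sqrt (grid_width n i)"
proof -
  have q: "(\<lambda>N. real (N div (2 * p * n)) / real N) \<longlonglongrightarrow> 1 / real (2 * p * n)"
    using p n by (intro div_limit) simp
  have "(\<lambda>N. real (card (grid_block n (N div (2 * p * n)) i)) / real N) \<longlonglongrightarrow> grid_width n i / real p"
  proof (cases "i = 0")
    case True
    have "(\<lambda>N. real n * (real (N div (2 * p * n)) / real N)) \<longlonglongrightarrow> real n * (1 / real (2 * p * n))"
      by (intro tendsto_mult tendsto_const q)
    then show ?thesis using True n p by (simp add: card_grid_block grid_width_def)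
  next
    case False
    then show ?thesis using q by (simp add: card_grid_block grid_width_def mult_ac)
  qed
  then have "(\<lambda>N. sqrt (real (card (grid_block n (N div (2 * p * n)) i)) / real N * (2 * block_mass a p))) \<longlonglongrightarrow>
      sqrt (grid_width n i / real p * (2 * block_mass a p))"
    by (intro tendsto_real_sqrt tendsto_mult_right)
  then show ?thesis
    by (simp add: grid_coeff_def real_sqrt_mult [symmetric] mult_ac)
qed

text \<open>For fixed \<open>p\<close> and \<open>n\<close> every group grows with \<open>N\<close>,
  and its sum has the law of a sum over an initial segment of blocks, to which the classical theorem
  applies.\<close>

lemma grid_sum_clt:
  assumes even: "\<And>h. a (- h) = a h" and v: "0 < block_mass a p" and p: "0 < p" and n: "0 < n"
  shows "weak_conv_m (\<lambda>N. distr M borel (grid_sum a p n (N div (2 * p * n)) i)) std_normal_distribution"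
proof -
  let ?\<sigma> = "sqrt (2 * block_mass a p)"
  let ?k = "\<lambda>N. card (grid_block n (N div (2 * p * n)) i)"
  have clt: "weak_conv_m (\<lambda>m. distr M borel (\<lambda>\<omega>. (\<Sum>b<m. block_form a p b \<omega>) / sqrt (real m * ?\<sigma>\<^sup>2))) std_normal_distribution"
  proof (rule central_limit_theorem_zero_mean)
    show "indep_vars (\<lambda>i. borel) (block_form a p) UNIV" by (rule indep_block_form)
    show "expectation (block_form a p b) = 0" for b by (rule expectation_block_form)
    show "0 < ?\<sigma>" using v by simp
    show "integrable M (\<lambda>\<omega>. (block_form a p b \<omega>)\<^sup>2)" for b
      using square_integrable_block_form by (simp add: square_integrable_def)
    show "variance (block_form a p b) = ?\<sigma>\<^sup>2" for b
      using v by (simp add: expectation_block_form expectation_block_form_square [where a = a, OF even])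
    show "distr M borel (block_form a p b) = distr M borel (block_form a p 0)" for b
      by (rule distr_block_form)
  qed
  have "filterlim ?k sequentially sequentially"
  proof (rule filterlim_at_top_mono [OF filterlim_div_at_top [of "2 * p * n"]])
    show "\<forall>\<^sub>F N in sequentially. N div (2 * p * n) \<le> ?k N"
      using n by (intro always_eventually allI) (simp add: card_grid_block)
  qed (use p n in simp)
  from weak_conv_m_compose [OF clt this]
  have "weak_conv_m (\<lambda>N. distr M borel (\<lambda>\<omega>. (\<Sum>b<?k N. block_form a p b \<omega>) / sqrt (real (?k N) * ?\<sigma>\<^sup>2))) std_normal_distribution" .
  also have "(\<lambda>N. distr M borel (\<lambda>\<omega>. (\<Sum>b<?k N. block_form a p b \<omega>) / sqrt (real (?k N) * ?\<sigma>\<^sup>2))) =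
      (\<lambda>N. distr M borel (grid_sum a p n (N div (2 * p * n)) i))"
  proof
    fix N
    have "distr M borel (grid_sum a p n (N div (2 * p * n)) i) =
        distr M borel (\<lambda>\<omega>. 1 / sqrt (real (?k N) * (2 * block_mass a p)) * (\<Sum>b<?k N. block_form a p b \<omega>))"
      unfolding grid_sum_def [abs_def]
      by (rule iid_sum_distr [OF indep_block_form distr_block_form]) simp
    then show "distr M borel (\<lambda>\<omega>. (\<Sum>b<?k N. block_form a p b \<omega>) / sqrt (real (?k N) * ?\<sigma>\<^sup>2)) =
        distr M borel (grid_sum a p n (N div (2 * p * n)) i)"
      using v by simp
  qed
  finally show ?thesis .
qed

lemma indep_grid_sum: "indep_vars (\<lambda>_. borel) (grid_sum a p n q) UNIV"
proof -
  have ind: "indep_vars (\<lambda>i. PiM (grid_block n q i) (\<lambda>_. borel)) (\<lambda>i \<omega>. restrict (\<lambda>b. block_form a p b \<omega>) (grid_block n q i)) UNIV"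
    by (rule indep_vars_restrict [OF indep_block_form _ disjoint_grid_block]) auto
  let ?F = "\<lambda>i x. 1 / sqrt (real (card (grid_block n q i)) * (2 * block_mass a p)) * (\<Sum>b\<in>grid_block n q i. x b)"
  have "?F i \<in> borel_measurable (PiM (grid_block n q i) (\<lambda>_. borel))" for i
    by (intro borel_measurable_times borel_measurable_const borel_measurable_sum measurable_component_singleton)
  from indep_vars_compose2 [OF ind this]
  have "indep_vars (\<lambda>_. borel) (\<lambda>i \<omega>. ?F i (restrict (\<lambda>b. block_form a p b \<omega>) (grid_block n q i))) UNIV" .
  also have "(\<lambda>i \<omega>. ?F i (restrict (\<lambda>b. block_form a p b \<omega>) (grid_block n q i))) = grid_sum a p n q"
    unfolding grid_sum_def by (intro ext) simp
  finally show ?thesis .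
qed

text \<open>Both sides evaluate one functional of n + 1 independent coordinates: grid sums with
  coefficients depending on \<open>N\<close>, and standardised Brownian increments with the limiting
  coefficients. So convergence of each coordinate and of each coefficient is enough.\<close>

lemma step_functional_limit:
  fixes B :: "real \<Rightarrow> 'b \<Rightarrow> real" and g :: "real \<Rightarrow> real \<Rightarrow> real"
  assumes B: "brownian P B" and even: "\<And>h. a (- h) = a h" and v: "0 < block_mass a p" and p: "0 < p" and n: "0 < n"
    and L: "0 \<le> L" and lip: "\<And>a b c d. \<bar>g a c - g b d\<bar> \<le> L * (\<bar>a - b\<bar> + \<bar>c - d\<bar>)"
    and bnd: "\<And>a c. \<bar>g a c\<bar> \<le> 1" and meas: "case_prod g \<in> borel_measurable borel"
  defines "S \<equiv> \<lambda>N s \<omega>. step_process n (grid_coeff a p n N) s (\<lambda>i. grid_sum a p n (N div (2 * p * n)) i \<omega>)"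
  defines "S' \<equiv> \<lambda>s \<omega>. step_process n (\<lambda>i. sqrt (2 * block_mass a p / real p) * sqrt (grid_width n i)) s
      (\<lambda>i. brownian.increment B n i \<omega>)"
  shows "(\<lambda>N. \<integral>\<omega>. g (S N 1 \<omega>) (sq_deviation (S N) \<omega>) \<partial>M) \<longlonglongrightarrow> (\<integral>\<omega>. g (S' 1 \<omega>) (sq_deviation S' \<omega>) \<partial>P)"
proof -
  interpret B: brownian P B by (rule B)
  let ?I = "{..n}"
  let ?q = "\<lambda>N. N div (2 * p * n)"
  let ?Y = "\<lambda>N i. grid_sum a p n (?q N) i"
  let ?c' = "\<lambda>i. sqrt (2 * block_mass a p / real p) * sqrt (grid_width n i)"
  let ?PB = "PiM ?I (\<lambda>_. borel) :: (nat \<Rightarrow> real) measure"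
  define \<phi> where "\<phi> c z = g (step_process n c 1 z) (sq_deviation (step_process n c) z)" for c z
  have mproc: "measurable_process ?PB (step_process n c)" for c
    using measurable_step_process [of n "\<lambda>i z. z i" ?PB c] by simp
  have m\<phi>: "\<phi> c \<in> borel_measurable ?PB" for c
  proof -
    have "step_process n c 1 \<in> borel_measurable ?PB" "sq_deviation (step_process n c) \<in> borel_measurable ?PB"
      using mproc [of c] measurable_sq_deviation [OF mproc [of c]] by (auto simp: measurable_process_def)
    from measurable_compose [OF borel_measurable_Pair [OF this] meas] show ?thesis
      unfolding \<phi>_def by simp
  qed
  \<comment> \<open>The functional sees only the coordinates 0 to \<open>n\<close>, so processes
    over \<omega> can be read as points of the product space.\<close>
  have red: "\<phi> c (\<lambda>i\<in>?I. y i \<omega>) = g (step_process n c 1 (\<lambda>i. y i \<omega>)) (sq_deviation (\<lambda>s \<omega>. step_process n c s (\<lambda>i. y i \<omega>)) \<omega>)"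
    for c and y :: "nat \<Rightarrow> 'c \<Rightarrow> real" and \<omega>
  proof -
    have st: "step_process n c s (\<lambda>i\<in>?I. y i \<omega>) = step_process n c s (\<lambda>i. y i \<omega>)" if "s \<le> 1" for s
      by (rule step_process_cong [OF that]) simp
    have "sq_deviation (step_process n c) (\<lambda>i\<in>?I. y i \<omega>) = sq_deviation (\<lambda>s \<omega>. step_process n c s (\<lambda>i. y i \<omega>)) \<omega>"
      unfolding sq_deviation_def by (intro set_lebesgue_integral_cong) (auto simp: st)
    then show ?thesis by (simp add: \<phi>_def st)
  qed
  have lawM: "PiM ?I (\<lambda>i. distr M borel (?Y N i)) = distr M ?PB (\<lambda>\<omega>. \<lambda>i\<in>?I. ?Y N i \<omega>)" for N
  proof -
    have "indep_vars (\<lambda>_. borel) (?Y N) ?I"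
      by (rule indep_vars_subset [OF indep_grid_sum subset_UNIV])
    then show ?thesis
      by (subst (asm) indep_vars_iff_distr_eq_PiM') auto
  qed
  have "(\<lambda>N. \<integral>z. \<phi> (grid_coeff a p n N) z \<partial>(PiM ?I (\<lambda>i. distr M borel (?Y N i)))) \<longlonglongrightarrow>
      (\<integral>z. \<phi> ?c' z \<partial>(PiM ?I (\<lambda>_. std_normal_distribution)))"
  proof (rule PiM_weak_conv_integral)
    show "real_distribution (distr M borel (?Y N i))" for N i
      by (rule real_distribution_distr) measurable
    show "real_distribution std_normal_distribution" by (rule real_dist_normal_dist)
    show "weak_conv_m (\<lambda>N. distr M borel (?Y N i)) std_normal_distribution" for i
      by (rule grid_sum_clt [OF even v p n])
    show "\<bar>\<phi> (grid_coeff a p n N) z\<bar> \<le> 1" for N z unfolding \<phi>_def by (rule bnd)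
    fix z :: "nat \<Rightarrow> nat \<Rightarrow> real" and z'
    assume z: "\<And>i. i \<in> ?I \<Longrightarrow> (\<lambda>N. z N i) \<longlonglongrightarrow> z' i"
    have 1: "(\<lambda>N. step_process n (grid_coeff a p n N) 1 (z N)) \<longlonglongrightarrow> step_process n ?c' 1 z'"
      by (rule step_process_tendsto) (auto intro: z grid_coeff_limit [OF p n])
    have 2: "(\<lambda>N. sq_deviation (step_process n (grid_coeff a p n N)) (z N)) \<longlonglongrightarrow> sq_deviation (step_process n ?c') z'"
      by (rule sq_deviation_step_tendsto) (auto intro: z grid_coeff_limit [OF p n])
    have "(\<lambda>N. L * (\<bar>step_process n (grid_coeff a p n N) 1 (z N) - step_process n ?c' 1 z'\<bar>
        + \<bar>sq_deviation (step_process n (grid_coeff a p n N)) (z N) - sq_deviation (step_process n ?c') z'\<bar>)) \<longlonglongrightarrow>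
        L * (\<bar>step_process n ?c' 1 z' - step_process n ?c' 1 z'\<bar> + \<bar>sq_deviation (step_process n ?c') z' - sq_deviation (step_process n ?c') z'\<bar>)"
      by (intro tendsto_intros 1 2)
    then have "(\<lambda>N. L * (\<bar>step_process n (grid_coeff a p n N) 1 (z N) - step_process n ?c' 1 z'\<bar>
        + \<bar>sq_deviation (step_process n (grid_coeff a p n N)) (z N) - sq_deviation (step_process n ?c') z'\<bar>)) \<longlonglongrightarrow> 0"
      by simp
    then have "(\<lambda>N. \<phi> (grid_coeff a p n N) (z N) - \<phi> ?c' z') \<longlonglongrightarrow> 0"
      by (rule Lim_null_comparison [rotated]) (simp add: \<phi>_def lip)
    then show "(\<lambda>N. \<phi> (grid_coeff a p n N) (z N)) \<longlonglongrightarrow> \<phi> ?c' z'" by (rule LIM_zero_cancel)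
  qed (auto intro: m\<phi>)
  moreover have "(\<integral>z. \<phi> (grid_coeff a p n N) z \<partial>(PiM ?I (\<lambda>i. distr M borel (?Y N i)))) = (\<integral>\<omega>. g (S N 1 \<omega>) (sq_deviation (S N) \<omega>) \<partial>M)" for N
    unfolding lawM S_def red [symmetric] by (rule integral_distr) (measurable, rule m\<phi>)
  moreover have "(\<integral>z. \<phi> ?c' z \<partial>(PiM ?I (\<lambda>_. std_normal_distribution))) = (\<integral>\<omega>. g (S' 1 \<omega>) (sq_deviation S' \<omega>) \<partial>P)"
  proof -
    have [measurable]: "B.increment n i \<in> borel_measurable P" for i by (rule B.increment_measurable [OF n])
    show ?thesis
      unfolding B.increments_law [OF n, symmetric] S'_def red [symmetric] by (rule integral_distr) (measurable, rule m\<phi>)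
  qed
  ultimately show ?thesis by (simp only:)
qed

end

section \<open>Approximation by step processes\<close>

text \<open>Two roundings shorten the covered range: \<open>s\<close> is lowered to a grid point, at
  a cost of at most N / (2 n), and \<open>N\<close> to a multiple of 2 p n, at a cost of at most 2 n
  p.\<close>

lemma grid_block_count:
  fixes N :: nat
  assumes p: "0 < p" and n: "0 < n" and s: "s \<in> {1/2..1}"
  defines "k \<equiv> (n + grid_index n s) * (N div (2 * p * n))" and "m \<equiv> nat \<lfloor>s * real N\<rfloor>"
  shows "k * p \<le> m" and "real N * (s - 1 / (2 * real n)) - 2 * real n * real p \<le> real k * real p"
proof -
  let ?i = "grid_index n s" and ?q = "N div (2 * p * n)"
  let ?g = "grid_point n ?i"
  have i: "?i \<le> n" using s by (intro grid_index_le) simp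
  have g: "?g \<le> s" "s < ?g + 1 / (2 * real n)" using grid_point_index [OF n s] by auto
  \<comment> \<open>Counted from time 0, a grid point closes n + i cells of length 1 / (2
    n).\<close>
  have gi: "real (n + ?i) = 2 * real n * ?g" using n by (simp add: grid_point_def field_simps)
  have "?q * (2 * p * n) \<le> N" by (rule div_times_less_eq_dividend)
  then have q: "real ?q * (2 * real p * real n) \<le> real N"
    by (metis of_nat_le_iff of_nat_mult of_nat_numeral)
  have "N < ?q * (2 * p * n) + 2 * p * n"
    using dividend_less_div_times [of "2 * p * n" N] p n by (simp add: ac_simps)
  then have "real N < real (?q * (2 * p * n) + 2 * p * n)" by (simp only: of_nat_less_iff)
  then have q': "real N - 2 * real p * real n \<le> real ?q * (2 * real p * real n)" by simp
  have kp: "real k * real p = ?g * (real ?q * (2 * real p * real n))"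
    unfolding k_def of_nat_mult gi by simp
  have g0: "0 \<le> ?g" "?g \<le> 1" using grid_point_in [OF n i] by auto
  have "real (k * p) \<le> s * real N"
  proof -
    have "real (k * p) \<le> ?g * real N" unfolding of_nat_mult kp by (rule mult_left_mono [OF q g0(1)])
    also have "\<dots> \<le> s * real N" by (rule mult_right_mono [OF g(1)]) simp
    finally show ?thesis .
  qed
  then show "k * p \<le> m" unfolding m_def by (rule le_nat_floor)
  have "real N * (s - 1 / (2 * real n)) - 2 * real n * real p \<le> real N * ?g - 2 * real n * real p * ?g"
  proof (rule diff_mono)
    show "real N * (s - 1 / (2 * real n)) \<le> real N * ?g" using g by (intro mult_left_mono) auto
    show "2 * real n * real p * ?g \<le> 2 * real n * real p" using g0 by (intro mult_right_le_one_le) auto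
  qed
  also have "\<dots> = ?g * (real N - 2 * real p * real n)" by (simp add: algebra_simps)
  also have "\<dots> \<le> real k * real p" unfolding kp by (rule mult_left_mono [OF q' g0(1)])
  finally show "real N * (s - 1 / (2 * real n)) - 2 * real n * real p \<le> real k * real p" .
qed

context white_noise
begin

text \<open>The complete blocks from \<open>k\<close> on are bounded separately by their own mass,
  which then combines with the mass outside the blocks; splitting the square turns the factor 2 into
  4.\<close>

lemma toeplitz_partial_block_diff:
  assumes p: "0 < p" and k: "k \<le> m div p"
  shows "expectation (\<lambda>\<omega>. (toeplitz_form a m \<omega> - (\<Sum>b<k. block_form a p b \<omega>))\<^sup>2) \<le>
    4 * (block_mass a m - real k * block_mass a p)"
proof -
  let ?q = "m div p"
  have split: "toeplitz_form a m \<omega> - (\<Sum>b<k. block_form a p b \<omega>) =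
      (toeplitz_form a m \<omega> - (\<Sum>b<?q. block_form a p b \<omega>)) + (\<Sum>b\<in>{k..<?q}. block_form a p b \<omega>)" for \<omega>
    using sum.atLeastLessThan_concat [of 0 k ?q "\<lambda>b. block_form a p b \<omega>"] k by (simp add: lessThan_atLeast0)
  have "expectation (\<lambda>\<omega>. (toeplitz_form a m \<omega> - (\<Sum>b<k. block_form a p b \<omega>))\<^sup>2) \<le>
      2 * expectation (\<lambda>\<omega>. (toeplitz_form a m \<omega> - (\<Sum>b<?q. block_form a p b \<omega>))\<^sup>2)
      + 2 * expectation (\<lambda>\<omega>. (\<Sum>b\<in>{k..<?q}. block_form a p b \<omega>)\<^sup>2)"
    unfolding split
    by (intro integral_square_add_le square_integrable_diff square_integrable_sum square_integrable_toeplitz_form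
        square_integrable_block_form)
  also have "\<dots> \<le> 2 * (2 * (block_mass a m - real ?q * block_mass a p)) + 2 * (2 * (real (card {k..<?q}) * block_mass a p))"
    by (intro add_mono mult_left_mono toeplitz_block_diff expectation_block_sum_square_le p) auto
  also have "\<dots> = 4 * (block_mass a m - real k * block_mass a p)"
    using k by (simp add: of_nat_diff algebra_simps)
  finally show ?thesis .
qed

definition scaled_periodogram :: "(real \<Rightarrow> real) \<Rightarrow> (int \<Rightarrow> 'a \<Rightarrow> real) \<Rightarrow> real \<Rightarrow> nat \<Rightarrow> real \<Rightarrow> 'a \<Rightarrow> real" where
  "scaled_periodogram w X \<Phi> N s \<omega> = sqrt (real N) * (integrated_periodogram w (\<lambda>k. X k \<omega>) N s - \<Phi>)"

lemma scaled_periodogram_form: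
  assumes "0 < N" "0 < s"
  shows "scaled_periodogram w X \<Phi> N s \<omega> = 1 / (s * sqrt (real N)) *
    ((\<Sum>k = 1..nat \<lfloor>s * real N\<rfloor>. \<Sum>l = 1..nat \<lfloor>s * real N\<rfloor>. dcos w N (int k - int l) * (X (int k) \<omega> * X (int l) \<omega>))
      - s * real N * \<Phi>)"
proof -
  define Q where "Q = (\<Sum>k = 1..nat \<lfloor>s * real N\<rfloor>. \<Sum>l = 1..nat \<lfloor>s * real N\<rfloor>. dcos w N (int k - int l) * (X (int k) \<omega> * X (int l) \<omega>))"
  define r where "r = sqrt (real N)"
  have r: "0 < r" "real N = r * r" using assms by (simp_all add: r_def)
  show ?thesis
    unfolding scaled_periodogram_def integrated_periodogram_quadratic Q_def [symmetric] r_def [symmetric] r(2)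
    using r(1) assms(2) by (simp add: field_simps)
qed

lemma measurable_scaled_periodogram:
  assumes X [measurable]: "\<And>k. X k \<in> borel_measurable M"
  shows "measurable_process M (scaled_periodogram w X \<Phi> N)"
  unfolding measurable_process_def
proof
  show "scaled_periodogram w X \<Phi> N 1 \<in> borel_measurable M"
    unfolding scaled_periodogram_def [abs_def] integrated_periodogram_quadratic by measurable
  let ?F = "\<lambda>p :: real \<times> 'a. indicator {1/2..1} (fst p) * (sqrt (real N) * (1 / (fst p * real N) *
      (\<Sum>k = 1..N. \<Sum>l = 1..N. (if k \<le> nat \<lfloor>fst p * real N\<rfloor> \<and> l \<le> nat \<lfloor>fst p * real N\<rfloor> then dcos w N (int k - int l) else 0)
        * (X (int k) (snd p) * X (int l) (snd p))) - \<Phi>))"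
  have "(\<lambda>(s, \<omega>). indicator {1/2..1} s * scaled_periodogram w X \<Phi> N s \<omega>) = ?F"
  proof (rule ext)
    fix p :: "real \<times> 'a"
    show "(case p of (s, \<omega>) \<Rightarrow> indicator {1/2..1} s * scaled_periodogram w X \<Phi> N s \<omega>) = ?F p"
    proof (cases "fst p \<in> {1/2..1}")
      case True
      let ?m = "nat \<lfloor>fst p * real N\<rfloor>"
      have "fst p * real N \<le> 1 * real N" using True by (intro mult_right_mono) auto
      then have m: "?m \<le> N" by (simp add: nat_le_iff floor_le_iff)
      have "(\<Sum>k = 1..?m. \<Sum>l = 1..?m. dcos w N (int k - int l) * (X (int k) (snd p) * X (int l) (snd p))) =
          (\<Sum>k = 1..N. \<Sum>l = 1..N. (if k \<le> ?m \<and> l \<le> ?m then dcos w N (int k - int l) else 0)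
            * (X (int k) (snd p) * X (int l) (snd p)))"
        unfolding sum.cartesian_product using m by (intro sum.mono_neutral_cong_left) (auto split: if_splits)
      then show ?thesis
        by (simp only: split_beta scaled_periodogram_def integrated_periodogram_quadratic)
    next
      case False
      then have "(indicator {1/2..1} (fst p) :: real) = 0" by (rule indicator_simps)
      then show ?thesis by (simp only: split_beta mult_zero_left)
    qed
  qed
  moreover have "?F \<in> borel_measurable (lborel \<Otimes>\<^sub>M M)" by measurable
  ultimately show "(\<lambda>(s, \<omega>). indicator {1/2..1} s * scaled_periodogram w X \<Phi> N s \<omega>) \<in> borel_measurable (lborel \<Otimes>\<^sub>M M)"
    by (simp only:)
qed

text \<open>The four terms stem from the reduction to a Toeplitz form, the index pairs outside the
  blocks, the rounding of \<open>s\<close> and the rounding of \<open>N\<close>. The squared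
  prefactor is at most 4 / N because s \<ge> 1/2. The second term is made small by \<open>p\<close>,
  the third by \<open>n\<close>, the other two by \<open>N\<close> for fixed \<open>p\<close> and
  \<open>n\<close>.\<close>

lemma scaled_periodogram_block_approx:
  fixes \<psi> :: "int \<Rightarrow> real"
  assumes cont: "continuous_on {0..pi} w"
    and holder: "\<And>x y. x \<in> {0..pi} \<Longrightarrow> y \<in> {0..pi} \<Longrightarrow> \<bar>w x - w y\<bar> \<le> H * \<bar>x - y\<bar> powr \<kappa>"
    and bound: "\<And>x. x \<in> {0..pi} \<Longrightarrow> \<bar>w x\<bar> \<le> K"
    and H: "0 \<le> H" and \<kappa>: "1 / 2 < \<kappa>" "\<kappa> \<le> 1" and N: "0 < N"
    and s: "s \<in> {1/2..1}" and X: "linear_process M \<psi> \<epsilon> X"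
    and \<psi>: "(\<lambda>i. \<bar>\<psi> i\<bar> * (1 + \<bar>real_of_int i\<bar>) powr \<kappa>) summable_on UNIV"
    and \<psi>1: "(\<lambda>i. \<bar>\<psi> i\<bar>) summable_on UNIV"
    and p: "0 < p" and n: "0 < n" and v: "0 < block_mass (fcos (\<lambda>x. w x * power_transfer \<psi> x)) p"
  defines "T \<equiv> (\<Sum>\<^sub>\<infinity>i. \<bar>\<psi> i\<bar> * (1 + \<bar>real_of_int i\<bar>) powr \<kappa>)"
  defines "u \<equiv> \<lambda>x. w x * power_transfer \<psi> x"
  defines "a \<equiv> fcos u"
  defines "G \<equiv> scaled_periodogram w X (a 0) N s"
  defines "S \<equiv> \<lambda>\<omega>. step_process n (grid_coeff a p n N) s (\<lambda>i. grid_sum a p n (N div (2 * p * n)) i \<omega>)"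
  defines "\<rho> \<equiv> 2 * (T ^ 4 * (4 * (\<Sum>k = 1..N. \<Sum>l = 1..N. (dcos w N (int k - int l) - fcos w (int k - int l))\<^sup>2) + 8 * msq w))
      + 2 * (T\<^sup>2 * ((7 * H + 17 * K) * real N powr (1 - \<kappa>)))\<^sup>2"
  shows "square_integrable M (\<lambda>\<omega>. G \<omega> - S \<omega>)" and "square_integrable M S"
    and "expectation (\<lambda>\<omega>. (G \<omega> - S \<omega>)\<^sup>2) \<le>
      8 * (\<rho> / real N) + 32 * (msq u - block_mass a p / real p) + 16 * msq u / real n + 64 * real n * block_mass a p / real N"
    and "expectation (\<lambda>\<omega>. (S \<omega>)\<^sup>2) \<le> 8 * msq u"
proof -
  define m where "m = nat \<lfloor>s * real N\<rfloor>"
  define k where "k = (n + grid_index n s) * (N div (2 * p * n))"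
  define V where "V = block_mass a p"
  define D where "D \<omega> = (\<Sum>k = 1..m. \<Sum>l = 1..m. dcos w N (int k - int l) * (X (int k) \<omega> * X (int l) \<omega>))
      - s * real N * a 0 - toeplitz_form a m \<omega>" for \<omega>
  define R where "R \<omega> = toeplitz_form a m \<omega> - (\<Sum>b<k. block_form a p b \<omega>)" for \<omega>
  let ?c = "1 / (s * sqrt (real N))"
  have s01: "s \<in> {0..1}" and s0: "0 < s" and s1: "s \<le> 1" using s by auto
  have D: "square_integrable M D" "expectation (\<lambda>\<omega>. (D \<omega>)\<^sup>2) \<le> \<rho>"
    using periodogram_form_approx [OF cont holder bound H \<kappa> N s01 X \<psi>]
    unfolding D_def [abs_def] m_def a_def u_def \<rho>_def T_def by simp_all
  have cu: "continuous_on {0..pi} u"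
    unfolding u_def by (intro continuous_intros cont continuous_power_transfer [OF \<psi>1])
  have R: "square_integrable M R"
    unfolding R_def by (intro square_integrable_diff square_integrable_sum square_integrable_toeplitz_form square_integrable_block_form)
  have km: "k * p \<le> m" and km': "real N * (s - 1 / (2 * real n)) - 2 * real n * real p \<le> real k * real p"
    using grid_block_count [OF p n s, of N] by (simp_all only: k_def m_def)
  have mN: "real m \<le> s * real N" using s0 by (simp add: m_def)
  have sN: "s * real N \<le> real N" using s1 by (simp add: mult_left_le_one_le s0 less_imp_le)
  have V0: "0 < V" using v by (simp only: V_def a_def u_def)
  \<comment> \<open>Coefficient mass per observation inside the blocks; its deficit from
    \<open>msq u\<close> measures what the blocks discard.\<close>
  define c where "c = V / real p"
  have c0: "0 < c" using V0 p by (simp add: c_def)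
  have Vc: "V = c * real p" using p by (simp add: c_def)
  have cB: "c \<le> msq u"
    using block_mass_le [OF cu, of p] p by (simp add: c_def V_def a_def field_simps)
  have kV: "real k * V = real k * real p * c" by (simp add: Vc)
  have c_lin: "?c\<^sup>2 \<le> 4 / real N"
  proof -
    have "(1 / 2)\<^sup>2 \<le> s\<^sup>2" using s by (intro power_mono) auto
    then have "1 / s\<^sup>2 \<le> 4" using s0 by (simp add: field_simps power2_eq_square)
    then have "1 / s\<^sup>2 / real N \<le> 4 / real N" by (rule divide_right_mono) simp
    then show ?thesis by (simp add: power_divide power_mult_distrib)
  qed
  have Sform: "S \<omega> = ?c * (\<Sum>b<k. block_form a p b \<omega>)" for \<omega>
    unfolding S_def k_def by (rule step_grid_sum) (use V0 in \<open>simp only: V_def\<close>)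
  have GS: "G \<omega> - S \<omega> = ?c * (D \<omega> + R \<omega>)" for \<omega>
    unfolding G_def scaled_periodogram_form [OF N s0] Sform D_def R_def m_def [symmetric]
    by (simp only: right_diff_distrib [symmetric]) simp
  show "square_integrable M (\<lambda>\<omega>. G \<omega> - S \<omega>)"
    unfolding GS by (intro square_integrable_cmult square_integrable_add D R)
  show "square_integrable M S"
    unfolding Sform [abs_def] by (intro square_integrable_cmult square_integrable_sum square_integrable_block_form)
  have "expectation (\<lambda>\<omega>. (R \<omega>)\<^sup>2) \<le> 4 * (block_mass a m - real k * V)"
    unfolding R_def V_def using km p
    by (intro toeplitz_partial_block_diff) (simp_all add: less_eq_div_iff_mult_less_eq)
  also have "\<dots> \<le> 4 * (real N * (msq u - c) + real N * msq u / (2 * real n) + 2 * real n * V)"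
  proof (rule mult_left_mono)
    have "block_mass a m \<le> real m * msq u" unfolding a_def by (rule block_mass_le [OF cu])
    also have "\<dots> \<le> s * real N * msq u" using c0 cB by (intro mult_right_mono mN) simp
    finally have 1: "block_mass a m \<le> s * real N * msq u" .
    have 2: "(real N * (s - 1 / (2 * real n)) - 2 * real n * real p) * c \<le> real k * V"
      unfolding kV using c0 by (intro mult_right_mono km') simp
    have 3: "s * real N * (msq u - c) \<le> real N * (msq u - c)"
      using cB by (intro mult_right_mono sN) simp
    have 4: "real N * c / (2 * real n) \<le> real N * msq u / (2 * real n)"
      using cB by (intro divide_right_mono mult_left_mono) auto
    have "(real N * (s - 1 / (2 * real n)) - 2 * real n * real p) * c = s * real N * c - real N * c / (2 * real n) - 2 * real n * V"
      by (simp add: Vc algebra_simps)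
    with 1 2 3 4 show "block_mass a m - real k * V \<le> real N * (msq u - c) + real N * msq u / (2 * real n) + 2 * real n * V"
      by (simp add: right_diff_distrib)
  qed simp
  finally have ER: "expectation (\<lambda>\<omega>. (R \<omega>)\<^sup>2) \<le> 4 * (real N * (msq u - c) + real N * msq u / (2 * real n) + 2 * real n * V)" .
  have "expectation (\<lambda>\<omega>. (G \<omega> - S \<omega>)\<^sup>2) = ?c\<^sup>2 * expectation (\<lambda>\<omega>. (D \<omega> + R \<omega>)\<^sup>2)"
    unfolding GS power_mult_distrib by (rule integral_mult_right_zero)
  also have "\<dots> \<le> 4 / real N * (2 * expectation (\<lambda>\<omega>. (D \<omega>)\<^sup>2) + 2 * expectation (\<lambda>\<omega>. (R \<omega>)\<^sup>2))"
    by (intro mult_mono c_lin integral_square_add_le D R) auto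
  also have "\<dots> \<le> 4 / real N * (2 * \<rho> + 2 * (4 * (real N * (msq u - c) + real N * msq u / (2 * real n) + 2 * real n * V)))"
    by (intro mult_left_mono add_mono D ER) auto
  also have "\<dots> = 8 * (\<rho> / real N) + 32 * (msq u - c) + 16 * msq u / real n + 64 * real n * V / real N"
  proof -
    have "4 / real N * (2 * \<rho> + 2 * (4 * (real N * d + real N * e / (2 * real n) + 2 * real n * V))) =
        8 * (\<rho> / real N) + 32 * d + 16 * e / real n + 64 * real n * V / real N" for d e
      using N n by (simp add: field_simps)
    then show ?thesis .
  qed
  finally show "expectation (\<lambda>\<omega>. (G \<omega> - S \<omega>)\<^sup>2) \<le>
      8 * (\<rho> / real N) + 32 * (msq u - block_mass a p / real p) + 16 * msq u / real n + 64 * real n * block_mass a p / real N"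
    by (simp only: c_def V_def)
  have "expectation (\<lambda>\<omega>. (S \<omega>)\<^sup>2) = ?c\<^sup>2 * expectation (\<lambda>\<omega>. (\<Sum>b<k. block_form a p b \<omega>)\<^sup>2)"
    unfolding Sform power_mult_distrib by (rule integral_mult_right_zero)
  also have "\<dots> \<le> 4 / real N * (2 * (real (card {..<k}) * V))"
    unfolding V_def by (intro mult_mono c_lin expectation_block_sum_square_le) auto
  also have "\<dots> \<le> 4 / real N * (2 * (real N * msq u))"
  proof (intro mult_left_mono)
    have "real (k * p) \<le> real m" using km by (simp only: of_nat_le_iff)
    then have "real k * real p \<le> real N" using mN sN by simp
    then have "real k * real p * c \<le> real N * msq u" using c0 cB by (intro mult_mono) auto
    then show "real (card {..<k}) * V \<le> real N * msq u" by (simp add: kV)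
  qed auto
  also have "\<dots> = 8 * msq u" using N by simp
  finally show "expectation (\<lambda>\<omega>. (S \<omega>)\<^sup>2) \<le> 8 * msq u" .
qed

text \<open>Division by \<open>N\<close> leaves the mean-square error of the coefficients, a
  constant over \<open>N\<close>, and a multiple of \<open>N powr (1 - 2 * \<kappa>)\<close>, which
  tends to 0 because \<kappa> > 1/2.\<close>

lemma form_error_limit:
  assumes cont: "continuous_on {0..pi} w"
    and holder: "\<And>x y. x \<in> {0..pi} \<Longrightarrow> y \<in> {0..pi} \<Longrightarrow> \<bar>w x - w y\<bar> \<le> H * \<bar>x - y\<bar> powr \<kappa>"
    and bound: "\<And>x. x \<in> {0..pi} \<Longrightarrow> \<bar>w x\<bar> \<le> K"
    and H: "0 \<le> H" and \<kappa>: "1 / 2 < \<kappa>" "\<kappa> \<le> 1"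
  shows "(\<lambda>N. (2 * (T ^ 4 * (4 * (\<Sum>k = 1..N. \<Sum>l = 1..N. (dcos w N (int k - int l) - fcos w (int k - int l))\<^sup>2) + 8 * msq w))
      + 2 * (T\<^sup>2 * ((7 * H + 17 * K) * real N powr (1 - \<kappa>)))\<^sup>2) / real N) \<longlonglongrightarrow> 0"
proof -
  let ?E = "\<lambda>N. \<Sum>k = 1..N. \<Sum>l = 1..N. (dcos w N (int k - int l) - fcos w (int k - int l))\<^sup>2"
  have E: "(\<lambda>N. ?E N / real N) \<longlonglongrightarrow> 0"
    using \<kappa> by (intro dcos_fcos_square_mean [OF cont holder bound H]) auto
  have pow: "(\<lambda>N. real N powr (1 - 2 * \<kappa>)) \<longlonglongrightarrow> 0"
    using \<kappa> by (intro tendsto_neg_powr filterlim_real_sequentially) auto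
  have one: "(\<lambda>N. 16 * T ^ 4 * msq w / real N) \<longlonglongrightarrow> 0" by (rule lim_const_over_n)
  have "(\<lambda>N. 8 * T ^ 4 * (?E N / real N) + 16 * T ^ 4 * msq w / real N + 2 * (T\<^sup>2 * (7 * H + 17 * K))\<^sup>2 * real N powr (1 - 2 * \<kappa>))
      \<longlonglongrightarrow> 8 * T ^ 4 * 0 + 0 + 2 * (T\<^sup>2 * (7 * H + 17 * K))\<^sup>2 * 0"
    by (intro tendsto_add tendsto_mult_left E one pow)
  moreover have "(2 * (T ^ 4 * (4 * e + 8 * msq w)) + 2 * (T\<^sup>2 * (c * real N powr (1 - \<kappa>)))\<^sup>2) / real N =
      8 * T ^ 4 * (e / real N) + 16 * T ^ 4 * msq w / real N + 2 * (T\<^sup>2 * c)\<^sup>2 * real N powr (1 - 2 * \<kappa>)" for e c N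
  proof (cases "N = 0")
    case False
    have "(real N powr (1 - \<kappa>))\<^sup>2 / real N = real N powr (1 - \<kappa> + (1 - \<kappa>) - 1)"
      unfolding powr_diff [of _ _ 1] powr_add power2_eq_square using False by simp
    also have "\<dots> = real N powr (1 - 2 * \<kappa>)" by simp
    finally have sq: "(real N powr (1 - \<kappa>))\<^sup>2 / real N = real N powr (1 - 2 * \<kappa>)" .
    show ?thesis
      unfolding sq [symmetric] by (simp add: power_mult_distrib add_divide_distrib algebra_simps)
  qed simp
  ultimately show ?thesis by simp
qed

end

section \<open>The limit process: joint measurability, discretisation, positive denominator\<close>

context brownian
begin

lemma expectation_B_square: "s \<in> {1/2..1} \<Longrightarrow> expectation (\<lambda>\<omega>. (B s \<omega>)\<^sup>2) = s"
  using expectation_B_product [of s s] by (simp add: power2_eq_square)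

lemma grid_index_tendsto:
  assumes s: "s \<in> {1/2..1}"
  shows "(\<lambda>n. grid_point (Suc n) (grid_index (Suc n) s)) \<longlonglongrightarrow> s"
proof (rule tendsto_sandwich)
  have "(\<lambda>n. 1 / real (Suc n)) \<longlonglongrightarrow> 0" by (rule LIMSEQ_Suc [OF lim_const_over_n])
  then have "(\<lambda>n. s - 1 / real (Suc n) / 2) \<longlonglongrightarrow> s - 0 / 2" by (intro tendsto_intros) auto
  then show "(\<lambda>n. s - 1 / (2 * real (Suc n))) \<longlonglongrightarrow> s" by (simp add: mult.commute)
  show "\<forall>\<^sub>F n in sequentially. s - 1 / (2 * real (Suc n)) \<le> grid_point (Suc n) (grid_index (Suc n) s)"
  proof (intro always_eventually allI)
    fix n
    show "s - 1 / (2 * real (Suc n)) \<le> grid_point (Suc n) (grid_index (Suc n) s)"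
      using grid_point_index(2) [of "Suc n" s] s by linarith
  qed
  show "\<forall>\<^sub>F n in sequentially. grid_point (Suc n) (grid_index (Suc n) s) \<le> s"
    using grid_point_index(1) [OF _ s] by (intro always_eventually allI) simp
qed simp

lemma B_grid_tendsto:
  assumes s: "s \<in> {1/2..1}" and \<omega>: "\<omega> \<in> space P"
  shows "(\<lambda>n. B (grid_point (Suc n) (grid_index (Suc n) s)) \<omega>) \<longlonglongrightarrow> B s \<omega>"
proof -
  have "continuous_on {1/2..1} (\<lambda>t. B t \<omega>)"
    using brownian \<omega> by (simp add: brownian_motion_on_def)
  moreover have "grid_point (Suc n) (grid_index (Suc n) s) \<in> {1/2..1}" for n
    using s by (intro grid_point_in grid_index_le) auto
  ultimately show ?thesis
    by (rule continuous_on_tendsto_compose [OF _ grid_index_tendsto [OF s] s always_eventually [OF allI]])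
qed

lemma step_process_increment:
  assumes n: "0 < n" and s: "s \<le> 1"
  shows "step_process n (\<lambda>i. c * sqrt (grid_width n i)) s (\<lambda>i. increment n i \<omega>) =
    1 / s * (c * B (grid_point n (grid_index n s)) \<omega>)"
  unfolding step_process_def mult.assoc sum_distrib_left [symmetric]
  by (simp only: increment_sum [OF n grid_index_le [OF s]])

text \<open>Path continuity makes the process a pointwise limit of step processes, which are jointly
  measurable.\<close>

lemma measurable_B_over_time: "measurable_process P (\<lambda>s \<omega>. \<sigma> * B s \<omega> / s)"
  unfolding measurable_process_def
proof
  show "(\<lambda>\<omega>. \<sigma> * B 1 \<omega> / 1) \<in> borel_measurable P" using B_measurable [of 1] by simp
  let ?x = "\<lambda>n (s :: real) \<omega>. step_process (Suc n) (\<lambda>i. \<sigma> * sqrt (grid_width (Suc n) i)) s (\<lambda>i. increment (Suc n) i \<omega>)"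
  show "(\<lambda>(s, \<omega>). indicator {1/2..1} s * (\<sigma> * B s \<omega> / s)) \<in> borel_measurable (lborel \<Otimes>\<^sub>M P)"
  proof (rule borel_measurable_LIMSEQ_real)
    have "measurable_process P (?x n)" for n
      by (rule measurable_step_process) (simp add: increment_measurable)
    then show "(\<lambda>(s, \<omega>). indicator {1/2..1} s * ?x n s \<omega>) \<in> borel_measurable (lborel \<Otimes>\<^sub>M P)" for n
      by (simp only: measurable_process_def)
    fix q :: "real \<times> 'b" assume q: "q \<in> space (lborel \<Otimes>\<^sub>M P)"
    obtain s \<omega> where q_eq: "q = (s, \<omega>)" by (cases q)
    have \<omega>: "\<omega> \<in> space P" using q by (simp add: q_eq space_pair_measure)
    show "(\<lambda>n. case q of (s :: real, \<omega>) \<Rightarrow> indicator {1/2..1} s * ?x n s \<omega>) \<longlonglongrightarrow>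
        (case q of (s, \<omega>) \<Rightarrow> indicator {1/2..1} s * (\<sigma> * B s \<omega> / s))"
    proof (cases "s \<in> {1/2..1}")
      case True
      then have le: "s \<le> 1" by simp
      have "(\<lambda>n. 1 / s * (\<sigma> * B (grid_point (Suc n) (grid_index (Suc n) s)) \<omega>)) \<longlonglongrightarrow> 1 / s * (\<sigma> * B s \<omega>)"
        by (intro tendsto_mult_left B_grid_tendsto True \<omega>)
      then show ?thesis
        using True by (simp add: q_eq step_process_increment [OF _ le])
    next
      case False
      then have "(indicator {1/2..1} s :: real) = 0" by (rule indicator_simps)
      then show ?thesis by (simp add: q_eq)
    qed
  qed
qed

lemma square_integrable_B_over_time: "s \<in> {1/2..1} \<Longrightarrow> square_integrable P (\<lambda>\<omega>. \<sigma> * B s \<omega> / s)"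
  using square_integrable_cmult [OF square_integrable_B [of s], of "\<sigma> / s"] by simp

lemma expectation_B_over_time_square:
  assumes s: "s \<in> {1/2..1}"
  shows "expectation (\<lambda>\<omega>. (\<sigma> * B s \<omega> / s)\<^sup>2) \<le> 2 * \<sigma>\<^sup>2"
proof -
  have "expectation (\<lambda>\<omega>. (\<sigma> * B s \<omega> / s)\<^sup>2) = expectation (\<lambda>\<omega>. (\<sigma> / s)\<^sup>2 * (B s \<omega>)\<^sup>2)"
    by (simp add: power_mult_distrib power_divide)
  also have "\<dots> = (\<sigma> / s)\<^sup>2 * s" by (simp add: expectation_B_square [OF s])
  also have "\<dots> = \<sigma>\<^sup>2 * (1 / s)" using s by (simp add: power2_eq_square)
  also have "\<dots> \<le> \<sigma>\<^sup>2 * 2" using s by (intro mult_left_mono) (auto simp: field_simps)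
  finally show ?thesis by simp
qed

text \<open>The error splits into a wrong constant, \<open>c\<close> for \<sigma>, and an increment
  within one cell, of variance at most 1 / (2 n); the squared prefactor is at most 4.\<close>

lemma step_process_B_approx:
  fixes c :: real
  assumes n: "0 < n" and s: "s \<in> {1/2..1}"
  defines "S \<equiv> \<lambda>\<omega>. step_process n (\<lambda>i. c * sqrt (grid_width n i)) s (\<lambda>i. increment n i \<omega>)"
  shows "square_integrable P (\<lambda>\<omega>. S \<omega> - \<sigma> * B s \<omega> / s)"
    and "expectation (\<lambda>\<omega>. (S \<omega> - \<sigma> * B s \<omega> / s)\<^sup>2) \<le> 8 * (c - \<sigma>)\<^sup>2 + 4 * \<sigma>\<^sup>2 / real n"
proof -
  let ?g = "grid_point n (grid_index n s)"
  have le: "s \<le> 1" using s by simp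
  have g: "?g \<in> {1/2..1}" by (rule grid_point_in [OF n grid_index_le [OF le]])
  have gs: "?g \<le> s" "s - ?g \<le> 1 / (2 * real n)" using grid_point_index [OF n s] by auto
  have eq: "S \<omega> - \<sigma> * B s \<omega> / s = 1 / s * ((c - \<sigma>) * B ?g \<omega> + (- \<sigma>) * (B s \<omega> - B ?g \<omega>))" for \<omega>
    unfolding S_def step_process_increment [OF n le] by (simp add: algebra_simps diff_divide_distrib)
  have sq: "square_integrable P (\<lambda>\<omega>. (c - \<sigma>) * B ?g \<omega>)" "square_integrable P (\<lambda>\<omega>. (- \<sigma>) * (B s \<omega> - B ?g \<omega>))"
    by (intro square_integrable_cmult square_integrable_diff square_integrable_B g s)+
  show "square_integrable P (\<lambda>\<omega>. S \<omega> - \<sigma> * B s \<omega> / s)"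
    unfolding eq by (intro square_integrable_cmult square_integrable_add sq)
  have "expectation (\<lambda>\<omega>. (S \<omega> - \<sigma> * B s \<omega> / s)\<^sup>2) =
      (1 / s)\<^sup>2 * expectation (\<lambda>\<omega>. ((c - \<sigma>) * B ?g \<omega> + (- \<sigma>) * (B s \<omega> - B ?g \<omega>))\<^sup>2)"
    unfolding eq power_mult_distrib by (rule integral_mult_right_zero)
  also have "\<dots> \<le> 4 * (2 * expectation (\<lambda>\<omega>. ((c - \<sigma>) * B ?g \<omega>)\<^sup>2) + 2 * expectation (\<lambda>\<omega>. ((- \<sigma>) * (B s \<omega> - B ?g \<omega>))\<^sup>2))"
  proof (intro mult_mono integral_square_add_le sq)
    have "(1 / s)\<^sup>2 \<le> 2\<^sup>2" using s by (intro power_mono) (auto simp: field_simps)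
    then show "(1 / s)\<^sup>2 \<le> 4" by simp
  qed auto
  also have "\<dots> = 4 * (2 * ((c - \<sigma>)\<^sup>2 * ?g) + 2 * (\<sigma>\<^sup>2 * (s - ?g)))"
    unfolding power_mult_distrib by (simp add: expectation_B_square [OF g] expectation_B_diff_square [OF g s gs(1)])
  also have "\<dots> \<le> 4 * (2 * ((c - \<sigma>)\<^sup>2 * 1) + 2 * (\<sigma>\<^sup>2 * (1 / (2 * real n))))"
    using g by (intro mult_left_mono add_mono gs) auto
  also have "\<dots> = 8 * (c - \<sigma>)\<^sup>2 + 4 * \<sigma>\<^sup>2 / real n" by simp
  finally show "expectation (\<lambda>\<omega>. (S \<omega> - \<sigma> * B s \<omega> / s)\<^sup>2) \<le> 8 * (c - \<sigma>)\<^sup>2 + 4 * \<sigma>\<^sup>2 / real n" .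
qed

text \<open>The variance is 1/2 - 1/2 + 1/4 = 1/4, which excludes the degenerate case, and a
  non-degenerate normal law has no atoms.\<close>

lemma AE_bridge_nonzero: "AE \<omega> in P. B (1/2) \<omega> - 1/2 * B 1 \<omega> \<noteq> 0"
proof -
  let ?Y = "\<lambda>\<omega>. B (1/2) \<omega> + (- 1/2) * B 1 \<omega>"
  have T: "(1/2 :: real) \<in> {1/2..1}" "(1 :: real) \<in> {1/2..1}" by auto
  have "lincomb_of {1/2..1} B (\<lambda>\<omega>. 1 * B (1/2) \<omega> + (- 1/2) * B 1 \<omega>)"
    by (intro lincomb_of_add lincomb_of_single T)
  then have "gaussian_rv P ?Y" using lincomb_gaussian by simp
  then obtain \<mu> where mY: "?Y \<in> borel_measurable P"
    and "(AE \<omega> in P. ?Y \<omega> = \<mu>) \<or> (\<exists>\<sigma>>0. distributed P lborel ?Y (normal_density \<mu> \<sigma>))"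
    unfolding gaussian_rv_def by blast
  then show ?thesis
  proof (elim disjE exE conjE)
    assume const: "AE \<omega> in P. ?Y \<omega> = \<mu>"
    have "expectation ?Y = 0"
      using B_integrable [OF T(1)] B_integrable [OF T(2)] expectation_B [OF T(1)] expectation_B [OF T(2)] by simp
    moreover have "expectation ?Y = expectation (\<lambda>_. \<mu>)"
      using const mY by (intro integral_cong_AE) auto
    ultimately have "\<mu> = 0" by (simp add: prob_space)
    with const have "expectation (\<lambda>\<omega>. (?Y \<omega>)\<^sup>2) = expectation (\<lambda>_. 0)"
      using mY by (intro integral_cong_AE) auto
    moreover have "expectation (\<lambda>\<omega>. (?Y \<omega>)\<^sup>2) =
        expectation (\<lambda>\<omega>. B (1/2) \<omega> * B (1/2) \<omega> - B (1/2) \<omega> * B 1 \<omega> + 1/4 * (B 1 \<omega> * B 1 \<omega>))"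
      by (intro Bochner_Integration.integral_cong) (auto simp: power2_eq_square algebra_simps)
    moreover have "\<dots> = 1 / 4"
      using B_product_integrable [OF T(1) T(1)] B_product_integrable [OF T(1) T(2)] B_product_integrable [OF T(2) T(2)]
        expectation_B_product [OF T(1) T(1)] expectation_B_product [OF T(1) T(2)] expectation_B_product [OF T(2) T(2)]
      by (simp add: min_def)
    ultimately show ?thesis by simp
  next
    fix \<sigma> :: real assume "0 < \<sigma>" and d: "distributed P lborel ?Y (normal_density \<mu> \<sigma>)"
    have "AE x in lborel. x \<noteq> (0::real)" by (rule AE_lborel_singleton)
    then have "AE x in density lborel (normal_density \<mu> \<sigma>). x \<noteq> 0"
      by (subst AE_density) auto
    then have "AE x in distr P lborel ?Y. x \<noteq> 0" by (simp only: distributed_distr_eq_density [OF d])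
    moreover have "?Y \<in> measurable P lborel" using mY by simp
    ultimately have "AE \<omega> in P. ?Y \<omega> \<noteq> 0" by (rule AE_distrD [rotated])
    then show ?thesis by simp
  qed
qed

text \<open>The integrand is continuous and non-negative, and at s = 1/2 it is (2 \<sigma>)^2 times
  the squared bridge value of \<open>AE_bridge_nonzero\<close>.\<close>

lemma AE_sq_deviation_pos:
  assumes \<sigma>: "\<sigma> \<noteq> 0"
  shows "AE \<omega> in P. 0 < sq_deviation (\<lambda>s \<omega>. \<sigma> * B s \<omega> / s) \<omega>"
  using AE_bridge_nonzero AE_space
proof eventually_elim
  case (elim \<omega>)
  let ?h = "\<lambda>s. (\<sigma> * B s \<omega> / s - \<sigma> * B 1 \<omega> / 1)\<^sup>2"
  have "continuous_on {1/2..1} (\<lambda>t. B t \<omega>)"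
    using brownian elim(2) by (simp add: brownian_motion_on_def)
  then have cont: "continuous_on {1/2..1} ?h" by (intro continuous_intros) auto
  have eq: "sq_deviation (\<lambda>s \<omega>. \<sigma> * B s \<omega> / s) \<omega> = integral {1/2..1} ?h"
    unfolding sq_deviation_def
    by (intro set_borel_integral_eq_integral borel_integrable_atLeastAtMost' cont)
  have "0 \<le> integral {1/2..1} ?h" by (rule integral_nonneg [OF integrable_continuous_interval [OF cont]]) simp
  moreover have "integral {1/2..1} ?h \<noteq> 0"
  proof
    assume "integral {1/2..1} ?h = 0"
    then have "\<forall>s\<in>{1/2..1}. ?h s = 0" by (subst (asm) integral_eq_0_iff [OF cont]) auto
    then have "?h (1/2) = 0" by (rule bspec) simp
    then have "\<sigma> * (2 * (B (1/2) \<omega> - 1/2 * B 1 \<omega>)) = 0" by (simp add: algebra_simps)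
    then show False using \<sigma> elim(1) by simp
  qed
  ultimately show ?case unfolding eq by simp
qed

end

section \<open>Convergence of Lipschitz functionals of the periodogram\<close>

context white_noise
begin

text \<open>Three comparisons, each below r / 3: the periodogram with block sums, block sums with
  Brownian increments, and these with the limit process. The outer two are comparisons in mean
  square through \<open>process_compare\<close>, the middle one is the central limit theorem. The
  choices are made in the order \<open>e\<close>, \<open>p\<close>, \<open>n\<close>,
  \<open>N\<close>, since the remaining errors vanish in \<open>N\<close> only for fixed
  \<open>p\<close> and \<open>n\<close>.\<close>

lemma scaled_periodogram_functional_limit:
  fixes \<psi> :: "int \<Rightarrow> real" and B :: "real \<Rightarrow> 'b \<Rightarrow> real" and g :: "real \<Rightarrow> real \<Rightarrow> real"
  assumes cont: "continuous_on {0..pi} w"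
    and holder: "\<And>x y. x \<in> {0..pi} \<Longrightarrow> y \<in> {0..pi} \<Longrightarrow> \<bar>w x - w y\<bar> \<le> H * \<bar>x - y\<bar> powr \<kappa>"
    and bound: "\<And>x. x \<in> {0..pi} \<Longrightarrow> \<bar>w x\<bar> \<le> K"
    and H: "0 \<le> H" and \<kappa>: "1 / 2 < \<kappa>" "\<kappa> \<le> 1"
    and X: "linear_process M \<psi> \<epsilon> X"
    and \<psi>: "(\<lambda>i. \<bar>\<psi> i\<bar> * (1 + \<bar>real_of_int i\<bar>) powr \<kappa>) summable_on UNIV"
    and \<psi>1: "(\<lambda>i. \<bar>\<psi> i\<bar>) summable_on UNIV"
    and B: "brownian P B"
    and L: "0 \<le> L" and lip: "\<And>a b c d. \<bar>g a c - g b d\<bar> \<le> L * (\<bar>a - b\<bar> + \<bar>c - d\<bar>)"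
    and bnd: "\<And>a c. \<bar>g a c\<bar> \<le> 1" and meas: "case_prod g \<in> borel_measurable borel"
  defines "u \<equiv> \<lambda>x. w x * power_transfer \<psi> x"
  assumes pos: "0 < msq u"
  defines "G \<equiv> scaled_periodogram w X (fcos u 0)"
  defines "z \<equiv> \<lambda>s \<omega>. sqrt (2 * msq u) * B s \<omega> / s"
  shows "(\<lambda>N. \<integral>\<omega>. g (G N 1 \<omega>) (sq_deviation (G N) \<omega>) \<partial>M) \<longlonglongrightarrow> (\<integral>\<omega>. g (z 1 \<omega>) (sq_deviation z \<omega>) \<partial>P)"
proof (rule LIMSEQ_I)
  fix r :: real assume r: "0 < r"
  interpret B: brownian P B by (rule B)
  define \<beta> where "\<beta> = msq u"
  define a where "a = fcos u"
  define V where "V p = block_mass a p" for p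
  \<comment> \<open>Scale of the limit at fixed block length; it approaches
    \<open>sqrt (2 * \<beta>)\<close> only as \<open>p\<close> grows.\<close>
  define c where "c p = sqrt (2 * V p / real p)" for p
  have \<beta>: "0 < \<beta>" using pos by (simp add: \<beta>_def)
  have cu: "continuous_on {0..pi} u"
    unfolding u_def by (intro continuous_intros cont continuous_power_transfer [OF \<psi>1])
  \<comment> \<open>This is the bound of \<open>process_compare\<close> with K = 8 \<beta>, which
    dominates the second moments of \<open>S N s\<close> and of \<open>z s\<close>.\<close>
  have "((\<lambda>e. L * (3 * e + 2 * e\<^sup>2 + 2 * (8 * \<beta>) * e)) \<longlongrightarrow> L * (3 * 0 + 2 * 0\<^sup>2 + 2 * (8 * \<beta>) * 0)) (at_right 0)"
    by (intro tendsto_intros)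
  then have "((\<lambda>e. L * (3 * e + 2 * e\<^sup>2 + 2 * (8 * \<beta>) * e)) \<longlongrightarrow> 0) (at_right 0)" by simp
  then have "\<forall>\<^sub>F e in at_right 0. L * (3 * e + 2 * e\<^sup>2 + 2 * (8 * \<beta>) * e) < r / 3"
    using r by (intro order_tendstoD) auto
  then obtain d where d: "0 < d" "\<And>e. 0 < e \<Longrightarrow> e < d \<Longrightarrow> L * (3 * e + 2 * e\<^sup>2 + 2 * (8 * \<beta>) * e) < r / 3"
    unfolding eventually_at_right_field by blast
  define e where "e = d / 2"
  have e: "0 < e" "L * (3 * e + 2 * e\<^sup>2 + 2 * (8 * \<beta>) * e) < r / 3"
    by (use d(1) in \<open>simp add: e_def\<close>, rule d(2)) (use d(1) in \<open>simp_all add: e_def\<close>)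
  \<comment> \<open>Each error group receives a share e^2 / 4; at most three groups occur in one
    comparison.\<close>
  have e2: "0 < e\<^sup>2 / 4" using e by simp
  have Vlim: "(\<lambda>p. V p / real p) \<longlonglongrightarrow> \<beta>"
    unfolding V_def a_def \<beta>_def by (rule block_mass_limit [OF cu])
  have "(\<lambda>p. 32 * (\<beta> - V p / real p)) \<longlonglongrightarrow> 32 * (\<beta> - \<beta>)"
    by (intro tendsto_mult_left tendsto_diff tendsto_const Vlim)
  then have ev1: "\<forall>\<^sub>F p in sequentially. 32 * (\<beta> - V p / real p) < e\<^sup>2 / 4"
    using e2 by (intro order_tendstoD) auto
  have ev2: "\<forall>\<^sub>F p in sequentially. 0 < V p / real p"
    by (rule order_tendstoD(1) [OF Vlim \<beta>])
  have "(\<lambda>p. 8 * (sqrt (2 * (V p / real p)) - sqrt (2 * \<beta>))\<^sup>2) \<longlonglongrightarrow> 8 * (sqrt (2 * \<beta>) - sqrt (2 * \<beta>))\<^sup>2"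
    by (intro tendsto_mult_left tendsto_power tendsto_diff tendsto_const tendsto_real_sqrt Vlim)
  then have "(\<lambda>p. 8 * (c p - sqrt (2 * \<beta>))\<^sup>2) \<longlonglongrightarrow> 0"
    by (simp only: c_def times_divide_eq_right diff_self zero_power2 mult_zero_right)
  then have ev3: "\<forall>\<^sub>F p in sequentially. 8 * (c p - sqrt (2 * \<beta>))\<^sup>2 < e\<^sup>2 / 4"
    using e2 by (rule order_tendstoD)
  obtain p where p: "32 * (\<beta> - V p / real p) < e\<^sup>2 / 4" "0 < V p / real p" "8 * (c p - sqrt (2 * \<beta>))\<^sup>2 < e\<^sup>2 / 4"
    using eventually_happens' [OF sequentially_bot eventually_conj [OF ev1 eventually_conj [OF ev2 ev3]]] by blast
  have p0: "0 < p" using p(2) by (cases p) auto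
  have V0: "0 < V p" using p(2) p0 by (simp add: zero_less_divide_iff)
  have "\<forall>\<^sub>F n in sequentially. 16 * \<beta> / real n < e\<^sup>2 / 4"
    using e2 by (intro order_tendstoD(2) [OF lim_const_over_n])
  moreover have "\<forall>\<^sub>F n in sequentially. 4 * (sqrt (2 * \<beta>))\<^sup>2 / real n < e\<^sup>2 / 4"
    using e2 by (intro order_tendstoD(2) [OF lim_const_over_n])
  ultimately have evn: "\<forall>\<^sub>F n in sequentially. 0 < n \<and> 16 * \<beta> / real n < e\<^sup>2 / 4 \<and> 4 * (sqrt (2 * \<beta>))\<^sup>2 / real n < e\<^sup>2 / 4"
    using eventually_gt_at_top [of 0] by eventually_elim auto
  then obtain n where n: "0 < n" "16 * \<beta> / real n < e\<^sup>2 / 4" "4 * (sqrt (2 * \<beta>))\<^sup>2 / real n < e\<^sup>2 / 4"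
    using eventually_happens' [OF sequentially_bot evn] by blast
  define T where "T = (\<Sum>\<^sub>\<infinity>i. \<bar>\<psi> i\<bar> * (1 + \<bar>real_of_int i\<bar>) powr \<kappa>)"
  define \<rho> where "\<rho> N = 2 * (T ^ 4 * (4 * (\<Sum>k = 1..N. \<Sum>l = 1..N. (dcos w N (int k - int l) - fcos w (int k - int l))\<^sup>2) + 8 * msq w))
      + 2 * (T\<^sup>2 * ((7 * H + 17 * K) * real N powr (1 - \<kappa>)))\<^sup>2" for N
  define S where "S N s \<omega> = step_process n (grid_coeff a p n N) s (\<lambda>i. grid_sum a p n (N div (2 * p * n)) i \<omega>)" for N s \<omega>
  define S' where "S' s \<omega> = step_process n (\<lambda>i. c p * sqrt (grid_width n i)) s (\<lambda>i. B.increment n i \<omega>)" for s \<omega>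
  have \<rho>lim: "(\<lambda>N. \<rho> N / real N) \<longlonglongrightarrow> 0"
    unfolding \<rho>_def by (rule form_error_limit [OF cont holder bound H \<kappa>])
  have "(\<lambda>N. 8 * (\<rho> N / real N) + 64 * real n * V p / real N) \<longlonglongrightarrow> 8 * 0 + 0"
    by (intro tendsto_add tendsto_mult_left \<rho>lim lim_const_over_n)
  then have evN: "\<forall>\<^sub>F N in sequentially. 8 * (\<rho> N / real N) + 64 * real n * V p / real N < e\<^sup>2 / 4"
    using e2 by (intro order_tendstoD) auto
  have clt: "(\<lambda>N. \<integral>\<omega>. g (S N 1 \<omega>) (sq_deviation (S N) \<omega>) \<partial>M) \<longlonglongrightarrow> (\<integral>\<omega>. g (S' 1 \<omega>) (sq_deviation S' \<omega>) \<partial>P)"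
    unfolding S_def [abs_def] S'_def [abs_def] c_def V_def
    by (rule step_functional_limit [OF B _ _ p0 n(1) L lip bnd meas]) (use V0 in \<open>simp_all add: V_def a_def\<close>)
  have near_step: "\<forall>\<^sub>F N in sequentially. \<bar>(\<integral>\<omega>. g (S N 1 \<omega>) (sq_deviation (S N) \<omega>) \<partial>M) - (\<integral>\<omega>. g (S' 1 \<omega>) (sq_deviation S' \<omega>) \<partial>P)\<bar> < r / 3"
    using tendstoD [OF clt, of "r / 3"] r by (simp add: dist_real_def)
  have near_limit: "\<bar>(\<integral>\<omega>. g (S' 1 \<omega>) (sq_deviation S' \<omega>) \<partial>P) - (\<integral>\<omega>. g (z 1 \<omega>) (sq_deviation z \<omega>) \<partial>P)\<bar> < r / 3"
  proof (rule le_less_trans [OF _ e(2)], rule process_compare [OF B.prob_space_axioms _ _ _ _ _ _ e(1) L lip bnd meas])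
    show "measurable_process P S'"
      unfolding S'_def [abs_def] by (rule measurable_step_process) (simp add: B.increment_measurable [OF n(1)])
    show "measurable_process P z" unfolding z_def by (rule B.measurable_B_over_time)
    fix s :: real assume s: "s \<in> {1/2..1}"
    show "square_integrable P (\<lambda>\<omega>. S' s \<omega> - z s \<omega>)"
      unfolding S'_def z_def by (rule B.step_process_B_approx(1) [OF n(1) s])
    have "B.expectation (\<lambda>\<omega>. (S' s \<omega> - z s \<omega>)\<^sup>2) \<le> 8 * (c p - sqrt (2 * \<beta>))\<^sup>2 + 4 * (sqrt (2 * \<beta>))\<^sup>2 / real n"
      unfolding S'_def z_def \<beta>_def by (rule B.step_process_B_approx(2) [OF n(1) s])
    also have "\<dots> \<le> e\<^sup>2" using p(3) n(3) e2 by linarith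
    finally show "B.expectation (\<lambda>\<omega>. (S' s \<omega> - z s \<omega>)\<^sup>2) \<le> e\<^sup>2" .
    show "square_integrable P (z s)" unfolding z_def by (rule B.square_integrable_B_over_time [OF s])
    have "B.expectation (\<lambda>\<omega>. (z s \<omega>)\<^sup>2) \<le> 2 * (sqrt (2 * \<beta>))\<^sup>2"
      unfolding z_def \<beta>_def by (rule B.expectation_B_over_time_square [OF s])
    then show "B.expectation (\<lambda>\<omega>. (z s \<omega>)\<^sup>2) \<le> 8 * \<beta>" using \<beta> by simp
  qed
  have "\<forall>\<^sub>F N in sequentially. \<bar>(\<integral>\<omega>. g (G N 1 \<omega>) (sq_deviation (G N) \<omega>) \<partial>M) - (\<integral>\<omega>. g (S N 1 \<omega>) (sq_deviation (S N) \<omega>) \<partial>M)\<bar> < r / 3"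
    using evN eventually_gt_at_top [of 0]
  proof eventually_elim
    case (elim N)
    have XM: "X k \<in> borel_measurable M" for k using X by (simp add: linear_process_def)
    have v: "0 < block_mass (fcos (\<lambda>x. w x * power_transfer \<psi> x)) p"
      using V0 by (simp only: V_def a_def u_def)
    have approx: "square_integrable M (\<lambda>\<omega>. G N s \<omega> - S N s \<omega>)" "square_integrable M (S N s)"
      "expectation (\<lambda>\<omega>. (G N s \<omega> - S N s \<omega>)\<^sup>2) \<le>
        8 * (\<rho> N / real N) + 32 * (\<beta> - V p / real p) + 16 * \<beta> / real n + 64 * real n * V p / real N"
      "expectation (\<lambda>\<omega>. (S N s \<omega>)\<^sup>2) \<le> 8 * \<beta>" if s: "s \<in> {1/2..1}" for s
      unfolding G_def S_def [abs_def] \<rho>_def T_def V_def \<beta>_def a_def u_def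
      by (rule scaled_periodogram_block_approx [OF cont _ _ H \<kappa> elim(2) s X \<psi> \<psi>1 p0 n(1) v];
          (rule holder | rule bound); assumption)+
    show ?case
    proof (rule le_less_trans [OF _ e(2)], rule process_compare [OF prob_space_axioms _ _ _ _ _ _ e(1) L lip bnd meas])
      show "measurable_process M (G N)" unfolding G_def by (rule measurable_scaled_periodogram [OF XM])
      show "measurable_process M (S N)"
        unfolding S_def [abs_def] by (rule measurable_step_process) simp
      fix s :: real assume s: "s \<in> {1/2..1}"
      show "square_integrable M (\<lambda>\<omega>. G N s \<omega> - S N s \<omega>)"
        by (rule approx(1) [OF s])
      have "expectation (\<lambda>\<omega>. (G N s \<omega> - S N s \<omega>)\<^sup>2) \<le>
          8 * (\<rho> N / real N) + 32 * (\<beta> - V p / real p) + 16 * \<beta> / real n + 64 * real n * V p / real N"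
        by (rule approx(3) [OF s])
      also have "\<dots> \<le> e\<^sup>2" using elim(1) p(1) n(2) e2 by linarith
      finally show "expectation (\<lambda>\<omega>. (G N s \<omega> - S N s \<omega>)\<^sup>2) \<le> e\<^sup>2" .
      show "square_integrable M (S N s)" by (rule approx(2) [OF s])
      show "expectation (\<lambda>\<omega>. (S N s \<omega>)\<^sup>2) \<le> 8 * \<beta>" by (rule approx(4) [OF s])
    qed
  qed
  with near_step have "\<forall>\<^sub>F N in sequentially. \<bar>(\<integral>\<omega>. g (G N 1 \<omega>) (sq_deviation (G N) \<omega>) \<partial>M) - (\<integral>\<omega>. g (z 1 \<omega>) (sq_deviation z \<omega>) \<partial>P)\<bar> < r"
    by eventually_elim (use near_limit in linarith)
  then show "\<exists>no. \<forall>N\<ge>no. norm ((\<integral>\<omega>. g (G N 1 \<omega>) (sq_deviation (G N) \<omega>) \<partial>M) - (\<integral>\<omega>. g (z 1 \<omega>) (sq_deviation z \<omega>) \<partial>P)) < r"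
    by (simp add: eventually_sequentially)
qed

end

lemma holder_exponent_mono:
  fixes w :: "real \<Rightarrow> real"
  assumes w: "\<And>x y. x \<in> {a..b} \<Longrightarrow> y \<in> {a..b} \<Longrightarrow> \<bar>w x - w y\<bar> \<le> C * \<bar>x - y\<bar> powr \<beta>"
    and C: "0 \<le> C" and \<kappa>: "\<kappa> \<le> \<beta>" and x: "x \<in> {a..b}" and y: "y \<in> {a..b}"
  shows "\<bar>w x - w y\<bar> \<le> C * (b - a) powr (\<beta> - \<kappa>) * \<bar>x - y\<bar> powr \<kappa>"
proof -
  have "\<bar>x - y\<bar> powr (\<beta> - \<kappa>) \<le> (b - a) powr (\<beta> - \<kappa>)"
    using \<kappa> x y by (intro powr_mono2) auto
  then have "C * (\<bar>x - y\<bar> powr (\<beta> - \<kappa>) * \<bar>x - y\<bar> powr \<kappa>) \<le> C * ((b - a) powr (\<beta> - \<kappa>) * \<bar>x - y\<bar> powr \<kappa>)"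
    using C by (intro mult_left_mono mult_right_mono) auto
  moreover have "\<bar>x - y\<bar> powr \<beta> = \<bar>x - y\<bar> powr (\<beta> - \<kappa>) * \<bar>x - y\<bar> powr \<kappa>"
    unfolding powr_add [symmetric] by simp
  ultimately show ?thesis using w [OF x y] by simp
qed

text \<open>The given weight vanishes at j = 0, so \<psi> 0 is added separately; elsewhere 1 +
  \<bar>j\<bar> \<le> 2 \<bar>j\<bar>.\<close>

lemma weighted_summable_shift:
  fixes \<psi> :: "int \<Rightarrow> real"
  assumes \<psi>: "(\<lambda>j. \<bar>real_of_int j\<bar> powr \<alpha> * \<bar>\<psi> j\<bar>) summable_on UNIV" and \<kappa>: "0 \<le> \<kappa>" "\<kappa> \<le> \<alpha>" "\<kappa> \<le> 1"
  shows "(\<lambda>j. \<bar>\<psi> j\<bar> * (1 + \<bar>real_of_int j\<bar>) powr \<kappa>) summable_on UNIV"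
proof (rule summable_on_comparison_test)
  have "(\<lambda>j. \<bar>\<psi> j\<bar> * of_bool (j = 0)) summable_on UNIV"
    by (rule finite_nonzero_values_imp_summable_on) (rule finite_subset [of _ "{0}"], auto)
  then show "(\<lambda>j. 2 * (\<bar>real_of_int j\<bar> powr \<alpha> * \<bar>\<psi> j\<bar>) + \<bar>\<psi> j\<bar> * of_bool (j = 0)) summable_on UNIV"
    by (intro summable_on_add summable_on_cmult_right \<psi>)
  fix j :: int
  show "\<bar>\<psi> j\<bar> * (1 + \<bar>real_of_int j\<bar>) powr \<kappa> \<le> 2 * (\<bar>real_of_int j\<bar> powr \<alpha> * \<bar>\<psi> j\<bar>) + \<bar>\<psi> j\<bar> * of_bool (j = 0)"
  proof (cases "j = 0")
    case False
    then have j: "1 \<le> \<bar>real_of_int j\<bar>" by linarith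
    have "(1 + \<bar>real_of_int j\<bar>) powr \<kappa> \<le> (2 * \<bar>real_of_int j\<bar>) powr \<kappa>"
      using j \<kappa> by (intro powr_mono2) auto
    also have "\<dots> = 2 powr \<kappa> * \<bar>real_of_int j\<bar> powr \<kappa>" by (simp add: powr_mult)
    also have "\<dots> \<le> 2 powr 1 * \<bar>real_of_int j\<bar> powr \<alpha>"
      using j \<kappa> by (intro mult_mono powr_mono) auto
    finally have "\<bar>\<psi> j\<bar> * (1 + \<bar>real_of_int j\<bar>) powr \<kappa> \<le> \<bar>\<psi> j\<bar> * (2 * \<bar>real_of_int j\<bar> powr \<alpha>)"
      by (intro mult_left_mono) auto
    then show ?thesis using False by (simp add: mult_ac)
  qed simp
qed auto

theorem theorem2p1:
  fixes M :: "'a measure" and P :: "'b measure"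
    and \<psi> :: "int \<Rightarrow> real" and \<epsilon> X :: "int \<Rightarrow> 'a \<Rightarrow> real"
    and w :: "real \<Rightarrow> real" and \<alpha> \<beta> \<Phi> :: real
    and \<Phi>\<^sub>N :: "nat \<Rightarrow> real \<Rightarrow> 'a \<Rightarrow> real"
    and B :: "real \<Rightarrow> 'b \<Rightarrow> real"
  assumes "prob_space M"
    and "gaussian_white_noise M \<epsilon>"
    and "linear_process M \<psi> \<epsilon> X"
    and "1/2 < \<alpha>" and "\<alpha> \<le> 1"
    and "(\<lambda>j. \<bar>real_of_int j\<bar> powr \<alpha> * \<bar>\<psi> j\<bar>) summable_on UNIV"
    and "0 < (\<Sum>\<^sub>\<infinity>j. \<bar>real_of_int j\<bar> powr \<alpha> * \<bar>\<psi> j\<bar>)"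
    and "1/2 < \<beta>" and "\<beta> \<le> 1"
    and "\<forall>l\<in>{-pi..pi}. w (- l) = w l"
    and "holder_continuous_on {-pi..pi} \<beta> w"
    and "AE l in lborel. l \<in> {-pi..pi} \<longrightarrow> w l \<noteq> 0"
    and "\<Phi> = (LINT l:{-pi..pi}|lborel. w l * spectral_density M X l)"
    and "\<And>N s \<omega>. \<Phi>\<^sub>N N s \<omega> = integrated_periodogram w (\<lambda>k. X k \<omega>) N s"
    and "prob_space P"
    and "brownian_motion_on P {1/2..1} B"
  shows "weak_conv_m
           (\<lambda>N. distr M borel (\<lambda>\<omega>. (\<Phi>\<^sub>N N 1 \<omega> - \<Phi>) /
              sqrt (LINT s:{1/2..1}|lborel. (\<Phi>\<^sub>N N s \<omega> - \<Phi>\<^sub>N N 1 \<omega>)\<^sup>2)))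
           (distr P borel (\<lambda>\<omega>. B 1 \<omega> /
              sqrt (LINT s:{1/2..1}|lborel. 1 / s\<^sup>2 * (B s \<omega> - s * B 1 \<omega>)\<^sup>2)))
         \<and> (AE \<omega> in P. sqrt (LINT s:{1/2..1}|lborel. 1 / s\<^sup>2 * (B s \<omega> - s * B 1 \<omega>)\<^sup>2) \<noteq> 0)"
proof -
  interpret white_noise M \<epsilon> using assms(1,2) by (simp add: white_noise_def white_noise_axioms_def)
  interpret B: brownian P B using assms(15,16) by (simp add: brownian_def brownian_axioms_def)
  have X: "linear_process M \<psi> \<epsilon> X" by fact
  \<comment> \<open>A single exponent serves the Hoelder bound and the filter weight; both
    conditions survive lowering it.\<close>
  define \<kappa> where "\<kappa> = min \<alpha> \<beta>"
  have \<kappa>: "1 / 2 < \<kappa>" "\<kappa> \<le> 1" "\<kappa> \<le> \<alpha>" "\<kappa> \<le> \<beta>" using assms(4,5,8,9) by (auto simp: \<kappa>_def)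
  have cont: "continuous_on {- pi..pi} w"
    by (rule holder_imp_continuous_on [OF assms(11)]) (use assms(8) in simp)
  then have cont0: "continuous_on {0..pi} w" by (rule continuous_on_subset) auto
  obtain C where C: "0 \<le> C" "\<And>x y. x \<in> {- pi..pi} \<Longrightarrow> y \<in> {- pi..pi} \<Longrightarrow> \<bar>w x - w y\<bar> \<le> C * \<bar>x - y\<bar> powr \<beta>"
    using holder_continuous_on_bound [OF assms(11)] by blast
  define H where "H = C * (pi - 0) powr (\<beta> - \<kappa>)"
  have H: "0 \<le> H" using C(1) by (simp add: H_def)
  have holder: "\<bar>w x - w y\<bar> \<le> H * \<bar>x - y\<bar> powr \<kappa>" if "x \<in> {0..pi}" "y \<in> {0..pi}" for x y
    unfolding H_def by (rule holder_exponent_mono [OF _ C(1) \<kappa>(4) that]) (rule C(2), auto)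
  have "compact (w ` {0..pi})" by (rule compact_continuous_image [OF cont0 compact_Icc])
  then obtain K where K: "\<And>x. x \<in> {0..pi} \<Longrightarrow> \<bar>w x\<bar> \<le> K"
    using compact_imp_bounded [of "w ` {0..pi}"] unfolding bounded_iff real_norm_def by blast
  have \<psi>: "(\<lambda>j. \<bar>\<psi> j\<bar> * (1 + \<bar>real_of_int j\<bar>) powr \<kappa>) summable_on UNIV"
    by (rule weighted_summable_shift [OF assms(6)]) (use \<kappa> in auto)
  have \<psi>1: "(\<lambda>j. \<bar>\<psi> j\<bar>) summable_on UNIV"
  proof (rule summable_on_comparison_test [OF \<psi>])
    fix j
    have "1 \<le> (1 + \<bar>real_of_int j\<bar>) powr \<kappa>" using \<kappa> by (intro ge_one_powr_ge_zero) auto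
    from mult_left_mono [OF this, of "\<bar>\<psi> j\<bar>"]
    show "\<bar>\<psi> j\<bar> \<le> \<bar>\<psi> j\<bar> * (1 + \<bar>real_of_int j\<bar>) powr \<kappa>" by simp
  qed auto
  \<comment> \<open>Positivity of the weighted sum excludes the zero filter, for which the limit
    variance would vanish.\<close>
  obtain j where j: "\<psi> j \<noteq> 0"
    using assms(7) by (cases "\<forall>j. \<psi> j = 0") auto
  define u where "u = (\<lambda>x. w x * power_transfer \<psi> x)"
  have pos: "0 < msq u" unfolding u_def by (rule msq_weighted_transfer_pos [OF cont0 \<psi>1 j assms(12)])
  have \<Phi>: "\<Phi> = fcos u 0"
    unfolding assms(13) u_def using assms(10) by (intro spectral_functional [OF \<psi>1 X cont]) auto
  define \<sigma> where "\<sigma> = sqrt (2 * msq u)"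
  have \<sigma>: "0 < \<sigma>" using pos by (simp add: \<sigma>_def)
  define G where "G = scaled_periodogram w X \<Phi>"
  define z where "z = (\<lambda>s \<omega>. \<sigma> * B s \<omega> / s)"
  have mG: "measurable_process M (G N)" for N
    unfolding G_def by (rule measurable_scaled_periodogram) (use X in \<open>simp add: linear_process_def\<close>)
  have mz: "measurable_process P z" unfolding z_def by (rule B.measurable_B_over_time)
  have z_pos: "AE \<omega> in P. 0 < sq_deviation z \<omega>"
    unfolding z_def by (rule B.AE_sq_deviation_pos) (use \<sigma> in simp)
  have conv: "weak_conv_m (\<lambda>N. distr M borel (\<lambda>\<omega>. G N 1 \<omega> / sqrt (sq_deviation (G N) \<omega>)))
      (distr P borel (\<lambda>\<omega>. z 1 \<omega> / sqrt (sq_deviation z \<omega>)))"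
  proof (rule ratio_weak_conv [OF prob_space_axioms B.prob_space_axioms _ _ _ _ z_pos])
    show "G N 1 \<in> borel_measurable M" "sq_deviation (G N) \<in> borel_measurable M" for N
      using mG [of N] measurable_sq_deviation [OF mG] by (auto simp: measurable_process_def)
    show "z 1 \<in> borel_measurable P" "sq_deviation z \<in> borel_measurable P"
      using mz measurable_sq_deviation [OF mz] by (auto simp: measurable_process_def)
    fix g :: "real \<Rightarrow> real \<Rightarrow> real" and L :: real
    assume g: "0 \<le> L" "\<And>a b c d. \<bar>g a c - g b d\<bar> \<le> L * (\<bar>a - b\<bar> + \<bar>c - d\<bar>)"
      "\<And>a c. \<bar>g a c\<bar> \<le> 1" "case_prod g \<in> borel_measurable borel"
    show "(\<lambda>N. \<integral>\<omega>. g (G N 1 \<omega>) (sq_deviation (G N) \<omega>) \<partial>M) \<longlonglongrightarrow> (\<integral>\<omega>. g (z 1 \<omega>) (sq_deviation z \<omega>) \<partial>P)"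
      unfolding G_def z_def \<sigma>_def \<Phi> u_def
      by (rule scaled_periodogram_functional_limit [OF cont0 holder K H \<kappa>(1,2) X \<psi> \<psi>1 B.brownian_axioms g])
        (use pos in \<open>simp_all add: u_def\<close>)
  qed
  \<comment> \<open>Numerator and denominator both carry the factor \<surd>N.\<close>
  have left: "G N 1 \<omega> / sqrt (sq_deviation (G N) \<omega>) =
      (\<Phi>\<^sub>N N 1 \<omega> - \<Phi>) / sqrt (LINT s:{1/2..1}|lborel. (\<Phi>\<^sub>N N s \<omega> - \<Phi>\<^sub>N N 1 \<omega>)\<^sup>2)" for N \<omega>
  proof -
    have "G N s \<omega> - G N 1 \<omega> = sqrt (real N) * (\<Phi>\<^sub>N N s \<omega> - \<Phi>\<^sub>N N 1 \<omega>)" for s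
      by (simp add: G_def scaled_periodogram_def assms(14) algebra_simps)
    then have "sq_deviation (G N) \<omega> = real N * (LINT s:{1/2..1}|lborel. (\<Phi>\<^sub>N N s \<omega> - \<Phi>\<^sub>N N 1 \<omega>)\<^sup>2)"
      unfolding sq_deviation_def by (simp add: power_mult_distrib set_integral_mult_right)
    moreover have "G N 1 \<omega> = sqrt (real N) * (\<Phi>\<^sub>N N 1 \<omega> - \<Phi>)"
      by (simp add: G_def scaled_periodogram_def assms(14))
    \<comment> \<open>for \<open>N = 0\<close> both quotients have denominator 0, hence are 0\<close>
    moreover have "\<Phi>\<^sub>N 0 s \<omega> = 0" for s by (simp add: assms(14) integrated_periodogram_def)
    ultimately show ?thesis
      by (cases "N = 0") (simp_all add: real_sqrt_mult set_lebesgue_integral_def)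
  qed
  \<comment> \<open>The difference \<open>z s \<omega> - z 1 \<omega>\<close> is \<sigma> / s times
    the bridge, so \<sigma> leaves the ratio.\<close>
  have sq_z: "sq_deviation z \<omega> = \<sigma>\<^sup>2 * (LINT s:{1/2..1}|lborel. 1 / s\<^sup>2 * (B s \<omega> - s * B 1 \<omega>)\<^sup>2)" for \<omega>
  proof -
    have "sq_deviation z \<omega> = (LINT s:{1/2..1}|lborel. \<sigma>\<^sup>2 * (1 / s\<^sup>2 * (B s \<omega> - s * B 1 \<omega>)\<^sup>2))"
      unfolding sq_deviation_def
    proof (rule set_lebesgue_integral_cong)
      show "\<forall>s. s \<in> {1/2..1} \<longrightarrow> (z s \<omega> - z 1 \<omega>)\<^sup>2 = \<sigma>\<^sup>2 * (1 / s\<^sup>2 * (B s \<omega> - s * B 1 \<omega>)\<^sup>2)"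
      proof (intro allI impI)
        fix s :: real assume "s \<in> {1/2..1}"
        then have "z s \<omega> - z 1 \<omega> = \<sigma> * (1 / s * (B s \<omega> - s * B 1 \<omega>))"
          by (simp add: z_def field_simps)
        then show "(z s \<omega> - z 1 \<omega>)\<^sup>2 = \<sigma>\<^sup>2 * (1 / s\<^sup>2 * (B s \<omega> - s * B 1 \<omega>)\<^sup>2)"
          by (simp only: power_mult_distrib power_divide power_one)
      qed
    qed simp
    then show ?thesis by (simp only: set_integral_mult_right)
  qed
  have right: "z 1 \<omega> / sqrt (sq_deviation z \<omega>) =
      B 1 \<omega> / sqrt (LINT s:{1/2..1}|lborel. 1 / s\<^sup>2 * (B s \<omega> - s * B 1 \<omega>)\<^sup>2)" for \<omega>
    using \<sigma> unfolding sq_z real_sqrt_mult by (simp add: z_def)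
  have "AE \<omega> in P. sqrt (LINT s:{1/2..1}|lborel. 1 / s\<^sup>2 * (B s \<omega> - s * B 1 \<omega>)\<^sup>2) \<noteq> 0"
    using z_pos unfolding sq_z by eventually_elim (auto simp: zero_less_mult_iff)
  with conv show ?thesis unfolding left right by simp
qed

end
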